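(* Let $L$ be an oriented Legendrian knot in $(\mathbb{R}^3,\xi_{std})$ and let $n\in\mathbb{N}$. The $n$-Legendrian rack $LR_n(D_L)$ associated to a front projection $D_L$ of $L$ is, up to isomorphism of racks, independent of the choice of the front projection $D_L$ of $L$. Therefore $LR_n(D_L)$ is an invariant of $L$ up to isotopy through a family of oriented Legendrian knots: if $L$ and $L'$ are oriented Legendrian knots that are Legendrian isotopic by an orientation-preserving isotopy, and $D_L$, $D_{L'}$ are front projections of $L$, $L'$, then $LR_n(D_L)\cong LR_n(D_{L'})$.
   Context: Racks. $\mathbb{N}=\{0,1,2,\dots\}$. A rack is a set $R$ with two binary operations $*$ and $/$ such that for all $x,y,z\in R$: $(x*y)*z=(x*z)*(y*z)$, $(x/y)/z=(x/z)/(y/z)$, $(x*y)/y=x$, $(x/y)*y=x$. Powers: $x^1=x$, $x^m=x^{m-1}*x$ for $m>1$. For $n\in\mathbb{N}$, an $n$-Legendrian rack is a rack such that $x^{2n+2}=x$ for all $x$. Legendrian knots. $\xi_{std}=\ker(dz-y\,dx)$ on $\mathbb{R}^3$. A smooth knot $L$ is Legendrian if $T_pL\subset\xi_{std}|_p$ for all $p\in L$. A Legendrian isotopy is an isotopy through Legendrian knots. A front projection $D_L$ of $L$ is a generic projection to the $xz$-plane (obtained after a Legendrian isotopy if necessary): it has no vertical tangencies, finitely many cusps, and finitely many transverse double points (crossings). Since $y=dz/dx$, at each crossing the branch with smaller slope $dz/dx$ is the over-branch. The associated rack. The strands of an oriented front projection $D_L$ are the connected segments of the diagram that begin and end at an under-crossing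 or a cusp (a strand continues through over-crossings and contains no cusp in its interior). $LR_n(D_L)$ is the $n$-Legendrian rack presented (in the class of $n$-Legendrian racks) by one generator for each strand and the following relations. At each crossing with over-strand $y$, incoming under-strand $x$ and outgoing under-strand $x'$ (with respect to the orientation): $x'=x*y$ if the crossing is positive and $x'=x/y$ if it is negative. At each cusp at which the strand $a$ is followed, along the orientation, by the strand $b$: $b=a^{n+1}$. *)

theory Defs
  imports "HOL-Analysis.Analysis"
begin

section \<open>Racks\<close>

record 'a rack =
  rcarrier :: "'a set"
  rmul :: "'a \<Rightarrow> 'a \<Rightarrow> 'a"
  rdiv :: "'a \<Rightarrow> 'a \<Rightarrow> 'a"

definition rack :: "('a, 'b) rack_scheme \<Rightarrow> bool" where
  "rack R \<longleftrightarrow>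
     (\<forall>x\<in>rcarrier R. \<forall>y\<in>rcarrier R. rmul R x y \<in> rcarrier R \<and> rdiv R x y \<in> rcarrier R) \<and>
     (\<forall>x\<in>rcarrier R. \<forall>y\<in>rcarrier R. \<forall>z\<in>rcarrier R.
        rmul R (rmul R x y) z = rmul R (rmul R x z) (rmul R y z) \<and>
        rdiv R (rdiv R x y) z = rdiv R (rdiv R x z) (rdiv R y z)) \<and>
     (\<forall>x\<in>rcarrier R. \<forall>y\<in>rcarrier R.
        rdiv R (rmul R x y) y = x \<and> rmul R (rdiv R x y) y = x)"

text \<open>Only the exponents \<open>m \<ge> 1\<close> are meaningful; the value at \<open>0\<close> is a dummy.\<close>

fun rack_power :: "('a \<Rightarrow> 'a \<Rightarrow> 'a) \<Rightarrow> 'a \<Rightarrow> nat \<Rightarrow> 'a" where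
  "rack_power f x 0 = x"
| "rack_power f x (Suc 0) = x"
| "rack_power f x (Suc (Suc m)) = f (rack_power f x (Suc m)) x"

definition legendrian_rack :: "nat \<Rightarrow> ('a, 'b) rack_scheme \<Rightarrow> bool" where
  "legendrian_rack n R \<longleftrightarrow>
     rack R \<and> (\<forall>x\<in>rcarrier R. rack_power (rmul R) x (2 * n + 2) = x)"

definition rack_isomorphic :: "('a, 'c) rack_scheme \<Rightarrow> ('b, 'd) rack_scheme \<Rightarrow> bool" where
  "rack_isomorphic R S \<longleftrightarrow>
     (\<exists>f. bij_betw f (rcarrier R) (rcarrier S) \<and>
          (\<forall>x\<in>rcarrier R. \<forall>y\<in>rcarrier R.
             f (rmul R x y) = rmul S (f x) (f y) \<and> f (rdiv R x y) = rdiv S (f x) (f y)))"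

section \<open>Presentations of Legendrian racks\<close>

datatype 'g rack_term =
  Gen 'g
| Mul "'g rack_term" "'g rack_term"
| Div "'g rack_term" "'g rack_term"

definition terms_over :: "'g set \<Rightarrow> 'g rack_term set" where
  "terms_over G = {t. set_rack_term t \<subseteq> G}"

text \<open>The least congruence on the terms over the generators \<open>G\<close> that contains the relations
  \<open>E\<close> and whose quotient is an \<open>n\<close>-Legendrian rack.\<close>

inductive rack_cong ::
    "nat \<Rightarrow> 'g set \<Rightarrow> ('g rack_term \<times> 'g rack_term) set \<Rightarrow> 'g rack_term \<Rightarrow> 'g rack_term \<Rightarrow> bool"
  for n G E where
  refl: "s \<in> terms_over G \<Longrightarrow> rack_cong n G E s s"
| sym: "rack_cong n G E s t \<Longrightarrow> rack_cong n G E t s"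
| trans: "rack_cong n G E s t \<Longrightarrow> rack_cong n G E t u \<Longrightarrow> rack_cong n G E s u"
| mul: "rack_cong n G E s s' \<Longrightarrow> rack_cong n G E t t' \<Longrightarrow> rack_cong n G E (Mul s t) (Mul s' t')"
| div: "rack_cong n G E s s' \<Longrightarrow> rack_cong n G E t t' \<Longrightarrow> rack_cong n G E (Div s t) (Div s' t')"
| rel: "(s, t) \<in> E \<Longrightarrow> s \<in> terms_over G \<Longrightarrow> t \<in> terms_over G \<Longrightarrow> rack_cong n G E s t"
| mul_distrib: "s \<in> terms_over G \<Longrightarrow> t \<in> terms_over G \<Longrightarrow> u \<in> terms_over G \<Longrightarrow>
    rack_cong n G E (Mul (Mul s t) u) (Mul (Mul s u) (Mul t u))"
| div_distrib: "s \<in> terms_over G \<Longrightarrow> t \<in> terms_over G \<Longrightarrow> u \<in> terms_over G \<Longrightarrow>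
    rack_cong n G E (Div (Div s t) u) (Div (Div s u) (Div t u))"
| div_mul: "s \<in> terms_over G \<Longrightarrow> t \<in> terms_over G \<Longrightarrow> rack_cong n G E (Div (Mul s t) t) s"
| mul_div: "s \<in> terms_over G \<Longrightarrow> t \<in> terms_over G \<Longrightarrow> rack_cong n G E (Mul (Div s t) t) s"
| legendrian: "s \<in> terms_over G \<Longrightarrow> rack_cong n G E (rack_power Mul s (2 * n + 2)) s"

definition presented_rack ::
    "nat \<Rightarrow> 'g set \<Rightarrow> ('g rack_term \<times> 'g rack_term) set \<Rightarrow> 'g rack_term set rack" where
  "presented_rack n G E =
     \<lparr> rcarrier = terms_over G // {(s, t). rack_cong n G E s t},
       rmul = (\<lambda>X Y. \<Union>s\<in>X. \<Union>t\<in>Y. {u. rack_cong n G E (Mul s t) u}),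
       rdiv = (\<lambda>X Y. \<Union>s\<in>X. \<Union>t\<in>Y. {u. rack_cong n G E (Div s t) u}) \<rparr>"

subsection \<open>Presented racks have the expected universal property\<close>

lemma terms_over_simps [simp]:
  "Gen g \<in> terms_over G \<longleftrightarrow> g \<in> G"
  "Mul s t \<in> terms_over G \<longleftrightarrow> s \<in> terms_over G \<and> t \<in> terms_over G"
  "Div s t \<in> terms_over G \<longleftrightarrow> s \<in> terms_over G \<and> t \<in> terms_over G"
  by (auto simp: terms_over_def)

lemma rack_power_terms_over [simp]:
  "rack_power Mul s m \<in> terms_over G \<longleftrightarrow> s \<in> terms_over G"
  by (induction m rule: induct_nat_012) auto

lemma rack_cong_terms_over:
  "rack_cong n G E s t \<Longrightarrow> s \<in> terms_over G \<and> t \<in> terms_over G"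
  by (induction rule: rack_cong.induct) auto

abbreviation cong_class ::
    "nat \<Rightarrow> 'g set \<Rightarrow> ('g rack_term \<times> 'g rack_term) set \<Rightarrow> 'g rack_term \<Rightarrow> 'g rack_term set" where
  "cong_class n G E s \<equiv> {u. rack_cong n G E s u}"

lemma presented_carrier:
  "rcarrier (presented_rack n G E) = cong_class n G E ` terms_over G"
  by (auto simp: presented_rack_def quotient_def)

lemma cong_class_eq_iff:
  assumes "s \<in> terms_over G"
  shows "cong_class n G E s = cong_class n G E t \<longleftrightarrow> rack_cong n G E s t"
proof
  assume "cong_class n G E s = cong_class n G E t"
  with rack_cong.refl[OF assms] have "rack_cong n G E t s" by blast
  then show "rack_cong n G E s t" by (rule rack_cong.sym)
next
  assume "rack_cong n G E s t"
  then show "cong_class n G E s = cong_class n G E t"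
    by (blast intro: rack_cong.trans dest: rack_cong.sym)
qed

lemma presented_mul:
  assumes "s \<in> terms_over G" "t \<in> terms_over G"
  shows "rmul (presented_rack n G E) (cong_class n G E s) (cong_class n G E t)
           = cong_class n G E (Mul s t)"
proof -
  have "rack_cong n G E (Mul s t) u"
    if "rack_cong n G E s s'" "rack_cong n G E t t'" "rack_cong n G E (Mul s' t') u" for s' t' u
    using rack_cong.trans[OF rack_cong.mul[OF that(1,2)] that(3)] .
  moreover have "rack_cong n G E s s" "rack_cong n G E t t"
    using assms by (auto intro: rack_cong.refl)
  ultimately show ?thesis
    unfolding presented_rack_def by simp blast
qed

lemma presented_div:
  assumes "s \<in> terms_over G" "t \<in> terms_over G"
  shows "rdiv (presented_rack n G E) (cong_class n G E s) (cong_class n G E t)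
           = cong_class n G E (Div s t)"
proof -
  have "rack_cong n G E (Div s t) u"
    if "rack_cong n G E s s'" "rack_cong n G E t t'" "rack_cong n G E (Div s' t') u" for s' t' u
    using rack_cong.trans[OF rack_cong.div[OF that(1,2)] that(3)] .
  moreover have "rack_cong n G E s s" "rack_cong n G E t t"
    using assms by (auto intro: rack_cong.refl)
  ultimately show ?thesis
    unfolding presented_rack_def by simp blast
qed

lemma presented_power:
  assumes "s \<in> terms_over G"
  shows "rack_power (rmul (presented_rack n G E)) (cong_class n G E s) m
           = cong_class n G E (rack_power Mul s m)"
  using assms by (induction m rule: induct_nat_012) (auto simp: presented_mul)

lemma legendrian_rack_presented_rack: "legendrian_rack n (presented_rack n G E)"
  unfolding legendrian_rack_def rack_def presented_carrier ball_simps
proof (intro conjI ballI)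
  fix s assume "s \<in> terms_over G"
  then show "rack_power (rmul (presented_rack n G E)) (cong_class n G E s) (2 * n + 2)
               = cong_class n G E s"
    by (simp only: presented_power cong_class_eq_iff rack_power_terms_over rack_cong.legendrian)
next
  fix s t assume st: "s \<in> terms_over G" "t \<in> terms_over G"
  then have "Mul s t \<in> terms_over G" "Div s t \<in> terms_over G"
    by simp_all
  then show "rmul (presented_rack n G E) (cong_class n G E s) (cong_class n G E t)
               \<in> cong_class n G E ` terms_over G"
    and "rdiv (presented_rack n G E) (cong_class n G E s) (cong_class n G E t)
           \<in> cong_class n G E ` terms_over G"
    unfolding presented_mul[OF st] presented_div[OF st]
    by (auto intro!: imageI[where f = "cong_class n G E"] simp del: terms_over_simps)
qed (simp_all add: presented_mul presented_div cong_class_eq_iff rack_cong.mul_distrib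
      rack_cong.div_distrib rack_cong.div_mul rack_cong.mul_div)

fun eval_term :: "('a, 'b) rack_scheme \<Rightarrow> ('g \<Rightarrow> 'a) \<Rightarrow> 'g rack_term \<Rightarrow> 'a" where
  "eval_term R h (Gen g) = h g"
| "eval_term R h (Mul s t) = rmul R (eval_term R h s) (eval_term R h t)"
| "eval_term R h (Div s t) = rdiv R (eval_term R h s) (eval_term R h t)"

lemma eval_rack_power: "eval_term R h (rack_power Mul s m) = rack_power (rmul R) (eval_term R h s) m"
  by (induction m rule: induct_nat_012) auto

lemma eval_term_closed:
  assumes "rack R" "h ` G \<subseteq> rcarrier R" "s \<in> terms_over G"
  shows "eval_term R h s \<in> rcarrier R"
  using assms(3) by (induction s) (use assms in \<open>auto simp: rack_def\<close>)

lemma rack_cong_eval: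
  assumes "legendrian_rack n R" "h ` G \<subseteq> rcarrier R"
    and "\<And>s t. (s, t) \<in> E \<Longrightarrow> eval_term R h s = eval_term R h t"
    and "rack_cong n G E s t"
  shows "eval_term R h s = eval_term R h t"
proof -
  have R: "rack R" using assms(1) by (simp add: legendrian_rack_def)
  note closed = eval_term_closed[OF R assms(2)]
  show ?thesis using assms(4)
  proof (induction rule: rack_cong.induct)
    case (legendrian s)
    then show ?case
      using assms(1) closed unfolding legendrian_rack_def eval_rack_power by blast
  next
    case (rel s t)
    then show ?case using assms(3) by blast
  next
    case (mul_distrib s t u)
    then show ?case using R closed unfolding rack_def eval_term.simps by blast
  next
    case (div_distrib s t u)
    then show ?case using R closed unfolding rack_def eval_term.simps by blast
  next
    case (div_mul s t)
    then show ?case using R closed unfolding rack_def eval_term.simps by blast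
  next
    case (mul_div s t)
    then show ?case using R closed unfolding rack_def eval_term.simps by blast
  qed simp_all
qed

lemma presented_rack_universal:
  assumes "legendrian_rack n R" "h ` G \<subseteq> rcarrier R"
    and "\<And>s t. (s, t) \<in> E \<Longrightarrow> eval_term R h s = eval_term R h t"
  shows "\<exists>f. f ` rcarrier (presented_rack n G E) \<subseteq> rcarrier R \<and>
             (\<forall>g\<in>G. f (cong_class n G E (Gen g)) = h g) \<and>
             (\<forall>x\<in>rcarrier (presented_rack n G E). \<forall>y\<in>rcarrier (presented_rack n G E).
                f (rmul (presented_rack n G E) x y) = rmul R (f x) (f y) \<and>
                f (rdiv (presented_rack n G E) x y) = rdiv R (f x) (f y))"
proof -
  define f where "f X = eval_term R h (SOME s. s \<in> X)" for X
  have f: "f (cong_class n G E s) = eval_term R h s" if "s \<in> terms_over G" for s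
  proof -
    have "(SOME u. u \<in> cong_class n G E s) \<in> cong_class n G E s"
      by (rule someI[of _ s]) (simp add: rack_cong.refl that)
    then show ?thesis
      using rack_cong_eval[OF assms] unfolding f_def by (metis mem_Collect_eq)
  qed
  have R: "rack R" using assms(1) by (simp add: legendrian_rack_def)
  show ?thesis
    unfolding presented_carrier
    by (rule exI[of _ f])
      (auto simp: f presented_mul presented_div intro!: eval_term_closed[OF R assms(2)])
qed

section \<open>Legendrian knots\<close>

fun higher_differentiable ::
    "nat \<Rightarrow> ('a::real_normed_vector \<Rightarrow> 'b::real_normed_vector) \<Rightarrow> bool" where
  "higher_differentiable 0 f \<longleftrightarrow> continuous_on UNIV f"
| "higher_differentiable (Suc k) f \<longleftrightarrow>
     (\<forall>x. f differentiable (at x)) \<and>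
     (\<forall>v. higher_differentiable k (\<lambda>x. frechet_derivative f (at x) v))"

definition smooth :: "('a::real_normed_vector \<Rightarrow> 'b::real_normed_vector) \<Rightarrow> bool" where
  "smooth f \<longleftrightarrow> (\<forall>k. higher_differentiable k f)"

abbreviation velocity :: "(real \<Rightarrow> 'a::real_normed_vector) \<Rightarrow> real \<Rightarrow> 'a" where
  "velocity c t \<equiv> vector_derivative c (at t)"

text \<open>Coordinates \<open>1, 2, 3\<close> of \<^typ>\<open>real ^ 3\<close> are \<open>x, y, z\<close>; the plane field is \<open>ker (dz - y dx)\<close>.\<close>

definition xi_std :: "real ^ 3 \<Rightarrow> (real ^ 3) set" where
  "xi_std p = {v. v $ 3 - p $ 2 * v $ 1 = 0}"

text \<open>An oriented knot is given by a regular parametrization of period 1 that traverses it in the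
  positive direction; two parametrizations give the same oriented knot iff they are related by
  \<open>same_oriented_knot\<close>.\<close>

definition smooth_knot :: "(real \<Rightarrow> real ^ 3) \<Rightarrow> bool" where
  "smooth_knot c \<longleftrightarrow>
     smooth c \<and> (\<forall>t. c (t + 1) = c t) \<and> inj_on c {0..<1} \<and> (\<forall>t. velocity c t \<noteq> 0)"

definition same_oriented_knot :: "(real \<Rightarrow> real ^ 3) \<Rightarrow> (real \<Rightarrow> real ^ 3) \<Rightarrow> bool" where
  "same_oriented_knot c d \<longleftrightarrow>
     (\<exists>\<phi> :: real \<Rightarrow> real. smooth \<phi> \<and> (\<forall>t. \<phi> (t + 1) = \<phi> t + 1) \<and> (\<forall>t. deriv \<phi> t > 0) \<and> d = c \<circ> \<phi>)"

definition legendrian_knot :: "(real \<Rightarrow> real ^ 3) \<Rightarrow> bool" where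
  "legendrian_knot c \<longleftrightarrow> smooth_knot c \<and> (\<forall>t. velocity c t \<in> xi_std (c t))"

text \<open>The isotopy parameter is the first component and runs through \<open>[0, 1]\<close>.  Asking the
  family to be smooth on the whole plane means smoothness up to the boundary of the strip.\<close>

definition legendrian_isotopic :: "(real \<Rightarrow> real ^ 3) \<Rightarrow> (real \<Rightarrow> real ^ 3) \<Rightarrow> bool" where
  "legendrian_isotopic c d \<longleftrightarrow>
     (\<exists>H :: real \<times> real \<Rightarrow> real ^ 3.
        smooth H \<and> (\<forall>s\<in>{0..1}. legendrian_knot (\<lambda>t. H (s, t))) \<and>
        same_oriented_knot c (\<lambda>t. H (0, t)) \<and> same_oriented_knot d (\<lambda>t. H (1, t)))"

section \<open>Front projections\<close>

text \<open>Coordinates \<open>1, 2\<close> of \<^typ>\<open>real ^ 2\<close> are \<open>x, z\<close>.\<close>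

definition front :: "(real \<Rightarrow> real ^ 3) \<Rightarrow> real \<Rightarrow> real ^ 2" where
  "front c t = vector [c t $ 1, c t $ 3]"

abbreviation det2 :: "real ^ 2 \<Rightarrow> real ^ 2 \<Rightarrow> real" where
  "det2 v w \<equiv> det (vector [v, w] :: real ^ 2 ^ 2)"

text \<open>Semicubical cusps: the first derivative vanishes, the second and third are independent.\<close>

definition cusp :: "(real \<Rightarrow> real ^ 2) \<Rightarrow> real \<Rightarrow> bool" where
  "cusp D t \<longleftrightarrow>
     velocity D t = 0 \<and> det2 (velocity (velocity D) t) (velocity (velocity (velocity D)) t) \<noteq> 0"

definition double_point :: "(real \<Rightarrow> real ^ 2) \<Rightarrow> real \<Rightarrow> real \<Rightarrow> bool" where
  "double_point D s t \<longleftrightarrow> s - t \<notin> \<int> \<and> D s = D t"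

definition generic_front :: "(real \<Rightarrow> real ^ 2) \<Rightarrow> bool" where
  "generic_front D \<longleftrightarrow>
     (\<forall>t. velocity D t \<noteq> 0 \<longrightarrow> velocity D t $ 1 \<noteq> 0) \<and>
     (\<forall>t. velocity D t = 0 \<longrightarrow> cusp D t) \<and>
     finite {t \<in> {0..<1}. cusp D t} \<and>
     finite {D t |s t. double_point D s t} \<and>
     (\<forall>s t. double_point D s t \<longrightarrow> det2 (velocity D s) (velocity D t) \<noteq> 0) \<and>
     (\<nexists>r s t. double_point D r s \<and> double_point D s t \<and> double_point D r t)"

definition front_projection_of :: "(real \<Rightarrow> real ^ 2) \<Rightarrow> (real \<Rightarrow> real ^ 3) \<Rightarrow> bool" where
  "front_projection_of D L \<longleftrightarrow>
     (\<exists>K. legendrian_knot K \<and> legendrian_isotopic L K \<and> D = front K \<and> generic_front D)"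

definition slope :: "(real \<Rightarrow> real ^ 2) \<Rightarrow> real \<Rightarrow> real" where
  "slope D t = velocity D t $ 2 / velocity D t $ 1"

text \<open>\<open>crossing D s t\<close>: the branch at \<open>s\<close> passes over the branch at \<open>t\<close>.\<close>

definition crossing :: "(real \<Rightarrow> real ^ 2) \<Rightarrow> real \<Rightarrow> real \<Rightarrow> bool" where
  "crossing D s t \<longleftrightarrow> double_point D s t \<and> slope D s < slope D t"

text \<open>The branch with the smaller \<open>y = dz/dx\<close> is on top, so the \<open>xz\<close>-plane is viewed from the
  side of negative \<open>y\<close>; from there \<open>(x, z)\<close> is positively oriented, and a crossing
  is positive iff (over-tangent, under-tangent) is a positively oriented basis.\<close>

definition positive_crossing :: "(real \<Rightarrow> real ^ 2) \<Rightarrow> real \<Rightarrow> real \<Rightarrow> bool" where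
  "positive_crossing D s t \<longleftrightarrow> crossing D s t \<and> det2 (velocity D s) (velocity D t) > 0"

definition negative_crossing :: "(real \<Rightarrow> real ^ 2) \<Rightarrow> real \<Rightarrow> real \<Rightarrow> bool" where
  "negative_crossing D s t \<longleftrightarrow> crossing D s t \<and> det2 (velocity D s) (velocity D t) < 0"

section \<open>The associated rack\<close>

definition breaks :: "(real \<Rightarrow> real ^ 2) \<Rightarrow> real set" where
  "breaks D = {t. cusp D t \<or> (\<exists>s. crossing D s t)}"

text \<open>A strand is encoded by the set of its interior parameter values, which is the set of all
  integer translates of an open interval between two consecutive breaks \<open>a < b\<close>.\<close>

definition strand_from_to :: "(real \<Rightarrow> real ^ 2) \<Rightarrow> real \<Rightarrow> real \<Rightarrow> real set \<Rightarrow> bool" where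
  "strand_from_to D a b S \<longleftrightarrow>
     a < b \<and> a \<in> breaks D \<and> b \<in> breaks D \<and> {a<..<b} \<inter> breaks D = {} \<and>
     S = {u. \<exists>k::int. u + of_int k \<in> {a<..<b}}"

definition strands :: "(real \<Rightarrow> real ^ 2) \<Rightarrow> real set set" where
  "strands D = {S. \<exists>a b. strand_from_to D a b S}"

definition strand_into :: "(real \<Rightarrow> real ^ 2) \<Rightarrow> real \<Rightarrow> real set \<Rightarrow> bool" where
  "strand_into D t S \<longleftrightarrow> (\<exists>a. strand_from_to D a t S)"

definition strand_out_of :: "(real \<Rightarrow> real ^ 2) \<Rightarrow> real \<Rightarrow> real set \<Rightarrow> bool" where
  "strand_out_of D t S \<longleftrightarrow> (\<exists>b. strand_from_to D t b S)"

definition LR_relations ::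
    "nat \<Rightarrow> (real \<Rightarrow> real ^ 2) \<Rightarrow> (real set rack_term \<times> real set rack_term) set" where
  "LR_relations n D =
     {(Gen x', Mul (Gen x) (Gen y)) |x x' y. \<exists>s t. positive_crossing D s t \<and>
        y \<in> strands D \<and> s \<in> y \<and> strand_into D t x \<and> strand_out_of D t x'} \<union>
     {(Gen x', Div (Gen x) (Gen y)) |x x' y. \<exists>s t. negative_crossing D s t \<and>
        y \<in> strands D \<and> s \<in> y \<and> strand_into D t x \<and> strand_out_of D t x'} \<union>
     {(Gen b, rack_power Mul (Gen a) (n + 1)) |a b. \<exists>t. cusp D t \<and>
        strand_into D t a \<and> strand_out_of D t b}"

definition LR :: "nat \<Rightarrow> (real \<Rightarrow> real ^ 2) \<Rightarrow> real set rack_term set rack" where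
  "LR n D = presented_rack n (strands D) (LR_relations n D)"

end

theory Submission
 imports Defs
begin

text \<open>Push the knot off itself in the \<open>z\<close>-direction, which is transverse to the contact planes, and
  consider the paths in the complement from the push-off to a viewer far away in the direction
  \<open>y = - \<infinity>\<close>.  Call a rack-valued function of these paths peripheral if it is invariant under
  homotopy and under sliding the starting point along the push-off, and if inserting a meridian
  multiplies it by the value of the path along which the meridian is reached.

  For a generic front the rack of the front carries a peripheral function: the colour of a strand is
  the value of the path that goes straight to the viewer, and the values of all paths come from a
  holonomy of the complement in the automorphisms of the rack; at a right cusp the framing by the
  push-off produces a twist, which is what the cusp relation absorbs.  Conversely the straight
  paths of any peripheral function satisfy the crossing and cusp relations, and they determine it.
  Hence the rack of the front is the universal target of peripheral functions, which does not
  mention the front.  A Legendrian isotopy extends to a homeomorphism that respects push-offs and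
  meridians (a composition of small Lipschitz perturbations of the identity), hence preserves
  peripheral functions.  No Reidemeister moves are needed.\<close>


section \<open>Racks and permutations\<close>

text \<open>The stages of an isotopy may have arbitrarily degenerate fronts, so the object to be
  compared has to exist for every Legendrian knot. The direction \<open>z\<close> serves because the
  horizontal velocity of a Legendrian knot never vanishes: the \<open>z\<close>-axis and the
  horizontal normal span a disc transverse to the knot, which gives push-off and meridian at once,
  uniformly along an isotopy.

  Holonomy in a group of permutations sees only how an element acts. In a rack \<open>a\<close> and
  \<open>a * a\<close> act alike, so twists of the framing are invisible to it. The value of a path
  is therefore an element, obtained by applying the holonomy to a label of the starting point.

  Write iota a = a * a. The law x^(2n+2) = x says that iota^(2n+1) is the identity, and the cusp
  relation is iota^n at cusps of both kinds. Changing the colours of strands that run to the left by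
  iota^n removes the relation at left cusps and leaves iota^(2n), the inverse of iota, at right
  cusps. This is exactly the one twist that the viewer sees in the push-off at a right cusp.\<close>

typedef 'a sym = "{f :: 'a => 'a. bij f}" morphisms app Sym by (auto intro: bij_id)

setup_lifting type_definition_sym

text \<open>Permutations act from the right: \<open>f + g\<close> first applies \<open>f\<close>.\<close>

instantiation sym :: (type) group_add
begin
lift_definition zero_sym :: "'a sym" is "id" by simp
lift_definition plus_sym :: "'a sym => 'a sym => 'a sym" is "%f g. g o f" by (auto intro: bij_comp)
lift_definition uminus_sym :: "'a sym => 'a sym" is inv by (auto intro: bij_imp_bij_inv)
definition minus_sym :: "'a sym => 'a sym => 'a sym" where "minus_sym a b = a + (- b)"
instance proof
 fix a b c :: "'a sym"
 show "a + b + c = a + (b + c)" by transfer (simp add: comp_assoc)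
 show "0 + a = a" by transfer simp
 show "a + 0 = a" by transfer simp
 show "- a + a = 0" by transfer (auto simp: bij_def surj_iff)
 show "a + - b = a - b" by (simp add: minus_sym_def)
qed
end

lemma app_zero [simp]: "app 0 a = a" by transfer simp
lemma app_plus [simp]: "app (f + g) a = app g (app f a)" by transfer simp
lemma app_uminus [simp]: "app (- f) (app f a) = a" "app f (app (- f) a) = a"
 by (metis app_plus app_zero right_minus, metis app_plus app_zero left_minus)
lemma sym_eqI: "(!!a. app f a = app g a) ==> f = g" by transfer auto

text \<open>Extending right multiplication by the identity off the carrier gives a permutation of
  the whole type, so that holonomies live in a \<open>group_add\<close> type whose laws carry no
  carrier conditions.\<close>

definition act :: "('a, 'b) rack_scheme => 'a => 'a sym" where
 "act R a = (if a:rcarrier R then Sym (%b. if b:rcarrier R then rmul R b a else b) else 0)"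

definition autos :: "('a, 'b) rack_scheme => 'a sym set" where
 "autos R = {f. (ALL a. app f a:rcarrier R \<longleftrightarrow> a:rcarrier R) &
   (ALL a:rcarrier R. ALL b:rcarrier R. app f (rmul R a b) = rmul R (app f a) (app f b))}"

definition rhom :: "('a, 'c) rack_scheme => ('b, 'd) rack_scheme => ('a => 'b) => bool" where
 "rhom R S f \<longleftrightarrow> (ALL x:rcarrier R. f x:rcarrier S) &
   (ALL x:rcarrier R. ALL y:rcarrier R. f (rmul R x y) = rmul S (f x) (f y) & f (rdiv R x y) = rdiv S (f x) (f y))"

text \<open>One full twist of the framing. It commutes with automorphisms and is invisible to
  \<open>act\<close>, which is why cusps, where it enters, do not disturb the holonomy.\<close>

abbreviation iota :: "('a, 'b) rack_scheme => 'a => 'a" where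
 "iota R a \<equiv> rmul R a a"

lemma autos_closed:
 "0:autos R"
 "f:autos R ==> g:autos R ==> f + g:autos R" by (auto simp: autos_def)

context
 fixes R :: "('a, 'b) rack_scheme"
 assumes rack: "rack R"
begin

lemma rack_closed:
 "x:rcarrier R ==> y:rcarrier R ==> rmul R x y:rcarrier R"
 "x:rcarrier R ==> y:rcarrier R ==> rdiv R x y:rcarrier R" using rack unfolding rack_def by auto

lemma rack_cancel:
 "x:rcarrier R ==> y:rcarrier R ==> rdiv R (rmul R x y) y = x"
 "x:rcarrier R ==> y:rcarrier R ==> rmul R (rdiv R x y) y = x" using rack unfolding rack_def by auto

lemma rack_distrib:
 "x:rcarrier R ==> y:rcarrier R ==> z:rcarrier R ==>
  rmul R (rmul R x y) z = rmul R (rmul R x z) (rmul R y z)" using rack unfolding rack_def by blast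

lemma app_act:
 assumes "a:rcarrier R" shows "app (act R a) b = (if b:rcarrier R then rmul R b a else b)" proof -
 let ?f = "%b. if b:rcarrier R then rmul R b a else b"
 have "bij ?f" by (rule o_bij[of "%b. if b:rcarrier R then rdiv R b a else b"])
   (auto simp: fun_eq_iff rack_closed rack_cancel assms)
 thus ?thesis using assms by (simp add: act_def Sym_inverse)
qed

lemma app_minus_act:
 assumes "a:rcarrier R" "b:rcarrier R" shows "app (- act R a) b = rdiv R b a" proof -
 have "b = app (act R a) (rdiv R b a)" using assms by (simp add: app_act rack_closed rack_cancel)
 thus ?thesis by (metis app_uminus(1))
qed

lemma autos_uminus:
 assumes f: "f:autos R" shows "- f:autos R" proof -
 have c: "app (- f) a:rcarrier R \<longleftrightarrow> a:rcarrier R" for a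
  using f unfolding autos_def by (metis (mono_tags, lifting) app_uminus(2) mem_Collect_eq)
 have "app (- f) (rmul R a b) = rmul R (app (- f) a) (app (- f) b)" if "a:rcarrier R" "b:rcarrier R" for a b proof -
  have "app f (rmul R (app (- f) a) (app (- f) b)) = rmul R a b" using f c that unfolding autos_def by simp
  thus ?thesis by (metis app_uminus(1))
 qed
 with c show ?thesis by (auto simp: autos_def)
qed

lemma act_autos: "act R a:autos R" proof (cases "a:rcarrier R")
 case True
 have "rmul R (rmul R b c) a = rmul R (rmul R b a) (rmul R c a)" if "b:rcarrier R" "c:rcarrier R" for b c using rack_distrib that True by blast
 thus ?thesis using True by (auto simp: autos_def app_act rack_closed)
qed (auto simp: act_def autos_def)

lemma autos_carrier: "f:autos R ==> app f a:rcarrier R \<longleftrightarrow> a:rcarrier R" by (auto simp: autos_def)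

text \<open>Self-distributivity makes an automorphism carry the action of \<open>a\<close> to the
  action of its image. This is the algebraic form of conjugating a meridian by a path and drives the
  crossing and meridian computations below.\<close>

lemma act_conj:
 assumes f: "f:autos R" and a: "a:rcarrier R" shows "- f + act R a + f = act R (app f a)" proof (rule sym_eqI)
 fix b
 have fa: "app f a:rcarrier R" using f a autos_carrier by blast
 note fm = autos_carrier[OF autos_uminus[OF f]]
 show "app (- f + act R a + f) b = app (act R (app f a)) b" proof (cases "b:rcarrier R")
  case True
  hence "app f (rmul R (app (- f) b) a) = rmul R (app f (app (- f) b)) (app f a)" using f a fm[of b] unfolding autos_def by blast
  thus ?thesis using True fm[of b] by (simp add: app_act[OF a] app_act[OF fa])
 next
  case False
  thus ?thesis using fm[of b] by (simp add: app_act[OF a] app_act[OF fa])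
 qed
qed

text \<open>The case \<open>f = act R a\<close> of \<open>act_conj\<close>: a permutation commutes
  with itself.\<close>

lemma act_iota:
 assumes a: "a:rcarrier R" shows "act R (iota R a) = act R a" using act_conj[OF act_autos a, of a] a by (simp add: app_act)

lemma iota_closed: "a:rcarrier R ==> (iota R ^^ m) a:rcarrier R" by (induction m) (auto simp: rack_closed)

lemma act_iota_pow: "a:rcarrier R ==> act R ((iota R ^^ m) a) = act R a" by (induction m) (auto simp: act_iota iota_closed)

lemma mul_iota_pow: "a:rcarrier R ==> b:rcarrier R ==> rmul R b ((iota R ^^ m) a) = rmul R b a"
 using act_iota_pow[of a m] app_act[of a b] app_act[of "(iota R ^^ m) a" b] iota_closed[of a m] by simp

lemma autos_iota_pow:
 "f:autos R ==> a:rcarrier R ==> app f ((iota R ^^ m) a) = (iota R ^^ m) (app f a)" by (induction m) (auto simp: autos_def iota_closed)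

text \<open>By \<open>mul_iota_pow\<close>, multiplying a power by \<open>a\<close> is the same as
  multiplying it by itself. The index is shifted because \<open>rack_power\<close> starts at
  exponent 1.\<close>

lemma rack_power_iota: "a:rcarrier R ==> rack_power (rmul R) a (Suc m) = (iota R ^^ m) a" proof (induction m)
 case (Suc m)
 thus ?case using mul_iota_pow[of a "(iota R ^^ m) a" m] iota_closed by simp
qed simp

end

text \<open>So the \<open>2 * n\<close>-fold iterate inverts \<open>iota\<close>, and the
  \<open>n\<close>- and \<open>(n + 1)\<close>-fold iterates invert each other. The first fact
  governs right cusps, the second the change of colours on strands that run to the left.\<close>

lemma legendrian_iota:
 assumes "legendrian_rack n R" "a:rcarrier R" shows "(iota R ^^ (2 * n + 1)) a = a" proof -
 have "rack_power (rmul R) a (Suc (2 * n + 1)) = a" using assms by (simp add: legendrian_rack_def)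
 thus ?thesis using rack_power_iota[of R a "2 * n + 1"] assms by (simp add: legendrian_rack_def)
qed

lemma presented_rack_induct:
 assumes "x:rcarrier (presented_rack n G E)"
  and gen: "!!g. g:G ==> P (cong_class n G E (Gen g))"
  and mul: "!!x y. x:rcarrier (presented_rack n G E) ==> y:rcarrier (presented_rack n G E) ==>
    P x ==> P y ==> P (rmul (presented_rack n G E) x y)"
  and div: "!!x y. x:rcarrier (presented_rack n G E) ==> y:rcarrier (presented_rack n G E) ==>
    P x ==> P y ==> P (rdiv (presented_rack n G E) x y)" shows "P x" proof -
 have "P (cong_class n G E s)" if "s:terms_over G" for s using that proof (induction s)
  case (Gen g) thus ?case using gen by simp
 next
  case (Mul s t)
  thus ?case using mul[of "cong_class n G E s" "cong_class n G E t"] presented_mul[of s G t n E] by (simp add: presented_carrier)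
 next
  case (Div s t)
  thus ?case using div[of "cong_class n G E s" "cong_class n G E t"] presented_div[of s G t n E] by (simp add: presented_carrier)
 qed
 thus ?thesis using assms(1) by (auto simp: presented_carrier)
qed

section \<open>Holonomy of locally defined group-valued transition data\<close>

locale cocycle =
 fixes I :: "'i set" and U :: "'i => 'a::topological_space set"
  and w :: "'i => 'a => 'a => 'g::group_add" and H :: "'g set"
 assumes open_U: "i:I ==> open (U i)"
  and w_trans: "i:I ==> p:U i ==> q:U i ==> r:U i ==> w i p q + w i q r = w i p r"
  and w_agree: "i:I ==> j:I ==> p:U i ==> p:U j ==> \<forall>\<^sub>F q in nhds p. w i p q = w j p q"
  and w_H: "i:I ==> p:U i ==> q:U i ==> w i p q:H"
  and H_zero: "0:H" and H_add: "a:H ==> b:H ==> a + b:H"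
  and H_uminus: "a:H ==> - a:H"
begin

text \<open>A lift of \<open>h\<close> to the covering defined by the data, seen through its
  increments. It can be changed by left translation with a constant, so only
  \<open>- l s + l t\<close> is meaningful.\<close>

definition primitive :: "'c::topological_space set => ('c => 'a) => ('c => 'g) => bool" where
 "primitive C h l \<longleftrightarrow> l ` C <= H & (ALL s:C. ALL i:I. h s:U i -->
   (\<forall>\<^sub>F s' in at s within C. l s' = l s + w i (h s) (h s')))"

lemma w_refl: assumes "i:I" "p:U i" shows "w i p p = 0" using w_trans[OF assms assms(2) assms(2)] by (metis add_right_imp_eq add_0_left)

text \<open>\<open>w_agree\<close> is an equality of germs; pulled back along the continuous
  \<open>h\<close>, it carries the local equation from one chart to every other chart through the
  same point.\<close>

lemma primitiveI_locally:
 assumes "l ` C <= H" "continuous_on C h"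
  and "!!s. s:C ==> EX i:I. h s:U i & (\<forall>\<^sub>F s' in at s within C. l s' = l s + w i (h s) (h s'))" shows "primitive C h l"
 unfolding primitive_def proof (intro conjI ballI impI assms(1))
 fix s j assume s: "s:C" and j: "j:I" "h s:U j"
 obtain i where i: "i:I" "h s:U i" "\<forall>\<^sub>F s' in at s within C. l s' = l s + w i (h s) (h s')" using assms(3)[OF s] by blast
 have "(h \<longlongrightarrow> h s) (at s within C)" using assms(2) s by (simp add: continuous_on_def)
 from eventually_compose_filterlim[OF w_agree[OF i(1) j(1) i(2) j(2)] this]
 have "\<forall>\<^sub>F s' in at s within C. w i (h s) (h s') = w j (h s) (h s')" .
 with i(3) show "\<forall>\<^sub>F s' in at s within C. l s' = l s + w j (h s) (h s')" by eventually_elim simp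
qed

lemma primitive_chart:
 assumes "continuous_on C h" "h ` C <= U i" "i:I" "p:U i" shows "primitive C h (%s. w i p (h s))" proof (rule primitiveI_locally)
 show "(%s. w i p (h s)) ` C <= H" using assms w_H by auto
 fix s assume s: "s:C"
 have "\<forall>\<^sub>F s' in at s within C. s':C" by (simp add: eventually_at_filter)
 hence "\<forall>\<^sub>F s' in at s within C. w i p (h s') = w i p (h s) + w i (h s) (h s')"
  by eventually_elim (metis assms(2-4) image_subset_iff s w_trans)
 thus "EX j:I. h s:U j & (\<forall>\<^sub>F s' in at s within C. w i p (h s') = w i p (h s) + w j (h s) (h s'))" using assms s by blast
qed (use assms in auto)

lemma primitive_add:
 assumes "primitive C h l" "k:H" shows "primitive C h (%s. k + l s)" using assms unfolding primitive_def
 by (auto simp: add.assoc H_add image_subset_iff)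

lemma primitive_compose:
 assumes "primitive C h l" "continuous_on C' f" "f ` C' <= C" shows "primitive C' (%s. h (f s)) (%s. l (f s))" unfolding primitive_def
proof (intro conjI ballI impI)
 show "(%s. l (f s)) ` C' <= H" using assms by (auto simp: primitive_def)
 fix s i assume s: "s:C'" "i:I" "h (f s):U i"
 hence "\<forall>\<^sub>F t in at (f s) within C. l t = l (f s) + w i (h (f s)) (h t)" using assms by (auto simp: primitive_def)
 hence ev: "\<forall>\<^sub>F t in nhds (f s). t:C --> l t = l (f s) + w i (h (f s)) (h t)" unfolding eventually_at_filter
  by (rule eventually_mono) (use s in "auto simp: w_refl")
 have "(f \<longlongrightarrow> f s) (at s within C')" using assms(2) s by (simp add: continuous_on_def)
 from eventually_compose_filterlim[OF ev this]
 have "\<forall>\<^sub>F t in at s within C'. f t:C --> l (f t) = l (f s) + w i (h (f s)) (h (f t))" .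
 moreover have "\<forall>\<^sub>F t in at s within C'. t:C'" by (simp add: eventually_at_filter)
 ultimately show "\<forall>\<^sub>F t in at s within C'. l (f t) = l (f s) + w i (h (f s)) (h (f t))" by eventually_elim (use assms(3) in auto)
qed

lemma primitive_cong:
 assumes "primitive C h l" "!!s. s:C ==> h s = h' s" "!!s. s:C ==> l s = l' s" shows "primitive C h' l'" unfolding primitive_def
proof (intro conjI ballI impI)
 show "l' ` C <= H" using assms(1,3) unfolding primitive_def by (metis image_cong)
 fix s i assume s: "s:C" "i:I" "h' s:U i"
 hence "\<forall>\<^sub>F s' in at s within C. l s' = l s + w i (h s) (h s')" using assms(1,2) by (auto simp: primitive_def)
 moreover have "\<forall>\<^sub>F t in at s within C. t:C" by (simp add: eventually_at_filter)
 ultimately show "\<forall>\<^sub>F s' in at s within C. l' s' = l' s + w i (h' s) (h' s')" by eventually_elim (use s assms in auto)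
qed

lemma primitive_subset: "primitive C h l ==> C' <= C ==> primitive C' h l"
 using primitive_compose[of C h l C' "%s. s"] by (simp add: image_subset_iff subset_iff)

text \<open>Under a small move both primitives acquire the same right factor, so
  \<open>l' s - l s\<close> is locally constant.\<close>

lemma primitive_unique:
 assumes "primitive C h l" "primitive C h l'" "connected C" "h ` C <= \<Union>(U ` I)" "s:C" "t:C" shows "- l s + l t = - l' s + l' t" proof -
 have "l' s - l s = l' t - l t" proof (rule connected_local_const[OF assms(3,5,6), of "%s. l' s - l s"], intro ballI)
  fix a assume a: "a:C"
  then obtain i where i: "i:I" "h a:U i" using assms(4) by auto
  have "\<forall>\<^sub>F s' in at a within C. l s' = l a + w i (h a) (h s')"
     "\<forall>\<^sub>F s' in at a within C. l' s' = l' a + w i (h a) (h s')" using assms(1,2) a i unfolding primitive_def by auto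
  thus "\<forall>\<^sub>F b in at a within C. l' a - l a = l' b - l b" by eventually_elim (simp add: diff_add_eq_diff_diff_swap)
 qed
 hence e: "l' t = (l' s - l s) + l t" by simp
 show ?thesis unfolding e by (simp add: add.assoc[symmetric] diff_conv_add_uminus del: add_uminus_conv_diff)
qed

text \<open>A left translation makes the primitives agree at one point of the connected
  intersection, hence on all of it. Since the pieces are closed, only one of them matters near a
  point outside the other.\<close>

lemma primitive_glue:
 assumes "closed C1" "closed C2" "connected (C1 Int C2)" "C1 Int C2 ~= {}"
  "h ` (C1 Un C2) <= \<Union>(U ` I)" "primitive C1 h l1" "primitive C2 h l2" shows "EX l. primitive (C1 Un C2) h l" proof -
 obtain s0 where s0: "s0:C1" "s0:C2" using assms by auto
 define l3 where "l3 s = (l1 s0 - l2 s0) + l2 s" for s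
 have "l1 s0 - l2 s0:H" unfolding diff_conv_add_uminus by (rule H_add[OF _ H_uminus]) (use assms(6,7) s0 in "auto simp: primitive_def")
 hence l3: "primitive C2 h l3" unfolding l3_def using primitive_add assms(7) by blast
 have eq: "l3 s = l1 s" if "s:C1" "s:C2" for s proof -
  have "- l3 s0 + l3 s = - l1 s0 + l1 s" by (rule primitive_unique[of "C1 Int C2" h])
    (use assms l3 s0 that primitive_subset[of C1 h l1 "C1 Int C2"] primitive_subset[of C2 h l3 "C1 Int C2"] in auto)
  moreover have "l3 s0 = l1 s0" by (simp add: l3_def)
  ultimately show ?thesis by simp
 qed
 define l where "l s = (if s:C1 then l1 s else l3 s)" for s
 have l1: "l s = l1 s" if "s:C1" for s using that by (simp add: l_def)
 have l2: "l s = l3 s" if "s:C2" for s using that eq by (simp add: l_def)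
 have "primitive (C1 Un C2) h l" unfolding primitive_def proof (intro conjI ballI impI)
  show "l ` (C1 Un C2) <= H" using assms(6) l3 by (auto simp: primitive_def l_def)
  fix s i assume s: "s:C1 Un C2" "i:I" "h s:U i"
  have *: "\<forall>\<^sub>F s' in at s within C. l s' = l s + w i (h s) (h s')"
   if C: "closed C" "primitive C h m" "!!s. s:C ==> l s = m s" for C m proof (cases "s:C")
   case True
   hence "\<forall>\<^sub>F s' in at s within C. m s' = m s + w i (h s) (h s')" using C s by (auto simp: primitive_def)
   moreover have "\<forall>\<^sub>F t in at s within C. t:C" by (simp add: eventually_at_filter)
   ultimately show ?thesis by eventually_elim (use C True in auto)
  next
   case False
   hence "\<forall>\<^sub>F s' in nhds s. s' ~: C" using eventually_nhds_in_open[of "- C" s] C(1) by (simp add: open_Compl)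
   thus ?thesis unfolding eventually_at_filter by (rule eventually_mono) auto
  qed
  show "\<forall>\<^sub>F s' in at s within C1 Un C2. l s' = l s + w i (h s) (h s')" unfolding at_within_union eventually_sup
   using *[OF assms(1,6) l1] *[OF assms(2) l3 l2] by blast
 qed
 thus ?thesis using [[show_types]] by (intro exI[of _ l])
qed

text \<open>Bisection in both directions: across first, for a strip of small height, then along the
  second axis. The rectangles that are glued meet in rectangles, so \<open>primitive_glue\<close>
  applies.\<close>

lemma primitive_rectangle:
 fixes h :: "real * real => 'a"
 assumes ab: "a <= b" "c <= d" and h: "continuous_on ({a..b} \<times> {c..d}) h" "h ` ({a..b} \<times> {c..d}) <= \<Union>(U ` I)"
 shows "EX l. primitive ({a..b} \<times> {c..d}) h l" proof -
 let ?R = "{a..b} \<times> {c..d}"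
 have glue: "EX l. primitive (C1 Un C2) h l" if "C1 = {p..q} \<times> {r..s}" "C2 = {p'..q'} \<times> {r'..s'}"
  "C1 Int C2 ~= {}" "C1 Un C2 <= ?R" "EX l. primitive C1 h l" "EX l. primitive C2 h l"
  for C1 C2 p q r s p' q' r' s' proof -
  have "C1 Int C2 = {max p p'..min q q'} \<times> {max r r'..min s s'}" unfolding that by auto
  hence "connected (C1 Int C2)" by (simp add: connected_Times)
  moreover have "closed C1" "closed C2" unfolding that by (auto intro: closed_Times)
  ultimately show ?thesis using primitive_glue[of C1 C2 h] that h(2) by blast
 qed
 have loc: "EX e>0. ALL C. C <= ?R Int ball s e --> (EX l. primitive C h l)" if s: "s:?R" for s proof -
  obtain i where i: "i:I" "h s:U i" using h s by auto
  have "(h \<longlongrightarrow> h s) (at s within ?R)" using h(1) s unfolding continuous_on_def by blast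
  hence "\<forall>\<^sub>F t in at s within ?R. h t:U i" using open_U i topological_tendstoD by blast
  then obtain e where e: "e > 0" "!!t. t:?R ==> t ~= s ==> dist t s < e ==> h t:U i" unfolding eventually_at by blast
  have "EX l. primitive C h l" if "C <= ?R Int ball s e" for C proof -
   have "h t:U i" if t: "t:C" for t proof (cases "t = s")
    case False
    have "t:?R" "dist t s < e" using t \<open>C <= ?R Int ball s e\<close> by (auto simp: dist_commute)
    thus ?thesis using e(2) False by blast
   qed (use i in simp)
   hence "h ` C <= U i" by blast
   moreover have "continuous_on C h" using h(1) that continuous_on_subset by blast
   ultimately show ?thesis using primitive_chart[of C h i "h s"] i by blast
  qed
  thus ?thesis using e(1) by blast
 qed
 \<comment> \<open>The admissible height of a strip may depend on \<open>t\<close>. When two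
   horizontal pieces are joined, the smaller of their heights works for both.\<close>
 have strip: "EX e>0. ALL c' d'. c <= c' & c' <= t & t <= d' & d' <= d & d' - c' < e --> (EX l. primitive ({a..b} \<times> {c'..d'}) h l)"
  if t: "c <= t" "t <= d" for t proof -
  define G where "G e p q \<longleftrightarrow> (ALL c' d'. c <= c' & c' <= t & t <= d' & d' <= d & d' - c' < e -->
   (EX l. primitive ({p..q} \<times> {c'..d'}) h l))" for e p q
  define P where "P p q \<longleftrightarrow> (a <= p & q <= b --> (EX e>0. G e p q))" for p q
  have "P a b" using ab(1) proof (induction rule: Bolzano)
   case (trans p q r)
   show ?case unfolding P_def proof
    assume pr: "a <= p & r <= b"
    hence "a <= p & q <= b" "a <= q & r <= b" using trans(3,4) by linarith+
    then obtain e1 e2 where e: "e1 > 0" "G e1 p q" "e2 > 0" "G e2 q r" using trans(1,2) unfolding P_def by blast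
    have "G (min e1 e2) p r" unfolding G_def proof (intro allI impI)
     fix c' d' assume cd: "c <= c' & c' <= t & t <= d' & d' <= d & d' - c' < min e1 e2"
     hence ex: "EX l. primitive ({p..q} \<times> {c'..d'}) h l" "EX l. primitive ({q..r} \<times> {c'..d'}) h l" using e(2,4) unfolding G_def by auto
     have "{p..r} \<times> {c'..d'} = {p..q} \<times> {c'..d'} Un {q..r} \<times> {c'..d'}" using trans(3,4) by auto
     moreover have "(q,t):{p..q} \<times> {c'..d'} Int {q..r} \<times> {c'..d'}" using trans(3,4) cd by auto
     hence "{p..q} \<times> {c'..d'} Int {q..r} \<times> {c'..d'} ~= {}" by blast
     moreover have "{p..r} \<times> {c'..d'} <= ?R" using pr cd by auto
     ultimately show "EX l. primitive ({p..r} \<times> {c'..d'}) h l" using glue[OF HOL.refl HOL.refl _ _ ex] by simp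
    qed
    thus "EX e>0. G e p r" using e by (meson min_less_iff_conj)
   qed
  next
   case (local x)
   hence "(x,t):?R" using t by auto
   from loc[OF this] obtain e where e: "e > 0" "!!C. C <= ?R Int ball (x,t) e ==> EX l. primitive C h l" by blast
   have "G (e/2) p q" if "a <= p" "q <= b" "p <= x" "x <= q" "q - p < e/2" for p q unfolding G_def proof (intro allI impI)
    fix c' d' assume cd: "c <= c' & c' <= t & t <= d' & d' <= d & d' - c' < e/2"
    have "(u,v):?R Int ball (x,t) e" if uv: "u:{p..q}" "v:{c'..d'}" for u v proof -
     have "dist (x,t) (u,v) <= dist x u + dist t v" unfolding dist_Pair_Pair by (rule sqrt_sum_squares_le_sum) auto
     also have "... < e" using uv cd that \<open>p <= x\<close> \<open>x <= q\<close> \<open>q - p < e/2\<close> by (auto simp: dist_real_def)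
     finally show "(u,v):?R Int ball (x,t) e" using uv cd \<open>a <= p\<close> \<open>q <= b\<close> by auto
    qed
    thus "EX l. primitive ({p..q} \<times> {c'..d'}) h l" by (intro e(2)) blast
   qed
   thus ?case using e(1) unfolding P_def by (meson half_gt_zero)
  qed
  thus ?thesis by (auto simp: G_def P_def)
 qed
 define Q where "Q p q \<longleftrightarrow> (c <= p & q <= d --> (EX l. primitive ({a..b} \<times> {p..q}) h l))" for p q
 have "Q c d" using ab(2) proof (induction rule: Bolzano)
  case (trans p q r)
  show ?case unfolding Q_def proof
   assume pr: "c <= p & r <= d"
   hence t: "c <= p & q <= d" "c <= q & r <= d" using trans(3,4) by linarith+
   have "{a..b} \<times> {p..r} = {a..b} \<times> {p..q} Un {a..b} \<times> {q..r}" using trans(3,4) by auto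
   moreover have "(a,q):{a..b} \<times> {p..q} Int {a..b} \<times> {q..r}" using trans(3,4) ab by auto
   hence "{a..b} \<times> {p..q} Int {a..b} \<times> {q..r} ~= {}" by blast
   moreover have "{a..b} \<times> {p..r} <= ?R" using pr by auto
   moreover have "EX l. primitive ({a..b} \<times> {p..q}) h l" "EX l. primitive ({a..b} \<times> {q..r}) h l"
    using trans(1,2) t unfolding Q_def by simp_all
   ultimately show "EX l. primitive ({a..b} \<times> {p..r}) h l" using glue[OF HOL.refl HOL.refl, of a b p q a b q r] by simp
  qed
 next
  case (local x)
  have "c <= x" "x <= d" using local by simp_all
   hence "EX e>0. ALL c' d'. c <= c' & c' <= x & x <= d' & d' <= d & d' - c' < e --> (EX l. primitive ({a..b} \<times> {c'..d'}) h l)"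
    by (intro strip) auto
   then obtain e where e: "e > 0" "ALL c' d'. c <= c' & c' <= x & x <= d' & d' <= d & d' - c' < e --> (EX l. primitive ({a..b} \<times> {c'..d'}) h l)"
    by (elim exE conjE)
   show ?case unfolding Q_def by (rule exI[of _ e], intro conjI allI impI, rule e(1), rule e(2)[rule_format]) simp
 qed
 thus ?thesis by (simp add: Q_def)
qed

definition holonomy :: "(real => 'a) => 'g" where
 "holonomy g = (SOME k. EX l. primitive {0..1} g l & k = - l 0 + l 1)"

lemma holonomy_eq:
 assumes "primitive {0..1} g l" "path_image g <= \<Union>(U ` I)" shows "holonomy g = - l 0 + l 1" proof -
 have "EX l. primitive {0..1} g l & holonomy g = - l 0 + l 1" unfolding holonomy_def by (rule someI_ex) (use assms in blast)
 thus ?thesis using primitive_unique[OF _ assms(1)] assms(2) by (fastforce simp: path_image_def)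
qed

lemma primitive_path:
 assumes "path g" "path_image g <= \<Union>(U ` I)" shows "EX l. primitive {0..1} g l" proof -
 have "continuous_on ({0..1} \<times> {0..1::real}) (%x. g (fst x))"
  using assms(1) unfolding path_def by (rule continuous_on_compose2) (auto intro: continuous_intros)
 then obtain l where l: "primitive ({0..1} \<times> {0..1::real}) (%x. g (fst x)) l"
  using primitive_rectangle[of 0 1 0 1 "%x. g (fst x)"] assms(2) by (fastforce simp: path_image_def)
 have "primitive {0..1} (%s. g (fst (s, 0::real))) (%s. l (s, 0))" by (rule primitive_compose[OF l]) (auto intro: continuous_intros)
 thus ?thesis by auto
qed

lemma holonomy_chart:
 assumes "path g" "path_image g <= U i" "i:I" shows "holonomy g = w i (pathstart g) (pathfinish g)" proof -
 have s: "pathstart g:U i" using assms by auto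
 have "primitive {0..1} g (%s. w i (pathstart g) (g s))" by (rule primitive_chart) (use assms s in "auto simp: path_def path_image_def")
 from holonomy_eq[OF this] assms s show ?thesis by (auto simp: pathstart_def pathfinish_def w_refl)
qed

lemma holonomy_in_H: assumes "path g" "path_image g <= \<Union>(U ` I)" shows "holonomy g:H" proof -
 obtain l where l: "primitive {0..1} g l" using primitive_path[OF assms] by blast
 hence "l 0:H" "l 1:H" by (auto simp: primitive_def)
 thus ?thesis using holonomy_eq[OF l assms(2)] H_add H_uminus by simp
qed

lemma holonomy_join:
 assumes "path g" "path k" "pathfinish g = pathstart k"
  "path_image g <= \<Union>(U ` I)" "path_image k <= \<Union>(U ` I)" shows "holonomy (g +++ k) = holonomy g + holonomy k" proof -
 have im: "path_image (g +++ k) <= \<Union>(U ` I)" using assms by (simp add: path_image_join)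
 obtain l where l: "primitive {0..1} (g +++ k) l" using primitive_path[OF _ im] assms by auto
 have "primitive {0..1} (%s. (g +++ k) (s/2)) (%s. l (s/2))" by (rule primitive_compose[OF l]) (auto intro!: continuous_intros)
 hence 1: "primitive {0..1} g (%s. l (s/2))" by (rule primitive_cong) (auto simp: joinpaths_def)
 have "primitive {0..1} (%s. (g +++ k) ((s+1)/2)) (%s. l ((s+1)/2))" by (rule primitive_compose[OF l]) (auto intro!: continuous_intros)
 hence 2: "primitive {0..1} k (%s. l ((s+1)/2))"
  by (rule primitive_cong) (use assms(3) in "auto simp: joinpaths_def pathstart_def pathfinish_def field_simps")
 show ?thesis using holonomy_eq[OF l im] holonomy_eq[OF 1 assms(4)] holonomy_eq[OF 2 assms(5)] by (simp add: add.assoc[symmetric])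
qed

text \<open>A primitive on the homotopy square compares the two paths along the boundary; on the two
  sides where an endpoint stays fixed it does not change.\<close>

lemma holonomy_homotopic:
 assumes "homotopic_paths (\<Union>(U ` I)) g k" shows "holonomy g = holonomy k" proof -
 let ?X = "\<Union>(U ` I)"
 from assms obtain h where h: "continuous_on ({0..1} \<times> {0..1}) h" "h ` ({0..1} \<times> {0..1}) <= ?X"
  "!!x. x:{0..1} ==> h (0, x) = g x" "!!x. x:{0..1} ==> h (1, x) = k x"
  "!!t. t:{0..1::real} ==> pathstart (h o Pair t) = pathstart g & pathfinish (h o Pair t) = pathfinish g"
  unfolding homotopic_paths by (auto simp: image_subset_iff_funcset)
 obtain l where l: "primitive ({0..1} \<times> {0..1::real}) h l" using primitive_rectangle[OF _ _ h(1,2)] by auto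
 have P: "primitive {0..1} (%s. h (f s)) (%s. l (f s))" if "continuous_on {0..1} f" "f ` {0..1} <= {0..1} \<times> {0..1}" for f :: "real => _"
  by (rule primitive_compose[OF l that])
 have gX: "path_image g <= ?X" "path_image k <= ?X" using assms homotopic_paths_imp_subset by blast+
 have const: "- l (f 0) + l (f 1) = 0" if f: "continuous_on {0..1} f" "f ` {0..1} <= {0..1} \<times> {0..1}" "!!s. s:{0..1} ==> h (f s) = p"
   for f :: "real => _" and p proof -
  have "f 0:{0..1} \<times> {0..1}" using f(2) by auto
  hence "p:?X" using h(2) f(3)[of 0] by (metis atLeastAtMost_iff image_subset_iff order_refl zero_le_one)
  then obtain i where i: "i:I" "p:U i" by auto
  have "primitive {0..1} (%s. p) (%s. w i p p)" by (rule primitive_chart) (use i in auto)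
  hence "primitive {0..1} (%s. h (f s)) (%s. 0)" by (rule primitive_cong) (use f(3) i in "auto simp: w_refl")
  from primitive_unique[OF P[OF f(1,2)] this, of 0 1] show ?thesis using i f(3) by auto
 qed
 have 0: "- l (0,0) + l (1,0) = 0"
  by (rule const[of "%s. (s,0)" "pathstart g", simplified]) (use h(5) in "auto intro!: continuous_intros simp: pathstart_def")
 have 1: "- l (0,1) + l (1,1) = 0"
  by (rule const[of "%s. (s,1)" "pathfinish g", simplified]) (use h(5) in "auto intro!: continuous_intros simp: pathfinish_def")
 have "primitive {0..1} (%s. h (0, s)) (%s. l (0, s))" by (rule P) (auto intro!: continuous_intros)
 hence g: "primitive {0..1} g (%s. l (0, s))" by (rule primitive_cong) (use h in auto)
 have "primitive {0..1} (%s. h (1, s)) (%s. l (1, s))" by (rule P) (auto intro!: continuous_intros)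
 hence k: "primitive {0..1} k (%s. l (1, s))" by (rule primitive_cong) (use h in auto)
 have "l (1,0) = l (0,0)" "l (1,1) = l (0,1)" using 0 1 by (metis neg_eq_iff_add_eq_0 minus_minus)+
 thus ?thesis using holonomy_eq[OF g gX(1)] holonomy_eq[OF k gX(2)] by simp
qed

end

section \<open>Concatenations of paths up to homotopy\<close>

text \<open>Paths are kept as lists of pieces, so that associativity and reparametrisation
  disappear. The constant path at the end gives the empty list a meaning.\<close>

fun jl :: "'a::real_normed_vector => (real => 'a) list => real => 'a" where
 "jl b [] = linepath b b"
| "jl b (g # xs) = g +++ jl b xs"

fun pchain :: "'a::real_normed_vector set => 'a => (real => 'a) list => 'a => bool" where
 "pchain X a [] b \<longleftrightarrow> a = b & a:X"
| "pchain X a (g # xs) b \<longleftrightarrow> path g & path_image g <= X & pathstart g = a & pchain X (pathfinish g) xs b"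

text \<open>Composability of both lists within \<open>X\<close> is part of the relation, so that
  each rewriting step carries its own well-formedness.\<close>

definition HE :: "'a::real_normed_vector set => 'a => (real => 'a) list => (real => 'a) list => 'a => bool" where
 "HE X a xs ys b \<longleftrightarrow> pchain X a xs b & pchain X a ys b & homotopic_paths X (jl b xs) (jl b ys)"

definition rl :: "(real => 'a) list => (real => 'a::real_normed_vector) list" where
 "rl xs = map reversepath (rev xs)"

lemma pchain_append: "pchain X a (xs @ ys) b \<longleftrightarrow> (EX c. pchain X a xs c & pchain X c ys b)" proof (induction xs arbitrary: a)
 case Nil
 have "pchain X a ys b ==> a:X" by (cases ys) auto
 thus ?case by auto
qed auto

lemma pchain_appendI: "pchain X a xs c ==> pchain X c ys b ==> pchain X a (xs @ ys) b" using pchain_append by blast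

lemma pchain_end: "pchain X a xs b ==> a:X & b:X" proof (induction xs arbitrary: a)
 case (Cons g xs)
 thus ?case using pathstart_in_path_image[of g] by auto
qed auto

lemma pchain_subset: "pchain X a xs b ==> X <= Y ==> pchain Y a xs b" by (induction xs arbitrary: a) auto

lemma pchain_jl:
 assumes "pchain X a xs b" shows "path (jl b xs)" "path_image (jl b xs) <= X" "pathstart (jl b xs) = a" "pathfinish (jl b xs) = b" using assms
 by (induction xs arbitrary: a) (auto simp: path_image_join, blast+)

lemma jl_append:
 assumes "pchain X a xs b" "pchain X b ys c" shows "homotopic_paths X (jl c (xs @ ys)) (jl b xs +++ jl c ys)" using assms(1)
proof (induction xs arbitrary: a)
 case Nil
 have n: "homotopic_paths X (linepath b b +++ jl c ys) (jl c ys)" using homotopic_paths_lid[of "jl c ys" X] pchain_jl[OF assms(2)] by simp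
 show ?case using homotopic_paths_sym[OF n] by (simp only: append_Nil jl.simps)
next
 case (Cons g xs)
 hence c: "pchain X (pathfinish g) xs b" and g: "path g" "path_image g <= X" by auto
 note j = pchain_jl[OF c] pchain_jl[OF assms(2)]
 have "homotopic_paths X (g +++ jl c (xs @ ys)) (g +++ (jl b xs +++ jl c ys))"
  by (rule homotopic_paths_join) (use Cons.IH[OF c] g pchain_jl(3)[OF pchain_appendI[OF c assms(2)]] in auto)
 also have "homotopic_paths X (g +++ (jl b xs +++ jl c ys)) ((g +++ jl b xs) +++ jl c ys)" by (rule homotopic_paths_assoc) (use j g in auto)
 finally show ?case by simp
qed

lemma HE_refl: "pchain X a xs b ==> HE X a xs xs b" by (simp add: HE_def pchain_jl)

lemma HE_sym: "HE X a xs ys b ==> HE X a ys xs b" by (auto simp: HE_def homotopic_paths_sym)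

lemma HE_trans [trans]: "HE X a xs ys b ==> HE X a ys zs b ==> HE X a xs zs b" by (auto simp: HE_def intro: homotopic_paths_trans)

lemma HE_pchain: "HE X a xs ys b ==> pchain X a xs b" "HE X a xs ys b ==> pchain X a ys b" by (auto simp: HE_def)

lemma HE_subset: "HE X a xs ys b ==> X <= Y ==> HE Y a xs ys b" by (auto simp: HE_def intro: pchain_subset homotopic_paths_subset)

lemma HE_append:
 assumes "HE X a xs xs' b" "HE X b ys ys' c" shows "HE X a (xs @ ys) (xs' @ ys') c" proof -
 note p = HE_pchain[OF assms(1)] HE_pchain[OF assms(2)]
 have "homotopic_paths X (jl c (xs @ ys)) (jl b xs +++ jl c ys)" by (rule jl_append) (use p in auto)
 also have "homotopic_paths X ... (jl b xs' +++ jl c ys')" by (rule homotopic_paths_join) (use assms p in "auto simp: HE_def pchain_jl")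
 also have "homotopic_paths X ... (jl c (xs' @ ys'))" by (rule homotopic_paths_sym, rule jl_append) (use p in auto)
 finally show ?thesis using p by (auto simp: HE_def intro: pchain_appendI)
qed

lemma HE_ctx:
 assumes "HE X a' ys ys' b'" "pchain X a xs a'" "pchain X b' zs b" shows "HE X a (xs @ ys @ zs) (xs @ ys' @ zs) b"
 using assms by (auto intro!: HE_append[of X a xs xs a'] HE_append[of X a' ys ys' b'] HE_refl)

lemma HE_homotopic:
 assumes "homotopic_paths X g h" shows "HE X (pathstart g) [g] [h] (pathfinish g)" proof -
 note h = homotopic_paths_imp_path[OF assms] homotopic_paths_imp_subset[OF assms]
  homotopic_paths_imp_pathstart[OF assms] homotopic_paths_imp_pathfinish[OF assms]
 have "homotopic_paths X (g +++ linepath (pathfinish g) (pathfinish g)) (h +++ linepath (pathfinish g) (pathfinish g))"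
  by (rule homotopic_paths_join) (use assms h pathfinish_in_path_image[of g] in auto)
 thus ?thesis using h pathfinish_in_path_image[of g] by (auto simp: HE_def)
qed

lemma HE_join:
 assumes "path g" "path h" "path_image g <= X" "path_image h <= X" "pathfinish g = pathstart h"
 shows "HE X (pathstart g) [g +++ h] [g, h] (pathfinish h)" proof -
 let ?c = "linepath (pathfinish h) (pathfinish h)"
 have "homotopic_paths X ((g +++ h) +++ ?c) (g +++ (h +++ ?c))" by (rule homotopic_paths_sym, rule homotopic_paths_assoc)
   (use assms pathfinish_in_path_image[of h] in auto)
 thus ?thesis using assms pathfinish_in_path_image[of h] by (auto simp: HE_def path_image_join)
qed

text \<open>The main source of homotopies: it serves in regions where only the endpoints of a path
  matter, namely in front of the knot, behind it, and in convex sets.\<close>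

lemma HE_simply:
 assumes "simply_connected S" "S <= X" "pchain S a xs b" "pchain S a ys b" shows "HE X a xs ys b" proof -
 have "homotopic_paths S (jl b xs) (jl b ys)" using assms(1) pchain_jl[OF assms(3)] pchain_jl[OF assms(4)]
  by (simp add: simply_connected_eq_homotopic_paths)
 hence "HE S a xs ys b" using assms by (simp add: HE_def)
 thus ?thesis using assms(2) HE_subset by blast
qed

lemma HE_convex:
 "convex S ==> S <= X ==> pchain S a xs b ==> pchain S a ys b ==> HE X a xs ys b" by (rule HE_simply) (auto intro: convex_imp_simply_connected)

lemma HE_linv:
 assumes "path g" "path_image g <= X" shows "HE X (pathfinish g) [reversepath g, g] [] (pathfinish g)" proof -
 let ?b = "pathfinish g"
 have b: "?b:X" using assms pathfinish_in_path_image by blast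
 have "HE X (pathstart (reversepath g)) [reversepath g +++ g] [reversepath g, g] ?b" by (rule HE_join) (use assms in auto)
 hence 1: "HE X ?b [reversepath g, g] [reversepath g +++ g] ?b" using HE_sym by simp
 have 2: "HE X ?b [reversepath g +++ g] [linepath ?b ?b] ?b" using HE_homotopic[OF homotopic_paths_linv[OF assms]] by simp
 have 3: "HE X ?b [linepath ?b ?b] [] ?b" by (rule HE_convex[of "{?b}"]) (use b in auto)
 show ?thesis using 1 2 3 HE_trans by blast
qed

lemma HE_rinv:
 assumes "path g" "path_image g <= X" shows "HE X (pathstart g) [g, reversepath g] [] (pathstart g)" using HE_linv[of "reversepath g" X] assms by simp

lemma rl_simps [simp]: "rl [] = []" "rl (g # xs) = rl xs @ [reversepath g]" "rl (xs @ ys) = rl ys @ rl xs" by (auto simp: rl_def)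

lemma pchain_rl: "pchain X a xs b ==> pchain X b (rl xs) a" proof (induction xs arbitrary: a)
 case (Cons g xs)
 thus ?case using pathstart_in_path_image[of g] by (auto simp: pchain_append)
qed auto

lemma HE_rl_right: "pchain X a xs b ==> HE X a (xs @ rl xs) [] a" proof (induction xs arbitrary: a)
 case (Cons g xs)
 hence g: "path g" "path_image g <= X" "pathstart g = a" "pchain X (pathfinish g) xs b" by auto
 have "HE X a ([g] @ (xs @ rl xs) @ [reversepath g]) ([g] @ [] @ [reversepath g]) a"
  by (rule HE_ctx) (use Cons g pathstart_in_path_image[of g] pathfinish_in_path_image[of g] in auto)
 also have "HE X a ([g] @ [] @ [reversepath g]) [] a" using HE_rinv[of g X] g by simp
 finally show ?case by simp
qed (auto intro: HE_refl)

lemma HE_rl_left: "pchain X a xs b ==> HE X b (rl xs @ xs) [] b" proof (induction xs arbitrary: a)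
 case (Cons g xs)
 hence g: "path g" "path_image g <= X" "pathstart g = a" "pchain X (pathfinish g) xs b" by auto
 have "HE X b (rl xs @ [reversepath g, g] @ xs) (rl xs @ [] @ xs) b" by (rule HE_ctx) (use HE_linv g in "auto simp: pchain_rl")
 also have "HE X b (rl xs @ [] @ xs) [] b" using Cons.IH g by simp
 finally show ?case by simp
qed (auto intro: HE_refl)

lemma HE_rl:
 assumes "HE X a xs ys b" shows "HE X b (rl xs) (rl ys) a" proof -
 note p = HE_pchain[OF assms]
 have "HE X b (rl xs @ []) (rl xs @ (ys @ rl ys)) a" by (rule HE_append[OF HE_refl[OF pchain_rl[OF p(1)]] HE_sym[OF HE_rl_right[OF p(2)]]])
 also have "HE X b (rl xs @ (ys @ rl ys)) (rl xs @ (xs @ rl ys)) a"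
  by (rule HE_append[OF HE_refl[OF pchain_rl[OF p(1)]] HE_append[OF HE_sym[OF assms] HE_refl[OF pchain_rl[OF p(2)]]]])
 also have "HE X b (rl xs @ (xs @ rl ys)) ([] @ rl ys) a" using HE_append[OF HE_rl_left[OF p(1)] HE_refl[OF pchain_rl[OF p(2)]]] by simp
 finally show ?thesis by simp
qed

definition pim :: "('a => 'b) => (real => 'a) list => (real => 'b) list" where
 "pim f xs = map ((o) f) xs"

lemma pim_simps [simp]: "pim f [] = []" "pim f (g # xs) = (f o g) # pim f xs" "pim f (xs @ ys) = pim f xs @ pim f ys" by (simp_all add: pim_def)

lemma pim_rl: "pim f (rl xs) = rl (pim f xs)" by (simp add: pim_def rl_def reversepath_def rev_map comp_def)

lemma pchain_image:
 assumes "continuous_on X f" "f ` X <= Y" "pchain X a xs b" shows "pchain Y (f a) (pim f xs) (f b)" using assms(3) proof (induction xs arbitrary: a)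
 case (Cons g xs)
 have "continuous_on (path_image g) f" using Cons.prems assms(1) continuous_on_subset by auto
 thus ?case using Cons assms(2)
  by (simp add: path_image_compose pathstart_compose pathfinish_compose path_continuous_image) (meson image_mono order_trans)
qed (use assms in auto)

lemma jl_image:
 "f o jl b xs = jl (f b) (pim f xs)" proof (induction xs)
 case Nil
 show ?case by (simp add: fun_eq_iff)
next
 case (Cons g xs)
 show ?case by (simp only: jl.simps pim_simps path_compose_join Cons)
qed

lemma HE_image:
 assumes "continuous_on X f" "f ` X <= Y" "HE X a xs ys b" shows "HE Y (f a) (pim f xs) (pim f ys) (f b)" proof -
 have "homotopic_paths Y (f o jl b xs) (f o jl b ys)" using assms by (intro homotopic_paths_continuous_image[of X]) (auto simp: HE_def)
 thus ?thesis using assms by (auto simp: HE_def jl_image intro: pchain_image)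
qed

text \<open>The two ways around a square are homotopic in the convex square. Applied to families of
  push-offs and meridians, this yields the sliding and shrinking relations.\<close>

lemma HE_square:
 fixes h :: "real * real => 'a::real_normed_vector"
 assumes "continuous_on ({0..1} \<times> {0..1}) h" "h ` ({0..1} \<times> {0..1}) <= X"
 shows "HE X (h (0,0)) [%s. h (s,0), %r. h (1,r)] [%r. h (0,r), %s. h (s,1)] (h (1,1))" proof -
 let ?S = "{0..1} \<times> {0..1::real} :: (real * real) set"
 have lp: "path (%s. (s, c))" "path (%s. (c, s))" for c :: real by (auto simp: path_def intro!: continuous_intros)
 have "HE ?S (0,0) [%s. (s,0), %r. (1,r)] [%r. (0,r), %s. (s,1)] (1,1)"
  by (rule HE_convex[of ?S]) (auto simp: lp convex_Times path_image_def pathstart_def pathfinish_def)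
 from HE_image[OF assms this] show ?thesis by (simp add: comp_def)
qed

section \<open>Peripheral functionals\<close>

type_synonym p3 = "real * real \<times> real"

definition cmpl :: "(real => p3) => p3 set" where "cmpl K = - range K"

definition push :: "(real => p3) => real => real => p3" where "push K u t = K t + (0, 0, u)"

definition slide :: "(real => p3) => real => real => real => p3" where
 "slide B s t = B o linepath s t"

text \<open>The unit circle of the \<open>l^1\<close> norm in two halves, on each of which the
  second coordinate has a fixed sign. It starts at \<open>(1, 0)\<close>, which \<open>emb\<close>
  sends to a point straight above the knot.\<close>

definition dia1 :: "real => real * real" where "dia1 = linepath (1, 0) (0, 1) +++ linepath (0, 1) (-1, 0)"
definition dia2 :: "real => real * real" where "dia2 = linepath (-1, 0) (0, -1) +++ linepath (0, -1) (1, 0)"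

text \<open>The plane through \<open>p\<close> spanned by the \<open>z\<close>-axis and a horizontal
  vector orthogonal to \<open>d\<close>. It is orthogonal to the horizontal part of
  \<open>d\<close>, hence transverse to the knot where the horizontal velocity does not
  vanish.\<close>

definition emb :: "p3 => p3 => real * real => p3" where
 "emb p d q = p + (snd q * fst (snd d), - (snd q * fst d), fst q)"

definition merid :: "(real => p3) => (real => p3) => real => real => real => p3" where
 "merid K dK u t = (%r. emb (K t) (dK t) (u *\<^sub>R (dia1 +++ dia2) r))"

text \<open>Equivalently, \<open>e\<close> is a multiplicative map on the fundamental rack of the
  knot framed by its push-off: the rack of classes of paths from the push-off to the viewer, where a
  product appends to the first path the meridian reached along the second.\<close>

definition peripheral :: "(real => p3) => (real => p3) => real => p3 => ('a, 'b) rack_scheme =>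
  (real => (real => p3) list => 'a) => bool" where
 "peripheral K dK u v R e \<longleftrightarrow>
   (ALL t xs. pchain (cmpl K) (push K u t) xs v --> e t xs:rcarrier R) &
   (ALL t xs ys. HE (cmpl K) (push K u t) xs ys v --> e t xs = e t ys) &
   (ALL s t xs. pchain (cmpl K) (push K u t) xs v --> e s (slide (push K u) s t # xs) = e t xs) &
   (ALL t xs. pchain (cmpl K) (push K u t) xs v --> e (t + 1) xs = e t xs) &
   (ALL s t xs ys. pchain (cmpl K) (push K u s) xs v --> pchain (cmpl K) (push K u t) ys v -->
    e s (xs @ rl ys @ merid K dK u t # ys) = rmul R (e s xs) (e t ys))"

text \<open>Meridians correspond only up to homotopy, since \<open>F\<close> need not carry the flat
  meridian discs of one knot to those of the other.\<close>

definition kequiv :: "real => p3 => (real => p3) => (real => p3) => (real => p3) => (real => p3) =>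
  (p3 => p3) => (p3 => p3) => bool" where
 "kequiv u v K dK K' dK' F G \<longleftrightarrow> continuous_on UNIV F & continuous_on UNIV G &
   (ALL p. F (G p) = p) & (ALL p. G (F p) = p) & (ALL t. F (K t) = K' t) &
   (ALL t. F (push K u t) = push K' u t) & F v = v &
   (ALL t. homotopic_paths (cmpl K') (F o merid K dK u t) (merid K' dK' u t))"

lemma kequiv_cmpl:
 assumes "kequiv u v K dK K' dK' F G" shows "F ` cmpl K <= cmpl K'" "G ` cmpl K' <= cmpl K" proof -
 have *: "F (G p) = p" "G (F p) = p" "F (K t) = K' t" for p t using assms unfolding kequiv_def by blast+
 have 1: "F p ~= K' t" if "p:cmpl K" for p t using *(2)[of p] *(2)[of "K t"] *(3)[of t] that by (auto simp: cmpl_def)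
 have 2: "G p ~= K t" if "p:cmpl K'" for p t using *(1)[of p] *(3)[of t] that by (auto simp: cmpl_def)
 show "F ` cmpl K <= cmpl K'" by (rule image_subsetI) (use 1 in "metis ComplI cmpl_def imageE")
 show "G ` cmpl K' <= cmpl K" by (rule image_subsetI) (use 2 in "metis ComplI cmpl_def imageE")
qed

lemma kequiv_sym:
 assumes "kequiv u v K dK K' dK' F G" shows "kequiv u v K' dK' K dK G F" proof -
 have *: "F (G p) = p" "G (F p) = p" "F (K t) = K' t" "F (push K u t) = push K' u t" "F v = v"
  "homotopic_paths (cmpl K') (F o merid K dK u t) (merid K' dK' u t)"
  "continuous_on S F" "continuous_on S G" for p t S
  using assms unfolding kequiv_def by (simp_all del: split_paired_All, (meson continuous_on_subset subset_UNIV)+)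
 have "homotopic_paths (cmpl K) (G o merid K' dK' u t) (merid K dK u t)" for t proof -
  have "homotopic_paths (cmpl K) (G o (F o merid K dK u t)) (G o merid K' dK' u t)"
   by (rule homotopic_paths_continuous_image[OF *(6,8)]) (use kequiv_cmpl[OF assms] in auto)
  moreover have "G o (F o merid K dK u t) = merid K dK u t" using *(2) by (auto simp: fun_eq_iff)
  ultimately show ?thesis by (simp add: homotopic_paths_sym)
 qed
 moreover have "G (K' t) = K t" "G (push K' u t) = push K u t" "G v = v" for t using *(2-5) by metis+
 ultimately show ?thesis using * unfolding kequiv_def by blast
qed

lemma kequiv_trans:
 assumes "kequiv u v K dK K' dK' F G" "kequiv u v K' dK' K'' dK'' F' G'" shows "kequiv u v K dK K'' dK'' (F' o F) (G o G')" proof -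
 have *: "F (G p) = p" "G (F p) = p" "F (K t) = K' t" "F (push K u t) = push K' u t" "F v = v"
  "homotopic_paths (cmpl K') (F o merid K dK u t) (merid K' dK' u t)"
  "continuous_on S F" "continuous_on S G" for p t S
  using assms(1) unfolding kequiv_def by (simp_all del: split_paired_All, (meson continuous_on_subset subset_UNIV)+)
 have **: "F' (G' p) = p" "G' (F' p) = p" "F' (K' t) = K'' t" "F' (push K' u t) = push K'' u t" "F' v = v"
  "homotopic_paths (cmpl K'') (F' o merid K' dK' u t) (merid K'' dK'' u t)"
  "continuous_on S F'" "continuous_on S G'" for p t S
  using assms(2) unfolding kequiv_def by (simp_all del: split_paired_All, (meson continuous_on_subset subset_UNIV)+)
 have "homotopic_paths (cmpl K'') (F' o (F o merid K dK u t)) (F' o merid K' dK' u t)" for t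
  by (rule homotopic_paths_continuous_image[OF *(6) **(7)]) (use kequiv_cmpl[OF assms(2)] in auto)
 hence "homotopic_paths (cmpl K'') (F' o (F o merid K dK u t)) (merid K'' dK'' u t)" for t using **(6) homotopic_paths_trans by blast
 moreover have c: "continuous_on UNIV (F' o F)" "continuous_on UNIV (G o G')" by (intro continuous_on_compose * **)+
 ultimately show ?thesis using * ** unfolding kequiv_def using c by (simp add: comp_assoc del: split_paired_All)
qed

text \<open>Everything is pulled back along images of paths; only the image of a meridian has first
  to be replaced by the homotopic meridian of \<open>K'\<close>.\<close>

lemma peripheral_kequiv:
 assumes k: "kequiv u v K dK K' dK' F G" and e: "peripheral K' dK' u v R e"
  and B: "!!t. merid K' dK' u t 0 = push K' u t" shows "peripheral K dK u v R (%t xs. e t (pim F xs))" proof -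
 have *: "F (K t) = K' t" "F (push K u t) = push K' u t" "F v = v"
  "homotopic_paths (cmpl K') (F o merid K dK u t) (merid K' dK' u t)"
  "continuous_on S F" for t S using k unfolding kequiv_def by (simp_all del: split_paired_All, (meson continuous_on_subset subset_UNIV)+)
 have pc: "pchain (cmpl K') (push K' u t) (pim F xs) v" if "pchain (cmpl K) (push K u t) xs v" for t xs
  using pchain_image[OF *(5) kequiv_cmpl(1)[OF k] that] *(2,3) by simp
 have he: "HE (cmpl K') (push K' u t) (pim F xs) (pim F ys) v" if "HE (cmpl K) (push K u t) xs ys v" for t xs ys
  using HE_image[OF *(5) kequiv_cmpl(1)[OF k] that] *(2,3) by simp
 have sl: "F o slide (push K u) s t = slide (push K' u) s t" for s t using *(2) by (auto simp: slide_def fun_eq_iff)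
 have m: "e s (pim F (xs @ rl ys @ merid K dK u t # ys)) = rmul R (e s (pim F xs)) (e t (pim F ys))"
  if p: "pchain (cmpl K) (push K u s) xs v" "pchain (cmpl K) (push K u t) ys v" for s t xs ys proof -
  let ?m = "pim F"
  note q = pc[OF p(1)] pc[OF p(2)]
  have st: "pathstart (F o merid K dK u t) = push K' u t" "pathfinish (F o merid K dK u t) = push K' u t"
   using homotopic_paths_imp_pathstart[OF *(4)[of t]] homotopic_paths_imp_pathfinish[OF *(4)[of t]] B[of t]
   by (auto simp: pathstart_def pathfinish_def merid_def dia1_def dia2_def joinpaths_def linepath_def)
  have "HE (cmpl K') (push K' u s) ((?m xs @ rl (?m ys)) @ [F o merid K dK u t] @ ?m ys)
    ((?m xs @ rl (?m ys)) @ [merid K' dK' u t] @ ?m ys) v"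
   by (rule HE_ctx) (use HE_homotopic[OF *(4)[of t]] st q in "auto intro: pchain_appendI pchain_rl")
  hence "e s ((?m xs @ rl (?m ys)) @ [F o merid K dK u t] @ ?m ys) = e s ((?m xs @ rl (?m ys)) @ [merid K' dK' u t] @ ?m ys)"
   using e by (auto simp: peripheral_def)
  also have "... = rmul R (e s (?m xs)) (e t (?m ys))" using e q by (simp add: peripheral_def)
  finally show ?thesis by (simp add: pim_rl)
 qed
 show ?thesis using e pc he sl m unfolding peripheral_def by auto
qed

section \<open>Isotopies\<close>

text \<open>McShane's extension, the infimum of the cones of slope \<open>L\<close> over the
  prescribed values. Positions may be repeated; the hypothesis then forces equal values.\<close>

lemma lipschitz_extension:
 fixes f :: "'j => real" and pos :: "'j => 'a::metric_space"
 assumes f: "!!i j. \<bar>f i - f j\<bar> <= L * dist (pos i) (pos j)" and L: "0 <= L"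
 shows "EX F. (ALL p q. \<bar>F p - F q\<bar> <= L * dist p q) & (ALL j. F (pos j) = f j)" proof -
 define F where "F p = (INF j. f j + L * dist p (pos j))" for p
 have lb: "f k - L * dist p (pos k) <= f j + L * dist p (pos j)" for p j k proof -
  have "f k - f j <= L * dist (pos k) (pos j)" using f[of k j] by linarith
  also have "... <= L * (dist p (pos k) + dist p (pos j))" by (rule mult_left_mono[OF _ L]) (metis dist_commute dist_triangle)
  finally show ?thesis by (simp add: algebra_simps)
 qed
 have bdd: "bdd_below (range (%j. f j + L * dist p (pos j)))" for p using lb by (intro bdd_belowI2)
 have le: "F p <= F q + L * dist p q" for p q proof -
  have "F p - L * dist p q <= f j + L * dist q (pos j)" for j proof -
   have "F p <= f j + L * dist p (pos j)" unfolding F_def by (rule cINF_lower[OF bdd]) simp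
   moreover have "L * dist p (pos j) <= L * (dist p q + dist q (pos j))" by (rule mult_left_mono[OF dist_triangle L])
   ultimately show ?thesis by (simp add: algebra_simps)
  qed
  hence "F p - L * dist p q <= F q" unfolding F_def[of q] by (intro cINF_greatest) auto
  thus ?thesis by simp
 qed
 have "F (pos k) = f k" for k proof (rule antisym)
  show "F (pos k) <= f k" unfolding F_def using cINF_lower[OF bdd, of k "pos k"] by simp
  show "f k <= F (pos k)" unfolding F_def by (rule cINF_greatest) (use lb[of k "pos k"] in auto)
 qed
 moreover have "\<bar>F p - F q\<bar> <= L * dist p q" for p q using le[of p q] le[of q p] by (simp add: dist_commute abs_le_iff)
 ultimately show ?thesis by blast
qed

lemma norm_p3_le: "norm (p :: p3) <= \<bar>fst p\<bar> + \<bar>fst (snd p)\<bar> + \<bar>snd (snd p)\<bar>" proof -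
 have "norm p <= norm (fst p) + norm (snd p)" by (metis norm_Pair_le prod.collapse)
 also have "norm (snd p) <= norm (fst (snd p)) + norm (snd (snd p))" by (metis norm_Pair_le prod.collapse)
 finally show ?thesis by simp
qed

lemma abs_components_p3:
 "\<bar>fst p\<bar> <= norm (p :: p3)" "\<bar>fst (snd p)\<bar> <= norm p" "\<bar>snd (snd p)\<bar> <= norm p" proof -
 show "\<bar>fst p\<bar> <= norm p" using norm_fst_le[of "fst p" "snd p"] by simp
 have s: "norm (snd p) <= norm p" using norm_snd_le[of "snd p" "fst p"] by simp
 show "\<bar>fst (snd p)\<bar> <= norm p" using norm_fst_le[of "fst (snd p)" "snd (snd p)"] s by simp
 show "\<bar>snd (snd p)\<bar> <= norm p" using norm_snd_le[of "snd (snd p)" "fst (snd p)"] s by simp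
qed

text \<open>Extending the three coordinates separately costs the factor 3.\<close>

lemma lipschitz_extension_p3:
 fixes f :: "'j => p3" and pos :: "'j => p3"
 assumes f: "!!i j. norm (f i - f j) <= L * dist (pos i) (pos j)" and L: "0 <= L"
 shows "EX F. (ALL p q. norm (F p - F q) <= (3 * L) * dist p q) & (ALL j. F (pos j) = f j)" proof -
 have *: "EX F. (ALL p q. \<bar>F p - F q\<bar> <= L * dist p q) & (ALL j. F (pos j) = g (f j))"
  if "!!p q. g (p - q) = g p - g q" "!!p. \<bar>g p\<bar> <= norm p" for g :: "p3 => real"
  by (rule lipschitz_extension[OF _ L]) (metis f order_trans that)
 obtain F1 where F1: "!!p q. \<bar>F1 p - F1 q\<bar> <= L * dist p q" "!!j. F1 (pos j) = fst (f j)"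
  using *[of fst] abs_components_p3 by (metis fst_diff)
 obtain F2 where F2: "!!p q. \<bar>F2 p - F2 q\<bar> <= L * dist p q" "!!j. F2 (pos j) = fst (snd (f j))"
  using *[of "%p. fst (snd p)"] abs_components_p3 by (metis fst_diff snd_diff)
 obtain F3 where F3: "!!p q. \<bar>F3 p - F3 q\<bar> <= L * dist p q" "!!j. F3 (pos j) = snd (snd (f j))"
  using *[of "%p. snd (snd p)"] abs_components_p3 by (metis snd_diff)
 have "norm ((F1 p, F2 p, F3 p) - (F1 q, F2 q, F3 q)) <= (3 * L) * dist p q" for p q
  using norm_p3_le[of "(F1 p, F2 p, F3 p) - (F1 q, F2 q, F3 q)"] F1(1)[of p q] F2(1)[of p q] F3(1)[of p q] by simp
 moreover have "(F1 (pos j), F2 (pos j), F3 (pos j)) = f j" for j using F1 F2 F3 by (simp add: prod_eq_iff)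
 ultimately show ?thesis by (intro exI[of _ "%p. (F1 p, F2 p, F3 p)"]) blast
qed

text \<open>Solving \<open>p + V p = q\<close> for \<open>p\<close> is a fixed point problem for a
  contraction, and the resulting inverse is Lipschitz with constant 2.\<close>

lemma small_perturbation_homeo:
 fixes V :: "'a::banach => 'a"
 assumes V: "!!p q. norm (V p - V q) <= 1/2 * dist p q"
 shows "EX G. continuous_on UNIV (%p. p + V p) & continuous_on UNIV G & (ALL p. G p + V (G p) = p) & (ALL p. G (p + V p) = p)" proof -
 have ex: "EX! p. p + V p = q" for q proof -
  have "EX! p. q - V p = p" by (rule banach_fix_type[of "1/2"]) (use V in "auto simp: dist_norm norm_minus_commute")
  moreover have "q - V p = p \<longleftrightarrow> p + V p = q" for p by (auto simp: algebra_simps)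
  ultimately show ?thesis by simp
 qed
 define G where "G q = (THE p. p + V p = q)" for q
 have G: "G q + V (G q) = q" for q unfolding G_def by (rule theI'[OF ex])
 have G': "G (p + V p) = p" for p using ex[of "p + V p"] G by blast
 have lip: "dist (p + V p) (q + V q) <= 3/2 * dist p q" "dist p q <= 2 * dist (p + V p) (q + V q)" for p q proof -
  have 1: "(p + V p) - (q + V q) = (p - q) + (V p - V q)" by simp
  show "dist (p + V p) (q + V q) <= 3/2 * dist p q" using norm_triangle_ineq[of "p - q" "V p - V q"] V[of p q] unfolding dist_norm 1 by linarith
  show "dist p q <= 2 * dist (p + V p) (q + V q)"
   using norm_triangle_ineq4[of "(p - q) + (V p - V q)" "V p - V q"] V[of p q] unfolding dist_norm 1 by simp
 qed
 have "continuous_on UNIV (%p. p + V p)" by (rule lipschitz_on_continuous_on[of "3/2"], rule lipschitz_onI) (use lip(1) in auto)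
 moreover have "continuous_on UNIV G" by (rule lipschitz_on_continuous_on[of 2], rule lipschitz_onI) (use lip(2)[of "G _" "G _"] G in auto)
 ultimately show ?thesis using G G' by blast
qed

text \<open>The punctured meridian discs of radius \<open>u\<close> miss the knot. Push-offs and
  meridians of all heights up to \<open>u\<close> lie in them.\<close>

definition valid :: "(real => p3) => (real => p3) => real => bool" where
 "valid K dK u \<longleftrightarrow> (ALL t q. 0 < \<bar>fst q\<bar> + \<bar>snd q\<bar> & \<bar>fst q\<bar> + \<bar>snd q\<bar> <= u --> emb (K t) (dK t) q:cmpl K)"

abbreviation hor :: "p3 => p3" where "hor d \<equiv> (fst d, fst (snd d), 0)"

lemma dia_in_diamond:
 assumes "r:{0..1}" shows "\<bar>fst ((dia1 +++ dia2) r)\<bar> + \<bar>snd ((dia1 +++ dia2) r)\<bar> = 1"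
 using assms by (auto simp: dia1_def dia2_def joinpaths_def linepath_def)

lemma path_dia: "path (dia1 +++ dia2)" unfolding dia1_def dia2_def by (intro path_join_imp path_linepath) auto

lemma path_merid: "path (merid k d u t)" proof -
 have "continuous_on {0..1} (dia1 +++ dia2)" using path_dia by (simp add: path_def)
 thus ?thesis unfolding path_def merid_def emb_def by (intro continuous_intros)
qed

lemma merid_ends: "merid k d u t 0 = push k u t" "merid k d u t 1 = push k u t"
 by (auto simp: merid_def push_def emb_def dia1_def dia2_def joinpaths_def linepath_def)

lemma periodic_int: "f (t + of_int k) = f t" if "!!t. f (t + 1) = f t" for f :: "real => 'b" proof -
 have n: "f (t + of_nat n) = f t" for t and n proof (induction n)
  case (Suc n)
  thus ?case using that[of "t + of_nat n"] by (simp add: add_ac)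
 qed simp
 show ?thesis proof (cases "k >= 0")
  case True
  thus ?thesis using n[of t "nat k"] by simp
 next
  case False
  thus ?thesis using n[of "t + of_int k" "nat (- k)"] by simp
 qed
qed

text \<open>Of the contact condition only \<open>imm\<close> remains. It holds for Legendrian knots
  because \<open>dz = y dx\<close> forces a velocity with vanishing horizontal part to vanish
  altogether.\<close>

locale isotopy =
 fixes K dK :: "real => real => p3"
 assumes contK: "continuous_on ({0..1} \<times> UNIV) (%q. K (fst q) (snd q))"
  and contdK: "continuous_on ({0..1} \<times> UNIV) (%q. dK (fst q) (snd q))"
  and deriv: "s:{0..1} ==> (K s has_vector_derivative dK s t) (at t)"
  and per: "s:{0..1} ==> K s (t + 1) = K s t"
  and inj: "s:{0..1} ==> K s t = K s t' ==> t - t':\<int>"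
  and imm: "s:{0..1} ==> hor (dK s t) ~= 0"
begin

lemma per_dK: assumes s: "s:{0..1}" shows "dK s (t + 1) = dK s t" proof -
 have "((%r. K s (r + 1)) has_vector_derivative dK s (t + 1)) (at t)"
  using vector_diff_chain_at[of "%r. r + 1" 1 t "K s" "dK s (t + 1)"] deriv[OF s, of "t + 1"]
  by (simp add: comp_def has_vector_derivative_add_const has_vector_derivative_id)
 hence "(K s has_vector_derivative dK s (t + 1)) (at t)" using per[OF s] by simp
 thus ?thesis using deriv[OF s, of t] vector_derivative_unique_at by blast
qed

lemma per_int:
 assumes s: "s:{0..1}" shows "K s (t + of_int k) = K s t" "dK s (t + of_int k) = dK s t"
 by (rule periodic_int, rule per[OF s], rule periodic_int, rule per_dK[OF s])

lemma compact_SR: "compact ({0..1} \<times> {a..b} :: (real * real) set)" by (intro compact_Times) auto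

lemma cont_K_comp:
 assumes "continuous_on S f" "continuous_on S g" "f ` S <= {0..1}" shows "continuous_on S (%p. K (f p) (g p))" "continuous_on S (%p. dK (f p) (g p))"
proof -
 have c: "continuous_on S (%p. (f p, g p))" by (intro continuous_intros assms)
 have i: "(%p. (f p, g p)) ` S <= {0..1} \<times> UNIV" using assms(3) by auto
 have "continuous_on S ((%q. K (fst q) (snd q)) o (%p. (f p, g p)))" by (rule continuous_on_compose[OF c continuous_on_subset[OF contK i]])
 thus "continuous_on S (%p. K (f p) (g p))" by (simp only: comp_def fst_conv snd_conv)
 have "continuous_on S ((%q. dK (fst q) (snd q)) o (%p. (f p, g p)))" by (rule continuous_on_compose[OF c continuous_on_subset[OF contdK i]])
 thus "continuous_on S (%p. dK (f p) (g p))" by (simp only: comp_def fst_conv snd_conv)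
qed

lemma reduce: "EX t':{0..1}. EX k. (t :: real) = t' + of_int k"
 by (rule bexI[of _ "frac t"], rule exI[of _ "floor t"]) (auto simp: frac_def less_imp_le intro: order_trans[OF less_imp_le[OF frac_lt_1[unfolded frac_def]]])

lemma bounded_K: "EX B. ALL s:{0..1}. ALL t. norm (K s t) <= B & norm (dK s t) <= B" proof -
 let ?S = "{0..1} \<times> {0..1} :: (real * real) set"
 have "compact ((%q. K (fst q) (snd q)) ` ?S)" "compact ((%q. dK (fst q) (snd q)) ` ?S)"
  by (intro compact_continuous_image compact_SR continuous_on_subset[OF contK] continuous_on_subset[OF contdK]; auto)+
 note b = this[THEN compact_imp_bounded, unfolded bounded_iff]
 obtain B1 where B1: "ALL q:?S. norm (K (fst q) (snd q)) <= B1" using b(1) by (auto simp del: split_paired_All)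
 obtain B2 where B2: "ALL q:?S. norm (dK (fst q) (snd q)) <= B2" using b(2) by (auto simp del: split_paired_All)
 note B = bspec[OF B1] bspec[OF B2]
 have "norm (K s t) <= max B1 B2 & norm (dK s t) <= max B1 B2" if s: "s:{0..1}" for s t proof -
  obtain t' k where t: "t':{0..1}" "t = t' + of_int k" using reduce by blast
  thus ?thesis using B(1)[of "(s, t')"] B(2)[of "(s, t')"] per_int[OF s, of t' k] s by auto
 qed
 thus ?thesis by blast
qed

text \<open>Compactness in \<open>s\<close>, \<open>t\<close> and in the parameter difference, which
  is the last variable of \<open>g\<close>; periodicity reduces every \<open>t\<close> to one
  period.\<close>

lemma horizontal_speed:
 "EX c>0. EX et>0. et < 1/2 & (ALL s:{0..1}. ALL t ta. \<bar>ta - t\<bar> <= et --> c <= hor (dK s t) \<bullet> dK s ta)" proof -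
 let ?S = "{0..1} \<times> {0..1} :: (real * real) set"
 define g where "g q = hor (dK (fst q) (fst (snd q))) \<bullet> dK (fst q) (fst (snd q) + snd (snd q))" for q :: "real * real \<times> real"
 let ?T = "{0..1} \<times> {0..1} \<times> {-1..1} :: (real * real \<times> real) set"
 have cg: "continuous_on ?T g" unfolding g_def by (intro continuous_intros cont_K_comp) auto
 have cT: "compact ?T" by (intro compact_Times) auto
 have g0: "g (s, t, 0) = norm (hor (dK s t)) ^ 2" for s t by (simp add: g_def inner_prod_def dot_square_norm[symmetric])
 have "continuous_on ?S (%q. g (fst q, snd q, 0))" by (rule continuous_on_compose2[OF cg]) (auto intro!: continuous_intros)
 from continuous_attains_inf[OF compact_SR _ this]
 obtain q0 where q0: "q0:?S" "!!q. q:?S ==> g (fst q0, snd q0, 0) <= g (fst q, snd q, 0)" by auto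
 \<comment> \<open>Half of the least squared horizontal speed. Uniform continuity of
   \<open>g\<close> keeps the inner product above this value for small parameter
   differences.\<close>
 define c where "c = g (fst q0, snd q0, 0) / 2"
 have c: "c > 0" using q0(1) imm[of "fst q0" "snd q0"] unfolding c_def g0 by (auto simp: zero_prod_def)
 obtain d where d: "d > 0" "!!p q. p:?T ==> q:?T ==> dist p q < d ==> dist (g p) (g q) < c"
  using compact_uniformly_continuous[OF cg cT] c unfolding uniformly_continuous_on_def by metis
 define et where "et = min (d/2) (1/4)"
 have "c <= hor (dK s t) \<bullet> dK s ta" if s: "s:{0..1}" and ta: "\<bar>ta - t\<bar> <= et" for s t ta proof -
  obtain t' k where t: "t':{0..1}" "t = t' + of_int k" using reduce by blast
  have "ta - t <= 1" "- 1 <= ta - t" using ta unfolding et_def by linarith+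
  hence in_T: "(s, t', ta - t):?T" "(s, t', 0):?T" using s t(1) by auto
  have "dist (s, t', ta - t) (s, t', 0) < d" using ta d(1) by (simp add: dist_Pair_Pair et_def)
  from d(2)[OF in_T this] have "g (s, t', ta - t) > g (s, t', 0) - c" by (simp add: dist_real_def abs_less_iff)
  moreover have "g (s, t', 0) >= 2 * c" using q0(2)[of "(s,t')"] s t(1) by (simp add: c_def)
  moreover have "g (s, t', ta - t) = hor (dK s t) \<bullet> dK s ta"
   using per_int(2)[OF s, of t' k] per_int(2)[OF s, of "t' + (ta - t)" k] t(2) by (simp add: g_def algebra_simps)
  ultimately show ?thesis by linarith
 qed
 moreover have "et > 0" "et < 1/2" using d(1) by (auto simp: et_def)
 ultimately show ?thesis using c by blast
qed

text \<open>The mean value theorem for the component along \<open>hor (dK s t)\<close>, the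
  direction orthogonal to the meridian disc at \<open>t\<close>.\<close>

lemma chord_bound:
 assumes c: "ALL s:{0..1}. ALL t ta. \<bar>ta - t\<bar> <= et --> c <= hor (dK s t) \<bullet> dK s ta"
  and s: "s:{0..1}" and t: "\<bar>t' - t\<bar> <= et" shows "c * \<bar>t' - t\<bar> <= \<bar>hor (dK s t) \<bullet> (K s t' - K s t)\<bar>" proof -
 define ph where "ph ta = hor (dK s t) \<bullet> K s ta" for ta
 have d: "(ph has_real_derivative hor (dK s t) \<bullet> dK s ta) (at ta)" for ta proof -
  have "(ph has_vector_derivative hor (dK s t) \<bullet> dK s ta) (at ta)" unfolding ph_def
   using bounded_linear.has_vector_derivative[OF bounded_linear_inner_right deriv[OF s]] by simp
  thus ?thesis by (simp add: has_real_derivative_iff_has_vector_derivative)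
 qed
 have "EX xi. \<bar>xi - t\<bar> <= et & \<bar>ph t' - ph t\<bar> = \<bar>t' - t\<bar> * \<bar>hor (dK s t) \<bullet> dK s xi\<bar>"
 proof (cases t' t rule: linorder_cases)
  case less
  from MVT2[OF less, of ph "%ta. hor (dK s t) \<bullet> dK s ta"] d obtain z where "t' < z" "z < t" "ph t - ph t' = (t - t') * (hor (dK s t) \<bullet> dK s z)" by blast
  thus ?thesis using t by (intro exI[of _ z]) (auto simp: abs_mult abs_minus_commute)
 next
  case greater
  from MVT2[OF greater, of ph "%ta. hor (dK s t) \<bullet> dK s ta"] d obtain z where "t < z" "z < t'" "ph t' - ph t = (t' - t) * (hor (dK s t) \<bullet> dK s z)" by blast
  thus ?thesis using t by (intro exI[of _ z]) (auto simp: abs_mult)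
 next
  case equal
  thus ?thesis using t by (intro exI[of _ t]) auto
 qed
 then obtain xi where xi: "\<bar>xi - t\<bar> <= et" "\<bar>ph t' - ph t\<bar> = \<bar>t' - t\<bar> * \<bar>hor (dK s t) \<bullet> dK s xi\<bar>" by blast
 have "c <= hor (dK s t) \<bullet> dK s xi" using c s xi(1) by blast
 hence "c <= \<bar>hor (dK s t) \<bullet> dK s xi\<bar>" by linarith
 hence "c * \<bar>t' - t\<bar> <= \<bar>hor (dK s t) \<bullet> dK s xi\<bar> * \<bar>t' - t\<bar>" by (rule mult_right_mono) simp
 thus ?thesis using xi(2) by (simp add: ph_def inner_diff_right mult.commute)
qed

text \<open>By injectivity the distance is positive on the compact set of pairs whose parameter
  difference lies in \<open>{et..1-et}\<close>, hence bounded below there.\<close>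

lemma far_bound:
 assumes "0 < et" shows "EX rh>0. ALL s:{0..1}. ALL t t'. (EX k. \<bar>t' + of_int k - t\<bar> <= et) | rh <= norm (K s t' - K s t)"
proof (cases "et <= 1 - et")
 case True
 let ?T = "{0..1} \<times> {0..1} \<times> {et..1-et} :: (real * real \<times> real) set"
 have cT: "compact ?T" by (intro compact_Times) auto
 have ne: "?T ~= {}" using True by auto
 have "continuous_on ?T (%q. norm (K (fst q) (fst (snd q) + snd (snd q)) - K (fst q) (fst (snd q))))" by (intro continuous_intros cont_K_comp) auto
 from continuous_attains_inf[OF cT ne this] obtain q where
  q: "q:?T" "!!q'. q':?T ==> norm (K (fst q) (fst (snd q) + snd (snd q)) - K (fst q) (fst (snd q)))
    <= norm (K (fst q') (fst (snd q') + snd (snd q')) - K (fst q') (fst (snd q')))" by blast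
 define s0 t0 d0 where "s0 = fst q" and "t0 = fst (snd q)" and "d0 = snd (snd q)"
 have q0: "s0:{0..1}" "d0:{et..1-et}" using q(1) by (auto simp: s0_def d0_def)
 have q03: "!!s t d. s:{0..1} ==> t:{0..1} ==> d:{et..1-et} ==>
    norm (K s0 (t0 + d0) - K s0 t0) <= norm (K s (t + d) - K s t)"
  unfolding s0_def t0_def d0_def by (rule q(2)[of "(_, _, _)", simplified fst_conv snd_conv]) blast
 define rh where "rh = norm (K s0 (t0 + d0) - K s0 t0)"
 have "d0 ~: \<int>" proof
  assume "d0:\<int>"
  then obtain k where "d0 = of_int k" by (auto elim: Ints_cases)
  hence "0 < (of_int k :: real)" "(of_int k :: real) < 1" using q0(2) assms by auto
  thus False by simp
 qed
 hence "K s0 (t0 + d0) ~= K s0 t0" using inj[OF q0(1), of "t0 + d0" t0] by auto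
 hence "rh > 0" by (simp add: rh_def)
 moreover have "(EX k. \<bar>t' + of_int k - t\<bar> <= et) | rh <= norm (K s t' - K s t)" if s: "s:{0..1}" for s t t' proof (rule disjCI)
  assume far: "~ rh <= norm (K s t' - K s t)"
  obtain t0 k where t: "t0:{0..1}" "t = t0 + of_int k" using reduce by blast
  define d where "d = frac (t' - t)"
  have e: "t' = t + d + of_int (floor (t' - t))" by (simp add: d_def frac_def)
  have "d ~: {et..1-et}" proof
   assume "d:{et..1-et}"
   hence "rh <= norm (K s (t0 + d) - K s t0)" unfolding rh_def using q03 s t \<open>d:{et..1-et}\<close> by blast
   moreover have "K s t' = K s (t0 + d)" using per_int(1)[OF s, of "t0 + d" "k + floor (t' - t)"] e t(2) by (simp add: add_ac)
   moreover have "K s t = K s t0" using t(2) per_int(1)[OF s] by simp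
   ultimately show False using far by simp
  qed
  moreover have "0 <= d" "d < 1" by (auto simp: d_def frac_lt_1)
  ultimately consider "d < et" | "1 - d < et" by fastforce
  thus "EX k. \<bar>t' + of_int k - t\<bar> <= et" proof cases
   case 1
   thus ?thesis using e \<open>0 <= d\<close> by (intro exI[of _ "- floor (t' - t)"]) auto
  next
   case 2
   thus ?thesis using e \<open>d < 1\<close> by (intro exI[of _ "- floor (t' - t) - 1"]) auto
  qed
 qed
 ultimately show ?thesis by blast
next
 case False
 \<comment> \<open>Here \<open>et > 1/2\<close>, while any two parameters differ by at most 1/2
   modulo integers. The first alternative always holds, and 1 serves as \<open>rh\<close>.\<close>
 have "EX k. \<bar>t' + of_int k - t\<bar> <= et" for t t' proof (rule exI[of _ "- round (t' - t)"])
  have "\<bar>t' + of_int (- round (t' - t)) - t\<bar> = \<bar>of_int (round (t' - t)) - (t' - t)\<bar>" by simp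
  thus "\<bar>t' + of_int (- round (t' - t)) - t\<bar> <= et" using of_int_round_abs_le[of "t' - t"] False by linarith
 qed
 thus ?thesis by (intro exI[of _ 1]) auto
qed

lemma bounded_K': "EX B>=0. ALL s:{0..1}. ALL t. norm (K s t) <= B & norm (dK s t) <= B"
 using bounded_K by (meson norm_ge_zero order_trans zero_le_one atLeastAtMost_iff order_refl)

lemma emb_displacement:
 assumes "norm d <= B" shows "norm (emb p d q - p) <= (1 + 2 * B) * (\<bar>fst q\<bar> + \<bar>snd q\<bar>)" proof -
 note a = abs_components_p3[of d]
 have B: "0 <= B" using assms norm_ge_zero order_trans by blast
 have "norm (emb p d q - p) <= \<bar>snd q * fst (snd d)\<bar> + \<bar>snd q * fst d\<bar> + \<bar>fst q\<bar>"
  using norm_p3_le[of "emb p d q - p"] by (simp add: emb_def)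
 also have "... <= \<bar>snd q\<bar> * B + \<bar>snd q\<bar> * B + \<bar>fst q\<bar>"
  unfolding abs_mult by (intro add_mono mult_left_mono) (use a assms in auto)
 also have "... <= (1 + 2 * B) * (\<bar>fst q\<bar> + \<bar>snd q\<bar>)" using B by (simp add: algebra_simps)
 finally show ?thesis .
qed

text \<open>A disc shorter than \<open>rh\<close> cannot reach distant strands, so a knot point on
  it has a parameter \<open>t'\<close> near \<open>t\<close> modulo integers. The disc is orthogonal
  to \<open>hor (dK s t)\<close>, hence \<open>chord_bound\<close> forces \<open>t' = t\<close>, and
  the point is the centre.\<close>

lemma valid_small: "EX u0>0. ALL u<=u0. ALL s:{0..1}. valid (K s) (dK s) u" proof -
 obtain c et where c: "c > 0" "et > 0" "ALL s:{0..1}. ALL t ta. \<bar>ta - t\<bar> <= et --> c <= hor (dK s t) \<bullet> dK s ta"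
  using horizontal_speed by blast
 obtain rh where rh: "rh > 0" "ALL s:{0..1}. ALL t t'. (EX k. \<bar>t' + of_int k - t\<bar> <= et) | rh <= norm (K s t' - K s t)"
  using far_bound[OF c(2)] by blast
 obtain B where B: "B >= 0" "!!s t. s:{0..1} ==> norm (K s t) <= B & norm (dK s t) <= B" using bounded_K' by blast
 define u0 where "u0 = rh / (2 * (1 + 2 * B))"
 have "(1 + 2 * B) * u0 = rh / 2" using B(1) by (simp add: u0_def field_simps)
 hence u0: "u0 > 0" "(1 + 2 * B) * u0 < rh" using rh(1) B(1) by (simp_all add: u0_def)
 have "emb (K s t) (dK s t) q:cmpl (K s)" if s: "s:{0..1}" and q: "0 < \<bar>fst q\<bar> + \<bar>snd q\<bar>" "\<bar>fst q\<bar> + \<bar>snd q\<bar> <= u0" for s t q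
 proof (rule ccontr)
  assume "emb (K s t) (dK s t) q ~: cmpl (K s)"
  then obtain t' where t': "K s t' = emb (K s t) (dK s t) q" by (auto simp: cmpl_def)
  have "norm (K s t' - K s t) <= (1 + 2 * B) * (\<bar>fst q\<bar> + \<bar>snd q\<bar>)"
   unfolding t' by (rule emb_displacement) (use B(2)[OF s] in auto)
  also have "... <= (1 + 2 * B) * u0" using q B(1) by (intro mult_left_mono) auto
  finally have "norm (K s t' - K s t) < rh" using u0 by simp
  then obtain k where k: "\<bar>t' + of_int k - t\<bar> <= et" using rh(2) s by force
  have e: "K s (t' + of_int k) = emb (K s t) (dK s t) q" using per_int(1)[OF s] t' by simp
  have "hor (dK s t) \<bullet> (emb (K s t) (dK s t) q - K s t) = 0" by (simp add: emb_def inner_prod_def)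
  with chord_bound[OF c(3) s k] have "c * \<bar>t' + of_int k - t\<bar> <= 0" by (simp add: e)
  hence "t' + of_int k = t" using c(1) by (simp add: mult_le_0_iff)
  hence "emb (K s t) (dK s t) q = K s t" using e by simp
  hence "snd q * fst (snd (dK s t)) = 0" "snd q * fst (dK s t) = 0" "fst q = 0" by (auto simp: emb_def prod_eq_iff)
  thus False using q(1) imm[OF s, of t] by (auto simp: zero_prod_def)
 qed
 thus ?thesis unfolding valid_def using u0(1) by (meson order_trans)
qed

text \<open>Validity makes the distance between meridians and knot positive; compactness makes it
  uniform over all stages of the isotopy.\<close>

lemma margin:
 assumes u: "0 < u" and v: "!!s. s:{0..1} ==> valid (K s) (dK s) u"
 shows "EX mu>0. ALL s:{0..1}. ALL t t' q. \<bar>fst q\<bar> + \<bar>snd q\<bar> = 1 --> mu <= norm (emb (K s t) (dK s t) (u *\<^sub>R q) - K s t')"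
proof -
 let ?D = "{q :: real * real. \<bar>fst q\<bar> + \<bar>snd q\<bar> = 1}"
 have "closed ?D" by (intro closed_Collect_eq continuous_intros)
 moreover have "bounded ?D" proof (rule boundedI)
  fix q assume "q:?D"
  thus "norm q <= 1" using norm_Pair_le[of "fst q" "snd q"] by simp
 qed
 ultimately have cD: "compact ?D" by (simp add: compact_eq_bounded_closed)
 let ?T = "{0..1} \<times> {0..1} \<times> {0..1} \<times> ?D :: (real * real \<times> real * real \<times> real) set"
 have cT: "compact ?T" by (intro compact_Times cD) auto
 have "(0, 0, 0, 1, 0):?T" by simp
 hence ne: "?T ~= {}" by blast
 let ?f = "%q. norm (emb (K (fst q) (fst (snd q))) (dK (fst q) (fst (snd q))) (u *\<^sub>R snd (snd (snd q))) - K (fst q) (fst (snd (snd q))))"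
 have "continuous_on ?T ?f" unfolding emb_def by (intro continuous_intros cont_K_comp) auto
 from continuous_attains_inf[OF cT ne this] obtain q0 where q0: "q0:?T" "!!q. q:?T ==> ?f q0 <= ?f q" by blast
 have "?f q0 > 0" proof -
  let ?d = "snd (snd (snd q0))"
  have "\<bar>fst (u *\<^sub>R ?d)\<bar> + \<bar>snd (u *\<^sub>R ?d)\<bar> = u" using q0(1) u by (auto simp: abs_mult simp flip: distrib_left)
  hence "emb (K (fst q0) (fst (snd q0))) (dK (fst q0) (fst (snd q0))) (u *\<^sub>R ?d):cmpl (K (fst q0))"
   using v[of "fst q0"] q0(1) u unfolding valid_def by auto
  thus ?thesis by (auto simp: cmpl_def)
 qed
 moreover have "?f q0 <= norm (emb (K s t) (dK s t) (u *\<^sub>R q) - K s t')"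
  if s: "s:{0..1}" and q: "\<bar>fst q\<bar> + \<bar>snd q\<bar> = 1" for s t t' q proof -
  obtain t0 k where t: "t0:{0..1}" "t = t0 + of_int k" using reduce by blast
  obtain t1 k' where t': "t1:{0..1}" "t' = t1 + of_int k'" using reduce by blast
  show ?thesis using q0(2)[of "(s, t0, t1, q)"] s q t t' per_int[OF s] by simp
 qed
 ultimately show ?thesis by blast
qed

lemma mvt_norm:
 fixes f :: "real => 'b::real_inner"
 assumes "!!x. (f has_vector_derivative f' x) (at x)" "!!x. norm (f' x) <= e" shows "norm (f b - f a) <= e * \<bar>b - a\<bar>" proof -
 have *: "norm (f b - f a) <= e * \<bar>b - a\<bar>" if "a < b" for a b proof -
  have "EX x:{a<..<b}. norm (f b - f a) <= norm ((b - a) *\<^sub>R f' x)" by (rule mvt_general[OF that])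
    (use assms(1) in "auto simp: has_vector_derivative_def intro!: continuous_at_imp_continuous_on has_vector_derivative_continuous")
  then obtain x where "norm (f b - f a) <= \<bar>b - a\<bar> * norm (f' x)" by auto
  also have "... <= \<bar>b - a\<bar> * e" by (intro mult_left_mono assms) auto
  finally show ?thesis by (simp add: mult.commute)
 qed
 show ?thesis using *[of a b] *[of b a] by (cases a b rule: linorder_cases) (auto simp: norm_minus_commute abs_minus_commute)
qed

text \<open>The displacement from \<open>K s\<close> to \<open>K s'\<close> is prescribed on the
  knot, copied to the push-off, and set to 0 at the viewer. Its Lipschitz constant is small where it
  is prescribed, so it extends to a field whose addition is a homeomorphism.\<close>

lemma step:
 assumes u: "0 < u" and val: "!!s. s:{0..1} ==> valid (K s) (dK s) u"
  and far: "!!s t. s:{0..1} ==> 1 <= norm (v - K s t) & 1 <= norm (v - push (K s) u t)"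
 shows "EX de>0. ALL s:{0..1}. ALL s':{0..1}. \<bar>s - s'\<bar> < de -->
   (EX F G. kequiv u v (K s) (dK s) (K s') (dK s') F G)" proof -
 obtain c et where c: "c > 0" "et > 0" "ALL s:{0..1}. ALL t ta. \<bar>ta - t\<bar> <= et --> c <= hor (dK s t) \<bullet> dK s ta"
  using horizontal_speed by blast
 obtain rh where rh: "rh > 0" "ALL s:{0..1}. ALL t t'. (EX k. \<bar>t' + of_int k - t\<bar> <= et) | rh <= norm (K s t' - K s t)"
  using far_bound[OF c(2)] by blast
 obtain B where B: "B >= 0" "!!s t. s:{0..1} ==> norm (K s t) <= B & norm (dK s t) <= B" using bounded_K' by blast
 obtain mu where mu: "mu > 0" "!!s t t' q. s:{0..1} ==> \<bar>fst q\<bar> + \<bar>snd q\<bar> = 1 ==> mu <= norm (emb (K s t) (dK s t) (u *\<^sub>R q) - K s t')"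
  using margin[OF u val] by blast
 \<comment> \<open>One summand for each kind of pair of prescribed points: nearby parameters (arc
   against chord), distant parameters, knot against push-off, and pairs with the viewer.\<close>
 define C where "C = (1 + 2 * B) / c + 2 / rh + 2 / mu + 1"
 have C: "C >= (1 + 2 * B) / c" "C >= 2 / rh" "C >= 2 / mu" "C >= 1" "C > 0" unfolding C_def using c rh mu B by (auto intro!: add_nonneg_pos)
 \<comment> \<open>\<open>ep * W\<close> will bound the distance between the image of a meridian and
   the new meridian: \<open>2 * ep\<close> for the motion of the centre, \<open>2 * u * ep\<close>
   for the turning of the disc, the rest for the variation of \<open>V\<close> over the
   disc.\<close>
 define W where "W = 2 + 2 * u + 3 * C * (1 + 2 * B) * u"
 have W: "W > 0" unfolding W_def using u C B by (intro add_pos_nonneg) auto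
 \<comment> \<open>The first bound makes the Lipschitz constant \<open>3 * (C * ep)\<close> of the
   extended field at most 1/2; the second keeps the segments between the two meridians off the
   knot.\<close>
 define ep where "ep = min (1 / (6 * C)) (mu / (2 * W))"
 have ep: "ep > 0" "3 * (C * ep) <= 1/2" "ep * W < mu" proof -
  show "ep > 0" unfolding ep_def using C W mu by simp
  have "C * ep <= C * (1 / (6 * C))" unfolding ep_def using C by (intro mult_left_mono) auto
  thus "3 * (C * ep) <= 1/2" using C by simp
  have "ep * W <= mu / (2 * W) * W" unfolding ep_def using W by (intro mult_right_mono) auto
  thus "ep * W < mu" using W mu by simp
 qed
 let ?S = "{0..1} \<times> {0..1} :: (real * real) set"
 have "uniformly_continuous_on ?S (%q. K (fst q) (snd q))" "uniformly_continuous_on ?S (%q. dK (fst q) (snd q))"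
  by (intro compact_uniformly_continuous compact_SR continuous_on_subset[OF contK] continuous_on_subset[OF contdK]; auto)+
 note uc = this[unfolded uniformly_continuous_on_def, rule_format, OF ep(1)]
 obtain de1 where de1: "de1 > 0" "ALL p:?S. ALL q:?S. dist q p < de1 --> dist (K (fst q) (snd q)) (K (fst p) (snd p)) < ep" using uc(1) by blast
 obtain de2 where de2: "de2 > 0" "ALL p:?S. ALL q:?S. dist q p < de2 --> dist (dK (fst q) (snd q)) (dK (fst p) (snd p)) < ep" using uc(2) by blast
 have "EX F G. kequiv u v (K s) (dK s) (K s') (dK s') F G"
  if s: "s:{0..1}" "s':{0..1}" and ss: "\<bar>s - s'\<bar> < min de1 de2" for s s' proof -
  have close: "norm (K s' t - K s t) <= ep" "norm (dK s' t - dK s t) <= ep" for t proof -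
   obtain t0 k where t: "t0:{0..1}" "t = t0 + of_int k" using reduce by blast
   have "dist (s', t0) (s, t0) < de1" "dist (s', t0) (s, t0) < de2" using ss by (auto simp: dist_Pair_Pair dist_real_def abs_minus_commute)
   hence "dist (K s' t0) (K s t0) < ep" "dist (dK s' t0) (dK s t0) < ep"
    using de1(2)[rule_format, of "(s, t0)" "(s', t0)"] de2(2)[rule_format, of "(s, t0)" "(s', t0)"] s t(1) by auto
   thus "norm (K s' t - K s t) <= ep" "norm (dK s' t - dK s t) <= ep"
    using t(2) per_int[OF s(1), of t0 k] per_int[OF s(2), of t0 k] by (auto simp: dist_norm)
  qed
  define D where "D t = K s' t - K s t" for t
  have D_lip: "norm (D t - D t') <= (C * ep) * dist (K s t) (K s t')" for t t' proof (cases "EX k. \<bar>t' + of_int k - t\<bar> <= et")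
   case True
   then obtain k where k: "\<bar>t' + of_int k - t\<bar> <= et" by blast
   let ?t = "t' + of_int k"
   have per: "D ?t = D t'" "K s ?t = K s t'" using per_int s by (auto simp: D_def)
   have "norm (D ?t - D t) <= ep * \<bar>?t - t\<bar>"
    unfolding D_def by (rule mvt_norm[of _ "%t. dK s' t - dK s t"]) (use s deriv close in "auto intro!: derivative_intros")
   also have "\<bar>?t - t\<bar> <= (1 + 2 * B) / c * norm (K s ?t - K s t)" proof -
    have "c * \<bar>?t - t\<bar> <= norm (hor (dK s t)) * norm (K s ?t - K s t)"
     using chord_bound[OF c(3) s(1) k] Cauchy_Schwarz_ineq2[of "hor (dK s t)" "K s ?t - K s t"] by linarith
    also have "norm (hor (dK s t)) <= 1 + 2 * B" using norm_p3_le[of "hor (dK s t)"] abs_components_p3[of "dK s t"] B(2)[OF s(1), of t] by simp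
    finally show ?thesis using c(1) by (simp add: field_simps mult_right_mono)
   qed
   also have "(1 + 2 * B) / c * norm (K s ?t - K s t) <= C * norm (K s ?t - K s t)" using C by (intro mult_right_mono) auto
   finally show ?thesis using ep(1) unfolding per dist_norm by (simp add: norm_minus_commute algebra_simps)
  next
   case False
   hence "rh <= norm (K s t' - K s t)" using rh(2) s by blast
   hence "2 * ep <= (2 / rh * ep) * norm (K s t' - K s t)" using rh(1) ep(1) by (simp add: field_simps mult_left_mono)
   also have "... <= (C * ep) * norm (K s t' - K s t)" using C ep(1) by (intro mult_right_mono) auto
   finally show ?thesis using norm_triangle_ineq4[of "D t" "D t'"] close[of t] close[of t'] by (simp add: D_def dist_norm norm_minus_commute)
  qed
  have D_push: "norm (D t - D t') <= (C * ep) * dist (push (K s) u t) (K s t')" for t t' proof -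
   have "mu <= dist (push (K s) u t) (K s t')" using mu(2)[OF s(1), of "(1,0)" t t'] by (simp add: emb_def push_def dist_norm)
   hence "2 * ep <= (2 / mu * ep) * dist (push (K s) u t) (K s t')" using mu(1) ep(1) by (simp add: field_simps mult_left_mono)
   also have "... <= (C * ep) * dist (push (K s) u t) (K s t')" using C ep(1) by (intro mult_right_mono) auto
   finally show ?thesis using norm_triangle_ineq4[of "D t" "D t'"] close[of t] close[of t'] by (simp add: D_def)
  qed
  have D_v: "norm (D t) <= (C * ep) * d" if "1 <= d" for d t proof -
   have "ep <= C * ep" using C ep(1) by simp
   also have "... <= C * ep * d" using C ep(1) that by simp
   finally show ?thesis using close(1)[of t] by (simp add: D_def)
  qed
  \<comment> \<open>\<open>None\<close> is the viewer, \<open>Some (t, b)\<close> a point of the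
    push-off or of the knot. A single index type lets one extension meet all prescriptions at
    once.\<close>
  define pos where "pos j = (case j of None => v | Some (t, b) => if b then push (K s) u t else K s t)" for j :: "(real \<times> bool) option"
  define f where "f j = (case j of None => 0 | Some (t, b) => D t)" for j :: "(real \<times> bool) option"
  have push_dist: "dist (push (K s) u t) (push (K s) u t') = dist (K s t) (K s t')" for t t' by (simp add: push_def dist_norm)
  have D_push': "norm (D t - D t') <= (C * ep) * dist (K s t) (push (K s) u t')" for t t'
   using D_push[of t' t] by (simp add: norm_minus_commute dist_commute)
  have f_lip: "norm (f i - f j) <= (C * ep) * dist (pos i) (pos j)" for i j
   using D_lip[unfolded dist_norm] D_push[unfolded dist_norm] D_push'[unfolded dist_norm]
    D_v far[OF s(1)] push_dist[unfolded dist_norm] by (auto simp: f_def pos_def dist_norm norm_minus_commute split: option.splits)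
  obtain V where V: "!!p q. norm (V p - V q) <= 3 * (C * ep) * dist p q" "!!j. V (pos j) = f j"
   using lipschitz_extension_p3[of f "C * ep" pos, OF f_lip mult_nonneg_nonneg[OF less_imp_le[OF C(5)] less_imp_le[OF ep(1)]]] by blast
  have V': "norm (V p - V q) <= 1/2 * dist p q" for p q using V(1)[of p q] mult_right_mono[OF ep(2), of "dist p q"] by simp
  define F where "F p = p + V p" for p
  obtain G where G: "continuous_on UNIV F" "continuous_on UNIV G" "ALL p. F (G p) = p" "ALL p. G (F p) = p"
   using small_perturbation_homeo[OF V'] unfolding F_def by blast
  have FK: "F (K s t) = K s' t" for t using V(2)[of "Some (t, False)"] by (simp add: F_def pos_def f_def D_def)
  have Fp: "F (push (K s) u t) = push (K s') u t" for t using V(2)[of "Some (t, True)"] by (simp add: F_def pos_def f_def D_def push_def)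
  have Fv: "F v = v" using V(2)[of None] by (simp add: F_def pos_def f_def)
  have "homotopic_paths (cmpl (K s')) (F o merid (K s) (dK s) u t) (merid (K s') (dK s') u t)" for t proof (rule homotopic_paths_linear)
   let ?g = "F o merid (K s) (dK s) u t" and ?h = "merid (K s') (dK s') u t"
   show "path ?g" by (intro path_continuous_image path_merid continuous_on_subset[OF G(1)]) auto
   show "path ?h" by (rule path_merid)
   show "pathstart ?h = pathstart ?g" "pathfinish ?h = pathfinish ?g" by (auto simp: pathstart_def pathfinish_def merid_ends Fp)
   fix r :: real assume r: "r:{0..1}"
   let ?q = "(dia1 +++ dia2) r"
   note dq = dia_in_diamond[OF r]
   let ?a = "emb (K s t) (dK s t) (u *\<^sub>R ?q)" and ?b = "emb (K s' t) (dK s' t) (u *\<^sub>R ?q)"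
   have 1: "norm (?b - ?a) <= ep + u * (2 * ep)" proof -
    have e: "?b - ?a = D t + (emb 0 (dK s' t - dK s t) (u *\<^sub>R (0, snd ?q)) - 0)" by (simp add: emb_def D_def algebra_simps prod_eq_iff)
    have "norm (emb 0 (dK s' t - dK s t) (u *\<^sub>R (0, snd ?q)) - 0) <= u * (2 * ep)" proof -
     define d where "d = dK s' t - dK s t"
     have "norm (emb 0 d (u *\<^sub>R (0, snd ?q)) - 0) <= \<bar>u * snd ?q * fst (snd d)\<bar> + \<bar>u * snd ?q * fst d\<bar>"
      using norm_p3_le[of "emb 0 d (u *\<^sub>R (0, snd ?q)) - 0"] by (simp add: emb_def abs_mult)
     also have "... = u * \<bar>snd ?q\<bar> * (\<bar>fst (snd d)\<bar> + \<bar>fst d\<bar>)" using u by (simp add: abs_mult algebra_simps)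
     also have "... <= u * 1 * (ep + ep)"
      using u dq abs_components_p3[of d] close(2)[of t] unfolding d_def[symmetric] by (intro mult_mono add_mono) auto
     finally have "norm (emb 0 d (u *\<^sub>R (0, snd ?q)) - 0) <= u * (2 * ep)" by simp
     thus ?thesis unfolding d_def .
    qed
    thus ?thesis unfolding e using norm_triangle_ineq close(1)[of t] unfolding D_def[symmetric] by (smt (verit))
   qed
   have 2: "norm (V ?a) <= ep + 3 * (C * ep) * ((1 + 2 * B) * u)" proof -
    have "norm (V ?a - V (K s t)) <= 3 * (C * ep) * dist ?a (K s t)" by (rule V(1))
    also have "dist ?a (K s t) <= (1 + 2 * B) * u" using emb_displacement[of "dK s t" B "K s t" "u *\<^sub>R ?q"] B(2)[OF s(1), of t] dq u
     by (simp add: dist_norm abs_mult flip: distrib_left)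
    finally have "norm (V ?a - V (K s t)) <= 3 * (C * ep) * ((1 + 2 * B) * u)" using C ep(1) by (simp add: mult_left_mono)
    moreover have "norm (V (K s t)) <= ep" using V(2)[of "Some (t, False)"] close(1)[of t] by (simp add: pos_def f_def D_def)
    ultimately show ?thesis using norm_triangle_sub[of "V ?a" "V (K s t)"] by linarith
   qed
   have "norm (?g r - ?h r) <= norm (V ?a) + norm (?b - ?a)"
    using norm_triangle_ineq4[of "V ?a" "?b - ?a"] by (simp add: F_def merid_def algebra_simps)
   also have "... <= ep * W" using 1 2 by (simp add: W_def algebra_simps)
   finally have d: "norm (?g r - ?h r) < mu" using ep(3) by linarith
   show "closed_segment (?g r) (?h r) <= cmpl (K s')" proof
    fix p assume "p:closed_segment (?g r) (?h r)"
    hence "norm (p - ?h r) <= norm (?g r - ?h r)" using segment_bound(2)[of p "?g r" "?h r"] by (simp add: norm_minus_commute)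
    hence "norm (p - ?h r) < mu" using d by simp
    moreover have "mu <= norm (?h r - K s' t')" for t' using mu(2)[OF s(2) dq] by (simp add: merid_def)
    ultimately show "p:cmpl (K s')" unfolding cmpl_def by (auto simp: norm_minus_commute) (metis not_less)
   qed
  qed
  thus ?thesis unfolding kequiv_def using G FK Fp Fv by blast
 qed
 thus ?thesis using de1(1) de2(1) by (intro exI[of _ "min de1 de2"]) auto
qed

text \<open>The step size in \<open>step\<close> is uniform, so bisection of the isotopy interval
  composes the small homeomorphisms. The bound \<open>B + 2\<close> keeps the viewer at distance at
  least 1 from the knots and push-offs of all stages.\<close>

theorem isotopy_kequiv:
 "EX u0>0. EX M0. ALL u M. 0 < u & u <= u0 & M0 <= M --> (ALL s:{0..1}. valid (K s) (dK s) u) &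
   (EX F G. kequiv u (0, - M, 0) (K 0) (dK 0) (K 1) (dK 1) F G)" proof -
 obtain u1 where u1: "u1 > 0" "ALL u<=u1. ALL s:{0..1}. valid (K s) (dK s) u" using valid_small by blast
 obtain B where B: "B >= 0" "!!s t. s:{0..1} ==> norm (K s t) <= B & norm (dK s t) <= B" using bounded_K' by blast
 have "EX F G. kequiv u (0, - M, 0) (K 0) (dK 0) (K 1) (dK 1) F G"
  if u: "0 < u" "u <= min u1 1" and M: "B + 2 <= M" for u M proof -
  define v :: p3 where "v = (0, - M, 0)"
  have far: "1 <= norm (v - K s t) & 1 <= norm (v - push (K s) u t)" if "s:{0..1}" for s t proof -
   have "\<bar>fst (snd (K s t))\<bar> <= B" using abs_components_p3(2)[of "K s t"] B(2)[OF that, of t] by linarith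
   moreover have "\<bar>- M - fst (snd (K s t))\<bar> <= norm (v - K s t)" "\<bar>- M - fst (snd (K s t))\<bar> <= norm (v - push (K s) u t)"
    using abs_components_p3(2)[of "v - K s t"] abs_components_p3(2)[of "v - push (K s) u t"] by (simp_all add: v_def push_def)
   ultimately show ?thesis using M by linarith
  qed
  obtain de where de: "de > 0" "!!s s'. s:{0..1} ==> s':{0..1} ==> \<bar>s - s'\<bar> < de ==> EX F G. kequiv u v (K s) (dK s) (K s') (dK s') F G"
   using step[OF u(1) _ far] u1(2) u by (metis min.boundedE)
  define P where "P a b \<longleftrightarrow> (0 <= a & b <= 1 --> (EX F G. kequiv u v (K a) (dK a) (K b) (dK b) F G))" for a b
  have "P 0 1" proof (rule Bolzano)
   fix a b c assume "P a b" "P b c" "a <= b" "b <= c"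
   thus "P a c" unfolding P_def using kequiv_trans by (meson order_trans)
  next
   fix x :: real assume x: "0 <= x" "x <= 1"
   have "P a b" if "a <= x & x <= b & b - a < de" for a b unfolding P_def using that x de(2)[of a b] by auto
   thus "EX d>0. ALL a b. a <= x & x <= b & b - a < d --> P a b" using de(1) by blast
  qed simp
  thus ?thesis by (simp add: P_def v_def)
 qed
 thus ?thesis using u1 by (intro exI[of _ "min u1 1"] conjI exI[of _ "B + 2"]) auto
qed

end

section \<open>Geometry of generic fronts\<close>

text \<open>The front and its slope \<open>y\<close> as real functions. The semicubical cusp
  condition becomes a simple zero of \<open>x'\<close>, and immersion of the knot means that
  \<open>y'\<close> does not vanish there.\<close>

locale plane_front =
 fixes x y z x' y' :: "real => real"
 assumes dx: "(x has_real_derivative x' t) (at t)"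
  and dy: "(y has_real_derivative y' t) (at t)"
  and dz: "(z has_real_derivative y t * x' t) (at t)"
  and cx': "continuous_on UNIV x'" and cy': "continuous_on UNIV y'"
  and px: "x (t + 1) = x t" and py: "y (t + 1) = y t" and pz: "z (t + 1) = z t"
  and imm: "x' t = 0 ==> y' t ~= 0"
  and cusp: "x' t = 0 ==> EX d. d ~= 0 & (x' has_real_derivative d) (at t)"
  and inj: "x s = x t ==> y s = y t ==> z s = z t ==> s - t:\<int>"
  and dbl: "x s = x t ==> z s = z t ==> s - t ~: \<int> ==> x' s ~= 0"
  and fin_dbl: "finite {(x t, z t) | s t. s - t ~: \<int> & x s = x t & z s = z t}"
  and no_triple: "r - s ~: \<int> ==> s - t ~: \<int> ==> r - t ~: \<int> ==>
    x r = x s ==> z r = z s ==> x s = x t ==> z s = z t ==> False"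
begin

definition D :: "real => real * real" where "D t = (x t, z t)"
definition K :: "real => p3" where "K t = (x t, y t, z t)"
definition dK :: "real => p3" where "dK t = (x' t, y' t, y t * x' t)"
definition dp :: "real => real => bool" where "dp s t \<longleftrightarrow> s - t ~: \<int> & D s = D t"
definition over :: "real => real => bool" where "over s t \<longleftrightarrow> dp s t & y s < y t"
definition brk :: "real => bool" where "brk t \<longleftrightarrow> x' t = 0 | (EX s. over s t)"
definition sing :: "(real * real) set" where "sing = D ` {t. x' t = 0} Un D ` {t. EX s. dp s t}"

lemma contx: "continuous_on S x" and conty: "continuous_on S y" and contz: "continuous_on S z"
 using dx dy dz by (meson DERIV_isCont continuous_at_imp_continuous_on)+

lemma isCont_xyz: "isCont x t" "isCont y t" "isCont z t" "isCont x' t" "isCont y' t"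
 using dx dy dz cx' cy' by (auto intro: DERIV_isCont simp: continuous_on_eq_continuous_at)

lemma contD: "continuous_on S D" and contK: "continuous_on S K" and contdK: "continuous_on S dK" unfolding D_def K_def dK_def
 by (intro continuous_intros contx conty contz continuous_on_subset[OF cx'] continuous_on_subset[OF cy'] subset_UNIV)+

lemma per_x': "x' (t + 1) = x' t" proof -
 have "((%r. x (r + 1)) has_real_derivative x' (t + 1)) (at t)" using DERIV_shift[of x "x' (t + 1)" t 1] dx[of "t + 1"] by simp
 hence "(x has_real_derivative x' (t + 1)) (at t)" by (simp add: px)
 thus ?thesis using dx DERIV_unique by blast
qed

lemma per_y': "y' (t + 1) = y' t" proof -
 have "((%r. y (r + 1)) has_real_derivative y' (t + 1)) (at t)" using DERIV_shift[of y "y' (t + 1)" t 1] dy[of "t + 1"] by simp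
 hence "(y has_real_derivative y' (t + 1)) (at t)" by (simp add: py)
 thus ?thesis using dy DERIV_unique by blast
qed

lemma per: "x (t + of_int k) = x t" "y (t + of_int k) = y t" "z (t + of_int k) = z t"
  "x' (t + of_int k) = x' t" "y' (t + of_int k) = y' t" "D (t + of_int k) = D t"
  "K (t + of_int k) = K t" "dK (t + of_int k) = dK t" by (rule periodic_int; simp add: px py pz per_x' per_y' D_def K_def dK_def)+

lemma Ints_shift: "(s + of_int k) - (t + of_int l):\<int> \<longleftrightarrow> s - t:(\<int> :: real set)" proof -
 have "(s + of_int k) - (t + of_int l) = (s - t) + of_int (k - l)" by simp
 thus ?thesis by (metis Ints_of_int add_diff_cancel_right' Ints_add Ints_diff)
qed

lemma dp_shift: "dp (s + of_int k) (t + of_int l) \<longleftrightarrow> dp s t" unfolding dp_def Ints_shift per ..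
lemma over_shift: "over (s + of_int k) (t + of_int l) \<longleftrightarrow> over s t" unfolding over_def dp_shift per ..
lemma brk_shift: "brk (t + of_int k) \<longleftrightarrow> brk t" proof -
 have "(EX s. over s (t + of_int k)) \<longleftrightarrow> (EX s. over s t)" by (metis over_shift[of _ 0, simplified])
 thus ?thesis by (simp add: brk_def per)
qed

lemma D_eq: "D s = D t ==> (EX k. s = t + of_int k) | dp s t" by (auto simp: dp_def elim!: Ints_cases) (metis add.commute diff_add_cancel)

lemma dp_sym: "dp s t ==> dp t s" using Ints_minus[of "t - s"] by (auto simp: dp_def)

lemma dp_y: "dp s t ==> y s ~= y t" using inj by (auto simp: dp_def D_def)

lemma dp_x': "dp s t ==> x' s ~= 0 & x' t ~= 0" using dbl dp_sym by (metis D_def Pair_inject dp_def)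

lemma dp_over: "dp s t ==> over s t | over t s" using dp_y[of s t] dp_sym[of s t] by (auto simp: over_def)

lemma two_points:
 assumes "dp s t" "D r = D t" shows "(EX k. r = s + of_int k) | (EX k. r = t + of_int k)" proof (rule ccontr)
 assume "~ ?thesis"
 hence "dp r s" "dp r t" using D_eq[of r s] D_eq[of r t] assms by (auto simp: dp_def)
 thus False using no_triple[of r s t] assms(1) by (auto simp: dp_def D_def)
qed

text \<open>A branch \<open>r\<close> over \<open>s\<close> would satisfy
  \<open>y r < y s < y t\<close> and so give a third parameter at the same point of the plane, which
  is excluded. Hence strands run through over-crossings.\<close>

lemma over_not_brk: assumes "over s t" shows "~ brk s" proof
 assume "brk s"
 then obtain r where r: "over r s" using dp_x' assms by (auto simp: brk_def over_def)
 thus False using two_points[of s t r] assms r by (auto simp: over_def dp_def per)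
qed

lemma singI: "x' t = 0 ==> D t:sing" "dp s t ==> D t:sing" "dp s t ==> D s:sing" "brk t ==> D t:sing"
 using dp_sym unfolding sing_def brk_def over_def by blast+

lemma regD: assumes "D t ~: sing" shows "x' t ~= 0" "~ brk t" "D s = D t ==> EX k. s = t + of_int k" using assms singI D_eq by blast+

text \<open>The zero is simple, so \<open>x'\<close> changes sign. Signs are recorded relative to
  the derivative \<open>d\<close>, which treats left and right cusps together.\<close>

lemma x'_near_zero:
 assumes "x' t = 0" shows "EX d. d ~= 0 & (EX de>0. (ALL s. t - de < s & s < t --> x' s * d < 0) & (ALL s. t < s & s < t + de --> x' s * d > 0))"
proof -
 obtain d where d: "d ~= 0" "(x' has_real_derivative d) (at t)" using cusp[OF assms] by blast
 have "((%s. x' s * d) has_real_derivative d * d) (at t)" using DERIV_cmult_right[OF d(2), of d] by simp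
 moreover have "d * d > 0" using d(1) by (metis not_real_square_gt_zero)
 ultimately have "EX e>0. ALL h>0. h < e --> x' t * d < x' (t + h) * d" "EX e>0. ALL h>0. h < e --> x' (t - h) * d < x' t * d"
  using DERIV_pos_inc_right[of "%s. x' s * d" "d * d" t] DERIV_pos_inc_left[of "%s. x' s * d" "d * d" t] by auto
 then obtain e1 e2 where e: "e1 > 0" "!!h. h > 0 ==> h < e1 ==> 0 < x' (t + h) * d" "e2 > 0" "!!h. h > 0 ==> h < e2 ==> x' (t - h) * d < 0"
  using assms by auto
 have "x' s * d < 0" if "t - min e1 e2 < s" "s < t" for s using e(4)[of "t - s"] that by simp
 moreover have "x' s * d > 0" if "s < t + min e1 e2" "t < s" for s using e(2)[of "s - t"] that by simp
 ultimately show ?thesis using e d(1) by (intro exI[of _ d] conjI exI[of _ "min e1 e2"]) auto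
qed

lemma x'_punctured: "EX de>0. ALL s. s ~= t & \<bar>s - t\<bar> < de --> x' s ~= 0" proof (cases "x' t = 0")
 case True
 then obtain d de where 1: "de > 0" "!!s. t - de < s & s < t ==> x' s * d < 0" "!!s. t < s & s < t + de ==> x' s * d > 0" using x'_near_zero by blast
 have "x' s ~= 0" if "s ~= t" "\<bar>s - t\<bar> < de" for s proof (cases "s < t")
  case True
  thus ?thesis using 1(2)[of s] that by auto
 next
  case False
  thus ?thesis using 1(3)[of s] that by auto
 qed
 thus ?thesis using 1(1) by blast
next
 case False
 have "open {s. x' s ~= 0}" by (intro open_Collect_neq cx' continuous_on_const)
 then obtain e where "e > 0" "ALL s. dist s t < e --> x' s ~= 0" using False unfolding open_dist by blast
 thus ?thesis by (auto simp: dist_real_def)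
qed

lemma rolle_x: assumes "s < t" "x s = x t" shows "EX r. s < r & r < t & x' r = 0" proof -
 from MVT2[OF assms(1), of x x'] dx obtain r where "s < r" "r < t" "x t - x s = (t - s) * x' r" by blast
 thus ?thesis using assms by auto
qed

text \<open>By Rolle's theorem a repeated value near \<open>t\<close> would give a zero of
  \<open>x'\<close> in a punctured neighbourhood where there is none. As a consequence every column
  meets the front in finitely many points.\<close>

lemma x_isolated: "EX de>0. ALL s. s ~= t & \<bar>s - t\<bar> < de --> x s ~= x t" proof -
 obtain de where de: "de > 0" "!!s. s ~= t ==> \<bar>s - t\<bar> < de ==> x' s ~= 0" using x'_punctured by blast
 have "x s ~= x t" if s: "s ~= t" "\<bar>s - t\<bar> < de" for s proof
  assume e: "x s = x t"
  consider "s < t" | "t < s" using s by linarith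
  thus False proof cases
   case 1
   then obtain r where "s < r" "r < t" "x' r = 0" using rolle_x e by blast
   thus False using de(2)[of r] s by auto
  next
   case 2
   then obtain r where "t < r" "r < s" "x' r = 0" using rolle_x[of t s] e by auto
   thus False using de(2)[of r] s by auto
  qed
 qed
 thus ?thesis using de(1) by blast
qed

lemma finite_if_isolated:
 assumes "closed S" "!!t. EX de>0. ALL s. s ~= t & \<bar>s - t\<bar> < de --> s ~: S" shows "finite (S Int {a..b::real})" proof (rule ccontr)
 assume inf: "infinite (S Int {a..b})"
 then obtain t where t: "t islimpt (S Int {a..b})" using Heine_Borel_imp_Bolzano_Weierstrass[of "{a..b}" "S Int {a..b}"] by auto
 obtain de where de: "de > 0" "ALL s. s ~= t & \<bar>s - t\<bar> < de --> s ~: S" using assms(2) by blast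
 thus False using t unfolding islimpt_approachable by (auto simp: dist_real_def)
qed

lemma finite_cusps: "finite {t:{a..b}. x' t = 0}" proof -
 have "closed {t. x' t = 0}" using continuous_closed_preimage_constant[OF cx' closed_UNIV, of 0] by simp
 hence "finite ({t. x' t = 0} Int {a..b})" by (rule finite_if_isolated) (use x'_punctured in simp)
 moreover have "{t:{a..b}. x' t = 0} = {t. x' t = 0} Int {a..b}" by auto
 ultimately show ?thesis by simp
qed

lemma finite_column: "finite {t:{a..b}. x t = c}" proof -
 have cl: "closed {t. x t = c}" using continuous_closed_preimage_constant[OF contx closed_UNIV, of c] by simp
 have "EX de>0. ALL s. s ~= t & \<bar>s - t\<bar> < de --> x s ~= c" for t proof (cases "x t = c")
  case True
  thus ?thesis using x_isolated by blast
 next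
  case False
  hence "open (- {t. x t = c})" "t:- {t. x t = c}" using cl by auto
  then obtain e where "e > 0" "!!s. dist s t < e ==> s:- {t. x t = c}" unfolding open_dist by blast
  thus ?thesis by (auto simp: dist_real_def)
 qed
 hence "finite ({t. x t = c} Int {a..b})" by (intro finite_if_isolated[OF cl]) simp
 moreover have "{t:{a..b}. x t = c} = {t. x t = c} Int {a..b}" by auto
 ultimately show ?thesis by simp
qed

lemma reduce: "EX s k. s:{0..1} & t = s + of_int k" for t :: real by (rule exI[of _ "frac t"], rule exI[of _ "floor t"])
   (auto simp: frac_def intro: order_trans[OF less_imp_le[OF frac_lt_1[unfolded frac_def]]])

lemma y_bounded: "EX B. ALL t. \<bar>y t\<bar> < B" proof -
 have "compact (y ` {0..1})" by (intro compact_continuous_image conty) auto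
 then obtain b where b: "ALL w:y ` {0..1}. norm w <= b" using compact_imp_bounded bounded_iff by metis
 have "\<bar>y t\<bar> < b + 1" for t proof -
  obtain s k where s: "s:{0..1}" "t = s + of_int k" using reduce[of t] by blast
  hence "\<bar>y s\<bar> <= b" "y t = y s" using b per(2)[of s k] by auto
  thus ?thesis by linarith
 qed
 thus ?thesis by blast
qed

lemma finite_column_z: "finite {P. fst P = c & P:range D}" proof -
 have "{P. fst P = c & P:range D} <= D ` {t:{0..1}. x t = c}" proof
  fix P assume "P:{P. fst P = c & P:range D}"
  then obtain t where t: "P = D t" "x t = c" by (auto simp: D_def)
  obtain s k where "s:{0..1}" "t = s + of_int k" using reduce[of t] by blast
  hence "P = D s" "s:{t:{0..1}. x t = c}" using t by (simp_all add: per)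
  thus "P:D ` {t:{0..1}. x t = c}" by blast
 qed
 thus ?thesis using finite_column finite_subset by blast
qed

lemma finite_sing: "finite sing" proof -
 have "D ` {t. x' t = 0} <= D ` {t:{0..1}. x' t = 0}" proof
  fix P assume "P:D ` {t. x' t = 0}"
  then obtain t where t: "P = D t" "x' t = 0" by auto
  obtain s k where "s:{0..1}" "t = s + of_int k" using reduce[of t] by blast
  hence "P = D s" "s:{t:{0..1}. x' t = 0}" using t by (simp_all add: per)
  thus "P:D ` {t:{0..1}. x' t = 0}" by blast
 qed
 hence "finite (D ` {t. x' t = 0})" using finite_cusps finite_subset by blast
 moreover have "D ` {t. EX s. dp s t} <= {(x t, z t) | s t. s - t ~: \<int> & x s = x t & z s = z t}" by (auto simp: dp_def D_def)
 ultimately show ?thesis using fin_dbl finite_subset unfolding sing_def by blast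
qed

lemma closed_D: "closed (range D)" proof -
 have "range D = D ` {0..1}" proof (intro equalityI subsetI)
  fix P assume "P:range D"
  then obtain t where "P = D t" by auto
  moreover obtain s k where "s:{0..1}" "t = s + of_int k" using reduce[of t] by blast
  ultimately have "P = D s" "s:{0..1}" by (simp_all add: per)
  thus "P:D ` {0..1}" by blast
 qed auto
 thus ?thesis by (simp add: compact_imp_closed compact_continuous_image contD)
qed

text \<open>The parameters in \<open>{0..1}\<close> outside all translates of \<open>J\<close> form
  a compact set whose image misses \<open>P\<close>; the complement of this image serves. Facts
  about parameters near those of \<open>P\<close> thus become facts about a neighbourhood of
  \<open>P\<close>.\<close>

lemma nearby:
 assumes "open J" "!!t. D t = P ==> EX k. t + of_int k:J" shows "EX Q. open Q & P:Q & (ALL t. D t:Q --> (EX k. t + of_int k:J))" proof -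
 define O' where "O' = (\<Union>k. (%t. t + of_int k) -` J)"
 have "open O'" unfolding O'_def by (intro open_UN ballI open_vimage assms(1) continuous_intros)
 hence c: "compact (D ` ({0..1} - O'))" by (intro compact_continuous_image contD compact_diff) auto
 have "P ~: D ` ({0..1} - O')" using assms(2) by (auto simp: O'_def)
 moreover have "EX k. t + of_int k:J" if "D t ~: D ` ({0..1} - O')" for t proof -
  obtain s k where s: "s:{0..1}" "t = s + of_int k" using reduce[of t] by blast
  hence "D s ~: D ` ({0..1} - O')" using that by (simp add: per)
  hence "s:O'" using s(1) by blast
  then obtain l where "s + of_int l:J" by (auto simp: O'_def)
  thus ?thesis using s(2) by (intro exI[of _ "l - k"]) simp
 qed
 ultimately show ?thesis using compact_imp_closed[OF c] by (intro exI[of _ "- D ` ({0..1} - O')"]) auto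
qed

lemma x_tendsto: "(x \<longlongrightarrow> x t) (nhds t)" and D_tendsto: "(D \<longlongrightarrow> D t) (nhds t)"
 using isCont_xyz(1)[of t] contD[of UNIV] by (simp_all add: isCont_def continuous_on_eq_continuous_at tendsto_at_iff_tendsto_nhds)

lemma reg_near: "\<forall>\<^sub>F t in at t0. D t ~: sing" proof -
 have "\<forall>\<^sub>F t in at t0. D t ~= P" for P proof (cases "P = D t0")
  case True
  obtain de where "de > 0" "ALL s. s ~= t0 & \<bar>s - t0\<bar> < de --> x s ~= x t0" using x_isolated by blast
  thus ?thesis using True unfolding eventually_at by (auto simp: dist_real_def D_def)
 next
  case False
  have "(D \<longlongrightarrow> D t0) (at t0)" using contD[of UNIV] by (simp add: continuous_on_def)
  thus ?thesis by (rule tendsto_imp_eventually_ne) (use False in auto)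
 qed
 hence "\<forall>\<^sub>F t in at t0. ALL P:sing. D t ~= P" using finite_sing by (simp add: eventually_ball_finite)
 thus ?thesis by eventually_elim auto
qed

lemma reg_interval: "EX de>0. ALL t. t ~= t0 & \<bar>t - t0\<bar> < de --> D t ~: sing"
 using reg_near[of t0] unfolding eventually_at by (auto simp: dist_real_def)

subsection \<open>Branches\<close>

text \<open>Also false when the column of \<open>P\<close> misses the branch. Next to a cusp this
  makes the contributions of both branches vanish on the empty side.\<close>

definition below :: "real set => real * real => bool" where
 "below J P \<longleftrightarrow> (EX t:J. x t = fst P & snd P < z t)"

definition branch :: "real set => bool" where
 "branch J \<longleftrightarrow> open J & is_interval J & (ALL t:J. x' t ~= 0)"

lemma branch_inj: assumes "branch J" "s:J" "t:J" "x s = x t" shows "s = t" proof (rule ccontr)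
 assume "s ~= t"
 then obtain r where r: "x' r = 0" "min s t < r" "r < max s t" using rolle_x[of s t] rolle_x[of t s] assms(4) by (cases s t rule: linorder_cases) auto
 hence "r:J" using assms(1-3) unfolding branch_def is_interval_1 by (metis less_imp_le max_def min_def)
 thus False using r assms(1) by (auto simp: branch_def)
qed

lemma near_inverse:
 assumes "x' t ~= 0" "open J" "t:J" shows "\<forall>\<^sub>F xi in nhds (x t). EX s:J. x s = xi" proof -
 obtain e where e: "e > 0" "!!s. \<bar>s - t\<bar> < e ==> s:J" using assms(2,3) unfolding open_dist by (auto simp: dist_real_def)
 have sides: "EX h1 h2. 0 < h1 & h1 < e & 0 < h2 & h2 < e & (x (t - h1) < x t & x t < x (t + h2) | x (t + h2) < x t & x t < x (t - h1))"
 proof (cases "x' t > 0")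
  case True
  from DERIV_pos_inc_right[OF dx this] DERIV_pos_inc_left[OF dx this]
  obtain d1 d2 where d: "d1 > 0" "!!h. 0 < h ==> h < d1 ==> x t < x (t + h)" "d2 > 0" "!!h. 0 < h ==> h < d2 ==> x (t - h) < x t" by blast
  show ?thesis by (intro exI[of _ "min d2 e / 2"] exI[of _ "min d1 e / 2"]) (use e d in auto)
 next
  case False
  hence n: "x' t < 0" using assms(1) by simp
  from DERIV_neg_dec_right[OF dx this] DERIV_neg_dec_left[OF dx this]
  obtain d1 d2 where d: "d1 > 0" "!!h. 0 < h ==> h < d1 ==> x (t + h) < x t" "d2 > 0" "!!h. 0 < h ==> h < d2 ==> x t < x (t - h)" by blast
  show ?thesis by (intro exI[of _ "min d2 e / 2"] exI[of _ "min d1 e / 2"]) (use e d in auto)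
 qed
 then obtain h1 h2 where h: "0 < h1" "h1 < e" "0 < h2" "h2 < e"
  "x (t - h1) < x t & x t < x (t + h2) | x (t + h2) < x t & x t < x (t - h1)" by blast
 define a b where "a = min (x (t - h1)) (x (t + h2))" and "b = max (x (t - h1)) (x (t + h2))"
 have "x t:{a<..<b}" using h(5) by (auto simp: a_def b_def)
 hence "\<forall>\<^sub>F xi in nhds (x t). xi:{a<..<b}" by (intro eventually_nhds_in_open) auto
 thus ?thesis proof eventually_elim
  case (elim xi)
  have c: "ALL s. t - h1 <= s & s <= t + h2 --> isCont x s" using isCont_xyz by blast
  have "EX s. t - h1 <= s & s <= t + h2 & x s = xi" proof (cases "x (t - h1) <= x (t + h2)")
   case True
   thus ?thesis using IVT[of x "t - h1" xi "t + h2"] c elim h by (auto simp: a_def b_def)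
  next
   case False
   thus ?thesis using IVT2[of x "t + h2" xi "t - h1"] c elim h by (auto simp: a_def b_def)
  qed
  then obtain s where s: "t - h1 <= s" "s <= t + h2" "x s = xi" by blast
  hence "\<bar>s - t\<bar> < e" using h by linarith
  thus ?case using e(2) s(3) by blast
 qed
qed

text \<open>Nearby columns meet the branch at nearby parameters, and the level \<open>m\<close>
  halfway between the branch and \<open>P\<close> keeps the two apart.\<close>

lemma below_local:
 assumes J: "branch J" and t: "t:J" "x t = fst P" "z t ~= snd P" shows "\<forall>\<^sub>F Q in nhds P. below J Q \<longleftrightarrow> below J P"
proof -
 define m where "m = (z t + snd P) / 2"
 have t0: "(fst \<longlongrightarrow> fst P) (nhds P)" "(snd \<longlongrightarrow> snd P) (nhds P)"
  by (auto intro!: tendsto_fst tendsto_snd filterlim_ident)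
 let ?O = "J Int (if z t > m then {s. z s > m} else {s. z s < m})"
 have "open ?O" using J open_Collect_less[of "%_. m" z] open_Collect_less[of z "%_. m"] contz[of UNIV] by (auto simp: branch_def)
 moreover have "t:?O" using t by (auto simp: m_def)
 moreover have "x' t ~= 0" using J t by (auto simp: branch_def)
 ultimately have "\<forall>\<^sub>F xi in nhds (x t). EX s:?O. x s = xi" by (intro near_inverse)
 hence 1: "\<forall>\<^sub>F Q in nhds P. EX s:?O. x s = fst Q" unfolding t(2) by (rule eventually_compose_filterlim[OF _ t0(1)])
 have 2: "\<forall>\<^sub>F Q in nhds P. if z t > m then snd Q < m else snd Q > m" proof (cases "z t > m")
  case True
  hence "\<forall>\<^sub>F Q in nhds P. snd Q < m" using order_tendstoD(2)[OF t0(2), of m] by (simp add: m_def)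
  thus ?thesis using True by simp
 next
  case False
  hence "\<forall>\<^sub>F Q in nhds P. snd Q > m" using order_tendstoD(1)[OF t0(2), of m] t(3) by (simp add: m_def)
  thus ?thesis using False by simp
 qed
 have ev: "\<forall>\<^sub>F Q in nhds P. below J Q \<longleftrightarrow> z t > m" using 1 2 proof eventually_elim
  case (elim Q)
  then obtain s where s: "s:?O" "x s = fst Q" by blast
  hence sJ: "s:J" by simp
  have "below J Q \<longleftrightarrow> snd Q < z s" unfolding below_def using branch_inj[OF J sJ] s(2) sJ by metis
  thus ?case using s elim(2) by (auto split: if_splits)
 qed
 moreover have "below J P \<longleftrightarrow> z t > m" using eventually_nhds_x_imp_x[OF ev] .
 ultimately show ?thesis by simp
qed

lemma below_restrict:
 assumes J: "branch J" "branch J'" and t: "t:J" "t:J'" shows "\<forall>\<^sub>F Q in nhds (D t). below J Q \<longleftrightarrow> below J' Q" proof -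
 have t0: "(fst \<longlongrightarrow> fst (D t)) (nhds (D t))" by (auto intro!: tendsto_fst filterlim_ident)
 have "\<forall>\<^sub>F xi in nhds (x t). EX s:J Int J'. x s = xi" using J t by (intro near_inverse) (auto simp: branch_def)
 hence "\<forall>\<^sub>F Q in nhds (D t). EX s:J Int J'. x s = fst Q" using eventually_compose_filterlim[OF _ t0] by (simp add: D_def)
 thus ?thesis proof eventually_elim
  case (elim Q)
  then obtain s where s: "s:J" "s:J'" "x s = fst Q" by blast
  thus ?case unfolding below_def using branch_inj[OF J(1) s(1)] branch_inj[OF J(2) s(2)] by metis
 qed
qed

lemma below_at: assumes "branch J" "t:J" "x t = fst P" shows "below J P \<longleftrightarrow> snd P < z t"
 unfolding below_def using branch_inj[OF assms(1,2)] assms(2,3) by metis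

lemma below_shift: "below ((%t. t + of_int k) ` J) P \<longleftrightarrow> below J P" by (auto simp: below_def per)

end

section \<open>Relative position of the branches at crossings and cusps\<close>

context plane_front
begin

lemma sign_const:
 fixes f :: "real => real"
 assumes "is_interval I" "!!t. t:I ==> f t ~= 0" "continuous_on UNIV f" "s:I" "t:I" "f s > (0::real)" shows "f t > 0" proof (rule ccontr)
 assume "~ f t > 0"
 hence n: "f t < 0" using assms(2,5) by (meson linorder_cases)
 have c: "continuous_on {a..b} f" for a b using assms(3) continuous_on_subset by blast
 have "EX r. min s t <= r & r <= max s t & f r = 0" proof (cases "s <= t")
  case True
  thus ?thesis using IVT2'[of f t 0 s] n assms(6) c by auto
 next
  case False
  thus ?thesis using IVT'[of f t 0 s] n assms(6) c by auto
 qed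
 then obtain r where "min s t <= r" "r <= max s t" "f r = 0" by blast
 moreover from this have "r:I" using assms(1,4,5) unfolding is_interval_1 by (metis max_def min_def)
 ultimately show False using assms(2) by blast
qed

text \<open>Since \<open>d(z - c x) = (y - c) dx\<close>, a chord is flatter or steeper than
  \<open>c\<close> according to the slopes \<open>y\<close> on \<open>I\<close>. The product form
  does not depend on the direction in which the branch is run.\<close>

lemma mvt_ratio:
 assumes "is_interval I" "!!t. t:I ==> x' t ~= 0" "s:I" "t:I" "s ~= t"
 shows "(ALL r:I. y r < c) ==> ((z t - c * x t) - (z s - c * x s)) * (x t - x s) < 0"
  and "(ALL r:I. c < y r) ==> 0 < ((z t - c * x t) - (z s - c * x s)) * (x t - x s)" proof -
 have *: "EX r1:I. EX r2:I. (z t - c * x t) - (z s - c * x s) = (t - s) * ((y r1 - c) * x' r1) & x t - x s = (t - s) * x' r2"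
  if "s < t" "s:I" "t:I" for s t proof -
  have d: "((%t. z t - c * x t) has_real_derivative (y r - c) * x' r) (at r)" for r by (auto intro!: derivative_eq_intros dx dz simp: algebra_simps)
  obtain r1 where r1: "s < r1" "r1 < t" "(z t - c * x t) - (z s - c * x s) = (t - s) * ((y r1 - c) * x' r1)"
   using MVT2[OF \<open>s < t\<close>, of "%t. z t - c * x t" "%r. (y r - c) * x' r"] d by blast
  obtain r2 where r2: "s < r2" "r2 < t" "x t - x s = (t - s) * x' r2" using MVT2[OF \<open>s < t\<close>, of x x'] dx by blast
  have "r1:I" "r2:I" using assms(1) that r1(1,2) r2(1,2) unfolding is_interval_1 by (meson less_imp_le)+
  thus ?thesis using r1(3) r2(3) by blast
 qed
 have "EX r1:I. EX r2:I. ((z t - c * x t) - (z s - c * x s)) * (x t - x s) = (t - s)^2 * ((y r1 - c) * (x' r1 * x' r2))" proof (cases "s < t")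
  case True
  from *[OF True assms(3,4)] show ?thesis by (elim bexE) (auto simp: power2_eq_square intro!: bexI)
 next
  case False
  hence "t < s" using assms(5) by simp
  from *[OF this assms(4,3)] obtain r1 r2 where r: "r1:I" "r2:I" "(z s - c * x s) - (z t - c * x t) = (s - t) * ((y r1 - c) * x' r1)" "x s - x t = (s - t) * x' r2" by blast
  have "((z t - c * x t) - (z s - c * x s)) * (x t - x s) = ((z s - c * x s) - (z t - c * x t)) * (x s - x t)" by (simp add: algebra_simps)
  also have "... = (t - s)^2 * ((y r1 - c) * (x' r1 * x' r2))" unfolding r(3,4) by (simp add: power2_eq_square algebra_simps)
  finally show ?thesis using r(1,2) by blast
 qed
 then obtain r1 r2 where r: "r1:I" "r2:I" "((z t - c * x t) - (z s - c * x s)) * (x t - x s) = (t - s)^2 * ((y r1 - c) * (x' r1 * x' r2))" by blast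
 have p: "x' r1 * x' r2 > 0" proof (cases "x' r1 > 0")
  case True
  thus ?thesis using sign_const[of I x' r1 r2] assms(1,2) cx' r by simp
 next
  case False
  hence "x' r1 < 0" using assms(2) r(1) by (meson linorder_cases)
  moreover from this have "x' r2 < 0" using sign_const[of I x' r2 r1] assms(1,2) cx' r by (meson less_asym linorder_cases)
  ultimately show ?thesis by (simp add: mult_neg_neg)
 qed
 have q: "(t - s)^2 > 0" using assms(5) by simp
 show "((z t - c * x t) - (z s - c * x s)) * (x t - x s) < 0" if "ALL r:I. y r < c" proof -
  have "(y r1 - c) * (x' r1 * x' r2) < 0" using that r(1) p by (simp add: mult_neg_pos)
  thus ?thesis unfolding r(3) using q by (simp add: mult_pos_neg)
 qed
 show "0 < ((z t - c * x t) - (z s - c * x s)) * (x t - x s)" if "ALL r:I. c < y r" proof -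
  have "(y r1 - c) * (x' r1 * x' r2) > 0" using that r(1) p by simp
  thus ?thesis unfolding r(3) using q by simp
 qed
qed

text \<open>The line through the crossing with slope midway between the two slopes separates the
  branches: the over-branch, having the smaller slope, is below it to the right and above it to the
  left.\<close>

lemma crossing_sides:
 assumes "over s0 t0" shows "EX de>0. ALL s t. \<bar>s - s0\<bar> < de & \<bar>t - t0\<bar> < de & x s = x t --> y s < y t &
  (x t0 < x t --> z s < z t) & (x t < x t0 --> z t < z s)" proof -
 define c where "c = (y s0 + y t0) / 2"
 have xz: "x s0 = x t0" "z s0 = z t0" "y s0 < c" "c < y t0" using assms by (auto simp: over_def dp_def D_def c_def)
 have nz: "x' s0 ~= 0" "x' t0 ~= 0" using dp_x' assms by (auto simp: over_def)
 let ?A = "{r. y r < c} Int {r. x' r ~= 0}" and ?B = "{r. c < y r} Int {r. x' r ~= 0}"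
 have "open ?A" "open ?B" by (intro open_Int open_Collect_less open_Collect_neq conty cx' continuous_on_const)+
 moreover have "s0:?A" "t0:?B" using xz nz by auto
 ultimately obtain d1 d2 where d: "d1 > 0" "!!r. \<bar>r - s0\<bar> < d1 ==> r:?A" "d2 > 0" "!!r. \<bar>r - t0\<bar> < d2 ==> r:?B"
  unfolding open_dist dist_real_def by meson
 define de where "de = min d1 d2"
 let ?I = "%r. {r - de<..<r + de}"
 have I: "is_interval (?I r)" for r by (simp add: is_interval_1)
 have "y s < y t & (x t0 < x t --> z s < z t) & (x t < x t0 --> z t < z s)"
  if st: "\<bar>s - s0\<bar> < de" "\<bar>t - t0\<bar> < de" "x s = x t" for s t proof -
  have y: "y s < y t" using d(2)[of s] d(4)[of t] st by (auto simp: de_def)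
  have A: "r:?A" if "r:?I s0" for r using that by (intro d(2)) (auto simp: de_def abs_less_iff)
  have B: "r:?B" if "r:?I t0" for r using that by (intro d(4)) (auto simp: de_def abs_less_iff)
  have in_I: "s:?I s0" "t:?I t0" "s0:?I s0" "t0:?I t0" using st d by (auto simp: abs_less_iff de_def)
  have "z s < z t & x t0 < x t | z t < z s & x t < x t0" if ne: "x t ~= x t0" proof -
   have ne': "s0 ~= s" "t0 ~= t" using ne st(3) xz by auto
   have 1: "((z s - c * x s) - (z s0 - c * x s0)) * (x s - x s0) < 0" by (rule mvt_ratio(1)[OF I[of s0] _ in_I(3,1) ne'(1)]) (use A in auto)
   have 2: "0 < ((z t - c * x t) - (z t0 - c * x t0)) * (x t - x t0)" by (rule mvt_ratio(2)[OF I[of t0] _ in_I(4,2) ne'(2)]) (use B in auto)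
   show ?thesis using 1 2 ne unfolding xz st(3) by (auto simp: mult_less_0_iff zero_less_mult_iff)
  qed
  thus ?thesis using y by force
 qed
 thus ?thesis using d by (intro exI[of _ de]) (auto simp: de_def)
qed

definition rcusp :: "real => bool" where
 "rcusp t \<longleftrightarrow> x' t = 0 & (EX de>0. ALL s. t - de < s & s < t --> x' s > 0)"

text \<open>At a right cusp the upper branch is in front of (has smaller \<open>y\<close> than) the lower one, at a
  left cusp it is behind.\<close>

lemma cusp_structure:
 assumes "x' t0 = 0"
 shows "EX de>0. (ALL s. t0 - de < s & s < t0 --> (x' s > 0 \<longleftrightarrow> rcusp t0) & (x' s < 0 \<longleftrightarrow> ~ rcusp t0)) &
  (ALL s. t0 < s & s < t0 + de --> (x' s < 0 \<longleftrightarrow> rcusp t0) & (x' s > 0 \<longleftrightarrow> ~ rcusp t0)) &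
  (ALL s t. t0 - de < s & s < t0 & t0 < t & t < t0 + de & x s = x t -->
   (if rcusp t0 then (z s - z t) * (y s - y t) < 0 else (z s - z t) * (y s - y t) > 0))" proof -
 obtain d de1 where d: "d ~= 0" "de1 > 0" "!!s. t0 - de1 < s ==> s < t0 ==> x' s * d < 0" "!!s. t0 < s ==> s < t0 + de1 ==> x' s * d > 0"
  using x'_near_zero[OF assms] by blast
 have rc: "rcusp t0 \<longleftrightarrow> d < 0" proof
  assume "rcusp t0"
  then obtain de where "de > 0" "ALL s. t0 - de < s & s < t0 --> x' s > 0" by (auto simp: rcusp_def)
  hence "x' (t0 - min de de1 / 2) > 0" "x' (t0 - min de de1 / 2) * d < 0" using d(2) by (auto intro!: d(3))
  thus "d < 0" by (simp add: mult_less_0_iff)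
 next
  assume "d < 0"
  hence "ALL s. t0 - de1 < s & s < t0 --> x' s > 0" using d(3) by (auto simp: mult_less_0_iff dest: less_asym)
  thus "rcusp t0" using d(2) assms unfolding rcusp_def by blast
 qed
 define e where "e = y' t0"
 have e: "e ~= 0" using imm assms by (simp add: e_def)
 have "((%s. y s * e) has_real_derivative e * e) (at t0)" using DERIV_cmult_right[OF dy[of t0], of e] by (simp add: e_def)
 moreover have "e * e > 0" using e by (metis not_real_square_gt_zero)
 ultimately obtain e1 e2 where e12: "e1 > 0" "!!h. h > 0 ==> h < e1 ==> y t0 * e < y (t0 + h) * e"
  "e2 > 0" "!!h. h > 0 ==> h < e2 ==> y (t0 - h) * e < y t0 * e"
  using DERIV_pos_inc_right[of "%s. y s * e" "e * e" t0] DERIV_pos_inc_left[of "%s. y s * e" "e * e" t0] by metis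
 define de where "de = min de1 (min e1 e2)"
 have de: "de > 0" using d(2) e12 by (simp add: de_def)
 have yl: "y s * e < y t0 * e" if "t0 - de < s" "s < t0" for s using e12(4)[of "t0 - s"] that by (simp add: de_def)
 have yr: "y t0 * e < y s * e" if "s < t0 + de" "t0 < s" for s using e12(2)[of "s - t0"] that by (simp add: de_def)
 have L: "(x' s > 0 \<longleftrightarrow> rcusp t0) & (x' s < 0 \<longleftrightarrow> ~ rcusp t0)" if "t0 - de < s" "s < t0" for s
  using d(1) d(3)[of s] that min.cobounded1[of de1 "min e1 e2"] unfolding rc de_def[symmetric] by (auto simp: mult_less_0_iff)
 have R: "(x' s < 0 \<longleftrightarrow> rcusp t0) & (x' s > 0 \<longleftrightarrow> ~ rcusp t0)" if "t0 < s" "s < t0 + de" for s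
  using d(1) d(4)[of s] that min.cobounded1[of de1 "min e1 e2"] unfolding rc de_def[symmetric] by (auto simp: zero_less_mult_iff)
 have main: "((z t - z s) * e) * d > 0 & (y t - y s) * e > 0"
  if st: "t0 - de < s" "s < t0" "t0 < t" "t < t0 + de" "x s = x t" for s t proof -
  \<comment> \<open>Up to a constant, \<open>z - y t0 * x\<close> is the height over the tangent of
    the cusp. Both factors of its derivative change sign at \<open>t0\<close>, so after
    multiplication by \<open>e\<close> and \<open>d\<close> it increases through the cusp.\<close>
  define f where "f r = (z r - y t0 * x r) * (e * d)" for r
  have df: "(f has_real_derivative ((y r - y t0) * e) * (x' r * d)) (at r)" for r
   unfolding f_def by (auto intro!: derivative_eq_intros dx dz simp: algebra_simps)
  have "f s < f t0" proof (rule DERIV_pos_imp_increasing_open[OF st(2)])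
   fix r assume r: "s < r" "r < t0"
   hence "(y r - y t0) * e < 0" "x' r * d < 0" using yl[of r] d(3)[of r] st by (auto simp: algebra_simps de_def)
   thus "EX y. (f has_real_derivative y) (at r) & 0 < y" using df mult_neg_neg by blast
  qed (use df in "auto intro!: continuous_at_imp_continuous_on intro: DERIV_isCont")
  moreover have "f t0 < f t" proof (rule DERIV_pos_imp_increasing_open[OF st(3)])
   fix r assume r: "t0 < r" "r < t"
   hence "(y r - y t0) * e > 0" "x' r * d > 0" using yr[of r] d(4)[of r] st by (auto simp: algebra_simps de_def)
   thus "EX y. (f has_real_derivative y) (at r) & 0 < y" using df mult_pos_pos by blast
  qed (use df in "auto intro!: continuous_at_imp_continuous_on intro: DERIV_isCont")
  ultimately have "f s < f t" by simp
  thus ?thesis using yl[OF st(1,2)] yr[OF st(4,3)] st(5) by (simp add: f_def algebra_simps)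
 qed
 have "if rcusp t0 then (z s - z t) * (y s - y t) < 0 else (z s - z t) * (y s - y t) > 0"
  if st: "t0 - de < s" "s < t0" "t0 < t" "t < t0 + de" "x s = x t" for s t proof -
  note m = main[OF st]
  have "0 < (((z t - z s) * e) * d) * ((y t - y s) * e)" by (rule mult_pos_pos[OF conjunct1[OF m] conjunct2[OF m]])
  also have "... = (e * e) * (((z s - z t) * (y s - y t)) * d)" by (simp add: algebra_simps)
  finally have "((z s - z t) * (y s - y t)) * d > 0" using \<open>e * e > 0\<close> by (simp add: zero_less_mult_iff)
  thus ?thesis using d(1) unfolding rc by (auto simp: zero_less_mult_iff)
 qed
 thus ?thesis using de L R by (intro exI[of _ de]) blast
qed

end

section \<open>Colourings and shadows\<close>

text \<open>The permutation by which the shadow changes on passing below the branch at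
  \<open>t\<close>; reversing the direction of the branch inverts it.\<close>

definition gsym :: "('a, 'b) rack_scheme => (real => real) => (real => 'a) => real => 'a sym" where
 "gsym R x' cf t = (if x' t > 0 then - act R (cf t) else act R (cf t))"

text \<open>\<open>cf\<close> is a colouring in which the twist at a cusp has been moved to the right cusps.\<close>

locale coloring = plane_front +
 fixes R :: "('a, 'b) rack_scheme" and cf :: "real => 'a"
 assumes rackR: "rack R"
  and cf_closed: "~ brk t ==> cf t:rcarrier R"
  and cf_per: "cf (t + 1) = cf t"
  and cf_const: "~ brk t ==> \<forall>\<^sub>F s in nhds t. cf s = cf t"
  and cf_cross: "over s t ==> \<forall>\<^sub>F t1 in at_left t. \<forall>\<^sub>F t2 in at_right t.
    (if x' t > 0 then cf t1 = app (gsym R x' cf s) (cf t2) else cf t2 = app (gsym R x' cf s) (cf t1))"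
  and cf_cusp: "x' t = 0 ==> \<forall>\<^sub>F t1 in at_left t. \<forall>\<^sub>F t2 in at_right t.
    cf t1 = (if rcusp t then iota R (cf t2) else cf t2)"
begin

abbreviation g :: "real => 'a sym" where "g \<equiv> gsym R x' cf"

lemma g_autos: "g t:autos R" using act_autos[OF rackR] autos_uminus[OF rackR] by (auto simp: gsym_def)

lemma per_cf: "cf (t + of_int k) = cf t" "g (t + of_int k) = g t" proof -
 show "cf (t + of_int k) = cf t" by (rule periodic_int) (rule cf_per)
 thus "g (t + of_int k) = g t" by (simp add: gsym_def per)
qed

lemma const_on_interval:
 assumes "is_interval I" "!!t. t:I ==> ~ brk t" "s:I" "t:I" shows "cf s = cf t" "x' s > 0 \<longleftrightarrow> x' t > 0" "g s = g t" proof -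
 show c: "cf s = cf t" proof (rule connected_local_const[of I s t cf])
  show "connected I" using assms(1) is_interval_connected by blast
  show "ALL a:I. \<forall>\<^sub>F b in at a within I. cf a = cf b" proof
   fix a assume "a:I"
   hence "\<forall>\<^sub>F b in nhds a. cf b = cf a" using cf_const assms(2) by blast
   thus "\<forall>\<^sub>F b in at a within I. cf a = cf b" unfolding eventually_at_filter by (rule eventually_mono) simp
  qed
 qed (use assms in auto)
 have nz: "x' t ~= 0" if "t:I" for t using assms(2)[OF that] by (auto simp: brk_def)
 show p: "x' s > 0 \<longleftrightarrow> x' t > 0" using sign_const[OF assms(1) nz cx' assms(3,4)] sign_const[OF assms(1) nz cx' assms(4,3)] by blast
 show "g s = g t" unfolding gsym_def using c p by simp
qed

definition good :: "real => real => bool" where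
 "good t de \<longleftrightarrow> 0 < de & de < 1/2 & (ALL s. s ~= t & \<bar>s - t\<bar> < de --> D s ~: sing)"

lemma good_exists: "EX de>0. ALL de'. 0 < de' & de' <= de --> good t de'" proof -
 obtain de where "de > 0" "ALL s. s ~= t & \<bar>s - t\<bar> < de --> D s ~: sing" using reg_interval by blast
 thus ?thesis unfolding good_def by (intro exI[of _ "min de (1/4)"]) auto
qed

lemma good_shift: "good (t + of_int k) de \<longleftrightarrow> good t de" proof -
 have *: "good (t + of_int k) de" if "good t de" for t k proof -
  have "D s ~: sing" if s: "s ~= t + of_int k" "\<bar>s - (t + of_int k)\<bar> < de" for s proof -
   have "D (s - of_int k) ~: sing" using \<open>good t de\<close> s by (auto simp: good_def algebra_simps)
   thus ?thesis using per(6)[of "s - of_int k" k] by simp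
  qed
  thus ?thesis using that by (auto simp: good_def)
 qed
 show ?thesis using *[of t k] *[of "t + of_int k" "- k"] by auto
qed

lemma good_left: assumes "good t de" "t - de < s" "s < t" "t - de < r" "r < t"
 shows "cf s = cf r" "x' s > 0 \<longleftrightarrow> x' r > 0" "g s = g r" "~ brk s" proof -
 have nb: "~ brk q" if "q:{t - de<..<t}" for q using assms(1) that regD(2)[of q] by (auto simp: good_def abs_less_iff)
 have "is_interval {t - de<..<t}" by (simp add: is_interval_1)
 from const_on_interval[OF this nb, of s r] nb[of s] assms show "cf s = cf r" "x' s > 0 \<longleftrightarrow> x' r > 0" "g s = g r" "~ brk s" by auto
qed

lemma good_right: assumes "good t de" "t < s" "s < t + de" "t < r" "r < t + de"
 shows "cf s = cf r" "x' s > 0 \<longleftrightarrow> x' r > 0" "g s = g r" "~ brk s" proof -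
 have nb: "~ brk q" if "q:{t<..<t + de}" for q using assms(1) that regD(2)[of q] by (auto simp: good_def abs_less_iff)
 have "is_interval {t<..<t + de}" by (simp add: is_interval_1)
 from const_on_interval[OF this nb, of s r] nb[of s] assms show "cf s = cf r" "x' s > 0 \<longleftrightarrow> x' r > 0" "g s = g r" "~ brk s" by auto
qed

lemma good_both: assumes "good t de" "~ brk t" "\<bar>s - t\<bar> < de" shows "cf s = cf t" "g s = g t" "~ brk s" proof -
 have nb: "~ brk q" if "q:{t - de<..<t + de}" for q using assms(1,2) that regD(2)[of q] by (cases "q = t") (auto simp: good_def abs_less_iff)
 have "is_interval {t - de<..<t + de}" by (simp add: is_interval_1)
 from const_on_interval[OF this nb, of s t] nb[of s] assms show "cf s = cf t" "g s = g t" "~ brk s" by (auto simp: good_def abs_less_iff)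
qed

lemma good_branch: "good t de ==> branch {t - de<..<t}" "good t de ==> branch {t<..<t + de}"
 "good t de ==> x' t ~= 0 ==> branch {t - de<..<t + de}" proof -
 assume G: "good t de"
 have nz: "x' q ~= 0" if "\<bar>q - t\<bar> < de" "q ~= t" for q using G that regD(1)[of q] by (auto simp: good_def)
 show "branch {t - de<..<t}" "branch {t<..<t + de}" using nz by (auto simp: branch_def is_interval_1 abs_less_iff)
 show "branch {t - de<..<t + de}" if "x' t ~= 0" proof -
  have "x' q ~= 0" if "q:{t - de<..<t + de}" for q using nz[of q] that \<open>x' t ~= 0\<close> by (cases "q = t") (auto simp: abs_less_iff)
  thus ?thesis by (auto simp: branch_def is_interval_1)
 qed
qed

lemma cross_color:
 assumes "over s t" "good t de" "t - de < t1" "t1 < t" "t < t2" "t2 < t + de"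
 shows "if x' t > 0 then cf t1 = app (g s) (cf t2) else cf t2 = app (g s) (cf t1)" proof -
 have "\<forall>\<^sub>F a in at_left t. a:{t - de<..<t}" using assms(2) by (intro eventually_at_left_real) (auto simp: good_def)
 hence "\<forall>\<^sub>F a in at_left t. a:{t - de<..<t} & (\<forall>\<^sub>F b in at_right t. if x' t > 0 then cf a = app (g s) (cf b) else cf b = app (g s) (cf a))"
  using cf_cross[OF assms(1)] by eventually_elim auto
 then obtain a where a: "a:{t - de<..<t}" "\<forall>\<^sub>F b in at_right t. if x' t > 0 then cf a = app (g s) (cf b) else cf b = app (g s) (cf a)"
  using eventually_happens'[OF trivial_limit_at_left_real] by blast
 have "\<forall>\<^sub>F b in at_right t. b:{t<..<t + de}" using assms(2) by (intro eventually_at_right_real) (auto simp: good_def)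
 with a(2) have "\<forall>\<^sub>F b in at_right t. b:{t<..<t + de} & (if x' t > 0 then cf a = app (g s) (cf b) else cf b = app (g s) (cf a))"
  by eventually_elim auto
 then obtain b where b: "b:{t<..<t + de}" "if x' t > 0 then cf a = app (g s) (cf b) else cf b = app (g s) (cf a)"
  using eventually_happens'[OF trivial_limit_at_right_real] by blast
 have "cf t1 = cf a" "cf t2 = cf b" using good_left(1)[OF assms(2), of t1 a] good_right(1)[OF assms(2), of t2 b] a(1) b(1) assms by auto
 thus ?thesis using b(2) by simp
qed

lemma cusp_color:
 assumes "x' t = 0" "good t de" "t - de < t1" "t1 < t" "t < t2" "t2 < t + de" shows "cf t1 = (if rcusp t then iota R (cf t2) else cf t2)" proof -
 have "\<forall>\<^sub>F a in at_left t. a:{t - de<..<t}" using assms(2) by (intro eventually_at_left_real) (auto simp: good_def)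
 hence "\<forall>\<^sub>F a in at_left t. a:{t - de<..<t} & (\<forall>\<^sub>F b in at_right t. cf a = (if rcusp t then iota R (cf b) else cf b))"
  using cf_cusp[OF assms(1)] by eventually_elim auto
 then obtain a where a: "a:{t - de<..<t}" "\<forall>\<^sub>F b in at_right t. cf a = (if rcusp t then iota R (cf b) else cf b)"
  using eventually_happens'[OF trivial_limit_at_left_real] by blast
 have "\<forall>\<^sub>F b in at_right t. b:{t<..<t + de}" using assms(2) by (intro eventually_at_right_real) (auto simp: good_def)
 with a(2) have "\<forall>\<^sub>F b in at_right t. b:{t<..<t + de} & cf a = (if rcusp t then iota R (cf b) else cf b)" by eventually_elim auto
 then obtain b where b: "b:{t<..<t + de}" "cf a = (if rcusp t then iota R (cf b) else cf b)"
  using eventually_happens'[OF trivial_limit_at_right_real] by blast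
 have "cf t1 = cf a" "cf t2 = cf b" using good_left(1)[OF assms(2), of t1 a] good_right(1)[OF assms(2), of t2 b] a(1) b(1) assms by auto
 thus ?thesis using b(2) by simp
qed

text \<open>The rule for colouring the regions of the plane: constant off the front, multiplied on
  the right by \<open>g t\<close> below a branch. Points on the branch carry the value of the region
  above it.\<close>

definition adm :: "(real * real => 'a sym) => real * real => bool" where
 "adm h p \<longleftrightarrow> (p ~: range D --> (\<forall>\<^sub>F q in nhds p. h q = h p)) &
   (ALL t J. p = D t --> branch J --> t:J --> (\<forall>\<^sub>F q in nhds p. h q = h p + (if below J q then g t else 0)))"

lemma adm_on_D:
 assumes "D t ~: sing" "branch J" "t:J" "\<forall>\<^sub>F q in nhds (D t). h q = h (D t) + (if below J q then g t else 0)" shows "adm h (D t)"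
 unfolding adm_def proof (intro conjI allI impI)
 fix s J' assume s: "D t = D s" "branch J'" "s:J'"
 obtain k where k: "t = s + of_int k" using regD(3)[of s t] assms(1) s(1) by auto
 let ?J = "(+) (of_int (- k)) ` J"
 have J': "below ?J P \<longleftrightarrow> below J P" for P using below_shift[of "- k" J P] by (simp add: add.commute)
 have "is_interval ?J" using assms(2) by (simp add: branch_def is_interval_translation)
 moreover have "open ?J" using assms(2) open_translation[of J] unfolding branch_def by blast
 moreover have "ALL r:?J. x' r ~= 0" proof
  fix r assume "r:?J"
  then obtain q where q: "q:J" "r = q + of_int (- k)" by auto
  show "x' r ~= 0" unfolding q(2) per using q(1) assms(2) by (simp add: branch_def)
 qed
 ultimately have b: "branch ?J" by (simp add: branch_def)
 have "s:?J" using assms(3) k by (auto intro!: image_eqI[of _ _ t])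
 from below_restrict[OF s(2) b s(3) this] have "\<forall>\<^sub>F q in nhds (D t). below J' q \<longleftrightarrow> below J q"
  unfolding s(1)[symmetric] J' .
 with assms(4) show "\<forall>\<^sub>F q in nhds (D t). h q = h (D t) + (if below J' q then g s else 0)" by eventually_elim (simp add: k per_cf)
qed auto

end

section \<open>Local shadows at regular points and crossings\<close>

context coloring
begin

definition two :: "real set => 'a sym => real set => 'a sym => real * real => 'a sym" where
 "two J1 A J2 B q = (if below J1 q then A else 0) + (if below J2 q then B else 0)"

text \<open>Nothing is required at the singular point itself: \<open>Q\<close> contains no other
  one, so two charts with different centres never have to agree at a singular point.\<close>

definition chart :: "real * real => (real * real) set => (real * real => 'a sym) => bool" where
 "chart P Q h \<longleftrightarrow> open Q & P:Q & (ALL q. h q:autos R) & (ALL p:Q. p:sing --> p = P) & (ALL p:Q. p ~: sing --> adm h p)"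

lemma sing_nbhd: "open (- (sing - {P}))" "P:- (sing - {P})" "p:- (sing - {P}) ==> p:sing ==> p = P"
 using open_Compl[OF finite_imp_closed[OF finite_Diff[OF finite_sing, of "{P}"]]] by auto

lemma off_D: assumes "p ~: range D" "x s = fst p" shows "z s ~= snd p" proof
 assume "z s = snd p"
 hence "p = D s" using assms(2) by (simp add: D_def prod_eq_iff)
 thus False using assms(1) by blast
qed

lemma sing_range: "sing <= range D" by (auto simp: sing_def)

lemma chartI:
 assumes "open Q" "P:Q" "!!q. h q:autos R" "!!p. p:Q ==> p ~: sing ==> adm h p" shows "chart P (Q Int - (sing - {P})) h" unfolding chart_def
proof (intro conjI)
 show "open (Q Int - (sing - {P}))" by (intro open_Int assms(1) sing_nbhd(1))
qed (use assms in auto)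

lemma column_nbhd:
 assumes "branch J" "t:J" "x t = fst P" shows "EX Q. open Q & P:Q & (ALL p:Q. EX s:J. x s = fst p)" proof -
 have "\<forall>\<^sub>F xi in nhds (fst P). EX s:J. x s = xi" using near_inverse[of t J] assms by (auto simp: branch_def)
 from eventually_compose_filterlim[OF this tendsto_fst[OF filterlim_ident]]
 have "\<forall>\<^sub>F p in nhds P. EX s:J. x s = fst p" .
 thus ?thesis unfolding eventually_nhds by blast
qed

lemma below_D: "branch J ==> t:J ==> ~ below J (D t)" using below_at[of J t "D t"] by (simp add: D_def)

lemma chart_empty:
 assumes "P ~: range D" shows "EX Q h. chart P Q h" unfolding chart_def by (intro exI[of _ "- range D"] exI[of _ "%_. 0"])
  (use assms closed_D sing_range in "auto simp: autos_closed adm_def")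

lemma chart_regular:
 assumes "D t0 ~: sing" shows "EX Q h. chart (D t0) Q h" proof -
 obtain de where de: "good t0 de" using good_exists by blast
 define J where "J = {t0 - de<..<t0 + de}"
 have J: "branch J" "t0:J" using good_branch(3)[OF de regD(1)[OF assms]] de by (auto simp: J_def good_def)
 obtain Q1 where Q1: "open Q1" "D t0:Q1" "ALL t. D t:Q1 --> (EX k. t + of_int k:J)"
  using nearby[of J "D t0"] J regD(3)[OF assms] by (auto simp: branch_def) (metis add_diff_cancel_right' diff_add_cancel add.commute add_uminus_conv_diff of_int_minus)
 obtain Q2 where Q2: "open Q2" "D t0:Q2" "ALL p:Q2. EX s:J. x s = fst p" using column_nbhd[OF J(1,2), of "D t0"] by (auto simp: D_def)
 define h where "h q = (if below J q then g t0 else 0)" for q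
 have "adm h p" if p: "p:Q1" "p:Q2" "p ~: sing" for p proof (cases "p:range D")
  case False
  obtain s where s: "s:J" "x s = fst p" using Q2(3) p by blast
  have "z s ~= snd p" using False s off_D by blast
  from below_local[OF J(1) s this] have "\<forall>\<^sub>F q in nhds p. h q = h p" by eventually_elim (simp add: h_def)
  thus ?thesis using False by (auto simp: adm_def)
 next
  case True
  then obtain t where t0: "p = D t" by blast
  then obtain k where "t + of_int k:J" using Q1(3) p(1) by blast
  with t0 have t: "p = D (t + of_int k)" "t + of_int k:J" by (simp_all add: per)
  have "\<bar>t + of_int k - t0\<bar> < de" using t(2) by (auto simp: J_def abs_less_iff)
  hence "g (t + of_int k) = g t0" using good_both(2)[OF de regD(2)[OF assms]] by blast
  thus ?thesis unfolding t(1) by (intro adm_on_D[OF _ J(1) t(2)]) (use p t below_D[OF J(1) t(2)] in "auto simp: h_def")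
 qed
 hence "chart (D t0) (Q1 Int Q2 Int - (sing - {D t0})) h" by (intro chartI) (use Q1 Q2 g_autos in "auto simp: h_def autos_closed")
 thus ?thesis by blast
qed

lemma branch_mono:
 assumes "branch J" "s:J" "t:J" shows "x' s > 0 ==> x s < x t \<longleftrightarrow> s < t" "x' s < 0 ==> x s < x t \<longleftrightarrow> t < s"
proof -
 have nz: "!!t. t:J ==> x' t ~= 0" and I: "is_interval J" using assms by (auto simp: branch_def)
 have pos: "x a < x b" if "a < b" "a:J" "b:J" "x' s > 0" for a b proof -
  from MVT2[OF that(1), of x x'] dx obtain r where r: "a < r" "r < b" "x b - x a = (b - a) * x' r" by blast
  have "r:J" using I that(2,3) r(1,2) unfolding is_interval_1 by (meson less_imp_le)
  hence "x' r > 0" using sign_const[OF I nz cx' assms(2)] that by blast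
  thus ?thesis using r that(1) by (metis diff_gt_0_iff_gt mult_pos_pos)
 qed
 have neg: "x b < x a" if "a < b" "a:J" "b:J" "x' s < 0" for a b proof -
  from MVT2[OF that(1), of x x'] dx obtain r where r: "a < r" "r < b" "x b - x a = (b - a) * x' r" by blast
  have "r:J" using I that(2,3) r(1,2) unfolding is_interval_1 by (meson less_imp_le)
  hence "x' r < 0" using sign_const[OF I nz cx' _ assms(2)] that(4) nz by (metis linorder_cases less_asym)
  thus ?thesis using r that(1) by (metis diff_gt_0_iff_gt mult_pos_neg diff_less_0_iff_less)
 qed
 show "x s < x t \<longleftrightarrow> s < t" if "x' s > 0" using pos[of s t] pos[of t s] assms that by (cases s t rule: linorder_cases) auto
 show "x s < x t \<longleftrightarrow> t < s" if "x' s < 0" using neg[of s t] neg[of t s] assms that by (cases s t rule: linorder_cases) auto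
qed

text \<open>Sample parameters to the right in the plane rather than later in time; together with
  \<open>lft\<close> this removes the orientation of the under-branch from the crossing
  rule.\<close>

definition rgt :: "real => real => real" where "rgt t de = (if x' t > 0 then t + de/2 else t - de/2)"
definition lft :: "real => real => real" where "lft t de = (if x' t > 0 then t - de/2 else t + de/2)"

text \<open>The first equation is the crossing rule. The second follows from it by
  \<open>act_conj\<close> and says that the jumps on the two ways around the crossing have the same
  product.\<close>

lemma cross_rel:
 assumes "over s t" "good t de" shows "cf (lft t de) = app (g s) (cf (rgt t de))" "g (rgt t de) + g s = g s + g (lft t de)" proof -
 have de: "de > 0" using assms(2) by (simp add: good_def)
 have nz: "x' t ~= 0" using assms(1) dp_x' by (auto simp: over_def)
 show c: "cf (lft t de) = app (g s) (cf (rgt t de))"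
  using cross_color[OF assms, of "t - de/2" "t + de/2"] de by (auto simp: lft_def rgt_def split: if_splits)
 have I: "is_interval {t - de<..<t + de}" by (simp add: is_interval_1)
 have nb: "~ brk (rgt t de)"
  using good_left(4)[OF assms(2), of "t - de/2" "t - de/2"] good_right(4)[OF assms(2), of "t + de/2" "t + de/2"] de by (auto simp: rgt_def)
 have br: "branch {t - de<..<t + de}" by (rule good_branch(3)[OF assms(2) nz])
 have in_J: "rgt t de:{t - de<..<t + de}" "lft t de:{t - de<..<t + de}" using de by (auto simp: rgt_def lft_def)
 have sg: "x' (rgt t de) > 0 \<longleftrightarrow> x' (lft t de) > 0"
  using sign_const[OF I, of x' "rgt t de" "lft t de"] sign_const[OF I, of x' "lft t de" "rgt t de"] br cx' in_J by (auto simp: branch_def)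
 have conj: "- g s + act R (cf (rgt t de)) + g s = act R (cf (lft t de))" using act_conj[OF rackR g_autos cf_closed[OF nb]] c by simp
 hence e1: "act R (cf (rgt t de)) + g s = g s + act R (cf (lft t de))" by (metis add.assoc add_minus_cancel)
 have "g s + (- (g s + act R (cf (lft t de)))) = g s + (- (act R (cf (rgt t de)) + g s))" using e1 by simp
 hence "g s + - act R (cf (lft t de)) + - g s = - act R (cf (rgt t de))" by (simp only: minus_add add.assoc[symmetric] right_minus add_0_left)
 hence e2: "- act R (cf (rgt t de)) + g s = g s + - act R (cf (lft t de))" by (metis add.assoc left_minus add_0_right)
 show "g (rgt t de) + g s = g s + g (lft t de)" using e1 e2 sg unfolding gsym_def[of R x' cf "rgt t de"] gsym_def[of R x' cf "lft t de"] by auto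
qed

text \<open>First the under-branch with the colour of its right half, then the over-branch. To the
  left, where the under-branch is the lower one, \<open>cross_rel\<close> rewrites the product in
  terms of the left colour.\<close>

definition cross_chart :: "real => real => real => real * real => 'a sym" where
 "cross_chart s t de = two {t - de<..<t + de} (g (rgt t de)) {s - de<..<s + de} (g s)"

lemma chart_cross:
 assumes ov: "over s0 t0" shows "EX de0>0. ALL de. 0 < de & de <= de0 --> (EX Q. chart (D t0) Q (cross_chart s0 t0 de))" proof -
 obtain de1 where de1: "de1 > 0" "!!s t. \<bar>s - s0\<bar> < de1 ==> \<bar>t - t0\<bar> < de1 ==> x s = x t ==> y s < y t &
  (x t0 < x t --> z s < z t) & (x t < x t0 --> z t < z s)" using crossing_sides[OF ov] by blast
 obtain de2 where de2: "de2 > 0" "!!de. 0 < de ==> de <= de2 ==> good s0 de" using good_exists by blast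
 obtain de3 where de3: "de3 > 0" "!!de. 0 < de ==> de <= de3 ==> good t0 de" using good_exists by blast
 have nz: "x' s0 ~= 0" "x' t0 ~= 0" using ov dp_x' by (auto simp: over_def)
 have st: "D s0 = D t0" using ov by (simp add: over_def dp_def)
 have "EX Q. chart (D t0) Q (cross_chart s0 t0 de)" if d: "0 < de" "de <= min de1 (min de2 de3)" for de proof -
  have gs: "good s0 de" and gt: "good t0 de" using de2 de3 d by auto
  define Js Jt where "Js = {s0 - de<..<s0 + de}" and "Jt = {t0 - de<..<t0 + de}"
  have Js: "branch Js" "s0:Js" and Jt: "branch Jt" "t0:Jt"
   using good_branch(3)[OF gs nz(1)] good_branch(3)[OF gt nz(2)] d by (auto simp: Js_def Jt_def)
  let ?X = "g (rgt t0 de)" and ?Y = "g s0" and ?h = "cross_chart s0 t0 de"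
  have h: "?h q = (if below Jt q then ?X else 0) + (if below Js q then ?Y else 0)" for q by (simp add: cross_chart_def two_def Js_def Jt_def)
  have "EX k. r + of_int k:Js Un Jt" if r: "D r = D t0" for r proof -
   from two_points[of s0 t0 r] ov r obtain k where "r = s0 + of_int k | r = t0 + of_int k" by (auto simp: over_def)
   thus ?thesis using Js(2) Jt(2) by (intro exI[of _ "- k"]) auto
  qed
  then obtain Q1 where Q1: "open Q1" "D t0:Q1" "ALL t. D t:Q1 --> (EX k. t + of_int k:Js Un Jt)"
   using nearby[of "Js Un Jt" "D t0"] Js Jt unfolding branch_def by (metis open_Un)
  obtain Q2 where Q2: "open Q2" "D t0:Q2" "ALL p:Q2. EX s:Js. x s = fst p" using column_nbhd[OF Js, of "D t0"] st by (auto simp: D_def)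
  obtain Q3 where Q3: "open Q3" "D t0:Q3" "ALL p:Q3. EX s:Jt. x s = fst p" using column_nbhd[OF Jt, of "D t0"] by (auto simp: D_def)
  have "adm ?h p" if p: "p:Q1" "p:Q2" "p:Q3" "p ~: sing" for p proof -
   obtain s where s: "s:Js" "x s = fst p" using Q2(3) p by blast
   obtain t where t: "t:Jt" "x t = fst p" using Q3(3) p by blast
   have ds: "\<bar>s - s0\<bar> < de" and dt: "\<bar>t - t0\<bar> < de" using s t by (auto simp: Js_def Jt_def abs_less_iff)
   hence sides: "y s < y t" "x t0 < x t ==> z s < z t" "x t < x t0 ==> z t < z s" using de1(2)[of s t] d s(2) t(2) by auto
   have zne: "z s ~= z t" if "snd p = z s | snd p = z t" proof
    assume e: "z s = z t"
    hence "D s = D t" "p = D t" using that s(2) t(2) by (auto simp: D_def prod_eq_iff)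
    then obtain k where "s = t + of_int k" using regD(3)[of t s] p(4) by auto
    thus False using sides(1) by (simp add: per)
   qed
   show ?thesis proof (cases "p:range D")
    case False
    have zz: "z s ~= snd p" "z t ~= snd p" using False s t off_D by blast+
    have "\<forall>\<^sub>F q in nhds p. ?h q = ?h p"
     using below_local[OF Js(1) s zz(1)] below_local[OF Jt(1) t zz(2)] unfolding h by eventually_elim simp
    thus ?thesis using False by (auto simp: adm_def)
   next
    case True
    then obtain r0 where r0: "p = D r0" by blast
    then obtain k where "r0 + of_int k:Js Un Jt" using Q1(3) p(1) by blast
    moreover have "p = D (r0 + of_int k)" using r0 by (simp add: per)
    ultimately obtain r where r: "p = D r" "r:Js Un Jt" by blast
    have "r = s | r = t" using r s t branch_inj[OF Js(1), of r s] branch_inj[OF Jt(1), of r t] by (auto simp: D_def)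
    thus ?thesis proof
     assume rs: "r = s"
     hence "z t ~= snd p" using zne r by (auto simp: D_def)
     hence ev: "\<forall>\<^sub>F q in nhds p. below Jt q = below Jt p" by (rule below_local[OF Jt(1) t])
     have nb: "~ below Js p" using below_D[OF Js(1)] s(1) r rs by simp
     have gss: "g s = ?Y" using good_both(2)[OF gs over_not_brk[OF ov] ds] .
     have "\<forall>\<^sub>F q in nhds p. ?h q = ?h p + (if below Js q then g s else 0)" using ev by eventually_elim (simp add: h nb gss)
     thus ?thesis using adm_on_D[OF _ Js(1) s(1)] p(4) r rs by simp
    next
     assume rt: "r = t"
     hence zs: "z s ~= snd p" using zne r by (auto simp: D_def)
     hence ev: "\<forall>\<^sub>F q in nhds p. below Js q = below Js p" by (rule below_local[OF Js(1) s])
     have nb: "~ below Jt p" using below_D[OF Jt(1)] t(1) r rt by simp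
     have tt0: "t ~= t0" using p(4) r rt singI(2)[of s0 t0] ov by (auto simp: over_def)
     have nx: "x t ~= x t0" using branch_inj[OF Jt(1) t(1) Jt(2)] tt0 by blast
     have bJs: "below Js p \<longleftrightarrow> z t < z s" using below_at[OF Js(1) s] r rt by (simp add: D_def)
     have mono: "x t < x t0 \<longleftrightarrow> (if x' t0 > 0 then t < t0 else t0 < t)"
      using branch_mono[OF Jt(1) Jt(2) t(1)] nz(2) nx tt0 by (auto simp: linorder_neq_iff)
     have gt_eq: "g t = (if below Js p then g (lft t0 de) else ?X)" proof (cases "below Js p")
      case True
      hence "x t < x t0" using bJs sides(2) nx by force
      hence "g t = g (lft t0 de)" using mono dt d(1) good_left(3)[OF gt, of t "t0 - de/2"] good_right(3)[OF gt, of t "t0 + de/2"]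
       by (auto simp: lft_def abs_less_iff split: if_splits)
      thus ?thesis using True by simp
     next
      case False
      hence "~ x t < x t0" using bJs sides(3) by force
      hence "g t = ?X" using mono dt d(1) tt0 good_left(3)[OF gt, of t "t0 - de/2"] good_right(3)[OF gt, of t "t0 + de/2"]
       by (auto simp: rgt_def abs_less_iff split: if_splits)
      thus ?thesis using False by simp
     qed
     have "\<forall>\<^sub>F q in nhds p. ?h q = ?h p + (if below Jt q then g t else 0)"
      using ev by eventually_elim (use cross_rel(2)[OF ov gt] in "simp add: h nb gt_eq")
     thus ?thesis using adm_on_D[OF _ Jt(1) t(1)] p(4) r rt by simp
    qed
   qed
  qed
  hence "chart (D t0) (Q1 Int Q2 Int Q3 Int - (sing - {D t0})) ?h" by (intro chartI) (use Q1 Q2 Q3 g_autos in "auto simp: h autos_closed")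
  thus ?thesis by blast
 qed
 thus ?thesis using de1(1) de2(1) de3(1) by (intro exI[of _ "min de1 (min de2 de3)"]) auto
qed

definition cusp_chart :: "real => real => real * real => 'a sym" where
 "cusp_chart t de = two {t - de<..<t} (g (t - de/2)) {t<..<t + de} (g (t + de/2))"

end

section \<open>Columns and local shadows at cusps\<close>

context plane_front
begin

text \<open>\<open>sig\<close> is the direction in which the cusp opens: near \<open>t0\<close> the
  function \<open>x * sig\<close> has a strict minimum at the cusp, so columns on that side meet
  both branches and the others neither.\<close>

lemma cusp_columns:
 assumes c: "x' t0 = 0" and d0: "0 < de" and sg: "sig = (if rcusp t0 then -1 else 1)"
  and L: "!!s. t0 - de < s ==> s < t0 ==> x' s * sig < 0" and R: "!!s. t0 < s ==> s < t0 + de ==> 0 < x' s * sig"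
 shows "!!r. \<bar>r - t0\<bar> < de ==> r ~= t0 ==> 0 < (x r - x t0) * sig"
  and "EX e>0. ALL xi. 0 < (xi - x t0) * sig & \<bar>xi - x t0\<bar> < e --> (EX s. t0 - de < s & s < t0 & x s = xi) & (EX t. t0 < t & t < t0 + de & x t = xi)"
proof -
 define f where "f r = x r * sig" for r
 have df: "(f has_real_derivative x' r * sig) (at r)" for r unfolding f_def by (rule DERIV_cmult_right[OF dx])
 have cf: "isCont f r" for r using df DERIV_isCont by blast
 have 1: "f t0 < f r" if r: "\<bar>r - t0\<bar> < de" "r ~= t0" for r proof (cases "r < t0")
  case True
  show ?thesis proof (rule DERIV_neg_imp_decreasing_open[OF True])
   fix a assume "r < a" "a < t0"
   thus "EX y. (f has_real_derivative y) (at a) & y < 0" using df L[of a] r by (intro exI[of _ "x' a * sig"]) (auto simp: abs_less_iff)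
  qed (use cf in "auto intro!: continuous_at_imp_continuous_on")
 next
  case False
  hence "t0 < r" using r by simp
  thus ?thesis proof (rule DERIV_pos_imp_increasing_open)
   fix a assume "t0 < a" "a < r"
   thus "EX y. (f has_real_derivative y) (at a) & 0 < y" using df R[of a] r by (intro exI[of _ "x' a * sig"]) (auto simp: abs_less_iff)
  qed (use cf in "auto intro!: continuous_at_imp_continuous_on")
 qed
 show "0 < (x r - x t0) * sig" if "\<bar>r - t0\<bar> < de" "r ~= t0" for r using 1[OF that] by (simp add: f_def algebra_simps)
 have sig: "sig * sig = 1" "\<bar>sig\<bar> = 1" using sg by auto
 define e where "e = min (f (t0 - de/2) - f t0) (f (t0 + de/2) - f t0)"
 have e: "e > 0" using 1[of "t0 - de/2"] 1[of "t0 + de/2"] d0 by (auto simp: e_def)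
 have "(EX s. t0 - de < s & s < t0 & x s = xi) & (EX t. t0 < t & t < t0 + de & x t = xi)"
  if xi: "0 < (xi - x t0) * sig" "\<bar>xi - x t0\<bar> < e" for xi proof -
  have lt: "f t0 < xi * sig" using xi(1) by (simp add: f_def algebra_simps)
  have "(xi - x t0) * sig < e" using xi sig(2) by (metis abs_ge_self abs_mult le_less_trans mult.right_neutral)
  hence gt: "xi * sig < f (t0 - de/2)" "xi * sig < f (t0 + de/2)" by (auto simp: e_def f_def algebra_simps)
  have bk: "x r = xi" if "f r = xi * sig" for r using that sg by (auto simp: f_def split: if_splits)
  obtain s where s: "t0 - de/2 <= s" "s <= t0" "f s = xi * sig" using IVT2[of f t0 "xi * sig" "t0 - de/2"] lt gt d0 cf by auto
  obtain t where t: "t0 <= t" "t <= t0 + de/2" "f t = xi * sig" using IVT[of f t0 "xi * sig" "t0 + de/2"] lt gt d0 cf by auto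
  have "s ~= t0" "t ~= t0" using s(3) t(3) lt by auto
  thus ?thesis using s t d0 bk by (intro conjI exI[of _ s] exI[of _ t]) auto
 qed
 thus "EX e>0. ALL xi. 0 < (xi - x t0) * sig & \<bar>xi - x t0\<bar> < e --> (EX s. t0 - de < s & s < t0 & x s = xi) & (EX t. t0 < t & t < t0 + de & x t = xi)"
  using e by blast
qed

end

context coloring
begin

text \<open>\<open>act\<close> does not see the twist \<open>iota\<close>, and the two branches run
  in opposite directions, so their jumps cancel.\<close>

lemma cusp_rel:
 assumes "x' t0 = 0" "good t0 de" "t0 - de < s" "s < t0" "t0 < t" "t < t0 + de" "(x' s > 0) ~= (x' t > 0)" shows "g s + g t = 0" proof -
 have nb: "~ brk s" "~ brk t" using good_left(4)[OF assms(2-4), of s] good_right(4)[OF assms(2) assms(5,6), of t] assms by auto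
 have "act R (cf s) = act R (cf t)" using cusp_color[OF assms(1-6)] act_iota[OF rackR cf_closed[OF nb(2)]] by (auto split: if_splits)
 thus ?thesis using assms(7) by (auto simp: gsym_def)
qed

lemma chart_cusp:
 assumes c: "x' t0 = 0" shows "EX de0>0. ALL de. 0 < de & de <= de0 --> (EX Q. chart (D t0) Q (cusp_chart t0 de))" proof -
 define sig :: real where "sig = (if rcusp t0 then -1 else 1)"
 obtain de1 where de1: "de1 > 0"
  "!!s. t0 - de1 < s ==> s < t0 ==> (x' s > 0 \<longleftrightarrow> rcusp t0) & (x' s < 0 \<longleftrightarrow> ~ rcusp t0)"
  "!!s. t0 < s ==> s < t0 + de1 ==> (x' s < 0 \<longleftrightarrow> rcusp t0) & (x' s > 0 \<longleftrightarrow> ~ rcusp t0)"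
  using cusp_structure[OF c] by blast
 obtain de2 where de2: "de2 > 0" "!!de. 0 < de ==> de <= de2 ==> good t0 de" using good_exists by blast
 have "EX Q. chart (D t0) Q (cusp_chart t0 de)" if d: "0 < de" "de <= min de1 de2" for de proof -
  have G: "good t0 de" using de2(2) d by auto
  have sgn: "x' s * sig < 0" if "t0 - de < s" "s < t0" for s using de1(2)[of s] that d by (auto simp: sig_def)
  have sgn': "0 < x' s * sig" if "t0 < s" "s < t0 + de" for s using de1(3)[of s] that d by (auto simp: sig_def)
  define JL JR where "JL = {t0 - de<..<t0}" and "JR = {t0<..<t0 + de}"
  have JL: "branch JL" and JR: "branch JR" using good_branch(1,2)[OF G] by (auto simp: JL_def JR_def)
  let ?A = "g (t0 - de/2)" and ?B = "g (t0 + de/2)" and ?h = "cusp_chart t0 de"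
  have h: "?h q = (if below JL q then ?A else 0) + (if below JR q then ?B else 0)" for q by (simp add: cusp_chart_def two_def JL_def JR_def)
  have AB: "?A + ?B = 0" proof (rule cusp_rel[OF c G])
   show "(0 < x' (t0 - de/2)) ~= (0 < x' (t0 + de/2))" using sgn[of "t0 - de/2"] sgn'[of "t0 + de/2"] d(1) by (auto simp: sig_def split: if_splits)
  qed (use d in auto)
  hence BA: "?B + ?A = 0" by (metis add.inverse_unique left_minus minus_minus)
  note cols = cusp_columns[OF c _ sig_def]
  have side: "0 < (x r - x t0) * sig" if "\<bar>r - t0\<bar> < de" "r ~= t0" for r by (rule cols(1)[OF d(1) sgn sgn' that])
  obtain e0 where e0: "e0 > 0" "!!xi. 0 < (xi - x t0) * sig ==> \<bar>xi - x t0\<bar> < e0 ==> (EX s:JL. x s = xi) & (EX t:JR. x t = xi)"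
   using cols(2)[OF d(1) sgn sgn'] unfolding JL_def JR_def by fastforce
  have "EX k. r + of_int k:{t0 - de<..<t0 + de}" if r: "D r = D t0" for r proof -
   from D_eq[OF r] obtain k where "r = t0 + of_int k" using dp_x' c by blast
   thus ?thesis using d(1) by (intro exI[of _ "- k"]) auto
  qed
  then obtain Q1 where Q1: "open Q1" "D t0:Q1" "ALL t. D t:Q1 --> (EX k. t + of_int k:{t0 - de<..<t0 + de})"
   using nearby[of "{t0 - de<..<t0 + de}" "D t0"] by auto
  define Q2 where "Q2 = {p :: real * real. \<bar>fst p - x t0\<bar> < e0}"
  have Q2: "open Q2" "D t0:Q2" unfolding Q2_def using e0(1) by (auto simp: D_def intro!: open_Collect_less continuous_intros)
  have "adm ?h p" if p: "p:Q1" "p:Q2" "p ~: sing" for p proof (cases "0 < (fst p - x t0) * sig")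
   case True
   then obtain s t where s: "s:JL" "x s = fst p" and t: "t:JR" "x t = fst p" using e0(2) p(2) unfolding Q2_def by blast
   have st: "s < t" "t < s + 1" using s t G by (auto simp: JL_def JR_def good_def)
   have zne: "z s ~= z t" if "snd p = z s | snd p = z t" proof
    assume e: "z s = z t"
    hence "D s = D t" "p = D t" using that s(2) t(2) by (auto simp: D_def prod_eq_iff)
    then obtain k where "s = t + of_int k" using regD(3)[of t s] p(3) by auto
    with st have "of_int k < (0::real)" "-1 < (of_int k :: real)" by auto
    thus False by simp
   qed
   show ?thesis proof (cases "p:range D")
    case False
    have zz: "z s ~= snd p" "z t ~= snd p" using False s t off_D by blast+
    have "\<forall>\<^sub>F q in nhds p. ?h q = ?h p" using below_local[OF JL s zz(1)] below_local[OF JR t zz(2)] unfolding h by eventually_elim simp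
    thus ?thesis using False by (auto simp: adm_def)
   next
    case True
    then obtain r0 where r0: "p = D r0" by blast
    then obtain k where "r0 + of_int k:{t0 - de<..<t0 + de}" using Q1(3) p(1) by blast
    moreover have "p = D (r0 + of_int k)" using r0 by (simp add: per)
    ultimately obtain r where r: "p = D r" "r:{t0 - de<..<t0 + de}" by blast
    have "r ~= t0" using r p(3) singI(1) c by auto
    hence "r:JL | r:JR" using r by (auto simp: JL_def JR_def)
    hence "r = s | r = t" using r s t branch_inj[OF JL, of r s] branch_inj[OF JR, of r t] by (auto simp: D_def)
    thus ?thesis proof
     assume rs: "r = s"
     hence "z t ~= snd p" using zne r by (auto simp: D_def)
     hence ev: "\<forall>\<^sub>F q in nhds p. below JR q = below JR p" by (rule below_local[OF JR t])
     have nb: "~ below JL p" using below_D[OF JL] s(1) r rs by simp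
     have gs: "g s = ?A" using good_left(3)[OF G, of s "t0 - de/2"] s(1) d(1) by (auto simp: JL_def)
     have "\<forall>\<^sub>F q in nhds p. ?h q = ?h p + (if below JL q then g s else 0)" using ev by eventually_elim (simp add: h nb gs AB BA)
     thus ?thesis using adm_on_D[OF _ JL s(1)] p(3) r rs by simp
    next
     assume rt: "r = t"
     hence "z s ~= snd p" using zne r by (auto simp: D_def)
     hence ev: "\<forall>\<^sub>F q in nhds p. below JL q = below JL p" by (rule below_local[OF JL s])
     have nb: "~ below JR p" using below_D[OF JR] t(1) r rt by simp
     have gt: "g t = ?B" using good_right(3)[OF G, of t "t0 + de/2"] t(1) d(1) by (auto simp: JR_def)
     have "\<forall>\<^sub>F q in nhds p. ?h q = ?h p + (if below JR q then g t else 0)" using ev by eventually_elim (simp add: h nb gt)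
     thus ?thesis using adm_on_D[OF _ JR t(1)] p(3) r rt by simp
    qed
   qed
  next
   case False
   \<comment> \<open>On the empty side, and on the column of the cusp itself, neither open branch is
     met.\<close>
   have no_col: "?h q = 0" if "~ 0 < (fst q - x t0) * sig" for q proof -
    have "x r ~= fst q" if "r:JL Un JR" for r using side[of r] that \<open>~ 0 < (fst q - x t0) * sig\<close> by (auto simp: JL_def JR_def abs_less_iff)
    hence "~ below JL q" "~ below JR q" by (auto simp: below_def)
    thus ?thesis by (simp add: h)
   qed
   have notD: "p ~: range D" proof
    assume "p:range D"
    then obtain r0 where r0: "p = D r0" by blast
    then obtain k where "r0 + of_int k:{t0 - de<..<t0 + de}" using Q1(3) p(1) by blast
    moreover have "p = D (r0 + of_int k)" using r0 by (simp add: per)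
    ultimately obtain r where r: "p = D r" "r:{t0 - de<..<t0 + de}" by blast
    hence "r ~= t0" using p(3) singI(1) c by auto
    thus False using side[of r] r False by (auto simp: D_def abs_less_iff)
   qed
   have "\<forall>\<^sub>F q in nhds p. ?h q = 0" proof (cases "fst p = x t0")
    \<comment> \<open>Here \<open>p\<close> is straight above or below the cusp. Near
      \<open>p\<close> both branches lie on the same side of the level \<open>m\<close>, and their
      jumps cancel.\<close>
    case True
    have "snd p ~= z t0" using off_D[OF notD, of t0] True by simp
    define m where "m = (snd p + z t0) / 2"
    have "EX d'>0. ALL r. \<bar>r - t0\<bar> < d' --> (if snd p < z t0 then m < z r else z r < m)" proof (cases "snd p < z t0")
     case True
     hence "open {r. m < z r}" "t0:{r. m < z r}" using contz[of UNIV] by (auto simp: m_def intro!: open_Collect_less continuous_intros)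
     thus ?thesis using True unfolding open_dist dist_real_def by auto
    next
     case False
     hence "open {r. z r < m}" "t0:{r. z r < m}" using contz[of UNIV] \<open>snd p ~= z t0\<close> by (auto simp: m_def intro!: open_Collect_less continuous_intros)
     thus ?thesis using False unfolding open_dist dist_real_def by auto
    qed
    then obtain d' where d': "d' > 0" "!!r. \<bar>r - t0\<bar> < d' ==> (if snd p < z t0 then m < z r else z r < m)" by blast
    define d'' where "d'' = min d' de"
    have d''0: "d'' > 0" using d' d by (simp add: d''_def)
    obtain e1 where e1: "e1 > 0" "!!xi. 0 < (xi - x t0) * sig ==> \<bar>xi - x t0\<bar> < e1 ==> (EX s. t0 - d'' < s & s < t0 & x s = xi) & (EX t. t0 < t & t < t0 + d'' & x t = xi)"
     using cols(2)[OF d''0] sgn sgn' by (force simp: d''_def)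
    have "open {q :: real * real. \<bar>fst q - x t0\<bar> < e1 & (if snd p < z t0 then snd q < m else m < snd q)}"
     by (cases "snd p < z t0") (auto intro!: open_Collect_conj open_Collect_less continuous_intros)
    moreover have "p:{q. \<bar>fst q - x t0\<bar> < e1 & (if snd p < z t0 then snd q < m else m < snd q)}"
     using True e1(1) \<open>snd p ~= z t0\<close> by (auto simp: m_def)
    ultimately have "\<forall>\<^sub>F q in nhds p. q:{q. \<bar>fst q - x t0\<bar> < e1 & (if snd p < z t0 then snd q < m else m < snd q)}"
     by (rule eventually_nhds_in_open)
    thus ?thesis proof eventually_elim
     case (elim q)
     show ?case proof (cases "0 < (fst q - x t0) * sig")
      case True
      then obtain s t where s: "t0 - d'' < s" "s < t0" "x s = fst q" and t: "t0 < t" "t < t0 + d''" "x t = fst q" using e1(2) elim by blast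
      have "s:JL" "t:JR" using s t by (auto simp: JL_def JR_def d''_def)
      hence "below JL q \<longleftrightarrow> snd q < z s" "below JR q \<longleftrightarrow> snd q < z t"
       using below_at[OF JL, of s q] below_at[OF JR, of t q] s t by auto
      moreover have "if snd p < z t0 then m < z s else z s < m" "if snd p < z t0 then m < z t else z t < m"
       using d'(2)[of s] d'(2)[of t] s t by (auto simp: d''_def abs_less_iff)
      ultimately have "below JL q = below JR q" using elim by (auto split: if_splits)
      thus ?thesis using AB by (simp add: h)
     qed (rule no_col)
    qed
   next
    case False
    hence "(fst p - x t0) * sig < 0" using \<open>~ 0 < (fst p - x t0) * sig\<close> by (auto simp: sig_def split: if_splits)
    moreover have "open {q :: real * real. (fst q - x t0) * sig < 0}" by (intro open_Collect_less continuous_intros)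
    ultimately have "\<forall>\<^sub>F q in nhds p. q:{q. (fst q - x t0) * sig < 0}" by (intro eventually_nhds_in_open) auto
    thus ?thesis by eventually_elim (rule no_col, simp)
   qed
   hence "\<forall>\<^sub>F q in nhds p. ?h q = ?h p" using no_col[OF False] by simp
   thus ?thesis using notD by (auto simp: adm_def)
  qed
  hence "chart (D t0) (Q1 Int Q2 Int - (sing - {D t0})) ?h" by (intro chartI) (use Q1 Q2 g_autos in "auto simp: h autos_closed")
  thus ?thesis by blast
 qed
 thus ?thesis using de1(1) de2(1) by (intro exI[of _ "min de1 de2"]) auto
qed

end

section \<open>The global shadow of a colouring\<close>

context coloring
begin

lemma interval_shift: "{a + of_int k<..<b + of_int k} = (%r. r + of_int k) ` {a<..<b :: real}" by (auto intro!: image_eqI[where x = "_ - of_int k"])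

lemma cross_chart_shift: "cross_chart (s + of_int k) (t + of_int l) de = cross_chart s t de" proof -
 have e: "{t + of_int l - de<..<t + of_int l + de} = {t - de + of_int l<..<t + de + of_int l}"
  "{s + of_int k - de<..<s + of_int k + de} = {s - de + of_int k<..<s + de + of_int k}" by (auto simp: algebra_simps)
 have r: "rgt (t + of_int l) de = rgt t de + of_int l" by (auto simp: rgt_def per)
 show ?thesis unfolding cross_chart_def two_def e interval_shift below_shift r per_cf ..
qed

lemma cusp_chart_shift: "cusp_chart (t + of_int l) de = cusp_chart t de" proof -
 have e: "{t + of_int l - de<..<t + of_int l} = {t - de + of_int l<..<t + of_int l}"
  "{t + of_int l<..<t + of_int l + de} = {t + of_int l<..<t + de + of_int l}" by (auto simp: algebra_simps)
 have r: "t + of_int l - de / 2 = t - de / 2 + of_int l" "t + of_int l + de / 2 = t + de / 2 + of_int l" by auto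
 show ?thesis unfolding cusp_chart_def two_def e interval_shift below_shift r per_cf ..
qed

lemma over_unique:
 assumes "over s t" "over s' t'" "D t' = D t" shows "EX k l. s' = s + of_int k & t' = t + of_int l" proof -
 have d: "dp s t" "dp s' t'" "D s' = D t'" "D s = D t" "y s < y t" "y s' < y t'" using assms by (auto simp: over_def dp_def)
 have 1: "(EX k. s' = s + of_int k) | (EX k. s' = t + of_int k)" by (rule two_points[OF d(1)]) (use d assms in auto)
 have 2: "(EX k. t' = s + of_int k) | (EX k. t' = t + of_int k)" by (rule two_points[OF d(1)]) (use d assms in auto)
 have "~ (EX k. s' = t + of_int k)" proof
  assume "EX k. s' = t + of_int k"
  hence "y s' = y t" by (auto simp: per)
  hence "y t' ~= y s" "y t' ~= y t" using d(5,6) by auto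
  thus False using 2 by (auto simp: per)
 qed
 moreover have "~ (EX k. t' = s + of_int k)" proof
  assume "EX k. t' = s + of_int k"
  hence "y t' = y s" by (auto simp: per)
  hence "y s' ~= y s" "y s' ~= y t" using d(5,6) by auto
  thus False using 1 by (auto simp: per)
 qed
 ultimately show ?thesis using 1 2 by blast
qed

text \<open>At crossings and cusps the chart is the explicit one, for every choice of representative
  parameters. The colours just above the front will be read off from these formulas.\<close>

lemma chart_at:
 "EX Q h. chart P Q h & (ALL s t. over s t --> D t = P --> (EX de. good s de & good t de & h = cross_chart s t de)) &
  (ALL t. x' t = 0 --> D t = P --> (EX de. good t de & h = cusp_chart t de))" proof -
 have excl: False if "over s t" "x' r = 0" "D r = D t" for s t r proof -
  have "x' s ~= 0" "x' t ~= 0" "dp s t" using that(1) dp_x' by (auto simp: over_def)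
  thus False using two_points[of s t r] that(2,3) by (auto simp: per)
 qed
 consider (cr) s t where "over s t" "D t = P" | (cu) t where "x' t = 0" "D t = P" | (reg) t where "P = D t" "D t ~: sing" | (off) "P ~: range D"
 proof (cases "P:range D")
  case True
  then obtain t where t: "P = D t" by blast
  show ?thesis proof (cases "D t:sing")
   case True
   then consider r where "x' r = 0" "D r = D t" | r q where "dp q r" "D r = D t" unfolding sing_def by auto
   thus ?thesis proof cases
    case 1 thus ?thesis using cu t by simp
   next
    case 2
    hence "D q = P" "D r = P" using t by (auto simp: dp_def)
    thus ?thesis using dp_over[OF 2(1)] cr by blast
   qed
  qed (use reg t in blast)
 qed (use off in blast)
 thus ?thesis proof cases
  case cr
  obtain de1 where de1: "de1 > 0" "ALL de. 0 < de & de <= de1 --> (EX Q. chart (D t) Q (cross_chart s t de))" using chart_cross[OF cr(1)] by blast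
  obtain de2 where de2: "de2 > 0" "ALL de. 0 < de & de <= de2 --> good s de" using good_exists by blast
  obtain de3 where de3: "de3 > 0" "ALL de. 0 < de & de <= de3 --> good t de" using good_exists by blast
  define de where "de = min de1 (min de2 de3)"
  have de: "0 < de" "good s de" "good t de" using de1 de2 de3 by (auto simp: de_def)
  have "de <= de1" by (simp add: de_def)
  then obtain Q where Q: "chart (D t) Q (cross_chart s t de)" using de1(2) de(1) by blast
  have "EX de. good s' de & good t' de & cross_chart s t de' = cross_chart s' t' de" if o: "over s' t'" "D t' = P" "de' = de" for s' t' de' proof -
   obtain k l where kl: "s' = s + of_int k" "t' = t + of_int l" using over_unique[OF cr(1) o(1)] cr o by auto
   show ?thesis unfolding kl cross_chart_shift good_shift o(3) using de by blast
  qed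
  moreover have "x' r = 0 ==> D r = P ==> False" for r using excl[OF cr(1), of r] cr by simp
  ultimately show ?thesis using Q cr(2) by blast
 next
  case cu
  obtain de1 where de1: "de1 > 0" "ALL de. 0 < de & de <= de1 --> (EX Q. chart (D t) Q (cusp_chart t de))" using chart_cusp[OF cu(1)] by blast
  obtain de3 where de3: "de3 > 0" "ALL de. 0 < de & de <= de3 --> good t de" using good_exists by blast
  define de where "de = min de1 de3"
  have de: "0 < de" "good t de" using de1 de3 by (auto simp: de_def)
  have "de <= de1" by (simp add: de_def)
  then obtain Q where Q: "chart (D t) Q (cusp_chart t de)" using de1(2) de(1) by blast
  have "EX de. good t' de & cusp_chart t de' = cusp_chart t' de" if o: "x' t' = 0" "D t' = P" "de' = de" for t' de' proof -
   obtain l where kl: "t' = t + of_int l" using D_eq[of t' t] cu o dp_x' by auto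
   show ?thesis unfolding kl cusp_chart_shift good_shift o(3) using de by blast
  qed
  moreover have "over s' t' ==> D t' = P ==> False" for s' t' using excl[of s' t' t] cu by simp
  ultimately show ?thesis using Q cu(2) by blast
 next
  case reg
  obtain Q h where "chart (D t) Q h" using chart_regular[OF reg(2)] by blast
  moreover have "~ (over s' t' & D t' = P)" "~ (x' t' = 0 & D t' = P)" for s' t' using reg singI(1)[of t'] singI(2)[of s' t'] by (auto simp: over_def)
  ultimately show ?thesis unfolding reg(1) by blast
 next
  case off
  thus ?thesis using chart_empty by blast
 qed
qed

text \<open>Wherever two local shadows meet, they have the same increments, so they form a cocycle.
  Over a square that contains the front this cocycle has a primitive, and the primitive is the
  shadow.\<close>

lemma shadow:
 "EX sh. (ALL p. sh p:autos R) & (ALL p. p ~: sing --> adm sh p) &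
  (ALL s t. over s t --> (EX de c. good s de & good t de & (\<forall>\<^sub>F q in nhds (D t). sh q = c + cross_chart s t de q))) &
  (ALL t. x' t = 0 --> (EX de c. good t de & (\<forall>\<^sub>F q in nhds (D t). sh q = c + cusp_chart t de q)))" proof -
 obtain Q h where Qh: "!!P. chart P (Q P) (h P)"
  and hc: "!!s t. over s t ==> EX de. good s de & good t de & h (D t) = cross_chart s t de"
  and hu: "!!t. x' t = 0 ==> EX de. good t de & h (D t) = cusp_chart t de" using chart_at by metis
 interpret C: cocycle UNIV Q "%P p q. - h P p + h P q" "autos R" proof
  fix i j p assume p: "p:Q i" "p:Q j"
  show "\<forall>\<^sub>F q in nhds p. - h i p + h i q = - h j p + h j q" proof (cases "p:sing")
   \<comment> \<open>A chart contains no singular point except its centre, so both charts are the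
     one at \<open>p\<close>.\<close>
   case True
   hence "i = j" using p Qh[of i] Qh[of j] unfolding chart_def by metis
   thus ?thesis by simp
  next
   case False
   hence a: "adm (h i) p" "adm (h j) p" using p Qh unfolding chart_def by auto
   show ?thesis proof (cases "p:range D")
    case True
    then obtain t where t: "p = D t" by blast
    obtain de where de: "good t de" using good_exists by blast
    define J where "J = {t - de<..<t + de}"
    have J: "branch J" "t:J" using good_branch(3)[OF de regD(1)] False t de by (auto simp: J_def good_def)
    have "\<forall>\<^sub>F q in nhds p. h i q = h i p + (if below J q then g t else 0)"
     "\<forall>\<^sub>F q in nhds p. h j q = h j p + (if below J q then g t else 0)" using a t J unfolding adm_def by blast+
    thus ?thesis by eventually_elim (simp add: add.assoc[symmetric])
   next
    case False
    hence "\<forall>\<^sub>F q in nhds p. h i q = h i p" "\<forall>\<^sub>F q in nhds p. h j q = h j p" using a unfolding adm_def by auto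
    thus ?thesis by eventually_elim simp
   qed
  qed
 next
  show "open (Q i)" for i using Qh by (simp add: chart_def)
  show "- h i p + h i q:autos R" for i p q using Qh[of i] unfolding chart_def by (intro autos_closed(2) autos_uminus[OF rackR]) blast+
 qed (simp_all add: add.assoc autos_closed autos_uminus[OF rackR])
 obtain M where M: "!!t. norm (D t) <= M" proof -
  have "bounded (D ` {0..1})" by (intro compact_imp_bounded compact_continuous_image contD) auto
  then obtain M where M: "ALL p:D ` {0..1}. norm p <= M" unfolding bounded_iff by blast
  have "norm (D t) <= M" for t proof -
   obtain s k where "s:{0..1}" "t = s + of_int k" using reduce[of t] by blast
   thus ?thesis using M by (simp add: per)
  qed
  thus ?thesis using that by blast
 qed
 have M0: "M >= 0" using M[of 0] norm_ge_zero order_trans by blast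
 have xzM: "\<bar>x t\<bar> <= M" "\<bar>z t\<bar> <= M" for t
  using M[of t] norm_fst_le[of "x t" "z t"] norm_snd_le[of "z t" "x t"] by (auto simp: D_def)
 let ?S = "{-(M+1)..M+1} \<times> {-(M+1)..M+1}"
 obtain l where l: "C.primitive ?S (%p. p) l" using C.primitive_rectangle[of "-(M+1)" "M+1" "-(M+1)" "M+1" "%p. p"] M0 Qh by (auto simp: chart_def)
 \<comment> \<open>Clamping to the square, whose margin 1 keeps the boundary off the front.
   Composition with it extends the primitive to the plane without creating jumps.\<close>
 define cl where "cl p = (max (-(M+1)) (min (M+1) (fst p)), max (-(M+1)) (min (M+1) (snd p)))" for p :: "real * real"
 have cl_S: "cl p:?S" for p using M0 by (auto simp: cl_def)
 have cl_id: "cl p = p" if "p:?S" for p using that by (auto simp: cl_def)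
 have cl_cont: "continuous_on UNIV cl" unfolding cl_def by (intro continuous_intros)
 define sh where "sh p = l (cl p)" for p
 have local: "\<forall>\<^sub>F q in nhds p. sh q = sh p + (- h (cl p) (cl p) + h (cl p) (cl q))" for p proof -
  have "\<forall>\<^sub>F q in at (cl p) within ?S. l q = l (cl p) + (- h (cl p) (cl p) + h (cl p) q)"
   using l cl_S Qh unfolding C.primitive_def chart_def by blast
  hence "\<forall>\<^sub>F q in nhds (cl p). q:?S --> l q = l (cl p) + (- h (cl p) (cl p) + h (cl p) q)"
   unfolding eventually_at_filter by (rule eventually_mono) (metis add.right_neutral left_minus)
  moreover have "(cl \<longlongrightarrow> cl p) (nhds p)"
   using cl_cont by (metis UNIV_I continuous_on_eq_continuous_at isContD open_UNIV tendsto_at_iff_tendsto_nhds)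
  ultimately have "\<forall>\<^sub>F q in nhds p. cl q:?S --> l (cl q) = l (cl p) + (- h (cl p) (cl p) + h (cl p) (cl q))"
   by (rule eventually_compose_filterlim)
  thus ?thesis unfolding sh_def by (rule eventually_mono) (use cl_S in blast)
 qed
 have inner: "\<forall>\<^sub>F q in nhds p. cl q = q" "cl p = p" if "p:range D" for p proof -
  have "p:{-(M+1)<..<M+1} \<times> {-(M+1)<..<M+1}" using that xzM by (auto simp: D_def) (smt (verit))+
  moreover have "open ({-(M+1)<..<M+1} \<times> {-(M+1)<..<M+1})" by (intro open_Times) auto
  ultimately have "\<forall>\<^sub>F q in nhds p. q:{-(M+1)<..<M+1} \<times> {-(M+1)<..<M+1}" by (intro eventually_nhds_in_open)
  thus ev: "\<forall>\<^sub>F q in nhds p. cl q = q" by (rule eventually_mono) (rule cl_id, auto)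
  show "cl p = p" using eventually_nhds_x_imp_x[OF ev] .
 qed
 have local_D: "\<forall>\<^sub>F q in nhds p. sh q = sh p + (- h p p + h p q)" if "p:range D" for p
  using local[of p] inner(1)[OF that] by eventually_elim (use inner(2)[OF that] in simp)
 have "adm sh p" if p: "p ~: sing" for p unfolding adm_def proof (intro conjI impI allI)
  assume off: "p ~: range D"
  have off': "cl p ~: range D" proof
   assume a: "cl p:range D"
   hence "\<bar>fst (cl p)\<bar> <= M" "\<bar>snd (cl p)\<bar> <= M" using xzM by (auto simp: D_def)
   hence "cl p = p" by (auto simp: cl_def prod_eq_iff)
   thus False using a off by simp
  qed
  hence "cl p ~: sing" using sing_range by blast
  hence "\<forall>\<^sub>F q in nhds (cl p). h (cl p) q = h (cl p) (cl p)" using Qh[of "cl p"] off' unfolding chart_def adm_def by blast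
  moreover have "(cl \<longlongrightarrow> cl p) (nhds p)"
   using cl_cont by (metis UNIV_I continuous_on_eq_continuous_at isContD open_UNIV tendsto_at_iff_tendsto_nhds)
  ultimately have "\<forall>\<^sub>F q in nhds p. h (cl p) (cl q) = h (cl p) (cl p)" by (rule eventually_compose_filterlim)
  with local[of p] show "\<forall>\<^sub>F q in nhds p. sh q = sh p" by eventually_elim simp
 next
  fix t J assume t: "p = D t" "branch J" "t:J"
  have "adm (h p) p" using Qh[of p] p unfolding chart_def by blast
  hence "\<forall>\<^sub>F q in nhds p. h p q = h p p + (if below J q then g t else 0)" using t unfolding adm_def by blast
  moreover have "\<forall>\<^sub>F q in nhds p. sh q = sh p + (- h p p + h p q)" using local_D t(1) by blast
  ultimately show "\<forall>\<^sub>F q in nhds p. sh q = sh p + (if below J q then g t else 0)" by eventually_elim (simp add: add.assoc[symmetric])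
 qed
 moreover have "sh p:autos R" for p proof -
  have "l ` ?S <= autos R" using l unfolding C.primitive_def by (elim conjE)
  thus ?thesis unfolding sh_def using cl_S[of p] by (rule subsetD[OF _ imageI])
 qed
 moreover have c: "EX c. \<forall>\<^sub>F q in nhds (D t). sh q = c + h (D t) q" for t proof (rule exI[of _ "sh (D t) - h (D t) (D t)"])
  show "\<forall>\<^sub>F q in nhds (D t). sh q = (sh (D t) - h (D t) (D t)) + h (D t) q"
   using local_D[OF rangeI] by (rule eventually_mono) (simp add: add.assoc[symmetric])
 qed
 moreover have "EX de c. good s de & good t de & (\<forall>\<^sub>F q in nhds (D t). sh q = c + cross_chart s t de q)" if ov: "over s t" for s t
 proof -
  obtain de where de: "good s de" "good t de" "h (D t) = cross_chart s t de" using hc[OF ov] by blast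
  obtain c where "\<forall>\<^sub>F q in nhds (D t). sh q = c + h (D t) q" using c by blast
  thus ?thesis using de by (intro exI[of _ de] exI[of _ c]) simp
 qed
 moreover have "EX de c. good t de & (\<forall>\<^sub>F q in nhds (D t). sh q = c + cusp_chart t de q)" if x0: "x' t = 0" for t proof -
  obtain de where de: "good t de" "h (D t) = cusp_chart t de" using hu[OF x0] by blast
  obtain c where "\<forall>\<^sub>F q in nhds (D t). sh q = c + h (D t) q" using c by blast
  thus ?thesis using de by (intro exI[of _ de] exI[of _ c]) simp
 qed
 ultimately show ?thesis by (intro exI[of _ sh] conjI allI impI)
qed

end

section \<open>The regions in front of and behind the knot\<close>

context plane_front
begin

abbreviation pl :: "p3 => real * real" where "pl p \<equiv> (fst p, snd (snd p))"
abbreviation py3 :: "p3 => real" where "py3 p \<equiv> fst (snd p)"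

text \<open>The viewer is at \<open>y = - \<infinity>\<close>: \<open>Uf\<close> consists of the points that are not behind the knot,
  \<open>Ub\<close> of those that are not in front of it.\<close>

definition Uf :: "p3 set" where "Uf = {p. ALL t. D t = pl p --> py3 p < y t}"
definition Ub :: "p3 set" where "Ub = {p. ALL t. D t = pl p --> y t < py3 p}"

text \<open>Each set is the sum of a compact piece of the knot and a closed ray along the
  \<open>y\<close>-axis.\<close>

lemma closed_behind:
 assumes "compact C" shows "closed {p :: p3. EX t:C. D t = pl p & y t <= py3 p}" "closed {p :: p3. EX t:C. D t = pl p & py3 p <= y t}" proof -
 have c: "compact (K ` C)" by (intro compact_continuous_image contK assms)
 have cl: "closed ({0::real} \<times> {0::real..} \<times> {0::real})" "closed ({0::real} \<times> {..0::real} \<times> {0::real})"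
  by (intro closed_Times closed_atLeast closed_atMost closed_singleton)+
 have "{p :: p3. EX t:C. D t = pl p & y t <= py3 p} = (UN a:K ` C. UN b:{0} \<times> {0..} \<times> {0}. {a + b})" proof (intro equalityI subsetI)
  fix p assume "p:{p :: p3. EX t:C. D t = pl p & y t <= py3 p}"
  then obtain t where t: "t:C" "D t = pl p" "y t <= py3 p" by blast
  hence "p = K t + (0, py3 p - y t, 0)" by (auto simp: K_def D_def prod_eq_iff)
  moreover have "(0, py3 p - y t, 0):{0::real} \<times> {0..} \<times> {0::real}" using t by simp
  ultimately show "p:(UN a:K ` C. UN b:{0} \<times> {0..} \<times> {0}. {a + b})" using t(1) by blast
 qed (auto simp: K_def D_def)
 thus "closed {p :: p3. EX t:C. D t = pl p & y t <= py3 p}" using compact_closed_sums[OF c cl(1)] by simp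
 have "{p :: p3. EX t:C. D t = pl p & py3 p <= y t} = (UN a:K ` C. UN b:{0} \<times> {..0} \<times> {0}. {a + b})" proof (intro equalityI subsetI)
  fix p assume "p:{p :: p3. EX t:C. D t = pl p & py3 p <= y t}"
  then obtain t where t: "t:C" "D t = pl p" "py3 p <= y t" by blast
  hence "p = K t + (0, py3 p - y t, 0)" by (auto simp: K_def D_def prod_eq_iff)
  moreover have "(0, py3 p - y t, 0):{0::real} \<times> {..0} \<times> {0::real}" using t by simp
  ultimately show "p:(UN a:K ` C. UN b:{0} \<times> {..0} \<times> {0}. {a + b})" using t(1) by blast
 qed (auto simp: K_def D_def)
 thus "closed {p :: p3. EX t:C. D t = pl p & py3 p <= y t}" using compact_closed_sums[OF c cl(2)] by simp
qed

lemma reduce_D: "(EX t. D t = P & Q (y t)) \<longleftrightarrow> (EX t:{0..1}. D t = P & Q (y t))" proof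
 assume "EX t. D t = P & Q (y t)"
 then obtain t where t: "D t = P" "Q (y t)" by blast
 obtain s k where "s:{0..1}" "t = s + of_int k" using reduce[of t] by blast
 thus "EX t:{0..1}. D t = P & Q (y t)" using t by (intro bexI[of _ s]) (auto simp: per)
qed blast

lemma open_Uf: "open Uf" and open_Ub: "open Ub" proof -
 have "- Uf = {p. EX t. D t = pl p & y t <= py3 p}" by (auto simp: Uf_def not_less)
 also have "... = {p. EX t:{0..1}. D t = pl p & y t <= py3 p}" by (intro Collect_cong reduce_D)
 finally have 1: "- Uf = {p. EX t:{0..1}. D t = pl p & y t <= py3 p}" .
 have "- Ub = {p. EX t. D t = pl p & py3 p <= y t}" by (auto simp: Ub_def not_less)
 also have "... = {p. EX t:{0..1}. D t = pl p & py3 p <= y t}" by (intro Collect_cong reduce_D)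
 finally have 2: "- Ub = {p. EX t:{0..1}. D t = pl p & py3 p <= y t}" .
 show "open Uf" unfolding open_closed 1 by (rule closed_behind) simp
 show "open Ub" unfolding open_closed 2 by (rule closed_behind) simp
qed

lemma Uf_cmpl: "Uf <= cmpl K" and Ub_cmpl: "Ub <= cmpl K" by (auto simp: Uf_def Ub_def cmpl_def K_def D_def)

end

section \<open>Holonomy of the knot complement\<close>

context coloring
begin

text \<open>A neighbourhood of the gap between the two branches over the crossing \<open>P\<close>,
  with the branch \<open>s\<close> in front. Moving there one passes behind \<open>s\<close> only,
  so the transition is the jump of \<open>s\<close>; the last two clauses match it with the trivial
  transition on \<open>Uf\<close> and with the shadow on \<open>Ub\<close>.\<close>

definition crossing_cell :: "real * real => p3 set => real => real => bool" where
 "crossing_cell P V s de \<longleftrightarrow> open V & V <= cmpl K &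
  (ALL p. pl p = P --> p:cmpl K --> p ~: Uf --> p ~: Ub --> p:V) &
  (ALL p:V. pl p:sing --> pl p = P) &
  (ALL p:V Int Uf. \<forall>\<^sub>F q in nhds (pl p). below {s - de<..<s + de} q = below {s - de<..<s + de} (pl p)) &
  (ALL p:V Int Ub. ALL sh. (ALL q. q ~: sing --> adm sh q) --> (\<forall>\<^sub>F q in nhds (pl p). - sh (pl p) + sh q =
    - (if below {s - de<..<s + de} (pl p) then g s else 0) + (if below {s - de<..<s + de} q then g s else 0)))"

lemma crossing_nbhd:
 assumes P: "EX s t. over s t & D t = P" shows "EX V s de. crossing_cell P V s de" proof -
 obtain s0 t0 where ov: "over s0 t0" and Pt: "D t0 = P" using P by blast
 have Ps: "D s0 = P" using ov Pt by (simp add: over_def dp_def)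
 obtain de1 where de1: "de1 > 0" "!!s t. \<bar>s - s0\<bar> < de1 ==> \<bar>t - t0\<bar> < de1 ==> x s = x t ==> y s < y t"
  using crossing_sides[OF ov] by blast
 obtain de2 where de2: "de2 > 0" "!!de. 0 < de ==> de <= de2 ==> good s0 de" using good_exists by blast
 obtain de3 where de3: "de3 > 0" "!!de. 0 < de ==> de <= de3 ==> good t0 de" using good_exists by blast
 have nz: "x' s0 ~= 0" "x' t0 ~= 0" using ov dp_x' by (auto simp: over_def)
 define de where "de = min de1 (min de2 de3)"
 have d: "de > 0" "good s0 de" "good t0 de" "de <= de1" using de1 de2 de3 by (auto simp: de_def)
 define Js Jt where "Js = {s0 - de<..<s0 + de}" and "Jt = {t0 - de<..<t0 + de}"
 have Js: "branch Js" "s0:Js" and Jt: "branch Jt" "t0:Jt"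
  using good_branch(3)[OF d(2) nz(1)] good_branch(3)[OF d(3) nz(2)] d by (auto simp: Js_def Jt_def)
 \<comment> \<open>Closed arcs of half the size are compact, which makes the sets removed from
   \<open>V\<close> closed.\<close>
 define Cs Ct where "Cs = {s0 - de/2..s0 + de/2}" and "Ct = {t0 - de/2..t0 + de/2}"
 have Cs: "compact Cs" "Cs <= Js" "s0:Cs" and Ct: "compact Ct" "Ct <= Jt" "t0:Ct" using d(1) by (auto simp: Cs_def Ct_def Js_def Jt_def)
 have near: "EX k. r + of_int k:{s0 - de/2<..<s0 + de/2} Un {t0 - de/2<..<t0 + de/2}" if r: "D r = P" for r proof -
  from two_points[of s0 t0 r] ov r Pt obtain k where "r = s0 + of_int k | r = t0 + of_int k" by (auto simp: over_def)
  thus ?thesis using d(1) by (intro exI[of _ "- k"]) auto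
 qed
 obtain Q1 where Q1: "open Q1" "P:Q1" "ALL t. D t:Q1 --> (EX k. t + of_int k:{s0 - de/2<..<s0 + de/2} Un {t0 - de/2<..<t0 + de/2})"
  using nearby[OF open_Un[OF open_greaterThanLessThan open_greaterThanLessThan] near] by blast
 have Q1': "EX k. t + of_int k:Cs Un Ct" if tq: "D t:Q1" for t proof -
  obtain k where "t + of_int k:{s0 - de/2<..<s0 + de/2} Un {t0 - de/2<..<t0 + de/2}" using Q1(3) tq by blast
  thus ?thesis unfolding Cs_def Ct_def by (intro exI[of _ k]) auto
 qed
 obtain Q2 where Q2: "open Q2" "P:Q2" "ALL p:Q2. EX s:Js. x s = fst p" using column_nbhd[OF Js, of P] Ps by (auto simp: D_def)
 define Q where "Q = Q1 Int Q2 Int - (sing - {P})"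
 have Q: "open Q" "P:Q" unfolding Q_def using Q1 Q2 by (auto intro!: open_Int sing_nbhd(1)[of P] simp del: Diff_insert Compl_Diff_eq)
 have st: "y s < y t" if "s:Js" "t:Jt" "x s = x t" for s t using de1(2)[of s t] that d(4) by (auto simp: Js_def Jt_def abs_less_iff)
 have inJs: "r:Cs" if rj: "r:Js" "D r:Q1" for r proof -
  obtain k where k: "r + of_int k:Cs Un Ct" using Q1' rj(2) by blast
  have "r + of_int k ~: Ct" proof
   assume "r + of_int k:Ct"
   hence "y r < y (r + of_int k)" using st[OF rj(1), of "r + of_int k"] Ct(2) by (auto simp: per)
   thus False by (simp add: per)
  qed
  hence "r + of_int k:Cs" using k by simp
  moreover from this have "r + of_int k = r" using branch_inj[OF Js(1), of "r + of_int k" r] Cs(2) rj(1) by (auto simp: per)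
  ultimately show ?thesis by simp
 qed
 \<comment> \<open>Removed are the points that are not behind the arc of the over-branch and those
   that are not in front of the arc of the under-branch.\<close>
 define V where "V = (%p. pl p) -` Q Int (- {p. EX t:Cs. D t = pl p & py3 p <= y t}) Int (- {p. EX t:Ct. D t = pl p & y t <= py3 p})"
 have VQ: "pl p:Q1" "pl p:Q2" "pl p:- (sing - {P})" "~ (EX t:Cs. D t = pl p & py3 p <= y t)"
  "~ (EX t:Ct. D t = pl p & y t <= py3 p)" if "p:V" for p using that unfolding V_def Q_def by blast+
 have v1: "open V" unfolding V_def by (intro open_Int open_Compl closed_behind Cs(1) Ct(1) open_vimage Q(1) continuous_intros)
 have v2: "V <= cmpl K" proof
  fix p assume p: "p:V"
  show "p:cmpl K" proof (rule ccontr)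
   assume "p ~: cmpl K"
   then obtain r where r: "p = K r" by (auto simp: cmpl_def)
   hence Dr: "D r = pl p" "y r = py3 p" by (auto simp: D_def K_def)
   hence "D r:Q1" using VQ(1)[OF p] by simp
   then obtain k where k: "r + of_int k:Cs Un Ct" using Q1' by blast
   have "D (r + of_int k) = pl p" "y (r + of_int k) = py3 p" using Dr by (simp_all add: per)
   hence "(EX t:Cs. D t = pl p & py3 p <= y t) | (EX t:Ct. D t = pl p & y t <= py3 p)" using k by auto
   thus False using VQ(4,5)[OF p] by blast
  qed
 qed
 have v3: "p:V" if p: "pl p = P" "p:cmpl K" "p ~: Uf" "p ~: Ub" for p proof -
  obtain r1 where r1: "D r1 = P" "y r1 <= py3 p" using p(1,3) by (auto simp: Uf_def not_less)
  obtain r2 where r2: "D r2 = P" "py3 p <= y r2" using p(1,4) by (auto simp: Ub_def not_less)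
  have ne: "y r ~= py3 p" if "D r = P" for r proof
   assume "y r = py3 p"
   hence "K r = p" using that p(1) by (auto simp: K_def D_def prod_eq_iff)
   thus False using p(2) by (auto simp: cmpl_def)
  qed
  have lt: "y r1 < py3 p" "py3 p < y r2" using r1 r2 ne[OF r1(1)] ne[OF r2(1)] by auto
  have yy: "y r = y s0 | y r = y t0" if "D r = P" for r proof -
   have "(EX k. r = s0 + of_int k) | (EX k. r = t0 + of_int k)" by (rule two_points) (use ov that Pt in "simp_all add: over_def")
   thus ?thesis by (elim disjE exE) (simp_all add: per)
  qed
  have y1: "y r1 = y s0 | y r1 = y t0" and y2: "y r2 = y s0 | y r2 = y t0" using yy[OF r1(1)] yy[OF r2(1)] .
  have "y s0 < y t0" using ov by (simp add: over_def)
  hence ys: "y s0 < py3 p" "py3 p < y t0" using y1 y2 lt by auto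
  have rs: "r = s0" if "r:Cs" "D r = P" for r proof -
   have "D r = D s0" using that(2) Ps by simp
   hence "x r = x s0" by (simp add: D_def)
   thus ?thesis using branch_inj[OF Js(1) _ Js(2)] that(1) Cs(2) by blast
  qed
  have rt: "r = t0" if "r:Ct" "D r = P" for r proof -
   have "D r = D t0" using that(2) Pt by simp
   hence "x r = x t0" by (simp add: D_def)
   thus ?thesis using branch_inj[OF Jt(1) _ Jt(2)] that(1) Ct(2) by blast
  qed
  have "~ (EX t:Cs. D t = pl p & py3 p <= y t)" "~ (EX t:Ct. D t = pl p & y t <= py3 p)" using rs rt ys unfolding p(1) by fastforce+
  moreover have "pl p:Q" using p(1) Q(2) by simp
  ultimately show ?thesis unfolding V_def by blast
 qed
 have v4: "pl p = P" if "p:V" "pl p:sing" for p using that(2) VQ(3)[OF that(1)] by blast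
 have v5: "\<forall>\<^sub>F q in nhds (pl p). below Js q = below Js (pl p)" if p: "p:V Int Uf" for p proof -
  have pV: "p:V" using p by blast
  obtain r where r: "r:Js" "x r = fst (pl p)" using Q2(3) VQ(2)[OF pV] by blast
  have "z r ~= snd (pl p)" proof
   assume "z r = snd (pl p)"
   hence D: "D r = pl p" using r by (simp add: D_def prod_eq_iff)
   hence "r:Cs" using inJs[OF r(1)] VQ(1)[OF pV] by simp
   hence "y r < py3 p" using D VQ(4)[OF pV] by (meson not_le)
   moreover have "py3 p < y r" using D p unfolding Uf_def by blast
   ultimately show False by simp
  qed
  thus ?thesis by (rule below_local[OF Js(1) r])
 qed
 have v6: "\<forall>\<^sub>F q in nhds (pl p). - sh (pl p) + sh q = - (if below Js (pl p) then g s0 else 0) + (if below Js q then g s0 else 0)"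
  if p: "p:V Int Ub" and sh: "ALL q. q ~: sing --> adm sh q" for p sh proof -
  have offt: "r ~: Ct" if "D r = pl p" for r proof
   assume "r:Ct"
   hence "py3 p < y r" using that VQ(5)[of p] p by (meson not_le IntE)
   moreover have "y r < py3 p" using that p unfolding Ub_def by blast
   ultimately show False by simp
  qed
  have ns: "pl p ~: sing" proof
   assume "pl p:sing"
   hence "pl p = P" using VQ(3)[of p] p by blast
   thus False using offt[of t0] Pt Ct(3) by simp
  qed
  have a: "adm sh (pl p)" using sh ns by blast
  have pV: "p:V" using p by blast
  obtain s where s: "s:Js" "x s = fst (pl p)" using Q2(3) VQ(2)[OF pV] by blast
  show ?thesis proof (cases "pl p:range D")
   case False
   hence "\<forall>\<^sub>F q in nhds (pl p). sh q = sh (pl p)" using a by (auto simp: adm_def)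
   moreover have "\<forall>\<^sub>F q in nhds (pl p). below Js q = below Js (pl p)" using below_local[OF Js(1) s off_D[OF False s(2)]] .
   ultimately show ?thesis by eventually_elim simp
  next
   case True
   then obtain r0 where r0: "D r0 = pl p" by auto
   hence "D r0:Q1" using VQ(1)[OF pV] by simp
   then obtain k where k: "r0 + of_int k:Cs Un Ct" using Q1' by blast
   have D: "D (r0 + of_int k) = pl p" using r0 by (simp add: per)
   then obtain r where r: "r:Js" "D r = pl p" using k offt Cs(2) by blast
   have "g r = g s0" using good_both(2)[OF d(2) over_not_brk[OF ov], of r] r(1) by (auto simp: Js_def abs_less_iff)
   hence "\<forall>\<^sub>F q in nhds (pl p). sh q = sh (pl p) + (if below Js q then g s0 else 0)"
    using a[unfolded adm_def, THEN conjunct2, THEN spec, THEN spec, THEN mp, THEN mp, THEN mp, OF r(2)[symmetric] Js(1) r(1)] by (simp only:)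
   moreover have "~ below Js (pl p)" using below_D[OF Js(1) r(1)] r(2) by simp
   ultimately show ?thesis by (auto elim!: eventually_mono)
  qed
 qed
 show ?thesis
  apply (rule exI[of _ V], rule exI[of _ s0], rule exI[of _ de]) unfolding Js_def[symmetric] crossing_cell_def
  apply (intro conjI)
     apply (rule v1)
    apply (rule v2)
    apply (intro allI impI, rule v3; assumption)
   apply (intro ballI impI, rule v4; assumption)
   apply (intro ballI, rule v5, assumption)
  apply (intro ballI allI impI, rule v6; assumption)
  done
qed

lemma between_sing:
 assumes "p:cmpl K" "p ~: Uf" "p ~: Ub" shows "EX s t. over s t & D t = pl p" proof -
 obtain r1 where r1: "D r1 = pl p" "y r1 <= py3 p" using assms by (auto simp: Uf_def not_less)
 obtain r2 where r2: "D r2 = pl p" "py3 p <= y r2" using assms by (auto simp: Ub_def not_less)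
 have "y r1 ~= y r2" proof
  assume "y r1 = y r2"
  hence "K r1 = p" using r1 r2 by (auto simp: K_def D_def prod_eq_iff)
  thus False using assms(1) by (auto simp: cmpl_def)
 qed
 hence "~ (EX k. r1 = r2 + of_int k)" by (auto simp: per)
 hence "dp r1 r2" using D_eq[of r1 r2] r1 r2 by auto
 thus ?thesis using dp_over[of r1 r2] r1 r2 by blast
qed

text \<open>A path in front of the knot collects nothing, a path behind it the change of the shadow,
  and the cells at crossings mediate. They complete the cover because a point with branches both in
  front and behind lies over a crossing.\<close>

lemma shadow_holonomy:
 assumes sh: "!!p. sh p:autos R" "!!p. p ~: sing ==> adm sh p"
 shows "EX W. (ALL a xs ys b. HE (cmpl K) a xs ys b --> sum_list (map W xs) = sum_list (map W ys)) &
  (ALL a xs b. pchain (cmpl K) a xs b --> sum_list (map W xs):autos R) &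
  (ALL ga. path ga --> path_image ga <= Uf --> W ga = 0) &
  (ALL ga. path ga --> path_image ga <= Ub --> W ga = - sh (pl (pathstart ga)) + sh (pl (pathfinish ga)))" proof -
 define cr where "cr = {P. EX s t. over s t & D t = P}"
 have "EX V s de. crossing_cell P V s de" if "P:cr" for P by (rule crossing_nbhd) (use that in "simp add: cr_def")
 then obtain V s de where VC: "!!P. P:cr ==> crossing_cell P (V P) (s P) (de P)" by metis
 note VC' = VC[unfolded crossing_cell_def]
 have V: "!!P. P:cr ==> open (V P)" "!!P. P:cr ==> V P <= cmpl K"
  and V3: "!!P p. P:cr ==> pl p = P ==> p:cmpl K ==> p ~: Uf ==> p ~: Ub ==> p:V P"
  and V4: "!!P p. P:cr ==> p:V P ==> pl p:sing ==> pl p = P"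
  and V5: "!!P p. P:cr ==> p:V P Int Uf ==> \<forall>\<^sub>F q in nhds (pl p). below {s P - de P<..<s P + de P} q = below {s P - de P<..<s P + de P} (pl p)"
  and V6: "!!P p. P:cr ==> p:V P Int Ub ==> \<forall>\<^sub>F q in nhds (pl p). - sh (pl p) + sh q =
    - (if below {s P - de P<..<s P + de P} (pl p) then g (s P) else 0) + (if below {s P - de P<..<s P + de P} q then g (s P) else 0)"
  using VC' sh(2) by blast+
 \<comment> \<open>\<open>None\<close> stands for \<open>Uf\<close>, \<open>Some None\<close> for
   \<open>Ub\<close>, and \<open>Some (Some P)\<close> for the cell over the crossing
   \<open>P\<close>.\<close>
 define I where "I = insert None (insert (Some None) (Some ` Some ` cr))"
 define U where "U i = (case i of None => Uf | Some None => Ub | Some (Some P) => V P)" for i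
 define k where "k P q = (if below {s P - de P<..<s P + de P} q then g (s P) else 0)" for P q
 define w where "w i p q = (case i of None => 0 | Some None => - sh (pl p) + sh (pl q) | Some (Some P) => - k P (pl p) + k P (pl q))" for i and p q :: p3
 have U: "U None = Uf" "U (Some None) = Ub" "U (Some (Some P)) = V P" for P by (simp_all add: U_def)
 have w: "w None p q = 0" "w (Some None) p q = - sh (pl p) + sh (pl q)" "w (Some (Some P)) p q = - k P (pl p) + k P (pl q)" for P p q by (simp_all add: w_def)
 have Icases: thesis if "i:I" "i = None ==> thesis" "i = Some None ==> thesis" "!!P. P:cr ==> i = Some (Some P) ==> thesis" for i thesis
  using that by (auto simp: I_def)
 have plt: "\<forall>\<^sub>F q in nhds p. A (pl q)" if "eventually A (nhds (pl p))" for A and p :: p3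
  by (rule eventually_compose_filterlim[OF that]) (intro tendsto_Pair tendsto_fst tendsto_snd filterlim_ident)
 have k_autos: "k P q:autos R" for P q using g_autos by (simp add: k_def autos_closed)
 have front: "\<forall>\<^sub>F q in nhds p. w i p q = 0" if i: "i:I" and p: "p:U i" "p:Uf" for i p proof (rule Icases[OF i])
  assume i: "i = Some None"
  have "pl p ~: range D" proof
   assume "pl p:range D"
   then obtain t where "D t = pl p" by auto
   hence "py3 p < y t" "y t < py3 p" using p i by (auto simp: U Uf_def Ub_def)
   thus False by simp
  qed
  hence "\<forall>\<^sub>F q in nhds (pl p). sh q = sh (pl p)" using sh(2)[of "pl p"] sing_range by (auto simp: adm_def)
  from plt[OF this] show ?thesis by eventually_elim (simp add: w i)
 next
  fix P assume P: "P:cr" "i = Some (Some P)"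
  have "p:V P Int Uf" using p P by (simp add: U)
  from plt[OF V5[OF P(1) this]] show ?thesis by eventually_elim (simp add: w k_def P)
 qed (simp add: w)
 have rear: "\<forall>\<^sub>F q in nhds p. w i p q = - sh (pl p) + sh (pl q)" if i: "i:I" and p: "p:U i" "p:Ub" for i p proof (rule Icases[OF i])
  assume i: "i = None"
  have "\<forall>\<^sub>F q in nhds p. w (Some None) p q = 0" by (rule front) (use p i in "simp_all add: U I_def")
  thus ?thesis by eventually_elim (simp add: w i)
 next
  fix P assume P: "P:cr" "i = Some (Some P)"
  have "p:V P Int Ub" using p P by (simp add: U)
  from plt[OF V6[OF P(1) this]] show ?thesis by eventually_elim (simp add: w k_def P)
 qed (simp add: w)
 interpret C: cocycle I U w "autos R" proof
  show "open (U i)" if "i:I" for i by (rule Icases[OF that]) (simp_all add: U open_Uf open_Ub V)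
  show "w i p q + w i q r = w i p r" for i p q r by (simp add: w_def add.assoc split: option.splits)
  show "w i p q:autos R" for i p q by (auto simp: w_def sh k_autos split: option.splits intro!: autos_closed autos_uminus[OF rackR])
  fix i j p assume i: "i:I" "j:I" "p:U i" "p:U j"
  consider "p:Uf" | "p:Ub" | "p ~: Uf" "p ~: Ub" by blast
  thus "\<forall>\<^sub>F q in nhds p. w i p q = w j p q" proof cases
   case 1
   from front[OF i(1,3) 1] front[OF i(2,4) 1] show ?thesis by eventually_elim simp
  next
   case 2
   from rear[OF i(1,3) 2] rear[OF i(2,4) 2] show ?thesis by eventually_elim simp
  next
   case 3
   \<comment> \<open>Both indices are cells. The projection of \<open>p\<close> is singular, hence
     the centre of each cell, so the cells coincide.\<close>
   obtain P where P: "P:cr" "i = Some (Some P)" using Icases[OF i(1)] i(3) 3 by (metis U(1,2))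
   obtain P' where P': "P':cr" "j = Some (Some P')" using Icases[OF i(2)] i(4) 3 by (metis U(1,2))
   have pV: "p:V P" "p:V P'" using i(3,4) P P' by (simp_all add: U)
   hence "p:cmpl K" using V(2)[OF P(1)] by blast
   from between_sing[OF this 3] have "pl p:sing" using singI(2) by (metis over_def)
   hence "P = P'" using V4[OF P(1) pV(1)] V4[OF P'(1) pV(2)] by simp
   thus ?thesis using P P' by simp
  qed
 qed (auto simp: autos_closed autos_uminus[OF rackR])
 have cover: "\<Union>(U ` I) = cmpl K" proof (intro equalityI subsetI)
  fix p assume "p:\<Union>(U ` I)"
  then obtain i where i: "i:I" "p:U i" by blast
  show "p:cmpl K" proof (rule Icases[OF i(1)])
   fix P assume "P:cr" "i = Some (Some P)"
   thus ?thesis using subsetD[OF V(2), of P p] i(2) by (simp add: U)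
  qed (use i(2) Uf_cmpl Ub_cmpl in "auto simp: U")
 next
  fix p assume p: "p:cmpl K"
  show "p:\<Union>(U ` I)" proof (cases "p:Uf | p:Ub")
   case True
   hence "p:U None | p:U (Some None)" by (simp add: U)
   thus ?thesis by (auto simp: I_def)
  next
   case False
   have "pl p:cr" using between_sing[OF p] False by (auto simp: cr_def)
   moreover from this have "p:U (Some (Some (pl p)))" unfolding U using V3[OF _ HOL.refl p] False by blast
   ultimately show ?thesis unfolding I_def by (metis UN_iff image_eqI insertCI)
  qed
 qed
 have hol: "C.holonomy (jl b xs) = sum_list (map C.holonomy xs)" if "pchain (cmpl K) a xs b" for a xs b using that proof (induction xs arbitrary: a)
  case Nil
  hence "b:cmpl K" by auto
  hence b: "b:\<Union>(U ` I)" using cover by blast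
  then obtain i where i: "i:I" "b:U i" by blast
  have "C.holonomy (linepath b b) = w i b b" using C.holonomy_chart[of "linepath b b" i] i by simp
  hence "C.holonomy (linepath b b) = 0" using C.w_refl[OF i] by (rule HOL.trans)
  thus ?case by (simp only: jl.simps list.map sum_list.Nil)
 next
  case (Cons ga xs)
  hence c: "pchain (cmpl K) (pathfinish ga) xs b" by simp
  have "C.holonomy (ga +++ jl b xs) = C.holonomy ga + C.holonomy (jl b xs)" by (rule C.holonomy_join) (use Cons.prems pchain_jl[OF c] cover in auto)
  thus ?case using Cons.IH[OF c] by simp
 qed
 have "sum_list (map C.holonomy xs) = sum_list (map C.holonomy ys)" if "HE (cmpl K) a xs ys b" for a xs ys b
  using C.holonomy_homotopic[of "jl b xs" "jl b ys"] hol[OF HE_pchain(1)[OF that]] hol[OF HE_pchain(2)[OF that]] that by (simp add: cover HE_def)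
 moreover have "sum_list (map C.holonomy xs):autos R" if "pchain (cmpl K) a xs b" for a xs b
  using C.holonomy_in_H[of "jl b xs"] hol[OF that] pchain_jl[OF that] by (simp add: cover)
 moreover have "C.holonomy ga = 0" if "path ga" "path_image ga <= Uf" for ga
  using C.holonomy_chart[OF that(1), of None] that(2) by (simp add: U w I_def)
 moreover have "C.holonomy ga = - sh (pl (pathstart ga)) + sh (pl (pathfinish ga))" if "path ga" "path_image ga <= Ub" for ga
  using C.holonomy_chart[OF that(1), of "Some None"] that(2) by (simp add: U w I_def)
 ultimately show ?thesis by (intro exI[of _ C.holonomy]) blast
qed

end

section \<open>Standard paths\<close>

text \<open>Push along the \<open>y\<close>-axis into a half-space, then contract the half-space to
  a point. The sign \<open>e\<close> treats both directions together.\<close>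

lemma pushable_simply_connected:
 fixes S :: "p3 set" and e c :: real
 assumes e: "e = 1 | e = -1"
  and push: "!!p y'. p:S ==> e * y' <= e * fst (snd p) ==> (fst p, y', snd (snd p)):S"
  and half: "!!p. e * fst (snd p) <= e * c ==> p:S" shows "simply_connected S" proof -
 define m where "m p = (if e = 1 then min (fst (snd p)) c else max (fst (snd p)) c)" for p :: p3
 have cm: "continuous_on A m" for A unfolding m_def using e by (cases "e = 1") (auto intro!: continuous_intros)
 have m: "e * m p <= e * fst (snd p)" "e * m p <= e * c" for p using e by (auto simp: m_def)
 have 1: "homotopic_with_canon (%_. True) S S (%p. p) (%p. (fst p, m p, snd (snd p)))" proof (rule homotopic_with_linear)
  fix p assume p: "p:S"
  show "closed_segment p (fst p, m p, snd (snd p)) <= S" proof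
   fix q assume "q:closed_segment p (fst p, m p, snd (snd p))"
   then obtain r where r: "0 <= r" "r <= 1" "q = (1 - r) *\<^sub>R p + r *\<^sub>R (fst p, m p, snd (snd p))" by (auto simp: in_segment)
   have q: "q = (fst p, (1 - r) * fst (snd p) + r * m p, snd (snd p))" unfolding r(3) by (simp add: prod_eq_iff algebra_simps)
   have "e * ((1 - r) * fst (snd p) + r * m p) = e * fst (snd p) + r * (e * m p - e * fst (snd p))" by (simp add: algebra_simps)
   also have "... <= e * fst (snd p)" using m(1)[of p] r(1) by (simp add: mult_nonneg_nonpos)
   finally show "q:S" unfolding q by (rule push[OF p])
  qed
 qed (auto intro!: continuous_intros cm)
 have 2: "homotopic_with_canon (%_. True) S S (%p. (fst p, m p, snd (snd p))) (%p. (0, c, 0))" proof (rule homotopic_with_linear)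
  fix p assume p: "p:S"
  have "convex {p :: p3. e * fst (snd p) <= e * c}" proof -
   have "linear (%p :: p3. e * fst (snd p))" by (auto intro!: linearI simp: algebra_simps)
   from convex_linear_vimage[OF this convex_real_interval(1), of "e * c"] show ?thesis
    using convex_linear_vimage[OF \<open>linear _\<close>, of "{..e * c}"] by (simp add: vimage_def)
  qed
  hence "closed_segment (fst p, m p, snd (snd p)) (0, c, 0) <= {p. e * fst (snd p) <= e * c}" using m(2)[of p] by (intro closed_segment_subset) auto
  thus "closed_segment (fst p, m p, snd (snd p)) (0, c, 0) <= S" using half by blast
 qed (auto intro!: continuous_intros cm)
 have "contractible S" unfolding contractible_def using homotopic_with_trans[OF 1 2] by (intro exI[of _ "(0, c, 0)"]) (simp add: id_def)
 thus ?thesis by (rule contractible_imp_simply_connected)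
qed

locale viewed = plane_front +
 fixes u M :: real
 assumes u: "0 < u" and valid: "valid K dK u" and M: "- M < y t"
begin

abbreviation X :: "p3 set" where "X \<equiv> cmpl K"
abbreviation B :: "real => p3" where "B \<equiv> push K u"
abbreviation v :: p3 where "v \<equiv> (0, - M, 0)"

definition vert :: "real => real => real => real => p3" where
 "vert t a b = linepath (push K a t) (push K b t)"

text \<open>First parallel to the \<open>y\<close>-axis, then within the plane of the viewer. For
  \<open>p\<close> in \<open>Uf\<close> this avoids the knot; for other points the first piece hits
  it.\<close>

definition sig :: "p3 => (real => p3) list" where
 "sig p = [linepath p (fst p, - M, snd (snd p)), linepath (fst p, - M, snd (snd p)) v]"

text \<open>At height \<open>u\<close> the push-off may be hidden behind other branches. Up to the
  height \<open>a\<close> the column above the front point is free, so the viewer sees the push-off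
  directly.\<close>

definition low :: "real => real => bool" where
 "low t a \<longleftrightarrow> 0 < a & a <= u & (ALL c. 0 < c & c <= a --> (x t, z t + c) ~: range D)"

lemma pl_push [simp]: "fst (push K a t) = x t" "fst (snd (push K a t)) = y t" "snd (snd (push K a t)) = z t + a" by (simp_all add: push_def K_def)

lemma push_X: "0 < a ==> a <= u ==> push K a t:X" using valid[unfolded valid_def, rule_format, of "(a, 0)" t] by (simp add: emb_def push_def)

lemma column_gap: "EX a>0. ALL c. 0 < \<bar>c\<bar> & \<bar>c\<bar> <= a --> (x t, z t + c) ~: range D" proof -
 have "finite {P. fst P = x t & P:range D}" by (rule finite_column_z)
 hence "finite (snd ` {P. fst P = x t & P:range D} - {z t})" by simp
 from finite_set_avoid[OF this, of "z t"]
 obtain d where d: "d > 0" "!!w. w:snd ` {P. fst P = x t & P:range D} - {z t} ==> w ~= z t ==> d <= dist (z t) w" by blast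
 have "(x t, z t + c) ~: range D" if c: "0 < \<bar>c\<bar>" "\<bar>c\<bar> <= d/2" for c proof
  assume a: "(x t, z t + c):range D"
  hence "(x t, z t + c):{P. fst P = x t & P:range D}" by simp
  hence "z t + c:snd ` {P. fst P = x t & P:range D}" by (rule image_eqI[rotated]) simp
  hence "z t + c:snd ` {P. fst P = x t & P:range D} - {z t}" using c(1) by simp
  hence "d <= dist (z t) (z t + c)" using d(2) c(1) by auto
  thus False using c d(1) by (simp add: dist_real_def)
 qed
 thus ?thesis using d(1) by (intro exI[of _ "d/2"]) auto
qed

lemma low_exists: "EX a. low t a & a <= b" if "0 < b" proof -
 obtain a where "a > 0" "ALL c. 0 < \<bar>c\<bar> & \<bar>c\<bar> <= a --> (x t, z t + c) ~: range D" using column_gap by blast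
 thus ?thesis using u that by (intro exI[of _ "min a (min b u)"]) (auto simp: low_def)
qed

lemma off_Uf_Ub: "pl p ~: range D ==> p:Uf" "pl p ~: range D ==> p:Ub" by (auto simp: Uf_def Ub_def image_iff) metis+

lemma low_Uf: "low t a ==> 0 < c ==> c <= a ==> push K c t:Uf" by (rule off_Uf_Ub(1)) (simp add: low_def)
lemma Uf_forward: "p:Uf ==> w <= fst (snd p) ==> (fst p, w, snd (snd p)):Uf" by (auto simp: Uf_def dest: le_less_trans)
lemma Ub_backward: "p:Ub ==> fst (snd p) <= w ==> (fst p, w, snd (snd p)):Ub" by (auto simp: Ub_def dest: less_le_trans)
lemma far_Uf: "fst (snd p) <= - M ==> p:Uf" using M by (auto simp: Uf_def intro: le_less_trans)

lemma simply_Uf: "simply_connected Uf" by (rule pushable_simply_connected[of 1 _ "- M"]) (auto intro: Uf_forward far_Uf)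

lemma simply_Ub: "simply_connected Ub" proof -
 obtain B where B: "!!t. \<bar>y t\<bar> < B" using y_bounded by blast
 hence B: "y t < B" for t using abs_less_iff by blast
 show ?thesis by (rule pushable_simply_connected[of "-1" _ B]) (auto intro: Ub_backward simp: Ub_def less_le_trans[OF B])
qed

lemma HE_Uf: "pchain Uf a xs b ==> pchain Uf a ys b ==> HE X a xs ys b" using HE_simply[OF simply_Uf Uf_cmpl] .
lemma HE_Ub: "pchain Ub a xs b ==> pchain Ub a ys b ==> HE X a xs ys b" using HE_simply[OF simply_Ub Ub_cmpl] .

lemma Uf_X: "pchain Uf a xs b ==> pchain X a xs b" using Uf_cmpl by (rule pchain_subset[rotated])
lemma Ub_X: "pchain Ub a xs b ==> pchain X a xs b" using Ub_cmpl by (rule pchain_subset[rotated])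

lemma segment_line:
 assumes "q:closed_segment (a, y1, b) (a, y2, b :: real)" shows "EX w. q = (a, w, b) & min y1 y2 <= w & w <= max (y1::real) y2" proof -
 obtain r where r: "0 <= r" "r <= 1" "q = (1 - r) *\<^sub>R (a, y1, b) + r *\<^sub>R (a, y2, b)" using assms by (auto simp: in_segment)
 have "(1 - r) * y1 + r * y2:closed_segment y1 y2" using r by (auto simp: in_segment)
 hence "min y1 y2 <= (1 - r) * y1 + r * y2 & (1 - r) * y1 + r * y2 <= max y1 y2" by (auto simp: closed_segment_eq_real_ivl split: if_splits)
 moreover have "q = (a, (1 - r) * y1 + r * y2, b)" unfolding r(3) by (simp add: prod_eq_iff algebra_simps)
 ultimately show ?thesis by blast
qed

lemma forward_Uf: assumes "p:Uf" "w <= fst (snd p)" shows "closed_segment p (fst p, w, snd (snd p)) <= Uf" proof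
 fix q assume "q:closed_segment p (fst p, w, snd (snd p))"
 hence "q:closed_segment (fst p, fst (snd p), snd (snd p)) (fst p, w, snd (snd p))" by simp
 from segment_line[OF this] show "q:Uf" using Uf_forward[OF assms(1)] assms(2) by auto
qed

lemma sig_pchain: assumes "p:Uf" shows "pchain Uf p (sig p) v" proof -
 have "closed_segment p (fst p, - M, snd (snd p)) <= Uf" proof (cases "- M <= fst (snd p)")
  case True
  thus ?thesis by (rule forward_Uf[OF assms])
 next
  case False
  have "q:Uf" if "q:closed_segment p (fst p, - M, snd (snd p))" for q proof -
   have "q:closed_segment (fst p, fst (snd p), snd (snd p)) (fst p, - M, snd (snd p))" using that by simp
   from segment_line[OF this] show "q:Uf" using False by (auto intro!: far_Uf)
  qed
  thus ?thesis by blast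
 qed
 moreover have "closed_segment (fst p, - M, snd (snd p)) v <= Uf" proof -
  have "q:Uf" if q: "q:closed_segment (fst p, - M, snd (snd p)) v" for q proof -
   obtain r where "q = (1 - r) *\<^sub>R (fst p, - M, snd (snd p)) + r *\<^sub>R v" using q by (auto simp: in_segment)
   hence "fst (snd q) = - M" by (simp add: algebra_simps)
   thus ?thesis by (intro far_Uf) simp
  qed
  thus ?thesis by blast
 qed
 ultimately show ?thesis by (auto simp: sig_def intro: far_Uf)
qed

lemma vert_image: "path_image (vert t a b) = (%c. push K c t) ` closed_segment a b" proof -
 have "vert t a b = (%c. push K c t) o linepath a b" by (auto simp: vert_def linepath_def push_def fun_eq_iff prod_eq_iff algebra_simps)
 thus ?thesis by (simp add: path_image_compose)
qed

lemma vert_ends [simp]: "pathstart (vert t a b) = push K a t" "pathfinish (vert t a b) = push K b t" "path (vert t a b)" by (simp_all add: vert_def)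

lemma vert_X: "0 < a ==> a <= u ==> 0 < b ==> b <= u ==> path_image (vert t a b) <= X"
 unfolding vert_image by (auto simp: closed_segment_eq_real_ivl intro!: push_X split: if_splits)

lemma vert_low: "low t c ==> 0 < a ==> a <= c ==> 0 < b ==> b <= c ==> path_image (vert t a b) <= Uf"
 unfolding vert_image by (auto simp: closed_segment_eq_real_ivl intro!: low_Uf split: if_splits)

lemma cont_push: "continuous_on S (%q. push K (f q) (h q))" if "continuous_on S f" "continuous_on S h"
 unfolding push_def by (intro continuous_intros that continuous_on_compose2[OF contK[of UNIV]]) auto

lemma slide_props:
 "path (slide (push K a) s t)" "pathstart (slide (push K a) s t) = push K a s" "pathfinish (slide (push K a) s t) = push K a t"
 "path_image (slide (push K a) s t) = push K a ` closed_segment s t" proof -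
 have c: "continuous_on A (push K a)" for A using cont_push[of A "%_. a" "%t. t"] by (simp add: eta_contract_eq)
 show "path (slide (push K a) s t)" unfolding slide_def by (intro path_continuous_image c path_linepath)
 show "pathstart (slide (push K a) s t) = push K a s" "pathfinish (slide (push K a) s t) = push K a t"
  by (simp_all add: slide_def pathstart_compose pathfinish_compose)
 show "path_image (slide (push K a) s t) = push K a ` closed_segment s t" by (simp add: slide_def path_image_compose)
qed

lemma slide_X: "0 < a ==> a <= u ==> path_image (slide (push K a) s t) <= X" unfolding slide_props by (auto intro!: push_X)

lemma slide_chain: "pchain X (B s) [slide B s t] (B t)" using slide_X[OF u order_refl] push_X[OF u order_refl] by (simp add: slide_props)

lemma vert_chain: assumes "0 < a" "a <= u" shows "pchain X (B t) [vert t u a] (push K a t)" "pchain X (push K a t) [vert t a u] (B t)"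
 using vert_X[OF u order_refl assms] vert_X[OF assms u order_refl] push_X[OF u order_refl] push_X[OF assms] by simp_all

lemma slide_lower:
 assumes a: "0 < a" "a <= u" shows "HE X (B s) [slide B s t] [vert s u a, slide (push K a) s t, vert t a u] (B t)" proof -
 let ?h = "%q. push K (linepath u a (snd q)) (linepath s t (fst q))"
 have c: "continuous_on ({0..1} \<times> {0..1}) ?h" unfolding linepath_def by (intro cont_push continuous_intros)
 have lp: "0 < linepath u a r & linepath u a r <= u" if "r:{0..1}" for r
  using linepath_in_path[OF that, of u a] a u by (auto simp: closed_segment_eq_real_ivl split: if_splits)
 have i: "?h ` ({0..1} \<times> {0..1}) <= X" using lp by (auto intro!: push_X)
 have e: "(%s'. ?h (s', 0)) = slide B s t" "(%s'. ?h (s', 1)) = slide (push K a) s t" "(%r. ?h (0, r)) = vert s u a" "(%r. ?h (1, r)) = vert t u a"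
  by (auto simp: slide_def vert_def linepath_def push_def fun_eq_iff prod_eq_iff algebra_simps)
 have 1: "HE X (B s) [slide B s t, vert t u a] [vert s u a, slide (push K a) s t] (push K a t)"
  using HE_square[OF c i] unfolding e by (simp add: linepath_def)
 have r: "reversepath (vert t u a) = vert t a u" by (simp add: vert_def)
 have vX: "path_image (vert t u a) <= X" "path_image (vert t a u) <= X" using vert_X[OF u _ a] vert_X[OF a u] by auto
 have "HE X (B s) ([slide B s t] @ [vert t u a, vert t a u]) ([slide B s t] @ []) (B t)"
  using HE_append[OF HE_refl HE_rinv[of "vert t u a" X], of "B s" "[slide B s t]"] vX slide_X[OF u, of s t] push_X[OF u, of t] by (simp add: r slide_props)
 hence 2: "HE X (B s) [slide B s t] [slide B s t, vert t u a, vert t a u] (B t)" using HE_sym by simp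
 have 3: "HE X (B s) ([slide B s t, vert t u a] @ [vert t a u]) ([vert s u a, slide (push K a) s t] @ [vert t a u]) (B t)"
  by (rule HE_append[OF 1 HE_refl]) (use vX push_X[OF u, of t] in simp)
 show ?thesis using HE_trans[OF 2] 3 by simp
qed

end

subsection \<open>Meridians\<close>

context plane_front
begin

lemma branch_near: assumes "x' t ~= 0" shows "EX de>0. ALL de'. 0 < de' & de' <= de --> branch {t - de'<..<t + de'}" proof -
 have "\<forall>\<^sub>F s in at t. x' s ~= 0" using tendsto_imp_eventually_ne[OF isCont_xyz(4)[of t, unfolded isCont_def] assms] .
 then obtain de where d: "de > 0" "!!s. s ~= t ==> dist s t < de ==> x' s ~= 0" unfolding eventually_at by blast
 have "branch {t - de'<..<t + de'}" if "0 < de'" "de' <= de" for de' proof -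
  have "x' s ~= 0" if "s:{t - de'<..<t + de'}" for s
   using d(2)[of s] assms that \<open>de' <= de\<close> by (cases "s = t") (auto simp: dist_real_def abs_less_iff)
  thus ?thesis by (simp add: branch_def is_interval_oo)
 qed
 thus ?thesis using d(1) by blast
qed

text \<open>The parameters near which points just above the front may be hidden: the under-branch of
  a crossing, and right cusps, where the upper branch passes in front of the lower.\<close>

definition rear :: "real => bool" where "rear t \<longleftrightarrow> (EX s. over s t) | rcusp t"

text \<open>Near \<open>t0\<close> the only other piece of the front in the same column is the other
  branch of a crossing or of a cusp. \<open>crossing_sides\<close> and \<open>cusp_structure\<close>
  tell which of the two is in front.\<close>

lemma side_local:
 "EX Q de. open Q & D t0:Q & 0 < de & (ALL t r. \<bar>t - t0\<bar> < de --> D r:Q --> x r = x t --> z t < z r -->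
   (if rear t0 then y r < y t else y t < y r))" proof (cases "x' t0 = 0")
 case True
 hence nd: "~ dp s t0" "~ over s t0" for s using dp_x' by (auto simp: over_def)
 from cusp_structure[OF True] obtain de1 where d1: "de1 > 0"
  "ALL s. t0 - de1 < s & s < t0 --> (x' s > 0 \<longleftrightarrow> rcusp t0) & (x' s < 0 \<longleftrightarrow> ~ rcusp t0)"
  "ALL s. t0 < s & s < t0 + de1 --> (x' s < 0 \<longleftrightarrow> rcusp t0) & (x' s > 0 \<longleftrightarrow> ~ rcusp t0)"
  "ALL s t. t0 - de1 < s & s < t0 & t0 < t & t < t0 + de1 & x s = x t -->
   (if rcusp t0 then (z s - z t) * (y s - y t) < 0 else (z s - z t) * (y s - y t) > 0)" by (elim exE conjE) (rule that)
 obtain de2 where d2: "de2 > 0" "!!s. s ~= t0 ==> \<bar>s - t0\<bar> < de2 ==> x s ~= x t0" using x_isolated[of t0] by blast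
 define de where "de = min de1 de2"
 have d: "de > 0" "de <= de1" "de <= de2" using d1(1) d2(1) by (auto simp: de_def)
 have "EX k. r + of_int k:{t0 - de<..<t0 + de}" if r: "D r = D t0" for r proof -
  obtain k where "r = t0 + of_int k" using D_eq[OF r] nd dp_sym by blast
  thus ?thesis using d(1) by (intro exI[of _ "- k"]) auto
 qed
 from nearby[OF open_greaterThanLessThan this] obtain Q where Q: "open Q" "D t0:Q" "!!r. D r:Q ==> EX k. r + of_int k:{t0 - de<..<t0 + de}" by blast
 have bl: "branch {t0 - de<..<t0}" using d1(2) d(2) unfolding branch_def by (auto simp: is_interval_oo; smt (verit))
 have br: "branch {t0<..<t0 + de}" using d1(3) d(2) unfolding branch_def by (auto simp: is_interval_oo; smt (verit))
 have "if rear t0 then y r < y t else y t < y r" if t: "\<bar>t - t0\<bar> < de" "D r:Q" "x r = x t" "z t < z r" for t r proof -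
  obtain k where k: "r + of_int k:{t0 - de<..<t0 + de}" using Q(3) t(2) by blast
  define q where "q = r + of_int k"
  have q: "\<bar>q - t0\<bar> < de" "x q = x t" "z t < z q" "y q = y r" using k t by (auto simp: q_def per abs_less_iff)
  have "q ~= t" using q by auto
  have "q ~= t0" using d2(2)[of t] q t d by (metis \<open>q ~= t\<close> less_le_trans)
  have "t ~= t0" using d2(2)[of q] q t d by (metis \<open>q ~= t0\<close> less_le_trans)
  have "~ (q < t0 & t < t0)" using branch_inj[OF bl, of q t] q t \<open>q ~= t\<close> by (auto simp: abs_less_iff)
  moreover have "~ (t0 < q & t0 < t)" using branch_inj[OF br, of q t] q t \<open>q ~= t\<close> by (auto simp: abs_less_iff)
  ultimately consider "q < t0" "t0 < t" | "t < t0" "t0 < q" using \<open>q ~= t0\<close> \<open>t ~= t0\<close> by linarith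
  hence "if rcusp t0 then (z q - z t) * (y q - y t) < 0 else (z q - z t) * (y q - y t) > 0" proof cases
   case 1
   thus ?thesis using d1(4)[rule_format, of q t] q t d by (simp add: abs_less_iff)
  next
   case 2
   hence "if rcusp t0 then (z t - z q) * (y t - y q) < 0 else (z t - z q) * (y t - y q) > 0"
    using d1(4)[rule_format, of t q] q t d by (simp add: abs_less_iff)
   moreover have "(z t - z q) * (y t - y q) = (z q - z t) * (y q - y t)" by (simp add: algebra_simps)
   ultimately show ?thesis by (simp only:)
  qed
  thus ?thesis using q nd by (auto simp: rear_def mult_less_0_iff zero_less_mult_iff)
 qed
 thus ?thesis using Q d(1) by blast
next
 case nz: False
 hence nr: "~ rcusp t0" by (simp add: rcusp_def)
 obtain de1 where d1: "de1 > 0" "!!de'. 0 < de' ==> de' <= de1 ==> branch {t0 - de'<..<t0 + de'}" using branch_near[OF nz] by blast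
 show ?thesis proof (cases "EX s. dp s t0")
  case False
  have "EX k. r + of_int k:{t0 - de1<..<t0 + de1}" if r: "D r = D t0" for r proof -
   obtain k where "r = t0 + of_int k" using D_eq[OF r] False by blast
   thus ?thesis using d1(1) by (intro exI[of _ "- k"]) auto
  qed
  from nearby[OF open_greaterThanLessThan this] obtain Q where Q: "open Q" "D t0:Q" "!!r. D r:Q ==> EX k. r + of_int k:{t0 - de1<..<t0 + de1}" by blast
  have "~ z t < z r" if t: "\<bar>t - t0\<bar> < de1" "D r:Q" "x r = x t" for t r proof -
   obtain k where k: "r + of_int k:{t0 - de1<..<t0 + de1}" using Q(3) t(2) by blast
   have "r + of_int k = t" using branch_inj[OF d1(2)[OF d1(1) order_refl] k, of t] t by (auto simp: per abs_less_iff)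
   thus ?thesis using per(3)[of r k] by simp
  qed
  thus ?thesis using Q d1(1) by blast
 next
  case True
  then obtain s0 where s0: "dp s0 t0" by blast
  have cs: "EX de>0. ALL s t. \<bar>s - s0\<bar> < de & \<bar>t - t0\<bar> < de & x s = x t --> (if rear t0 then y s < y t else y t < y s)"
  proof (cases "over s0 t0")
   case True
   hence "rear t0" by (auto simp: rear_def)
   thus ?thesis using crossing_sides[OF True] by auto
  next
   case False
   hence o: "over t0 s0" using dp_over[OF s0] by blast
   have "~ over s t0" for s proof
    assume s: "over s t0"
    hence "D s = D t0" by (simp add: over_def dp_def)
    from two_points[OF s0 this] show False proof (elim disjE exE)
     fix k assume "s = s0 + of_int k"
     thus False using s o by (auto simp: over_def per)
    next
     fix k assume "s = t0 + of_int k"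
     thus False using s by (auto simp: over_def per)
    qed
   qed
   hence "~ rear t0" using nr by (simp add: rear_def)
   thus ?thesis using crossing_sides[OF o] by auto
  qed
  then obtain de2 where d2: "de2 > 0" "!!s t. \<bar>s - s0\<bar> < de2 ==> \<bar>t - t0\<bar> < de2 ==> x s = x t ==> (if rear t0 then y s < y t else y t < y s)" by blast
  define de where "de = min de1 de2"
  have d: "de > 0" "de <= de1" "de <= de2" using d1(1) d2(1) by (auto simp: de_def)
  have "EX k. r + of_int k:{t0 - de<..<t0 + de} Un {s0 - de<..<s0 + de}" if r: "D r = D t0" for r proof -
   obtain k where "r = t0 + of_int k | r = s0 + of_int k" using two_points[OF s0 r] by blast
   thus ?thesis using d(1) by (intro exI[of _ "- k"]) auto
  qed
  from nearby[OF open_Un[OF open_greaterThanLessThan open_greaterThanLessThan] this] obtain Q where Q: "open Q" "D t0:Q" "!!r. D r:Q ==> EX k. r + of_int k:{t0 - de<..<t0 + de} Un {s0 - de<..<s0 + de}" by blast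
  have "if rear t0 then y r < y t else y t < y r" if t: "\<bar>t - t0\<bar> < de" "D r:Q" "x r = x t" "z t < z r" for t r proof -
   obtain k where k: "r + of_int k:{t0 - de<..<t0 + de} Un {s0 - de<..<s0 + de}" using Q(3) t(2) by blast
   have "r + of_int k ~: {t0 - de<..<t0 + de}" proof
    assume "r + of_int k:{t0 - de<..<t0 + de}"
    hence "r + of_int k = t" using branch_inj[OF d1(2)[OF d(1,2)], of "r + of_int k" t] t by (auto simp: per abs_less_iff)
    thus False using t(4) per(3)[of r k] by simp
   qed
   hence "\<bar>r + of_int k - s0\<bar> < de" using k by (auto simp: abs_less_iff)
   thus ?thesis using d2(2)[of "r + of_int k" t, unfolded per] t d by simp
  qed
  thus ?thesis using Q d(1) by blast
 qed
qed

end

context viewed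
begin

text \<open>A uniform strip above the branch lies wholly behind or wholly in front of the knot.
  Holonomies and values of functionals are compared within such strips.\<close>

lemma near_side:
 assumes Q: "open Q" "D t0:Q" shows "EX de>0. EX ze>0. ze <= u & (ALL t c. \<bar>t - t0\<bar> < de --> 0 < c --> c <= ze -->
   push K c t:(if rear t0 then Ub else Uf) & (x t, z t + c):Q)" proof -
 obtain Q' de1 where Q': "open Q'" "D t0:Q'" "0 < de1" and
  s: "!!t r. \<bar>t - t0\<bar> < de1 ==> D r:Q' ==> x r = x t ==> z t < z r ==> (if rear t0 then y r < y t else y t < y r)"
  using side_local[of t0] by blast
 let ?f = "%q :: real * real. (x (fst q), z (fst q) + snd q)"
 have "open (?f -` (Q Int Q'))"
  by (intro open_vimage open_Int Q Q' continuous_intros continuous_on_compose2[OF contx[of UNIV]] continuous_on_compose2[OF contz[of UNIV]]) auto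
 moreover have "(t0, 0):?f -` (Q Int Q')" using Q Q' by (simp add: D_def)
 ultimately obtain A B where AB: "open A" "open B" "(t0, 0):A \<times> B" "A \<times> B <= ?f -` (Q Int Q')" by (rule open_prod_elim)
 hence AB': "t0:A" "0:B" by auto
 obtain de2 where d2: "de2 > 0" "ball t0 de2 <= A" using AB(1) AB'(1) openE by blast
 obtain de3 where d3: "de3 > 0" "ball 0 de3 <= B" using AB(2) AB'(2) openE by blast
 define de ze where "de = min de1 de2" and "ze = min u (de3 / 2)"
 have "push K c t:(if rear t0 then Ub else Uf) & (x t, z t + c):Q" if t: "\<bar>t - t0\<bar> < de" "0 < c" "c <= ze" for t c proof -
  have "t:A" using t(1) d2(2) by (auto simp: de_def dist_real_def)
  moreover have "c:B" using t d3 by (auto simp: ze_def dist_real_def)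
  ultimately have q: "?f (t, c):Q Int Q'" using AB(4) by blast
  have "if rear t0 then y r < y t else y t < y r" if "D r = (x t, z t + c)" for r by (rule s) (use q t that in "auto simp: de_def D_def")
  hence "push K c t:(if rear t0 then Ub else Uf)" by (auto simp: Uf_def Ub_def)
  thus ?thesis using q by simp
 qed
 thus ?thesis using Q'(3) d2(1) d3(1) u by (intro exI[of _ de] conjI exI[of _ ze]) (auto simp: de_def ze_def)
qed

lemma merid_diamond_X: assumes "0 < a" "a <= u" "r:{0..1}" shows "merid K dK a t r:X" proof -
 have "\<bar>fst (a *\<^sub>R (dia1 +++ dia2) r)\<bar> + \<bar>snd (a *\<^sub>R (dia1 +++ dia2) r)\<bar> = a"
  using dia_in_diamond[OF assms(3)] assms(1) by (simp add: abs_mult flip: distrib_left)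
 thus ?thesis using valid[unfolded valid_def, rule_format, of "a *\<^sub>R (dia1 +++ dia2) r" t] assms unfolding merid_def by (simp only: order_refl)
qed

lemma merid_X: "path_image (merid K dK u t) <= X" using merid_diamond_X[OF u order_refl] by (auto simp: path_image_def)

lemma cont_merid:
 assumes "continuous_on S f" "continuous_on S h" "continuous_on S r" "r ` S <= {0..1}" shows "continuous_on S (%q. merid K dK (f q) (h q) (r q))"
proof -
 have "continuous_on {0..1} (dia1 +++ dia2)" using path_dia by (simp add: path_def)
 from continuous_on_compose2[OF this assms(3,4)] have "continuous_on S (%q. (dia1 +++ dia2) (r q))" .
 thus ?thesis unfolding merid_def emb_def
  by (intro continuous_intros assms continuous_on_compose2[OF contK[of UNIV] assms(2)] continuous_on_compose2[OF contdK[of UNIV] assms(2)]) auto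
qed

lemma slide_merid: "HE X (B s) [slide B s t, merid K dK u t] [merid K dK u s, slide B s t] (B t)" proof -
 let ?h = "%q. merid K dK u (linepath s t (fst q)) (snd q)"
 have c: "continuous_on ({0..1} \<times> {0..1}) ?h" unfolding linepath_def by (intro cont_merid continuous_intros) auto
 have i: "?h ` ({0..1} \<times> {0..1}) <= X" using merid_diamond_X[OF u order_refl] by auto
 have e: "(%s'. ?h (s', 0)) = slide B s t" "(%s'. ?h (s', 1)) = slide B s t" "(%r. ?h (0, r)) = merid K dK u s" "(%r. ?h (1, r)) = merid K dK u t"
  by (auto simp: slide_def merid_ends linepath_def fun_eq_iff)
 show ?thesis using HE_square[OF c i] unfolding e by (simp add: merid_ends linepath_def)
qed

lemma merid_shrink:
 assumes a: "0 < a" "a <= u" shows "HE X (B t) [merid K dK u t] [vert t u a, merid K dK a t, vert t a u] (B t)" proof -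
 let ?h = "%q. merid K dK (linepath u a (fst q)) t (snd q)"
 have lp: "0 < linepath u a r & linepath u a r <= u" if "r:{0..1}" for r
  using linepath_in_path[OF that, of u a] a u by (auto simp: closed_segment_eq_real_ivl split: if_splits)
 have c: "continuous_on ({0..1} \<times> {0..1}) ?h" unfolding linepath_def by (intro cont_merid continuous_intros) auto
 have i: "?h ` ({0..1} \<times> {0..1}) <= X" using merid_diamond_X lp by auto
 have e: "(%s'. ?h (s', 0)) = vert t u a" "(%s'. ?h (s', 1)) = vert t u a" "(%r. ?h (0, r)) = merid K dK u t" "(%r. ?h (1, r)) = merid K dK a t"
  by (auto simp: merid_ends linepath_def fun_eq_iff vert_def push_def prod_eq_iff algebra_simps)
 have 1: "HE X (B t) [merid K dK u t, vert t u a] [vert t u a, merid K dK a t] (push K a t)"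
  using HE_sym[OF HE_square[OF c i]] unfolding e by (simp add: merid_ends linepath_def)
 have r: "reversepath (vert t u a) = vert t a u" by (simp add: vert_def)
 have vX: "path_image (vert t u a) <= X" "path_image (vert t a u) <= X" using vert_X[OF u _ a] vert_X[OF a u] by auto
 have mp: "pchain X (B t) [merid K dK u t] (B t)" using merid_X push_X[OF u, of t] by (simp add: path_merid pathstart_def pathfinish_def merid_ends)
 have "HE X (B t) ([merid K dK u t] @ [vert t u a, vert t a u]) ([merid K dK u t] @ []) (B t)"
  using HE_append[OF HE_refl[OF mp] HE_rinv[of "vert t u a" X, simplified, unfolded r]] vX by simp
 hence 2: "HE X (B t) [merid K dK u t] [merid K dK u t, vert t u a, vert t a u] (B t)" using HE_sym by simp
 have 3: "HE X (B t) ([merid K dK u t, vert t u a] @ [vert t a u]) ([vert t u a, merid K dK a t] @ [vert t a u]) (B t)"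
  by (rule HE_append[OF 1 HE_refl]) (use vX push_X[OF u, of t] in simp)
 show ?thesis using HE_trans[OF 2] 3 by simp
qed

end

context viewed
begin

text \<open>Oriented so that it descends in front of the branch and rises behind it, whichever way
  the branch is run.\<close>

definition mer :: "real => real => p3" where
 "mer t = (if x' t > 0 then merid K dK u t else reversepath (merid K dK u t))"

text \<open>Near a regular point the transversal disc can be turned until it is parallel to the
  direction of projection; it stays transversal on the way.\<close>

lemma turned_disc:
 assumes "D t ~: sing" shows "EX a0>0. ALL a ka b c. 0 < a --> a <= a0 --> 0 <= ka --> ka <= 1 --> \<bar>b\<bar> + \<bar>c\<bar> = 1 -->
   K t + (a * c * (1 - ka) * y' t, - (a * c * x' t), a * b):X" proof -
 have nz: "x' t ~= 0" using regD(1)[OF assms] .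
 \<comment> \<open>The amount by which \<open>y' t * y' ta\<close>, which is nonnegative at
   \<open>ta = t\<close>, may fall below 0: it is then outweighed by \<open>x' t * x' ta\<close> for
   every weight \<open>1 - ka\<close> between 0 and 1.\<close>
 define m where "m = x' t * x' t / 2"
 have pos: "m > 0" "x' t * x' t > m" using nz by (auto simp: m_def zero_less_mult_iff less_divide_eq)
 have tx: "((%ta. x' t * x' ta) \<longlongrightarrow> x' t * x' t) (at t)" and ty: "((%ta. y' t * y' ta) \<longlongrightarrow> y' t * y' t) (at t)"
  by (intro tendsto_intros isCont_xyz(4,5)[of t, unfolded isCont_def])+
 have "y' t * y' t > - m" using pos(1) zero_le_square[of "y' t"] by linarith
 hence "\<forall>\<^sub>F ta in at t. x' t * x' ta > m & y' t * y' ta > - m"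
  using order_tendstoD(1)[OF tx pos(2)] order_tendstoD(1)[OF ty] by (simp add: eventually_conj)
 then obtain de where d: "de > 0" "!!ta. ta ~= t ==> \<bar>ta - t\<bar> < de ==> x' t * x' ta > m & y' t * y' ta > - m"
  unfolding eventually_at by (auto simp: dist_real_def)
 have d': "x' t * x' ta + (1 - ka) * (y' t * y' ta) > 0" if ka: "0 <= ka" "ka <= 1" and ta: "\<bar>ta - t\<bar> < de" for ka ta proof (cases "ta = t")
  case True
  have "0 <= (1 - ka) * (y' t * y' t)" using ka by (simp add: mult_nonneg_nonneg)
  thus ?thesis using pos True by simp
 next
  case False
  have y: "y' t * y' ta > - m" "x' t * x' ta > m" using d(2)[OF False ta] by auto
  have "(1 - ka) * (y' t * y' ta) >= (1 - ka) * (- m)" using y ka by (intro mult_left_mono) auto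
  moreover have "(1 - ka) * (- m) >= - m" using ka pos(1) by (simp add: algebra_simps)
  ultimately show ?thesis using y by linarith
 qed
 have mono: "t1 = t" if ka: "0 <= ka" "ka <= 1" and t1: "\<bar>t1 - t\<bar> < de"
  and eq: "x' t * (x t1 - x t) + (1 - ka) * (y' t * (y t1 - y t)) = 0" for ka t1 proof (rule ccontr)
  assume ne: "t1 ~= t"
  \<comment> \<open>The component in the direction \<open>(x' t, (1 - ka) * y' t)\<close>, which is
    orthogonal to the turned disc. It increases along the knot near \<open>t\<close>, so the disc
    meets this piece at its centre only.\<close>
  define ps where "ps ta = x' t * x ta + (1 - ka) * (y' t * y ta)" for ta
  have der: "(ps has_real_derivative x' t * x' ta + (1 - ka) * (y' t * y' ta)) (at ta)" for ta
   unfolding ps_def by (auto intro!: derivative_eq_intros dx dy)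
  have "ps a < ps b" if "a < b" "\<bar>a - t\<bar> < de" "\<bar>b - t\<bar> < de" for a b proof (rule DERIV_pos_imp_increasing[OF that(1)])
   fix ta assume "a <= ta" "ta <= b"
   hence "\<bar>ta - t\<bar> < de" using that by linarith
   from der d'[OF ka this] show "EX y. (ps has_real_derivative y) (at ta) & y > 0" by blast
  qed
  from this[of t t1] this[of t1 t] have "ps t ~= ps t1" using ne t1 d(1) by (cases t t1 rule: linorder_cases) auto
  moreover have "ps t1 = ps t" using eq unfolding ps_def by (simp add: algebra_simps)
  ultimately show False by simp
 qed
 have "EX k. r + of_int k:{t - de<..<t + de}" if r: "D r = D t" for r proof -
  obtain k where "r = t + of_int k" using regD(3)[OF assms r] by blast
  thus ?thesis using d(1) by (intro exI[of _ "- k"]) auto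
 qed
 from nearby[OF open_greaterThanLessThan this] obtain Q where Q: "open Q" "D t:Q" "!!r. D r:Q ==> EX k. r + of_int k:{t - de<..<t + de}" by blast
 obtain e where e: "e > 0" "ball (D t) e <= Q" using openE[OF Q(1,2)] .
 define a0 where "a0 = e / (2 * (\<bar>y' t\<bar> + 1))"
 have a0: "a0 > 0" "a0 * (\<bar>y' t\<bar> + 1) < e" using e(1) by (auto simp: a0_def field_simps add_pos_nonneg)
 have main: "K t + (a * c * (1 - ka) * y' t, - (a * c * x' t), a * b):X"
  if a: "0 < a" "a <= a0" and ka: "0 <= ka" "ka <= 1" and bc: "\<bar>b\<bar> + \<bar>c\<bar> = 1" for a ka b c proof (rule ccontr)
  assume "~ ?thesis"
  then obtain r where "K t + (a * c * (1 - ka) * y' t, - (a * c * x' t), a * b) = K r" by (auto simp: cmpl_def)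
  hence r: "x r = x t + a * c * (1 - ka) * y' t" "y r = y t - a * c * x' t" "z r = z t + a * b" by (auto simp: K_def)
  have "norm (D r - D t) <= norm (a * c * (1 - ka) * y' t) + norm (a * b)"
   using norm_Pair_le[of "a * c * (1 - ka) * y' t" "a * b"] r by (simp add: D_def)
  also have "... = a * (\<bar>c\<bar> * (1 - ka) * \<bar>y' t\<bar> + \<bar>b\<bar>)" using a ka by (simp add: abs_mult distrib_left mult.assoc)
  also have "... <= a * (\<bar>y' t\<bar> + 1)" proof (intro mult_left_mono add_mono)
   have "\<bar>c\<bar> * (1 - ka) <= 1 * 1" using bc ka by (intro mult_mono) auto
   thus "\<bar>c\<bar> * (1 - ka) * \<bar>y' t\<bar> <= \<bar>y' t\<bar>" by (intro mult_left_le_one_le) (use ka in auto)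
  qed (use a bc in auto)
  also have "... <= a0 * (\<bar>y' t\<bar> + 1)" using a by (intro mult_right_mono) auto
  finally have "D r:ball (D t) e" using a0 by (simp add: dist_norm norm_minus_commute)
  then obtain k where k: "r + of_int k:{t - de<..<t + de}" using Q(3) e(2) by blast
  have eq: "x' t * (x r - x t) + (1 - ka) * (y' t * (y r - y t)) = 0" unfolding r by (simp add: algebra_simps)
  have "r + of_int k = t" by (rule mono[OF ka]) (use k eq in "auto simp: per abs_less_iff")
  hence "x r = x t" "y r = y t" "z r = z t" using per(1-3)[of r k] by auto
  hence "a * c * x' t = 0" "a * b = 0" using r by auto
  thus False using a nz bc by auto
 qed
 show ?thesis using a0(1) main by (intro exI[of _ a0]) blast
qed

text \<open>Once the disc is turned, the loop stays over the column of \<open>t\<close>. One half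
  lies in front of the branch and the other behind it, and for small \<open>a\<close> no other part
  of the front is in the way.\<close>

lemma mer_split:
 assumes reg: "D t ~: sing" and b: "0 < b"
 shows "EX a dn up. 0 < a & a <= b & a <= u & (ALL c. 0 < \<bar>c\<bar> & \<bar>c\<bar> <= a --> (x t, z t + c) ~: range D) &
  pchain Uf (push K a t) [dn] (push K (- a) t) & pchain Ub (push K (- a) t) [up] (push K a t) &
  HE X (B t) [mer t] [vert t u a, dn, up, vert t a u] (B t)" proof -
 obtain a0 where a0: "a0 > 0" "!!a ka b c. 0 < a ==> a <= a0 ==> 0 <= ka ==> ka <= 1 ==> \<bar>b\<bar> + \<bar>c\<bar> = 1 ==>
   K t + (a * c * (1 - ka) * y' t, - (a * c * x' t), a * b):X" using turned_disc[OF reg] by blast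
 obtain a1 where a1: "a1 > 0" "!!c. 0 < \<bar>c\<bar> ==> \<bar>c\<bar> <= a1 ==> (x t, z t + c) ~: range D" using column_gap[of t] by blast
 define a where "a = min (min a0 a1) (min b u)"
 have a: "0 < a" "a <= a0" "a <= a1" "a <= b" "a <= u" using a0(1) a1(1) b u by (auto simp: a_def)
 have nz: "x' t ~= 0" using regD(1)[OF reg] .
 \<comment> \<open>The end of the turning, where the disc is spanned by the \<open>y\<close>- and
   \<open>z\<close>-axes.\<close>
 define flat where "flat ga = (%r. K t + (0, - (a * snd (ga r) * x' t), a * fst (ga r)))" for ga :: "real => real * real"
 have pth: "path (flat ga)" if "path ga" for ga using that unfolding path_def flat_def by (intro continuous_intros)
 have dia: "path dia1" "path dia2" unfolding dia1_def dia2_def by (intro path_join_imp path_linepath; simp)+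
 have dd: "\<bar>fst (dia1 r)\<bar> + \<bar>snd (dia1 r)\<bar> = 1 & 0 <= snd (dia1 r)" "\<bar>fst (dia2 r)\<bar> + \<bar>snd (dia2 r)\<bar> = 1 & snd (dia2 r) <= 0" if "r:{0..1}" for r
  using that by (auto simp: dia1_def dia2_def joinpaths_def linepath_def)
 have ends: "pathstart (flat dia1) = push K a t" "pathfinish (flat dia1) = push K (- a) t"
  "pathstart (flat dia2) = push K (- a) t" "pathfinish (flat dia2) = push K a t"
  by (simp_all add: flat_def dia1_def dia2_def pathstart_def pathfinish_def joinpaths_def linepath_def push_def)
 have side: "flat ga r:Uf & w > 0 | flat ga r:Ub & w < 0"
  if w: "w ~= 0" "w * x' t * snd (ga r) >= 0" "\<bar>fst (ga r)\<bar> + \<bar>snd (ga r)\<bar> = 1" for ga r w proof (cases "fst (ga r) = 0")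
  case False
  hence c: "0 < \<bar>a * fst (ga r)\<bar>" "\<bar>a * fst (ga r)\<bar> <= a" using a(1) w(3) by (auto simp: abs_mult mult_le_cancel_left1)
  have "pl (flat ga r) ~: range D" using a1(2)[OF c(1)] c(2) a(3) by (simp add: flat_def K_def)
  thus ?thesis using off_Uf_Ub[of "flat ga r"] w(1) by auto
 next
  case True
  hence s: "snd (ga r) ~= 0" using w(3) by auto
  have f: "flat ga r = (x t, y t - a * snd (ga r) * x' t, z t)" using True by (simp add: flat_def K_def)
  have yr: "y r' = y t" if "D r' = (x t, z t)" for r' using regD(3)[OF reg, of r'] that by (auto simp: D_def per)
  have "w * x' t * snd (ga r) > 0" using w s nz by (simp add: order.not_eq_order_implies_strict)
  hence "0 < a * (w * x' t * snd (ga r))" using a(1) by simp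
  hence "0 < w * (a * snd (ga r) * x' t)" by (simp add: mult_ac)
  hence "0 < w & 0 < a * snd (ga r) * x' t | w < 0 & a * snd (ga r) * x' t < 0" by (simp add: zero_less_mult_iff)
  thus ?thesis unfolding f Uf_def Ub_def using yr by auto
 qed
 have s1: "path_image (flat dia1) <= (if x' t > 0 then Uf else Ub)" "path_image (flat dia2) <= (if x' t > 0 then Ub else Uf)" proof -
  have "flat dia1 r:(if x' t > 0 then Uf else Ub)" "flat dia2 r:(if x' t > 0 then Ub else Uf)" if r: "r:{0..1}" for r proof -
   have "0 <= x' t * x' t * snd (dia1 r)" "0 <= - x' t * x' t * snd (dia2 r)" using dd[OF r] by (auto simp: mult_nonneg_nonpos)
   thus "flat dia1 r:(if x' t > 0 then Uf else Ub)" "flat dia2 r:(if x' t > 0 then Ub else Uf)"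
    using side[of "x' t" dia1 r] side[of "- x' t" dia2 r] dd[OF r] nz by auto
  qed
  thus "path_image (flat dia1) <= (if x' t > 0 then Uf else Ub)" "path_image (flat dia2) <= (if x' t > 0 then Ub else Uf)"
   unfolding path_image_def by blast+
 qed
 have mm: "merid K dK a t = (%r. K t + (a * snd ((dia1 +++ dia2) r) * y' t, - (a * snd ((dia1 +++ dia2) r) * x' t), a * fst ((dia1 +++ dia2) r)))"
  by (simp add: merid_def emb_def dK_def)
 have "homotopic_paths X (merid K dK a t) (flat (dia1 +++ dia2))" proof (rule homotopic_paths_linear)
  show "path (merid K dK a t)" by (rule path_merid)
  show "path (flat (dia1 +++ dia2))" by (rule pth[OF path_dia])
  show "pathstart (flat (dia1 +++ dia2)) = pathstart (merid K dK a t)" "pathfinish (flat (dia1 +++ dia2)) = pathfinish (merid K dK a t)"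
   unfolding mm by (simp_all add: flat_def pathstart_def pathfinish_def dia1_def dia2_def joinpaths_def linepath_def)
  fix r :: real assume r: "r:{0..1}"
  show "closed_segment (merid K dK a t r) (flat (dia1 +++ dia2) r) <= X" proof
   fix p assume "p:closed_segment (merid K dK a t r) (flat (dia1 +++ dia2) r)"
   then obtain ka where l: "0 <= ka" "ka <= 1" "p = (1 - ka) *\<^sub>R merid K dK a t r + ka *\<^sub>R flat (dia1 +++ dia2) r" by (auto simp: in_segment)
   have "p = K t + (a * snd ((dia1 +++ dia2) r) * (1 - ka) * y' t, - (a * snd ((dia1 +++ dia2) r) * x' t), a * fst ((dia1 +++ dia2) r))"
    unfolding l(3) mm flat_def by (simp add: prod_eq_iff algebra_simps)
   thus "p:X" using a0(2)[OF a(1,2) l(1,2) dia_in_diamond[OF r]] by simp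
  qed
 qed
 from HE_homotopic[OF this] have h1: "HE X (push K a t) [merid K dK a t] [flat (dia1 +++ dia2)] (push K a t)"
  by (simp add: pathstart_def pathfinish_def merid_ends)
 have j: "flat (dia1 +++ dia2) = flat dia1 +++ flat dia2" by (auto simp: flat_def joinpaths_def fun_eq_iff)
 have sX: "path_image (flat dia1) <= X" "path_image (flat dia2) <= X" using s1 Uf_cmpl Ub_cmpl by (auto split: if_splits)
 have "HE X (push K a t) [flat (dia1 +++ dia2)] [flat dia1, flat dia2] (push K a t)" using HE_join[OF pth[OF dia(1)] pth[OF dia(2)] sX] ends j by simp
 from HE_trans[OF h1 this] have h2: "HE X (push K a t) [merid K dK a t] [flat dia1, flat dia2] (push K a t)" .
 note v = vert_chain[OF a(1,5), of t]
 have h3: "HE X (B t) [merid K dK u t] [vert t u a, flat dia1, flat dia2, vert t a u] (B t)"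
  using HE_trans[OF merid_shrink[OF a(1,5)]] HE_ctx[OF h2 v] by simp
 have r: "reversepath (vert t a b) = vert t b a" for a b by (simp add: vert_def)
 define dn up where "dn = (if x' t > 0 then flat dia1 else reversepath (flat dia2))"
  and "up = (if x' t > 0 then flat dia2 else reversepath (flat dia1))"
 have "HE X (B t) [mer t] [vert t u a, dn, up, vert t a u] (B t)" using h3 HE_rl[OF h3] by (simp add: mer_def dn_def up_def r)
 moreover have "pchain Uf (push K a t) [dn] (push K (- a) t)" "pchain Ub (push K (- a) t) [up] (push K a t)" proof -
  have "pl (push K c t) ~: range D" if "c = a | c = -a" for c using a1(2)[of c] that a by auto
  from off_Uf_Ub[OF this] show "pchain Uf (push K a t) [dn] (push K (- a) t)" "pchain Ub (push K (- a) t) [up] (push K a t)"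
   using s1 ends pth dia by (auto simp: dn_def up_def)
 qed
 ultimately show ?thesis using a a1(2) by (intro exI[of _ a] exI[of _ dn] exI[of _ up]) auto
qed

end

subsection \<open>Colours just above the front\<close>

context plane_front
begin

text \<open>\<open>w\<close> is the sign of \<open>y'\<close> at the cusp: for \<open>w = 1\<close>
  the branch that enters the right cusp is the upper one, for \<open>w = -1\<close> the lower
  one.\<close>

lemma cusp_order:
 assumes rc: "rcusp t0"
 shows "EX w ep. (w = 1 | w = (-1::real)) & 0 < ep & (ALL s. t0 - ep < s & s < t0 --> x' s > 0) & (ALL s. t0 < s & s < t0 + ep --> x' s < 0) &
  (ALL s t. t0 - ep < s & s < t0 & t0 < t & t < t0 + ep & x s = x t --> w * z t < w * z s)" proof -
 have z0: "x' t0 = 0" using rc by (simp add: rcusp_def)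
 obtain de1 where d1: "de1 > 0"
  "ALL s. t0 - de1 < s & s < t0 --> (x' s > 0 \<longleftrightarrow> rcusp t0) & (x' s < 0 \<longleftrightarrow> ~ rcusp t0)"
  "ALL s. t0 < s & s < t0 + de1 --> (x' s < 0 \<longleftrightarrow> rcusp t0) & (x' s > 0 \<longleftrightarrow> ~ rcusp t0)"
  "ALL s t. t0 - de1 < s & s < t0 & t0 < t & t < t0 + de1 & x s = x t -->
   (if rcusp t0 then (z s - z t) * (y s - y t) < 0 else (z s - z t) * (y s - y t) > 0)" using cusp_structure[OF z0] by (elim exE conjE) (rule that)
 obtain w de2 where w: "w = 1 | w = (-1::real)" "de2 > 0" "!!r. t0 - de2 < r ==> r < t0 ==> w * y r < w * y t0" "!!r. t0 < r ==> r < t0 + de2 ==> w * y t0 < w * y r"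
 proof (cases "y' t0 > 0")
  case True
  from DERIV_pos_inc_right[OF dy True] DERIV_pos_inc_left[OF dy True]
  obtain e1 e2 where e: "e1 > 0" "ALL h>0. h < e1 --> y t0 < y (t0 + h)" "e2 > 0" "ALL h>0. h < e2 --> y (t0 - h) < y t0" by blast
  show ?thesis proof (rule that[of 1 "min e1 e2"])
   show "1 * y r < 1 * y t0" if "t0 - min e1 e2 < r" "r < t0" for r using e(4)[rule_format, of "t0 - r"] that by simp
   show "1 * y t0 < 1 * y r" if "t0 < r" "r < t0 + min e1 e2" for r using e(2)[rule_format, of "r - t0"] that by simp
  qed (use e in auto)
 next
  case False
  hence n: "y' t0 < 0" using imm[OF z0] by simp
  from DERIV_neg_dec_right[OF dy n] DERIV_neg_dec_left[OF dy n]
  obtain e1 e2 where e: "e1 > 0" "ALL h>0. h < e1 --> y (t0 + h) < y t0" "e2 > 0" "ALL h>0. h < e2 --> y t0 < y (t0 - h)" by blast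
  show ?thesis proof (rule that[of "-1" "min e1 e2"])
   show "-1 * y r < -1 * y t0" if "t0 - min e1 e2 < r" "r < t0" for r using e(4)[rule_format, of "t0 - r"] that by simp
   show "-1 * y t0 < -1 * y r" if "t0 < r" "r < t0 + min e1 e2" for r using e(2)[rule_format, of "r - t0"] that by simp
  qed (use e in auto)
 qed
 define ep where "ep = min de1 de2"
 have eps: "0 < ep" "ep <= de1" "ep <= de2" using d1(1) w(2) by (auto simp: ep_def)
 have xs: "x' s > 0" if "t0 - ep < s" "s < t0" for s using d1(2) that eps rc by auto
 have xt: "x' s < 0" if "t0 < s" "s < t0 + ep" for s using d1(3) that eps rc by auto
 have order: "w * z t < w * z s" if "t0 - ep < s" "s < t0" "t0 < t" "t < t0 + ep" "x s = x t" for s t proof -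
  have "w * y s < w * y t" using w(3)[of s] w(4)[of t] that eps by auto
  moreover have "(z s - z t) * (y s - y t) < 0" using d1(4)[rule_format, of s t] that eps rc by auto
  ultimately show ?thesis using w(1) by (auto simp: mult_less_0_iff)
 qed
 show ?thesis using w(1) eps(1) xs xt order by (intro exI[of _ w] exI[of _ ep]) auto
qed

end

context coloring
begin

lemma point_above:
 assumes "open N" "D t:N" shows "EX e>0. ALL b. 0 < b & b < e --> (x t, z t + b):N" proof -
 obtain e where e: "e > 0" "ball (D t) e <= N" using openE[OF assms] .
 have "(x t, z t + b):N" if "0 < b" "b < e" for b proof -
  have "dist (D t) (x t, z t + b) = \<bar>b\<bar>" by (simp add: D_def dist_Pair_Pair dist_real_def)
  thus ?thesis using e(2) that by auto
 qed
 thus ?thesis using e(1) by blast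
qed

text \<open>To the left of the crossing a point just above the under-branch is below the
  over-branch, so the shadow has an extra factor \<open>g s\<close>. It cancels the change of colour
  at the crossing.\<close>

lemma above_cross:
 assumes ov: "over s t0" and gs: "good s de" "good t0 de"
  and sh: "\<forall>\<^sub>F q in nhds (D t0). sh q = c + cross_chart s t0 de q"
 shows "EX d>0. EX A. ALL t. t ~= t0 & \<bar>t - t0\<bar> < d --> (EX c0>0. ALL b. 0 < b & b < c0 --> app (- sh (x t, z t + b)) (cf t) = A)" proof -
 have nz: "x' s ~= 0" "x' t0 ~= 0" and Ds: "D s = D t0" using ov dp_x' by (auto simp: over_def dp_def)
 have dpos: "0 < de" using gs(1) by (simp add: good_def)
 define Js Jt where "Js = {s - de<..<s + de}" and "Jt = {t0 - de<..<t0 + de}"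
 have Js: "branch Js" "s:Js" and Jt: "branch Jt" "t0:Jt"
  using good_branch(3)[OF gs(1) nz(1)] good_branch(3)[OF gs(2) nz(2)] dpos by (auto simp: Js_def Jt_def)
 obtain de1 where d1: "de1 > 0" "!!s' t. \<bar>s' - s\<bar> < de1 ==> \<bar>t - t0\<bar> < de1 ==> x s' = x t ==>
  (x t0 < x t --> z s' < z t) & (x t < x t0 --> z t < z s')" using crossing_sides[OF ov] by blast
 define J where "J = {s - min de de1<..<s + min de de1}"
 have "\<forall>\<^sub>F xi in nhds (x s). EX s':J. x s' = xi" by (rule near_inverse[OF nz(1)]) (use dpos d1 in "auto simp: J_def")
 hence "\<forall>\<^sub>F xi in nhds (x t0). EX s':J. x s' = xi" using Ds by (simp add: D_def)
 from eventually_compose_filterlim[OF this x_tendsto] have "\<forall>\<^sub>F t in nhds t0. EX s':J. x s' = x t" .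
 moreover obtain N where N: "open N" "D t0:N" "!!q. q:N ==> sh q = c + cross_chart s t0 de q" using sh unfolding eventually_nhds by blast
 from topological_tendstoD[OF D_tendsto N(1,2)] have "\<forall>\<^sub>F t in nhds t0. D t:N" .
 ultimately have "\<forall>\<^sub>F t in nhds t0. (EX s':J. x s' = x t) & D t:N" by (rule eventually_conj)
 then obtain d where d: "d > 0" "!!t. \<bar>t - t0\<bar> < d ==> (EX s':J. x s' = x t) & D t:N"
  unfolding eventually_nhds_metric by (auto simp: dist_real_def)
 define A where "A = app (- c) (cf (rgt t0 de))"
 have "EX c0>0. ALL b. 0 < b & b < c0 --> app (- sh (x t, z t + b)) (cf t) = A" if t: "t ~= t0" "\<bar>t - t0\<bar> < min d (min de de1)" for t
 proof -
  obtain s' where s': "s':J" "x s' = x t" using d(2)[of t] t by auto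
  have tJ: "t:Jt" and sJ: "s':Js" using t s' by (auto simp: Jt_def Js_def J_def abs_less_iff)
  have xt: "x t ~= x t0" using branch_inj[OF Jt(1) tJ Jt(2)] t(1) by blast
  obtain e where e: "e > 0" "!!b. 0 < b ==> b < e ==> (x t, z t + b):N" using point_above[OF N(1), of t] d(2)[of t] t by auto
  have zz: "(x t0 < x t --> z s' < z t) & (x t < x t0 --> z t < z s')" by (rule d1(2)) (use t s' in "auto simp: J_def abs_less_iff")
  have bt: "~ below Jt (x t, z t + b)" if "0 < b" for b using below_at[OF Jt(1) tJ, of "(x t, z t + b)"] that by simp
  have bs: "below Js (x t, z t + b) \<longleftrightarrow> z t + b < z s'" for b using below_at[OF Js(1) sJ, of "(x t, z t + b)"] s' by simp
  have shv: "sh (x t, z t + b) = c + (if z t + b < z s' then g s else 0)" if "0 < b" "b < e" for b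
   using N(3)[OF e(2)[OF that]] bt[OF that(1)] bs by (simp add: cross_chart_def two_def Js_def Jt_def)
  show ?thesis proof (cases "x t0 < x t")
   case True
   hence "cf t = cf (rgt t0 de)"
    using branch_mono[OF Jt(1) Jt(2) tJ] nz(2) t good_right(1)[OF gs(2), of t "t0 + de/2"] good_left(1)[OF gs(2), of t "t0 - de/2"] dpos
    unfolding rgt_def by (cases "x' t0 > 0") (auto simp: abs_less_iff)
   hence "app (- sh (x t, z t + b)) (cf t) = A" if "0 < b" "b < e" for b using shv[OF that] zz True that by (simp add: A_def)
   thus ?thesis using e(1) by blast
  next
   case False
   hence l: "x t < x t0" using xt by simp
   hence "cf t = cf (lft t0 de)"
    using branch_mono[OF Jt(1) Jt(2) tJ] nz(2) t good_right(1)[OF gs(2), of t "t0 + de/2"] good_left(1)[OF gs(2), of t "t0 - de/2"] dpos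
    unfolding lft_def by (cases "x' t0 > 0") (auto simp: abs_less_iff)
   hence c: "cf t = app (g s) (cf (rgt t0 de))" using cross_rel(1)[OF ov gs(2)] by simp
   have "app (- sh (x t, z t + b)) (cf t) = A" if "0 < b" "b < min e (z s' - z t)" for b
    using shv[of b] that by (simp add: A_def minus_add c del: add_uminus_conv_diff)
   moreover have "min e (z s' - z t) > 0" using e(1) zz l by simp
   ultimately show ?thesis by blast
  qed
 qed
 thus ?thesis using d(1) d1(1) dpos by (intro exI[of _ "min d (min de de1)"] conjI exI[of _ A]) auto
qed

text \<open>Just above the lower branch one is still below the upper branch, whose jump acts by the
  colour itself. This accounts exactly for the twist \<open>iota\<close> of a colouring at a right
  cusp.\<close>

lemma above_cusp:
 assumes rc: "rcusp t0" and gs: "good t0 de"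
  and sh: "\<forall>\<^sub>F q in nhds (D t0). sh q = c + cusp_chart t0 de q"
 shows "EX d>0. EX A. ALL t. t ~= t0 & \<bar>t - t0\<bar> < d --> (EX c0>0. ALL b. 0 < b & b < c0 --> app (- sh (x t, z t + b)) (cf t) = A)" proof -
 have z0: "x' t0 = 0" using rc by (simp add: rcusp_def)
 have dpos: "0 < de" using gs by (simp add: good_def)
 obtain w ep0 where w: "w = 1 | w = (-1::real)" "0 < ep0" "ALL s. t0 - ep0 < s & s < t0 --> x' s > 0" "ALL s. t0 < s & s < t0 + ep0 --> x' s < 0"
  "ALL s t. t0 - ep0 < s & s < t0 & t0 < t & t < t0 + ep0 & x s = x t --> w * z t < w * z s" using cusp_order[OF rc] by blast
 define ep where "ep = min de ep0"
 have eps: "0 < ep" "ep <= de" "ep <= ep0" using dpos w(2) by (auto simp: ep_def)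
 have xs: "x' s > 0" if "t0 - ep < s" "s < t0" for s using w(3) that eps by auto
 have xt: "x' s < 0" if "t0 < s" "s < t0 + ep" for s using w(4) that eps by auto
 have order: "w * z t < w * z s" if "t0 - ep < s" "s < t0" "t0 < t" "t < t0 + ep" "x s = x t" for s t using w(5)[rule_format, of s t] that eps by auto
 have cols: "!!r. \<bar>r - t0\<bar> < ep ==> r ~= t0 ==> 0 < (x r - x t0) * (-1)"
  "EX e>0. ALL xi. 0 < (xi - x t0) * (-1) & \<bar>xi - x t0\<bar> < e --> (EX s. t0 - ep < s & s < t0 & x s = xi) & (EX t. t0 < t & t < t0 + ep & x t = xi)"
  using cusp_columns[OF z0 eps(1), of "-1"] rc xs xt by simp_all
 obtain e1 where e1: "e1 > 0" "!!xi. 0 < (xi - x t0) * (-1) ==> \<bar>xi - x t0\<bar> < e1 ==> (EX s. t0 - ep < s & s < t0 & x s = xi) & (EX t. t0 < t & t < t0 + ep & x t = xi)"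
  using cols(2) by blast
 obtain N where N: "open N" "D t0:N" "!!q. q:N ==> sh q = c + cusp_chart t0 de q" using sh unfolding eventually_nhds by blast
 from topological_tendstoD[OF D_tendsto N(1,2)] have "\<forall>\<^sub>F t in nhds t0. D t:N" .
 moreover from tendstoD[OF x_tendsto e1(1)] have "\<forall>\<^sub>F t in nhds t0. dist (x t) (x t0) < e1" .
 ultimately have "\<forall>\<^sub>F t in nhds t0. D t:N & dist (x t) (x t0) < e1" by (rule eventually_conj)
 then obtain d where d: "d > 0" "!!t. \<bar>t - t0\<bar> < d ==> D t:N & \<bar>x t - x t0\<bar> < e1"
  unfolding eventually_nhds_metric by (auto simp: dist_real_def)
 define s0 t1 where "s0 = t0 - de/2" and "t1 = t0 + de/2"
 define Js Jt where "Js = {t0 - de<..<t0}" and "Jt = {t0<..<t0 + de}"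
 have Js: "branch Js" and Jt: "branch Jt" using good_branch[OF gs] by (auto simp: Js_def Jt_def)
 have cc: "cf s0 = iota R (cf t1)" using cusp_color[OF z0 gs, of s0 t1] rc dpos by (simp add: s0_def t1_def)
 have cl: "cf t1:rcarrier R" using cf_closed good_right(4)[OF gs, of t1 t1] dpos by (simp add: t1_def)
 have gl: "x' s0 > 0" "x' t1 < 0" proof -
  show "x' s0 > 0" using good_left(2)[OF gs, of s0 "t0 - ep/2"] xs[of "t0 - ep/2"] eps by (simp add: s0_def)
  have "~ x' t1 > 0" using good_right(2)[OF gs, of t1 "t0 + ep/2"] xt[of "t0 + ep/2"] eps by (simp add: t1_def)
  moreover have "x' t1 ~= 0" using good_right(4)[OF gs, of t1 t1] dpos by (simp add: t1_def brk_def)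
  ultimately show "x' t1 < 0" by simp
 qed
 have gg: "g s0 = - act R (cf t1)" "g t1 = act R (cf t1)" using gl act_iota[OF rackR cl] by (auto simp: gsym_def cc)
 \<comment> \<open>The colour of the upper branch: just above it the shadow is the bare constant
   \<open>c\<close>.\<close>
 define A where "A = app (- c) (if w = 1 then cf s0 else cf t1)"
 have "EX c0>0. ALL b. 0 < b & b < c0 --> app (- sh (x t, z t + b)) (cf t) = A" if t: "t ~= t0" "\<bar>t - t0\<bar> < min d ep" for t proof -
  have "0 < (x t - x t0) * (-1)" by (rule cols(1)) (use t in auto)
  then obtain s' t' where p: "t0 - ep < s'" "s' < t0" "x s' = x t" "t0 < t'" "t' < t0 + ep" "x t' = x t" using e1(2)[of "x t"] d(2)[of t] t by auto
  have pJ: "s':Js" "t':Jt" using p eps by (auto simp: Js_def Jt_def)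
  have tt: "t = s' | t = t'"
   using branch_inj[OF Js pJ(1), of t] branch_inj[OF Jt pJ(2), of t] p t eps by (cases "t < t0") (auto simp: Js_def Jt_def abs_less_iff)
  have wo: "w * z t' < w * z s'" using order[of s' t'] p by simp
  obtain e where e: "e > 0" "!!b. 0 < b ==> b < e ==> (x t, z t + b):N" using point_above[OF N(1), of t] d(2)[of t] t by auto
  have bs: "below Js (x t, z t + b) \<longleftrightarrow> z t + b < z s'" "below Jt (x t, z t + b) \<longleftrightarrow> z t + b < z t'" for b
   using below_at[OF Js pJ(1), of "(x t, z t + b)"] below_at[OF Jt pJ(2), of "(x t, z t + b)"] p by auto
  have shv: "sh (x t, z t + b) = c + ((if z t + b < z s' then g s0 else 0) + (if z t + b < z t' then g t1 else 0))" if "0 < b" "b < e" for b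
   using N(3)[OF e(2)[OF that]] bs by (simp add: cusp_chart_def two_def Js_def Jt_def s0_def t1_def)
  have cs: "cf s' = cf s0" "cf t' = cf t1" using good_left(1)[OF gs, of s' s0] good_right(1)[OF gs, of t' t1] p eps by (auto simp: s0_def t1_def)
  have io: "app (act R (cf t1)) (cf t1) = cf s0" "app (- act R (cf t1)) (cf s0) = cf t1" proof -
   show 1: "app (act R (cf t1)) (cf t1) = cf s0" using cl cc by (simp add: app_act[OF rackR cl])
   show "app (- act R (cf t1)) (cf s0) = cf t1" unfolding 1[symmetric] by simp
  qed
  have zne: "z s' ~= z t'" using wo by auto
  have "app (- sh (x t, z t + b)) (cf t) = A" if b: "0 < b" "b < min e \<bar>z s' - z t'\<bar>" for b proof (cases "w = 1")
   case True
   hence zz: "z t' < z s'" using wo by simp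
   show ?thesis proof (cases "t = s'")
    case ts: True
    thus ?thesis using shv[of b] b zz True cs by (simp add: A_def)
   next
    case False
    hence "t = t'" using tt by simp
    thus ?thesis using shv[of b] b zz True cs by (simp add: A_def gg minus_add io del: add_uminus_conv_diff)
   qed
  next
   case False
   hence zz: "z s' < z t'" and w1: "w ~= 1" using wo w(1) by auto
   show ?thesis proof (cases "t = t'")
    case ts: True
    thus ?thesis using shv[of b] b zz w1 cs by (simp add: A_def)
   next
    case False
    hence "t = s'" using tt by simp
    thus ?thesis using shv[of b] b zz w1 cs by (simp add: A_def gg minus_add io del: add_uminus_conv_diff)
   qed
  qed
  moreover have "min e \<bar>z s' - z t'\<bar> > 0" using e(1) zne by simp
  ultimately show ?thesis by blast
 qed
 thus ?thesis using d(1) eps(1) by (intro exI[of _ "min d ep"] conjI exI[of _ A]) auto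
qed

text \<open>Where \<open>rear\<close> fails the only possible break is a left cusp, where colours do
  not change. A singular \<open>t0\<close> is left out because the value of \<open>cf\<close> at a
  break is arbitrary.\<close>

lemma front_const:
 assumes nr: "~ rear t0" shows "EX d>0. EX A. ALL t. (t ~= t0 | D t0 ~: sing) & \<bar>t - t0\<bar> < d --> cf t = A" proof -
 obtain de where gs: "good t0 de" "de > 0" using good_exists by blast
 show ?thesis proof (cases "brk t0")
  case False
  thus ?thesis using good_both(1)[OF gs(1) False] gs(2) by blast
 next
  case True
  hence z0: "x' t0 = 0" "~ rcusp t0" "D t0:sing" using nr singI by (auto simp: brk_def rear_def)
  have "cf t = cf (t0 + de/2)" if t: "t ~= t0" "\<bar>t - t0\<bar> < de" for t proof (cases "t < t0")
   case True
   thus ?thesis using cusp_color[OF z0(1) gs(1), of t "t0 + de/2"] z0(2) t gs(2) by (auto simp: abs_less_iff)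
  next
   case False
   thus ?thesis using good_right(1)[OF gs(1), of t "t0 + de/2"] t gs(2) by (auto simp: abs_less_iff)
  qed
  hence "ALL t. (t ~= t0 | D t0 ~: sing) & \<bar>t - t0\<bar> < de --> cf t = cf (t0 + de/2)" using z0(3) by metis
  thus ?thesis using gs(2) by (intro exI[of _ de] conjI exI[of _ "cf (t0 + de/2)"])
 qed
qed

end

subsection \<open>The peripheral functional of a colouring\<close>

context viewed
begin

lemma vert_add:
 assumes "0 < a" "a <= u" "0 < b" "b <= u" "0 < c" "c <= u" shows "HE X (push K a t) [vert t a b, vert t b c] [vert t a c] (push K c t)" proof -
 let ?S = "(%c. push K c t) ` {0<..u}"
 have "?S = (%p. K t + p) ` (({0} \<times> {0} \<times> {0<..u}))" by (auto simp: push_def image_iff)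
 hence cv: "convex ?S" by (simp only:) (intro convex_translation convex_Times convex_singleton convex_real_interval)
 have s: "push K a t:?S" if "0 < a" "a <= u" for a using that by auto
 have v: "path_image (vert t a b) <= ?S" if "0 < a" "a <= u" "0 < b" "b <= u" for a b
  using closed_segment_subset[OF s[OF that(1,2)] s[OF that(3,4)] cv] by (simp add: vert_def)
 show ?thesis by (rule HE_convex[OF cv]) (use v assms s push_X in auto)
qed

lemma slide_add: assumes "0 < c" "c <= u" shows "HE X (push K c r) [slide (push K c) r s, slide (push K c) s t] [slide (push K c) r t] (push K c t)"
proof -
 have c: "continuous_on UNIV (push K c)" using cont_push[of UNIV "%_. c" "%t. t"] by (simp add: eta_contract_eq)
 have "HE UNIV r [linepath r s, linepath s t] [linepath r t] t" by (rule HE_convex[OF convex_UNIV]) auto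
 from HE_image[OF c _ this, of X] push_X[OF assms] show ?thesis by (auto simp: slide_def)
qed

lemma slide_loop: assumes "0 < c" "c <= u" shows "HE X (push K c r) [slide (push K c) r r] [] (push K c r)" proof -
 have c: "continuous_on UNIV (push K c)" using cont_push[of UNIV "%_. c" "%t. t"] by (simp add: eta_contract_eq)
 have "HE UNIV r [linepath r r] [] r" by (rule HE_convex[OF convex_UNIV]) auto
 from HE_image[OF c _ this, of X] push_X[OF assms] show ?thesis by (auto simp: slide_def)
qed

lemma slide_shift: "slide B (s + 1) (t + 1) = slide B s t" proof -
 have "B (r + 1) = B r" for r using per(7)[of r 1] by (simp add: push_def)
 moreover have "linepath (s + 1) (t + 1) r = linepath s t r + 1" for r by (simp add: linepath_def algebra_simps)
 ultimately show ?thesis by (simp add: slide_def fun_eq_iff)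
qed

end

locale shaded = coloring + viewed x y z x' y' u M for u M +
 fixes sh :: "real * real => 'a sym" and W :: "(real => p3) => 'a sym"
 assumes sh_adm: "p ~: sing ==> adm sh p"
  and sh_cross: "over s t ==> EX de c. good s de & good t de & (\<forall>\<^sub>F q in nhds (D t). sh q = c + cross_chart s t de q)"
  and sh_cusp: "x' t = 0 ==> EX de c. good t de & (\<forall>\<^sub>F q in nhds (D t). sh q = c + cusp_chart t de q)"
  and W_HE: "HE X a xs ys b ==> sum_list (map W xs) = sum_list (map W ys)"
  and W_autos: "pchain X a xs b ==> sum_list (map W xs):autos R"
  and W_Uf: "path ga ==> path_image ga <= Uf ==> W ga = 0"
  and W_Ub: "path ga ==> path_image ga <= Ub ==> W ga = - sh (pl (pathstart ga)) + sh (pl (pathfinish ga))"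
begin

lemma W_Uf_list: "pchain Uf a xs b ==> sum_list (map W xs) = 0" proof (induction xs arbitrary: a)
 case (Cons ga xs)
 thus ?case using Cons.IH[of "pathfinish ga"] W_Uf[of ga] by simp
qed simp

lemma W_vert: assumes "0 < a" "a <= u" "0 < b" "b <= u" "0 < c" "c <= u" shows "W (vert t a b) + W (vert t b c) = W (vert t a c)"
 using W_HE[OF vert_add[OF assms, of t]] by simp

lemma W_vert_loop: assumes "0 < a" "a <= u" shows "W (vert t a a) = 0"
 using W_vert[OF assms assms assms, of t] add_left_cancel[of "W (vert t a a)" "W (vert t a a)" 0] by simp

lemma W_vert_rev: assumes "0 < a" "a <= u" "0 < b" "b <= u" shows "W (vert t b a) = - W (vert t a b)"
 using W_vert[OF assms assms(1,2), of t] W_vert_loop[OF assms(1,2), of t] minus_unique[of "W (vert t a b)" "W (vert t b a)"] by simp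

lemma W_slide: assumes "0 < c" "c <= u" shows "W (slide (push K c) r s) + W (slide (push K c) s t) = W (slide (push K c) r t)"
 using W_HE[OF slide_add[OF assms, of r s t]] by simp

lemma W_slide_loop: assumes "0 < c" "c <= u" shows "W (slide (push K c) r r) = 0" using W_HE[OF slide_loop[OF assms, of r]] by simp

lemma W_slide_rev: assumes "0 < c" "c <= u" shows "W (slide (push K c) t s) = - W (slide (push K c) s t)"
 using W_slide[OF assms, of s t s] W_slide_loop[OF assms, of s] minus_unique[of "W (slide (push K c) s t)" "W (slide (push K c) t s)"] by simp

text \<open>The colour of the branch, transported from just above it to the push-off at height
  \<open>u\<close>.\<close>

definition val :: "real => 'a" where "val t = app (W (vert t (SOME a. low t a) u)) (cf t)"

lemma lowD: "low t a ==> 0 < a & a <= u" by (simp add: low_def)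

lemma val_low: assumes "low t a" shows "val t = app (W (vert t a u)) (cf t)" proof -
 define b where "b = (SOME a. low t a)"
 have b: "low t b" unfolding b_def by (rule someI[of _ a]) (rule assms)
 note ab = lowD[OF assms] lowD[OF b]
 have "EX c. low t c & c = max a b" using assms b by (auto simp: max_def)
 hence "path_image (vert t a b) <= Uf" using vert_low[of t "max a b" a b] ab by auto
 hence "W (vert t a b) = 0" by (rule W_Uf[OF vert_ends(3)])
 moreover have "W (vert t a b) + W (vert t b u) = W (vert t a u)" using W_vert ab u by blast
 ultimately show ?thesis by (simp add: val_def b_def)
qed

lemma val_high:
 assumes "low t c" "0 < ze" "ze <= u" shows "val t = app (W (vert t ze u)) (app (W (vert t c ze)) (cf t))"
 using val_low[OF assms(1)] W_vert[of c ze u t] lowD[OF assms(1)] assms u by (metis app_plus order_refl)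

definition dom :: "real => real => real => bool" where
 "dom t0 d t \<longleftrightarrow> (t ~= t0 | D t0 ~: sing) & \<bar>t - t0\<bar> < d"

text \<open>Values are compared at a height \<open>ze\<close> where the strip above the branch is
  wholly in front or wholly behind. In front, transport is trivial and the colour constant; behind,
  transport is the change of the shadow, and \<open>above_cross\<close> and
  \<open>above_cusp\<close> give the constant \<open>A\<close>.\<close>

lemma slide_local: "EX d>0. ALL t t'. dom t0 d t & dom t0 d t' --> app (W (slide B t t')) (val t) = val t'" proof -
 obtain de ze where n: "de > 0" "ze > 0" "ze <= u" "!!t c. \<bar>t - t0\<bar> < de ==> 0 < c ==> c <= ze ==> push K c t:(if rear t0 then Ub else Uf)"
  using near_side[OF open_UNIV UNIV_I, of t0] by blast
 \<comment> \<open>Reduction to the row at height \<open>ze\<close>: it suffices that the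
   transported colours \<open>ka\<close> are carried into each other along this row.\<close>
 have red: "EX d>0. ALL t t'. dom t0 d t & dom t0 d t' --> app (W (slide B t t')) (val t) = val t'"
  if k: "d1 > 0" "!!t. dom t0 d1 t ==> EX c. low t c & c <= ze & app (W (vert t c ze)) (cf t) = ka t"
   "!!t t'. dom t0 d1 t ==> dom t0 d1 t' ==> app (W (slide (push K ze) t t')) (ka t) = ka t'" for d1 ka proof -
  have "app (W (slide B t t')) (val t) = val t'" if d: "dom t0 d1 t" "dom t0 d1 t'" for t t' proof -
   have v: "val t = app (W (vert t ze u)) (ka t)" if "dom t0 d1 t" for t using k(2)[OF that] val_high[OF _ n(2,3)] by metis
   have "W (slide B t t') = W (vert t u ze) + W (slide (push K ze) t t') + W (vert t' ze u)"
    using W_HE[OF slide_lower[OF n(2,3), of t t']] by (simp add: add.assoc)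
   thus ?thesis using W_vert_rev[OF n(2,3) u order_refl, of t] by (simp add: v[OF d(1)] v[OF d(2)] k(3)[OF d])
  qed
  thus ?thesis using k(1) by blast
 qed
 have path: "path (slide (push K ze) t t')" "path (vert t c ze)" for t t' c by (simp_all add: slide_props)
 have seg: "\<bar>r - t0\<bar> < de" if "r:closed_segment t t'" "\<bar>t - t0\<bar> < de" "\<bar>t' - t0\<bar> < de" for r t t'
  using that by (auto simp: closed_segment_eq_real_ivl abs_less_iff split: if_splits)
 have si: "path_image (slide (push K ze) t t') <= (if rear t0 then Ub else Uf)" if "\<bar>t - t0\<bar> < de" "\<bar>t' - t0\<bar> < de" for t t'
  unfolding slide_props using n(4)[OF seg[OF _ that] n(2) order_refl] by blast
 have vi: "path_image (vert t c ze) <= (if rear t0 then Ub else Uf)" if "\<bar>t - t0\<bar> < de" "0 < c" "c <= ze" for t c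
  unfolding vert_image using n(4)[OF that(1)] that by (auto simp: closed_segment_eq_real_ivl)
 show ?thesis proof (cases "rear t0")
  case False
  obtain d A where d: "d > 0" "!!t. (t ~= t0 | D t0 ~: sing) ==> \<bar>t - t0\<bar> < d ==> cf t = A" using front_const[OF False] by blast
  show ?thesis proof (rule red[of "min d de" "%_. A"])
   fix t assume t: "dom t0 (min d de) t"
   obtain c where c: "low t c" "c <= ze" using low_exists[OF n(2)] by blast
   have "W (vert t c ze) = 0" using W_Uf[OF path(2)] vi[of t c] t False lowD[OF c(1)] c(2) by (simp add: dom_def)
   thus "EX c. low t c & c <= ze & app (W (vert t c ze)) (cf t) = A" using c d(2)[of t] t by (auto simp: dom_def)
  next
   fix t t' assume "dom t0 (min d de) t" "dom t0 (min d de) t'"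
   hence "W (slide (push K ze) t t') = 0" using W_Uf[OF path(1)] si[of t t'] False by (simp add: dom_def)
   thus "app (W (slide (push K ze) t t')) A = A" by simp
  qed (use d(1) n(1) in simp)
 next
  case True
  have "EX d>0. EX A. ALL t. t ~= t0 & \<bar>t - t0\<bar> < d --> (EX c0>0. ALL b. 0 < b & b < c0 --> app (- sh (x t, z t + b)) (cf t) = A)"
  proof (cases "EX s. over s t0")
   case True
   then obtain s where s: "over s t0" by blast
   from sh_cross[OF s] obtain de' c where "good s de'" "good t0 de'" "\<forall>\<^sub>F q in nhds (D t0). sh q = c + cross_chart s t0 de' q" by blast
   from above_cross[OF s this] show ?thesis .
  next
   case False
   hence rc: "rcusp t0" using \<open>rear t0\<close> by (simp add: rear_def)
   hence "x' t0 = 0" by (simp add: rcusp_def)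
   from sh_cusp[OF this] obtain de' c where "good t0 de'" "\<forall>\<^sub>F q in nhds (D t0). sh q = c + cusp_chart t0 de' q" by blast
   from above_cusp[OF rc this] show ?thesis .
  qed
  then obtain d A where d: "d > 0" "!!t. t ~= t0 ==> \<bar>t - t0\<bar> < d ==> EX c0>0. ALL b. 0 < b & b < c0 --> app (- sh (x t, z t + b)) (cf t) = A" by blast
  have s: "D t0:sing" using True singI(1)[of t0] singI(2)[of _ t0] by (auto simp: rear_def over_def rcusp_def)
  show ?thesis proof (rule red[of "min d de" "%t. app (sh (x t, z t + ze)) A"])
   fix t assume t: "dom t0 (min d de) t"
   obtain c0 where c0: "c0 > 0" "!!b. 0 < b ==> b < c0 ==> app (- sh (x t, z t + b)) (cf t) = A" using d(2)[of t] t s by (auto simp: dom_def)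
   obtain c where c: "low t c" "c <= min ze (c0/2)" using low_exists[of "min ze (c0/2)"] n(2) c0(1) by auto
   have "W (vert t c ze) = - sh (x t, z t + c) + sh (x t, z t + ze)" using W_Ub[OF path(2)] vi[of t c] t True lowD[OF c(1)] c(2) by (simp add: dom_def)
   thus "EX c. low t c & c <= ze & app (W (vert t c ze)) (cf t) = app (sh (x t, z t + ze)) A" using c c0(2)[of c] c0(1) lowD[OF c(1)] by (intro exI[of _ c]) simp
  next
   fix t t' assume "dom t0 (min d de) t" "dom t0 (min d de) t'"
   hence "W (slide (push K ze) t t') = - sh (x t, z t + ze) + sh (x t', z t' + ze)" using W_Ub[OF path(1)] si[of t t'] True by (simp add: dom_def slide_props)
   thus "app (W (slide (push K ze) t t')) (app (sh (x t, z t + ze)) A) = app (sh (x t', z t' + ze)) A" by simp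
  qed (use d(1) n(1) in simp)
 qed
qed

lemma label_exists: "EX w. EX d>0. ALL t. dom t0 d t --> app (W (slide B t t0)) (val t) = w" proof -
 obtain d where d: "d > 0" "!!t t'. dom t0 d t ==> dom t0 d t' ==> app (W (slide B t t')) (val t) = val t'" using slide_local[of t0] by blast
 define t1 where "t1 = t0 + d/2"
 have t1: "dom t0 d t1" using d(1) by (simp add: dom_def t1_def)
 have "app (W (slide B t t0)) (val t) = app (W (slide B t1 t0)) (val t1)" if "dom t0 d t" for t
  using W_slide[OF u order_refl, of t t1 t0] d(2)[OF that t1] by (metis app_plus)
 thus ?thesis using d(1) by blast
qed

text \<open>Extends \<open>val\<close> across singular parameters by transport from nearby ones, so
  that \<open>label_slide\<close> can treat all parameters alike.\<close>

definition label :: "real => 'a" where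
 "label t0 = (SOME w. EX d>0. ALL t. dom t0 d t --> app (W (slide B t t0)) (val t) = w)"

lemma label: "EX d>0. ALL t. dom t0 d t --> app (W (slide B t t0)) (val t) = label t0" unfolding label_def by (rule someI_ex) (rule label_exists)

lemma label_regular: "D t ~: sing ==> label t = val t" proof -
 assume r: "D t ~: sing"
 obtain d where "d > 0" "!!r. dom t d r ==> app (W (slide B r t)) (val r) = label t" using label by blast
 from this(2)[of t] this(1) r show ?thesis using W_slide_loop[OF u order_refl, of t] by (simp add: dom_def)
qed

lemma label_slide: "app (W (slide B s t)) (label s) = label t" proof -
 define P where "P s t \<longleftrightarrow> app (W (slide B s t)) (label s) = label t" for s t
 have tr: "P a b ==> P b c ==> P a c" for a b c unfolding P_def using W_slide[OF u order_refl, of a b c] by (metis app_plus)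
 have sy: "P a b ==> P b a" for a b unfolding P_def using W_slide_rev[OF u order_refl, of a b] by (metis app_uminus(1))
 have loc: "EX d>0. ALL t. \<bar>t - t0\<bar> < d --> P t0 t" for t0 proof -
  obtain d where d: "d > 0" "!!t. dom t0 d t ==> app (W (slide B t t0)) (val t) = label t0" using label by blast
  have "P t0 t" if t: "\<bar>t - t0\<bar> < d" for t proof -
   obtain e where e: "e > 0" "!!r. dom t e r ==> app (W (slide B r t)) (val r) = label t" using label by blast
   \<comment> \<open>A sample point in the domains around both \<open>t0\<close> and
     \<open>t\<close>; being different from both, it is admissible even if they are
     singular.\<close>
   obtain r where r: "r ~= t0" "r ~= t" "\<bar>r - t\<bar> < e" "\<bar>r - t0\<bar> < d" proof -
    define q where "q = min e (d - \<bar>t - t0\<bar>)"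
    have "q > 0" "q <= e" "q <= d - \<bar>t - t0\<bar>" using e(1) t by (auto simp: q_def)
    moreover define h where "h = q / 2"
    ultimately have h: "h > 0" "h < e" "h < d - \<bar>t - t0\<bar>" by auto
    show thesis proof (cases "t + h = t0")
     case True
     thus thesis using that[of "t + h/2"] h by (simp add: abs_less_iff abs_if split: if_splits)
    next
     case False
     thus thesis using that[of "t + h"] h by (auto simp: abs_less_iff abs_if split: if_splits)
    qed
   qed
   have 1: "app (W (slide B r t)) (val r) = label t" by (rule e(2)) (use r in "simp add: dom_def")
   have 2: "app (W (slide B r t0)) (val r) = label t0" by (rule d(2)) (use r in "simp add: dom_def")
   show ?thesis unfolding P_def using W_slide[OF u order_refl, of r t0 t] 1 2 by (metis app_plus)
  qed
  thus ?thesis using d(1) by blast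
 qed
 have le: "P s t" if "s <= t" for s t proof (rule Bolzano[OF that])
  show "P a c" if "P a b" "P b c" "a <= b" "b <= c" for a b c using tr that by blast
  fix t0
  obtain d where d: "d > 0" "!!t. \<bar>t - t0\<bar> < d ==> P t0 t" using loc by blast
  have "P a b" if "a <= t0 & t0 <= b & b - a < d" for a b using tr[OF sy[OF d(2)[of a]] d(2)[of b]] that by auto
  thus "EX d>0. ALL a b. a <= t0 & t0 <= b & b - a < d --> P a b" using d(1) by blast
 qed
 have "P s t" using le[of s t] sy[OF le[of t s]] by (cases "s <= t") auto
 thus ?thesis by (simp add: P_def)
qed

lemma near_regular: "0 < d ==> EX r. \<bar>r - t\<bar> < d & D r ~: sing" proof -
 assume d: "0 < d"
 obtain e where e: "e > 0" "!!r. r ~= t ==> \<bar>r - t\<bar> < e ==> D r ~: sing" using reg_interval[of t] by blast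
 show ?thesis using e(2)[of "t + min d e / 2"] e(1) d by (intro exI[of _ "t + min d e / 2"]) auto
qed

lemma label_closed: "label t:rcarrier R" proof -
 obtain r where r: "D r ~: sing" using near_regular[of 1 t] by auto
 obtain a where a: "low r a" using low_exists[OF u] by blast
 from W_autos[OF vert_chain(2)] lowD[OF a] have v: "W (vert r a u):autos R" by simp
 have "val r:rcarrier R" unfolding val_low[OF a] autos_carrier[OF rackR v] by (rule cf_closed[OF regD(2)[OF r]])
 hence l: "label r:rcarrier R" using label_regular[OF r] by simp
 from W_autos[OF slide_chain] have "W (slide B r t):autos R" by simp
 thus ?thesis using label_slide[of r t] l autos_carrier[OF rackR] by metis
qed

lemma label_per: "label (t + 1) = label t" proof -
 obtain r where r: "D r ~: sing" using near_regular[of 1 t] by auto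
 have r1: "D (r + 1) ~: sing" using r per(6)[of r 1] by simp
 obtain a where a: "low r a" using low_exists[OF u] by blast
 have p: "push K c (r + 1) = push K c r" for c using per(7)[of r 1] by (simp add: push_def)
 have a1: "low (r + 1) a" using a per(1,3)[of r 1] by (simp add: low_def)
 have "val (r + 1) = val r" unfolding val_low[OF a] val_low[OF a1] by (simp add: vert_def p cf_per)
 hence "label (r + 1) = label r" using label_regular r r1 by simp
 thus ?thesis using label_slide[of "r + 1" "t + 1"] label_slide[of r t] by (simp add: slide_shift)
qed

lemma W_reverse: assumes "path ga" "path_image ga <= X" shows "W (reversepath ga) = - W ga"
 using W_HE[OF HE_rinv[OF assms]] by (simp add: minus_unique)

text \<open>At a regular parameter \<open>mer_split\<close> leaves one passage behind the branch,
  with holonomy \<open>- g r\<close>. Conjugation by the vertical path turns the colour into the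
  label, and sliding reaches all other parameters.\<close>

lemma W_merid: "W (merid K dK u t) = act R (label t)" proof -
 obtain r where r: "D r ~: sing" using near_regular[of 1 t] by auto
 have nz: "x' r ~= 0" using regD(1)[OF r] .
 obtain de where d: "de > 0" "branch {r - de<..<r + de}" using branch_near[OF nz] by blast
 have "\<forall>\<^sub>F q in nhds (D r). sh q = sh (D r) + (if below {r - de<..<r + de} q then g r else 0)"
  using sh_adm[OF r, unfolded adm_def, THEN conjunct2, THEN spec, THEN spec, THEN mp, THEN mp, THEN mp, OF HOL.refl d(2)] d(1) by simp
 then obtain N where N: "open N" "D r:N" "!!q. q:N ==> sh q = sh (D r) + (if below {r - de<..<r + de} q then g r else 0)"
  unfolding eventually_nhds by blast
 obtain e where e: "e > 0" "ball (D r) e <= N" using openE[OF N(1,2)] .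
 have rin: "r:{r - de<..<r + de}" using d(1) by simp
 have shc: "sh (x r, z r + c) = sh (D r) + (if c < 0 then g r else 0)" if "\<bar>c\<bar> < e" for c proof -
  have "dist (D r) (x r, z r + c) = \<bar>c\<bar>" by (simp add: D_def dist_Pair_Pair dist_real_def)
  hence "(x r, z r + c):N" using e(2) that by auto
  thus ?thesis using N(3) below_at[OF d(2) rin, of "(x r, z r + c)"] by simp
 qed
 obtain a dn up where a: "0 < a" "a <= e/2" "a <= u" "!!c. 0 < \<bar>c\<bar> ==> \<bar>c\<bar> <= a ==> (x r, z r + c) ~: range D"
  and dn: "pchain Uf (push K a r) [dn] (push K (- a) r)" and up: "pchain Ub (push K (- a) r) [up] (push K a r)"
  and h: "HE X (B r) [mer r] [vert r u a, dn, up, vert r a u] (B r)"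
  using mer_split[OF r half_gt_zero[OF e(1)]] by (elim exE conjE) (rule that; blast)
 have low: "low r a" using a by (simp add: low_def)
 have "W dn = 0" using W_Uf dn by simp
 moreover have "W up = - (sh (D r) + g r) + sh (D r)" using W_Ub[of up] up shc[of a] shc[of "- a"] a e(1) by simp
 hence "W up = - g r" by (simp add: minus_add add.assoc del: add_uminus_conv_diff)
 ultimately have "W (mer r) = - W (vert r a u) + (- g r + W (vert r a u))"
  using W_HE[OF h] W_vert_rev[OF a(1,3) u order_refl, of r] by (simp add: add.assoc)
 moreover have "W (mer r) = (if x' r > 0 then W (merid K dK u r) else - W (merid K dK u r))"
  using W_reverse[OF path_merid merid_X] by (simp add: mer_def)
 moreover have v: "W (vert r a u):autos R" using W_autos[OF vert_chain(2)[OF a(1,3)]] by simp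
 have "- W (vert r a u) + act R (cf r) + W (vert r a u) = act R (label r)"
  using act_conj[OF rackR v cf_closed[OF regD(2)[OF r]]] label_regular[OF r] val_low[OF low] by simp
 ultimately have m: "W (merid K dK u r) = act R (label r)"
  by (cases "x' r > 0") (auto simp: gsym_def add.assoc, metis minus_add minus_minus add.assoc)
 from W_autos[OF slide_chain] have s: "W (slide B r t):autos R" by simp
 have "W (slide B r t) + W (merid K dK u t) = W (merid K dK u r) + W (slide B r t)" using W_HE[OF slide_merid[of r t]] by simp
 hence "W (merid K dK u t) = - W (slide B r t) + W (merid K dK u r) + W (slide B r t)" by (metis add.assoc minus_add_cancel)
 also have "... = act R (label t)" unfolding m act_conj[OF rackR s label_closed] label_slide ..
 finally show ?thesis .
qed

definition ev :: "real => (real => p3) list => 'a" where "ev t xs = app (sum_list (map W xs)) (label t)"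

text \<open>The product rule is \<open>act_conj\<close>: the meridian conjugated by
  \<open>ys\<close> acts as \<open>act R (ev t ys)\<close>.\<close>

theorem peripheral_ev: "peripheral K dK u v R ev" unfolding peripheral_def proof (intro conjI allI impI)
 fix t xs assume p: "pchain X (B t) xs v"
 show "ev t xs:rcarrier R" using autos_carrier[OF rackR W_autos[OF p]] label_closed by (simp add: ev_def)
 show "ev (t + 1) xs = ev t xs" by (simp add: ev_def label_per)
 fix s show "ev s (slide B s t # xs) = ev t xs" by (simp add: ev_def label_slide)
next
 fix t xs ys assume "HE X (B t) xs ys v"
 from W_HE[OF this] show "ev t xs = ev t ys" by (simp add: ev_def)
next
 fix s t xs ys assume p: "pchain X (B s) xs v" "pchain X (B t) ys v"
 have "sum_list (map W (rl ys @ ys)) = sum_list (map W [])" using W_HE[OF HE_rl_left[OF p(2)]] .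
 hence "sum_list (map W (rl ys)) + sum_list (map W ys) = 0" by simp
 hence r: "sum_list (map W (rl ys)) = - sum_list (map W ys)" by (metis add_eq_0_iff2)
 note wy = W_autos[OF p(2)]
 have "sum_list (map W (rl ys @ merid K dK u t # ys)) = - sum_list (map W ys) + act R (label t) + sum_list (map W ys)"
  by (simp add: r W_merid add.assoc)
 also have "... = act R (ev t ys)" unfolding act_conj[OF rackR wy label_closed] by (simp add: ev_def)
 finally have "ev s (xs @ rl ys @ merid K dK u t # ys) = app (act R (ev t ys)) (ev s xs)" by (simp add: ev_def)
 also have "... = rmul R (ev s xs) (ev t ys)" proof -
  have "ev t ys:rcarrier R" "ev s xs:rcarrier R" using autos_carrier[OF rackR W_autos] p label_closed by (simp_all add: ev_def)
  thus ?thesis by (simp add: app_act[OF rackR])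
 qed
 finally show "ev s (xs @ rl ys @ merid K dK u t # ys) = rmul R (ev s xs) (ev t ys)" .
qed

lemma ev_standard:
 assumes "D t ~: sing" "low t a" shows "ev t (vert t u a # sig (push K a t)) = cf t" proof -
 have a: "0 < a" "a <= u" using lowD[OF assms(2)] by auto
 have "sum_list (map W (sig (push K a t))) = 0" by (rule W_Uf_list[OF sig_pchain[OF low_Uf[OF assms(2) a(1) order_refl]]])
 thus ?thesis using label_regular[OF assms(1)] val_low[OF assms(2)] W_vert_rev[OF a u order_refl, of t] by (simp add: ev_def)
qed

end

locale colored = coloring + viewed x y z x' y' u M for u M
begin

theorem peripheral_exists:
 "EX ev. peripheral K dK u v R ev & (ALL t a. D t ~: sing --> low t a --> ev t (vert t u a # sig (push K a t)) = cf t)" proof -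
 obtain sh where sh: "!!p. sh p:autos R" "!!p. p ~: sing ==> adm sh p"
  "!!s t. over s t ==> EX de c. good s de & good t de & (\<forall>\<^sub>F q in nhds (D t). sh q = c + cross_chart s t de q)"
  "!!t. x' t = 0 ==> EX de c. good t de & (\<forall>\<^sub>F q in nhds (D t). sh q = c + cusp_chart t de q)" using shadow by blast
 obtain W where W: "!!a xs ys b. HE X a xs ys b ==> sum_list (map W xs) = sum_list (map W ys)"
  "!!a xs b. pchain X a xs b ==> sum_list (map W xs):autos R"
  "!!ga. path ga ==> path_image ga <= Uf ==> W ga = 0"
  "!!ga. path ga ==> path_image ga <= Ub ==> W ga = - sh (pl (pathstart ga)) + sh (pl (pathfinish ga))" using shadow_holonomy[OF sh(1,2)] by blast
 interpret S: shaded x y z x' y' R cf u M sh W by unfold_locales (use sh W in blast)+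
 show ?thesis using S.peripheral_ev S.ev_standard by blast
qed

end

section \<open>Universality\<close>

context viewed
begin

text \<open>Down to a height from which the viewer is in plain sight, then straight on. The value of
  a functional on this path will be the colour of the branch.\<close>

definition std :: "real => real => (real => p3) list" where "std t a = vert t u a # sig (push K a t)"

lemma lowI: "low t a ==> 0 < a" "low t a ==> a <= u" by (simp_all add: low_def)

lemma std_pchain: assumes "push K a t:Uf" "0 < a" "a <= u" shows "pchain X (B t) (std t a) v"
 using Uf_X[OF sig_pchain[OF assms(1)]] vert_X[OF u order_refl assms(2,3)] by (simp add: std_def)

lemma low_pchain: "low t a ==> pchain X (B t) (std t a) v" by (rule std_pchain) (auto intro: low_Uf lowI)

lemma std_raise:
 assumes b: "0 < b" "b <= u" and a: "0 < a" "a <= u" and i: "path_image (vert t b a) <= Uf" shows "HE X (B t) (std t b) (std t a) v" proof -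
 have f: "push K a t:Uf" "push K b t:Uf" using i pathstart_in_path_image[of "vert t b a"] pathfinish_in_path_image[of "vert t b a"] by auto
 have 1: "HE X (push K b t) (sig (push K b t)) ([vert t b a] @ sig (push K a t)) v"
  by (rule HE_Uf) (use sig_pchain[OF f(1)] sig_pchain[OF f(2)] i in auto)
 have 2: "HE X (B t) ([vert t u b] @ sig (push K b t)) ([vert t u b] @ [vert t b a] @ sig (push K a t)) v"
  by (rule HE_append[OF HE_refl 1]) (use vert_X[OF u order_refl b] push_X[OF b] in simp)
 have 3: "HE X (B t) ([vert t u b, vert t b a] @ sig (push K a t)) ([vert t u a] @ sig (push K a t)) v"
  by (rule HE_append[OF vert_add[OF u order_refl b a] HE_refl]) (rule Uf_X[OF sig_pchain[OF f(1)]])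
 show ?thesis using HE_trans[OF 2] 3 by (simp add: std_def)
qed

lemma std_HE: assumes "low t a" "0 < b" "b <= a" shows "HE X (B t) (std t b) (std t a) v"
 by (rule std_raise) (use lowI[OF assms(1)] assms vert_low[OF assms(1), of b a] in auto)

lemma seg_off:
 assumes "!!c. min c1 c2 <= c ==> c <= max c1 c2 ==> (w, c) ~: range D" shows "closed_segment (w, y1, c1) (w, y2, c2) <= Uf Int Ub" proof
 fix p assume "p:closed_segment (w, y1, c1) (w, y2, c2)"
 then obtain r where r: "0 <= r" "r <= 1" "p = (1 - r) *\<^sub>R (w, y1, c1) + r *\<^sub>R (w, y2, c2)" by (auto simp: in_segment)
 have "(1 - r) * c1 + r * c2:closed_segment c1 c2" using r by (auto simp: in_segment)
 hence "min c1 c2 <= (1 - r) * c1 + r * c2 & (1 - r) * c1 + r * c2 <= max c1 c2" by (auto simp: closed_segment_eq_real_ivl split: if_splits)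
 moreover have "pl p = (w, (1 - r) * c1 + r * c2)" unfolding r(3) by (simp add: algebra_simps)
 ultimately show "p:Uf Int Ub" using assms off_Uf_Ub[of p] by auto
qed

text \<open>Passing upwards behind the branch at a regular point \<open>t\<close> amounts to its meridian.\<close>

lemma vcross:
 assumes reg: "D t ~: sing" and a: "0 < a" "!!c. 0 < \<bar>c\<bar> ==> \<bar>c\<bar> <= a ==> (x t, z t + c) ~: range D"
  and Y: "y t < Y" and b: "low t b"
 defines "p \<equiv> (x t, Y, z t - a)" and "q \<equiv> (x t, Y, z t + a)"
 shows "HE X p [linepath p q] (sig p @ rl (std t b) @ mer t # std t b @ rl (sig q)) q" proof -
 obtain a' dn up where a': "0 < a'" "a' <= min a b" "a' <= u"
  and dn: "pchain Uf (push K a' t) [dn] (push K (- a') t)" and up: "pchain Ub (push K (- a') t) [up] (push K a' t)"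
  and h: "HE X (B t) [mer t] [vert t u a', dn, up, vert t a' u] (B t)" proof -
  have "0 < min a b" using lowI[OF b] a(1) by simp
  from mer_split[OF reg this] show thesis by (elim exE conjE) (rule that)
 qed
 let ?p = "push K (- a') t" and ?q = "push K a' t"
 have pe: "?p = (x t, y t, z t - a')" "?q = (x t, y t, z t + a')" by (auto simp: prod_eq_iff)
 have off: "(x t, c) ~: range D" if "a' <= \<bar>c - z t\<bar>" "\<bar>c - z t\<bar> <= a" for c using a(2)[of "c - z t"] that a'(1) by auto
 have s1: "closed_segment p ?p <= Uf Int Ub" unfolding p_def pe by (rule seg_off, rule off) (use a' a(1) in "auto simp: abs_if")
 have s2: "closed_segment ?q q <= Uf Int Ub" unfolding q_def pe by (rule seg_off, rule off) (use a' a(1) in "auto simp: abs_if")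
 have s3: "closed_segment p q <= Ub" proof
  fix r assume "r:closed_segment p q"
  then obtain l where l: "r = (1 - l) *\<^sub>R p + l *\<^sub>R q" "0 <= l" "l <= 1" by (auto simp: in_segment)
  have r: "r = (x t, Y, z t + (2 * l - 1) * a)" unfolding l(1) p_def q_def by (simp add: prod_eq_iff algebra_simps)
  show "r:Ub" proof (cases "2 * l - 1 = 0")
   case True
   have "y s < Y" if Ds: "D s = (x t, z t)" for s proof -
    obtain k where "s = t + of_int k" using regD(3)[OF reg, of s] Ds by (auto simp: D_def)
    thus ?thesis using Y by (simp add: per)
   qed
   thus ?thesis unfolding r True by (simp add: Ub_def)
  next
   case False
   have "\<bar>2 * l - 1\<bar> <= 1" using l by auto
   hence "\<bar>(2 * l - 1) * a\<bar> <= a" using a(1) by (simp add: abs_mult mult_left_le_one_le)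
   moreover have "0 < \<bar>(2 * l - 1) * a\<bar>" using False a(1) by auto
   ultimately show ?thesis using a(2) by (intro off_Uf_Ub(2)) (simp add: r)
  qed
 qed
 have f: "p:Uf" "q:Uf" "?q:Uf" "p:Ub" "q:Ub" using s1 s2 by (auto dest: subsetD[OF _ ends_in_segment(1)] subsetD[OF _ ends_in_segment(2)])
 have sg: "pchain Uf p (sig p) v" "pchain Uf q (sig q) v" "pchain Uf ?q (sig ?q) v" by (rule sig_pchain, rule f)+
 \<comment> \<open>Behind the knot the passage is pulled to the half meridian \<open>up\<close>. In
   front of the knot its ends are completed by \<open>sig\<close> and by the other half
   \<open>dn\<close>.\<close>
 have 1: "HE X p [linepath p q] ([linepath p ?p] @ [up] @ [linepath ?q q]) q" by (rule HE_Ub) (use s1 s2 s3 f up in auto)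
 have 2: "HE X p [linepath p ?p] (sig p @ rl (sig ?q) @ [dn]) ?p"
  by (rule HE_Uf) (use s1 dn pchain_appendI[OF sg(1) pchain_appendI[OF pchain_rl[OF sg(3)] dn]] in auto)
 have 3: "HE X ?q [linepath ?q q] (sig ?q @ rl (sig q)) q" by (rule HE_Uf) (use s2 f pchain_appendI[OF sg(3) pchain_rl[OF sg(2)]] in auto)
 have 4: "HE X p [linepath p q] ((sig p @ rl (sig ?q) @ [dn]) @ [up] @ (sig ?q @ rl (sig q))) q"
  by (rule HE_trans[OF 1 HE_append[OF 2 HE_append[OF HE_refl[OF Ub_X[OF up]] 3]]])
 have av: "a' <= u" "0 < a'" using a' by auto
 note vp = vert_chain[OF av(2,1), of t]
 have vv: "HE X ?q [vert t a' u, vert t u a'] [] ?q" using HE_rinv[of "vert t a' u" X] vp by (simp add: vert_def)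
 have dX: "pchain X ?q [dn, up] ?q" using pchain_appendI[OF Uf_X[OF dn] Ub_X[OF up]] push_X[OF av(2,1), of t] by simp
 \<comment> \<open>The pair \<open>dn\<close>, \<open>up\<close> is the meridian with its base point
   moved to height \<open>a'\<close>.\<close>
 have 5: "HE X ?q ([vert t a' u] @ [mer t] @ [vert t u a']) [dn, up] ?q" proof -
  have "HE X ?q ([vert t a' u] @ [mer t] @ [vert t u a']) ([vert t a' u] @ [vert t u a', dn, up, vert t a' u] @ [vert t u a']) ?q"
   by (rule HE_ctx[OF h vp(2,1)])
  moreover have "HE X ?q ([vert t a' u, vert t u a'] @ [dn, up] @ [vert t a' u, vert t u a']) ([] @ [dn, up] @ []) ?q"
   by (rule HE_append[OF vv HE_append[OF HE_refl[OF dX] vv]])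
  ultimately show ?thesis using HE_trans by simp
 qed
 have sX: "pchain X v (rl (sig ?q)) ?q" "pchain X ?q (sig ?q) v" "pchain X p (sig p) v" "pchain X q (sig q) v"
  using Uf_X[OF pchain_rl[OF sg(3)]] Uf_X[OF sg(3)] Uf_X[OF sg(1)] Uf_X[OF sg(2)] by auto
 have 6: "HE X v (rl (sig ?q) @ ([vert t a' u] @ [mer t] @ [vert t u a']) @ sig ?q) (rl (sig ?q) @ [dn, up] @ sig ?q) v"
  by (rule HE_ctx[OF 5 sX(1,2)])
 have r: "rl (std t a') = rl (sig ?q) @ [vert t a' u]" by (simp add: std_def vert_def)
 have 7: "HE X v (rl (sig ?q) @ [dn, up] @ sig ?q) (rl (std t a') @ [mer t] @ std t a') v" using HE_sym[OF 6] by (simp add: r) (simp add: std_def)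
 have st: "HE X (B t) (std t a') (std t b) v" using std_HE[OF b a'(1)] a'(2) by simp
 have mX: "pchain X (B t) [mer t] (B t)" using HE_pchain(1)[OF h] .
 have 8: "HE X v (rl (sig ?q) @ [dn, up] @ sig ?q) (rl (std t b) @ [mer t] @ std t b) v"
  by (rule HE_trans[OF 7 HE_append[OF HE_rl[OF st] HE_append[OF HE_refl[OF mX] st]]])
 have 9: "HE X p (sig p @ (rl (sig ?q) @ [dn, up] @ sig ?q) @ rl (sig q)) (sig p @ (rl (std t b) @ [mer t] @ std t b) @ rl (sig q)) q"
  by (rule HE_ctx[OF 8 sX(3) pchain_rl[OF sX(4)]])
 show ?thesis using HE_trans[OF 4] 9 by simp
qed

end

section \<open>Colourings obtained from peripheral functionals\<close>

locale functional = viewed + fixes R :: "('a, 'b) rack_scheme" and e :: "real => (real => p3) list => 'a"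
 assumes rackR: "rack R" and peri: "peripheral K dK u v R e"
begin

lemma e_closed: "pchain X (B t) xs v ==> e t xs:rcarrier R"
 and e_HE: "HE X (B t) xs ys v ==> e t xs = e t ys"
 and e_slide: "pchain X (B t) xs v ==> e s (slide B s t # xs) = e t xs"
 and e_per: "pchain X (B t) xs v ==> e (t + 1) xs = e t xs"
 and e_merid: "pchain X (B s) xs v ==> pchain X (B t) ys v ==> e s (xs @ rl ys @ merid K dK u t # ys) = rmul R (e s xs) (e t ys)"
 using peri unfolding peripheral_def by blast+

definition opr :: "real => 'a => 'a => 'a" where "opr t = (if x' t > 0 then rmul R else rdiv R)"

lemma merid_loop: "pchain X (B t) [merid K dK u t] (B t)"
 using merid_X push_X[OF u, of t] by (simp add: path_merid pathstart_def pathfinish_def merid_ends)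

lemma mer_loop: "pchain X (B t) [mer t] (B t)" using merid_loop[of t] push_X[OF u order_refl, of t] by (simp add: mer_def)

text \<open>If the meridian is reversed, appending it once more in its own direction gives back
  \<open>xs\<close>; cancelling in the rack turns this into the division.\<close>

lemma e_mer: assumes xs: "pchain X (B s) xs v" and ys: "pchain X (B t) ys v" shows "e s (xs @ rl ys @ mer t # ys) = opr t (e s xs) (e t ys)"
proof (cases "x' t > 0")
 case True
 thus ?thesis using e_merid[OF xs ys] by (simp add: mer_def opr_def)
next
 case False
 let ?m = "merid K dK u t"
 let ?ws = "xs @ rl ys @ mer t # ys"
 have m: "mer t = reversepath ?m" using False by (simp add: mer_def)
 have ws: "pchain X (B s) ?ws v" using pchain_appendI[OF xs pchain_appendI[OF pchain_rl[OF ys] pchain_appendI[OF mer_loop ys]]] by simp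
 have mm: "HE X (B t) [mer t, ?m] [] (B t)" using HE_linv[of ?m X] merid_loop[of t] by (simp add: m)
 have yy: "HE X (B t) (ys @ rl ys) [] (B t)" using HE_rl_right[OF ys] .
 have 1: "HE X (B t) ([mer t] @ (ys @ rl ys) @ [?m]) ([mer t] @ [] @ [?m]) (B t)" by (rule HE_ctx[OF yy mer_loop merid_loop])
 have 2: "HE X (B t) ([mer t] @ (ys @ rl ys) @ [?m]) [] (B t)" using HE_trans[OF 1] mm by simp
 have 3: "HE X (B s) ((xs @ rl ys) @ ([mer t] @ (ys @ rl ys) @ [?m]) @ ys) ((xs @ rl ys) @ [] @ ys) v"
  by (rule HE_ctx[OF 2 pchain_appendI[OF xs pchain_rl[OF ys]] ys])
 have 4: "HE X (B s) (xs @ (rl ys @ ys)) (xs @ []) v" by (rule HE_append[OF HE_refl[OF xs] HE_rl_left[OF ys]])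
 have "HE X (B s) (?ws @ rl ys @ ?m # ys) xs v" using HE_trans[OF 3] 4 by simp
 hence "rmul R (e s ?ws) (e t ys) = e s xs" using e_HE e_merid[OF ws ys] by metis
 moreover have "e s ?ws:rcarrier R" "e t ys:rcarrier R" using e_closed ws ys by auto
 ultimately have "e s ?ws = rdiv R (e s xs) (e t ys)" using rack_cancel(1)[OF rackR, of "e s ?ws" "e t ys"] by metis
 thus ?thesis using False by (simp add: opr_def)
qed

definition E :: "real => 'a" where "E t = e t (std t (SOME a. low t a))"

lemma E_low: assumes "low t a" shows "E t = e t (std t a)" proof -
 define b where "b = (SOME a. low t a)"
 have b: "low t b" unfolding b_def by (rule someI[of _ a]) (rule assms)
 have "e t (std t a) = e t (std t b)" proof (cases "a <= b")
  case True
  show ?thesis by (rule e_HE[OF std_HE[OF b lowI(1)[OF assms] True]])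
 next
  case False
  thus ?thesis using e_HE[OF std_HE[OF assms lowI(1)[OF b]]] by simp
 qed
 thus ?thesis by (simp add: E_def b_def)
qed

lemma E_closed: "E t:rcarrier R" proof -
 obtain a where a: "low t a" using low_exists[OF u] by blast
 show ?thesis unfolding E_low[OF a] by (rule e_closed[OF low_pchain[OF a]])
qed

lemma E_per: "E (t + 1) = E t" proof -
 obtain a where a: "low t a" using low_exists[OF u] by blast
 have p: "push K c (t + 1) = push K c t" for c using per(7)[of t 1] by (simp add: push_def)
 have a1: "low (t + 1) a" using a per(1,3)[of t 1] by (simp add: low_def)
 have "std (t + 1) a = std t a" by (simp add: std_def vert_def p)
 thus ?thesis unfolding E_low[OF a] E_low[OF a1] using e_per[OF low_pchain[OF a]] by simp
qed

lemma cross_up: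
 assumes reg: "D t ~: sing" and a: "0 < a" "!!c. 0 < \<bar>c\<bar> ==> \<bar>c\<bar> <= a ==> (x t, z t + c) ~: range D"
  and Y: "y t < Y" and xs: "pchain X (B s) xs (x t, Y, z t - a)"
 shows "e s (xs @ linepath (x t, Y, z t - a) (x t, Y, z t + a) # sig (x t, Y, z t + a)) =
  opr t (e s (xs @ sig (x t, Y, z t - a))) (E t)" proof -
 let ?p = "(x t, Y, z t - a)" and ?q = "(x t, Y, z t + a)"
 have f: "?p:Uf" "?q:Uf" using a(1) a(2)[of a] a(2)[of "- a"] by (auto intro!: off_Uf_Ub(1))
 have sp: "pchain X ?p (sig ?p) v" "pchain X ?q (sig ?q) v" using Uf_X[OF sig_pchain] f by auto
 obtain b where b: "low t b" using low_exists[OF u] by blast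
 note st = low_pchain[OF b]
 have h: "HE X ?p [linepath ?p ?q] (sig ?p @ rl (std t b) @ mer t # std t b @ rl (sig ?q)) ?q" by (rule vcross[OF reg a(1) _ Y b]) (use a(2) in auto)
 have xp: "pchain X (B s) (xs @ sig ?p) v" by (rule pchain_appendI[OF xs sp(1)])
 let ?l = "(xs @ sig ?p) @ rl (std t b) @ mer t # std t b"
 have l: "pchain X (B s) ?l v" using pchain_appendI[OF xp pchain_appendI[OF pchain_rl[OF st] pchain_appendI[OF mer_loop st]]] by simp
 have 1: "HE X (B s) (xs @ [linepath ?p ?q] @ sig ?q) (xs @ (sig ?p @ rl (std t b) @ mer t # std t b @ rl (sig ?q)) @ sig ?q) v"
  by (rule HE_ctx[OF h xs sp(2)])
 have 2: "HE X (B s) (?l @ (rl (sig ?q) @ sig ?q)) (?l @ []) v" by (rule HE_append[OF HE_refl[OF l] HE_rl_left[OF sp(2)]])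
 have "HE X (B s) (xs @ [linepath ?p ?q] @ sig ?q) ?l v" using HE_trans[OF 1] 2 by simp
 hence "e s (xs @ [linepath ?p ?q] @ sig ?q) = e s ?l" by (rule e_HE)
 also have "... = opr t (e s (xs @ sig ?p)) (e t (std t b))" by (rule e_mer[OF xp st])
 finally show ?thesis by (simp add: E_low[OF b])
qed

end

context functional
begin

lemma e_std_slide:
 assumes z: "0 < ze" "ze <= u" and i: "path_image (slide (push K ze) s t) <= Uf" shows "e s (std s ze) = e t (std t ze)" proof -
 let ?l = "slide (push K ze) s t"
 have "push K ze s:path_image ?l" "push K ze t:path_image ?l" by (auto simp: slide_props)
 hence f: "push K ze s:Uf" "push K ze t:Uf" using i by auto
 note sX = Uf_X[OF sig_pchain[OF f(1)]] Uf_X[OF sig_pchain[OF f(2)]]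
 note vX = vert_chain(1)[OF z, of s] vert_chain(2)[OF z, of t]
 have lX: "pchain X (push K ze s) [?l] (push K ze t)" using slide_X[OF z] push_X[OF z] by (simp add: slide_props)
 have 1: "HE X (B s) ([slide B s t] @ std t ze) ([vert s u ze, ?l, vert t ze u] @ std t ze) v"
  by (rule HE_append[OF slide_lower[OF z] HE_refl[OF std_pchain[OF f(2) z]]])
 have vv: "HE X (push K ze t) [vert t ze u, vert t u ze] [] (push K ze t)" using HE_rinv[of "vert t ze u" X] vX by (simp add: vert_def)
 have 2: "HE X (B s) (([vert s u ze] @ [?l]) @ [vert t ze u, vert t u ze] @ sig (push K ze t)) (([vert s u ze] @ [?l]) @ [] @ sig (push K ze t)) v"
  by (rule HE_ctx[OF vv pchain_appendI[OF vX(1) lX] sX(2)])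
 have "HE X (push K ze s) ([?l] @ sig (push K ze t)) (sig (push K ze s)) v"
  by (rule HE_Uf) (use i f sig_pchain[OF f(1)] sig_pchain[OF f(2)] in "simp_all add: slide_props(1-3)")
 hence 3: "HE X (B s) ([vert s u ze] @ [?l] @ sig (push K ze t)) ([vert s u ze] @ sig (push K ze s)) v" by (rule HE_append[OF HE_refl[OF vX(1)]])
 have 4: "HE X (B s) ([slide B s t] @ std t ze) (([vert s u ze] @ [?l]) @ [] @ sig (push K ze t)) v" using HE_trans[OF 1] 2 by (simp add: std_def)
 have "HE X (B s) (slide B s t # std t ze) (std s ze) v" using HE_trans[OF 4] 3 by (simp add: std_def)
 thus ?thesis using e_HE e_slide[OF std_pchain[OF f(2) z]] by metis
qed

lemma seg_dist: "\<bar>r - t0\<bar> < d" if "r:closed_segment t t'" "\<bar>t - t0\<bar> < d" "\<bar>t' - t0\<bar> < d" for r t t' d :: real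
 using that by (auto simp: closed_segment_eq_real_ivl abs_less_iff split: if_splits)

text \<open>Where \<open>rear\<close> fails the strip above the branch is in front of the knot, so
  standard paths may all descend to the common height \<open>ze\<close> and slide along it.\<close>

lemma E_const: assumes nr: "~ rear t0" shows "EX d>0. ALL t. \<bar>t - t0\<bar> < d --> E t = E t0" proof -
 obtain de ze where n: "de > 0" "ze > 0" "ze <= u" "!!t c. \<bar>t - t0\<bar> < de ==> 0 < c ==> c <= ze ==> push K c t:Uf"
  using near_side[OF open_UNIV UNIV_I, of t0] nr by auto
 have 1: "E t = e t (std t ze)" if t: "\<bar>t - t0\<bar> < de" for t proof -
  obtain c where c: "low t c" "c <= ze" using low_exists[OF n(2)] by blast
  have "path_image (vert t c ze) <= Uf" unfolding vert_image using n(4)[OF t] lowI[OF c(1)] c(2) by (auto simp: closed_segment_eq_real_ivl)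
  thus ?thesis unfolding E_low[OF c(1)] by (intro e_HE std_raise) (use lowI[OF c(1)] n in auto)
 qed
 have "E t = E t0" if t: "\<bar>t - t0\<bar> < de" for t proof -
  have t0: "\<bar>t0 - t0\<bar> < de" using n(1) by simp
  have "path_image (slide (push K ze) t t0) <= Uf" unfolding slide_props using n(4)[OF seg_dist[OF _ t t0] n(2) order_refl] by blast
  from e_std_slide[OF n(2,3) this] show ?thesis using 1[OF t] 1[OF t0] by simp
 qed
 thus ?thesis using n(1) by blast
qed

text \<open>Between the branch at \<open>t\<close> and the height \<open>ze\<close> there is one
  other piece of the front, the branch \<open>r\<close>, which passes in front. Rising behind it
  applies its colour to the value.\<close>

lemma column_step:
 assumes z: "0 < ze" "ze <= u" and ub: "!!c. 0 < c ==> c <= ze ==> push K c t:Ub"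
  and r: "D r = (x t, z t + c1)" "0 < c1" "c1 < ze" "D r ~: sing"
  and off: "!!c. 0 < c ==> c <= ze ==> c ~= c1 ==> (x t, z t + c) ~: range D" shows "e t (std t ze) = opr r (E t) (E r)" proof -
 define a where "a = min c1 (ze - c1) / 2"
 have a: "0 < a" "a < c1" "c1 + a < ze" using r(2,3) by (auto simp: a_def min_def field_simps)
 have xr: "x r = x t" "z r = z t + c1" using r(1) by (auto simp: D_def)
 have yr: "y r < y t" using ub[of c1] r by (auto simp: Ub_def)
 have low: "low t (c1 - a)" using off a z by (auto simp: low_def)
 have p: "(x r, y t, z r - a) = push K (c1 - a) t" "(x r, y t, z r + a) = push K (c1 + a) t" using xr by (auto simp: prod_eq_iff)
 have k: "0 < c1 - a" "c1 - a <= u" "0 < c1 + a" "c1 + a <= u" using a z by auto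
 have gap: "(x r, z r + c) ~: range D" if "0 < \<bar>c\<bar>" "\<bar>c\<bar> <= a" for c using off[of "c1 + c"] that a xr by (auto simp: add.assoc)
 have "pchain X (B t) [vert t u (c1 - a)] (x r, y t, z r - a)" unfolding p using vert_X[OF u order_refl k(1,2)] push_X[OF k(1,2)] by simp
 from cross_up[OF r(4) a(1) gap yr this]
 have 1: "e t ([vert t u (c1 - a)] @ vert t (c1 - a) (c1 + a) # sig (push K (c1 + a) t)) = opr r (E t) (E r)"
  unfolding p E_low[OF low] by (simp add: std_def vert_def)
 have i: "path_image (vert t (c1 + a) ze) <= Uf" proof -
  have "push K w t:Uf" if "c1 + a <= w" "w <= ze" for w using off[of w] that a r(2) by (intro off_Uf_Ub(1)) simp
  thus ?thesis unfolding vert_image using a by (auto simp: closed_segment_eq_real_ivl)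
 qed
 hence f: "push K (c1 + a) t:Uf" using pathstart_in_path_image[of "vert t (c1 + a) ze"] by auto
 have "HE X (B t) ([vert t u (c1 - a), vert t (c1 - a) (c1 + a)] @ sig (push K (c1 + a) t)) ([vert t u (c1 + a)] @ sig (push K (c1 + a) t)) v"
  by (rule HE_append[OF vert_add[OF u order_refl k] HE_refl[OF Uf_X[OF sig_pchain[OF f]]]])
 hence 2: "opr r (E t) (E r) = e t (std t (c1 + a))" using e_HE 1 by (metis append_Cons append_Nil std_def)
 have "e t (std t (c1 + a)) = e t (std t ze)" by (rule e_HE[OF std_raise[OF k(3,4) z i]])
 thus ?thesis using 2 by simp
qed

lemma E_clear:
 assumes z: "0 < ze" "ze <= u" and off: "!!c. 0 < c ==> c <= ze ==> (x t, z t + c) ~: range D" shows "e t (std t ze) = E t"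
 using E_low[of t ze] z off by (simp add: low_def)

text \<open>A row at height \<open>ze\<close> that misses the front at \<open>t0\<close> misses it
  nearby, so the standard values along it coincide. Both sides of a crossing or cusp are then
  compared with this one value.\<close>

lemma top_row:
 assumes r: "rear t0" and Q: "open Q" "D t0:Q"
 shows "EX ze d. 0 < ze & ze <= u & 0 < d & (ALL t. \<bar>t - t0\<bar> < d --> (ALL c. 0 < c & c <= ze --> push K c t:Ub & (x t, z t + c):Q) &
   (x t, z t + ze) ~: range D & \<bar>z t - z t0\<bar> < ze/2 & e t (std t ze) = e t0 (std t0 ze))" proof -
 obtain de ze0 where n: "de > 0" "ze0 > 0" "ze0 <= u" "!!t c. \<bar>t - t0\<bar> < de ==> 0 < c ==> c <= ze0 ==> push K c t:Ub & (x t, z t + c):Q"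
  using near_side[OF Q] r by auto
 obtain ze where z: "low t0 ze" "ze <= ze0" using low_exists[OF n(2)] by blast
 have zp: "0 < ze" "ze <= u" using lowI[OF z(1)] by auto
 have "open ((%t. (x t, z t + ze)) -` (- range D))" by (intro open_vimage open_Compl closed_D continuous_intros contx contz)
 moreover have "t0:(%t. (x t, z t + ze)) -` (- range D)" using z(1) zp by (auto simp: low_def)
 ultimately obtain de1 where d1: "de1 > 0" "ball t0 de1 <= (%t. (x t, z t + ze)) -` (- range D)" using openE by blast
 have "open ((%t. \<bar>z t - z t0\<bar>) -` {..<ze/2})" by (intro open_vimage open_lessThan continuous_intros contz)
 moreover have "t0:(%t. \<bar>z t - z t0\<bar>) -` {..<ze/2}" using zp by auto
 ultimately obtain de2 where d2: "de2 > 0" "ball t0 de2 <= (%t. \<bar>z t - z t0\<bar>) -` {..<ze/2}" using openE by blast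
 define d where "d = min de (min de1 de2)"
 have d: "0 < d" "d <= de" "d <= de1" "d <= de2" using n d1 d2 by (auto simp: d_def)
 have off: "(x t, z t + ze) ~: range D" if "\<bar>t - t0\<bar> < d" for t proof -
  have "t:ball t0 de1" using that d by (auto simp: dist_real_def)
  thus ?thesis using d1(2) by blast
 qed
 have zd: "\<bar>z t - z t0\<bar> < ze/2" if "\<bar>t - t0\<bar> < d" for t proof -
  have "t:ball t0 de2" using that d by (auto simp: dist_real_def)
  thus ?thesis using d2(2) by blast
 qed
 have "e t (std t ze) = e t0 (std t0 ze)" if t: "\<bar>t - t0\<bar> < d" for t proof (rule e_std_slide[OF zp])
  have t0: "\<bar>t0 - t0\<bar> < d" using d(1) by simp
  show "path_image (slide (push K ze) t t0) <= Uf" proof -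
   have "push K ze r:Uf" if "r:closed_segment t t0" for r by (rule off_Uf_Ub(1)) (use off[OF seg_dist[OF that t t0]] in simp)
   thus ?thesis unfolding slide_props by blast
  qed
 qed
 moreover have "push K c t:Ub & (x t, z t + c):Q" if "\<bar>t - t0\<bar> < d" "0 < c" "c <= ze" for t c by (rule n(4)) (use that d z(2) in auto)
 ultimately show ?thesis using d(1) zp off zd by (intro exI[of _ ze] exI[of _ d] conjI allI impI; blast)
qed

text \<open>\<open>A\<close> is the value on the row above. To the right of the crossing nothing
  lies between the under-branch and this row; to the left the over-branch does.\<close>

lemma E_cross:
 assumes ov: "over s0 t0"
 shows "EX d>0. EX A. ALL t. t ~= t0 & \<bar>t - t0\<bar> < d --> (x t0 < x t --> E t = A) & (x t < x t0 --> A = opr s0 (E t) (E s0))" proof -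
 have nz: "x' s0 ~= 0" "x' t0 ~= 0" and Ds: "D s0 = D t0" and dp0: "dp s0 t0" using ov dp_x' by (auto simp: over_def dp_def)
 have nrs: "~ rear s0" using over_not_brk[OF ov] by (auto simp: rear_def brk_def rcusp_def)
 obtain de1 where d1: "de1 > 0" "!!s' t. \<bar>s' - s0\<bar> < de1 ==> \<bar>t - t0\<bar> < de1 ==> x s' = x t ==>
  (x t0 < x t --> z s' < z t) & (x t < x t0 --> z t < z s')" using crossing_sides[OF ov] by blast
 obtain de2 where d2: "de2 > 0" "!!de'. 0 < de' ==> de' <= de2 ==> branch {s0 - de'<..<s0 + de'}" using branch_near[OF nz(1)] by blast
 obtain de3 where d3: "de3 > 0" "!!de'. 0 < de' ==> de' <= de3 ==> branch {t0 - de'<..<t0 + de'}" using branch_near[OF nz(2)] by blast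
 obtain de4 where d4: "de4 > 0" "!!s. \<bar>s - s0\<bar> < de4 ==> E s = E s0" using E_const[OF nrs] by blast
 obtain de5 where d5: "de5 > 0" "!!s. s ~= s0 ==> \<bar>s - s0\<bar> < de5 ==> D s ~: sing" using reg_interval[of s0] by blast
 define de where "de = Min {de1, de2, de3, de4, de5}"
 have d: "de > 0" "de <= de1" "de <= de2" "de <= de3" "de <= de4" "de <= de5" using d1(1) d2(1) d3(1) d4(1) d5(1) by (auto simp: de_def)
 define Js Jt where "Js = {s0 - de<..<s0 + de}" and "Jt = {t0 - de<..<t0 + de}"
 have Js: "branch Js" "s0:Js" and Jt: "branch Jt" "t0:Jt" using d2(2)[OF d(1,3)] d3(2)[OF d(1,4)] d(1) by (auto simp: Js_def Jt_def)
 have "EX k. r + of_int k:Jt Un Js" if r: "D r = D t0" for r proof -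
  obtain k where "r = t0 + of_int k | r = s0 + of_int k" using two_points[OF dp0 r] by blast
  thus ?thesis using d(1) by (intro exI[of _ "- k"]) (auto simp: Js_def Jt_def)
 qed
 moreover have "open (Jt Un Js)" by (auto simp: Js_def Jt_def)
 ultimately obtain Q where Q: "open Q" "D t0:Q" "!!r. D r:Q ==> EX k. r + of_int k:Jt Un Js" using nearby[of "Jt Un Js" "D t0"] by blast
 have rear: "rear t0" using ov by (auto simp: rear_def)
 obtain ze d0 where z: "0 < ze" "ze <= u" "0 < d0" and top: "!!t. \<bar>t - t0\<bar> < d0 ==> (ALL c. 0 < c & c <= ze --> push K c t:Ub & (x t, z t + c):Q) &
   (x t, z t + ze) ~: range D & \<bar>z t - z t0\<bar> < ze/2 & e t (std t ze) = e t0 (std t0 ze)" using top_row[OF rear Q(1,2)] by blast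
 \<comment> \<open>The condition on \<open>z\<close> keeps the over-branch below the row, the one on
   \<open>x'\<close> keeps \<open>opr\<close> the same as at \<open>s0\<close>.\<close>
 define J where "J = Js Int ((%s. z s) -` {..<z s0 + ze/2} Int (%s. x' s * x' s0) -` {0<..})"
 have "open J" "s0:J" unfolding J_def
  using Js z(1) nz by (auto simp: Js_def zero_less_mult_iff intro!: open_Int open_vimage continuous_intros contz cx')
 from near_inverse[OF nz(1) this] have "\<forall>\<^sub>F xi in nhds (x t0). EX s':J. x s' = xi" using Ds by (simp add: D_def)
 from eventually_compose_filterlim[OF this x_tendsto] have "\<forall>\<^sub>F t in nhds t0. EX s':J. x s' = x t" .
 then obtain d' where d': "d' > 0" "!!t. \<bar>t - t0\<bar> < d' ==> EX s':J. x s' = x t"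
  unfolding eventually_nhds_metric by (auto simp: dist_real_def)
 let ?A = "e t0 (std t0 ze)"
 have "(x t0 < x t --> E t = ?A) & (x t < x t0 --> ?A = opr s0 (E t) (E s0))" if t: "t ~= t0" "\<bar>t - t0\<bar> < min d' (min d0 de)" for t proof -
  obtain s' where s': "s':J" "x s' = x t" using d'(2)[of t] t by auto
  have sJ: "s':Js" "z s' < z s0 + ze/2" "x' s' * x' s0 > 0" using s' by (auto simp: J_def)
  have tJ: "t:Jt" using t by (auto simp: Jt_def abs_less_iff)
  have zz: "(x t0 < x t --> z s' < z t) & (x t < x t0 --> z t < z s')" by (rule d1(2)) (use t s' sJ d in "auto simp: Js_def abs_less_iff")
  have T: "!!c. 0 < c ==> c <= ze ==> push K c t:Ub & (x t, z t + c):Q" "(x t, z t + ze) ~: range D" "\<bar>z t - z t0\<bar> < ze/2" "e t (std t ze) = ?A"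
   using top[of t] t by auto
  have pts: "z t + c = z s'" if c: "0 < c" "c <= ze" "(x t, z t + c):range D" for c proof -
   obtain r where r: "D r = (x t, z t + c)" using c(3) by auto
   then obtain k where k: "r + of_int k:Jt Un Js" using Q(3) T(1)[OF c(1,2)] by metis
   have xz: "x (r + of_int k) = x t" "z (r + of_int k) = z t + c" using r by (auto simp: per D_def)
   have "r + of_int k ~: Jt" using branch_inj[OF Jt(1) _ tJ xz(1)] xz(2) c(1) by auto
   hence "r + of_int k = s'" using branch_inj[OF Js(1) _ sJ(1), of "r + of_int k"] k xz(1) s'(2) by auto
   thus ?thesis using xz(2) by simp
  qed
  have "E t = ?A" if "x t0 < x t" proof -
   have "(x t, z t + c) ~: range D" if "0 < c" "c <= ze" for c using pts[OF that] zz \<open>x t0 < x t\<close> that by auto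
   from E_clear[OF z(1,2) this] show ?thesis using T(4) by simp
  qed
  moreover have "?A = opr s0 (E t) (E s0)" if l: "x t < x t0" proof -
   have "s' ~= s0" using s'(2) Ds l by (auto simp: D_def)
   hence reg: "D s' ~: sing" using d5(2)[of s'] sJ(1) d(6) by (auto simp: Js_def abs_less_iff)
   have "e t (std t ze) = opr s' (E t) (E s')" proof (rule column_step[OF z(1,2), of t s' "z s' - z t"])
    show "D s' = (x t, z t + (z s' - z t))" using s'(2) by (simp add: D_def)
    show "0 < z s' - z t" using zz l by simp
    have "z s0 = z t0" using Ds by (simp add: D_def)
    thus "z s' - z t < ze" using sJ(2) T(3) by linarith
    show "(x t, z t + c) ~: range D" if "0 < c" "c <= ze" "c ~= z s' - z t" for c using pts[OF that(1,2)] that(3) by auto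
   qed (use T(1) reg in auto)
   moreover have "E s' = E s0" using d4(2)[of s'] sJ(1) d by (auto simp: Js_def abs_less_iff)
   moreover have "opr s' = opr s0" using sJ(3) by (auto simp: opr_def zero_less_mult_iff)
   ultimately show ?thesis using T(4) by simp
  qed
  ultimately show ?thesis by blast
 qed
 thus ?thesis using d'(1) z(3) d(1) by (intro exI[of _ "min d' (min d0 de)"] conjI exI[of _ ?A]) auto
qed

text \<open>The upper branch sees the row above directly and has its value. From the lower branch
  one passes behind the upper one, so this value is the lower colour multiplied or divided by the
  upper. In both cases the incoming colour is the square of the outgoing one.\<close>

lemma E_cusp:
 assumes rc: "rcusp t0" shows "EX d>0. ALL s t. t0 - d < s & s < t0 & t0 < t & t < t0 + d --> E s = iota R (E t)" proof -
 have z0: "x' t0 = 0" using rc by (simp add: rcusp_def)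
 have nd: "~ dp s t0" for s using dp_x' z0 by blast
 obtain w ep0 where w: "w = 1 | w = (-1::real)" "0 < ep0" "ALL s. t0 - ep0 < s & s < t0 --> x' s > 0" "ALL s. t0 < s & s < t0 + ep0 --> x' s < 0"
  "ALL s t. t0 - ep0 < s & s < t0 & t0 < t & t < t0 + ep0 & x s = x t --> w * z t < w * z s" using cusp_order[OF rc] by blast
 obtain ep1 where e1: "ep1 > 0" "!!s. s ~= t0 ==> \<bar>s - t0\<bar> < ep1 ==> D s ~: sing" using reg_interval[of t0] by blast
 define de where "de = min ep0 ep1"
 have d: "0 < de" "de <= ep0" "de <= ep1" using w(2) e1(1) by (auto simp: de_def)
 have "EX k. r + of_int k:{t0 - de<..<t0 + de}" if r: "D r = D t0" for r proof -
  obtain k where "r = t0 + of_int k" using D_eq[OF r] nd by blast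
  thus ?thesis using d(1) by (intro exI[of _ "- k"]) auto
 qed
 from nearby[OF open_greaterThanLessThan this] obtain Q where Q: "open Q" "D t0:Q" "!!r. D r:Q ==> EX k. r + of_int k:{t0 - de<..<t0 + de}" by blast
 have rear: "rear t0" using rc by (simp add: rear_def)
 obtain ze d0 where z: "0 < ze" "ze <= u" "0 < d0" and top: "!!t. \<bar>t - t0\<bar> < d0 ==> (ALL c. 0 < c & c <= ze --> push K c t:Ub & (x t, z t + c):Q) &
   (x t, z t + ze) ~: range D & \<bar>z t - z t0\<bar> < ze/2 & e t (std t ze) = e t0 (std t0 ze)" using top_row[OF rear Q(1,2)] by blast
 define ep where "ep = min d0 de"
 have eps: "0 < ep" "ep <= d0" "ep <= de" "ep <= ep0" using z(3) d by (auto simp: ep_def)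
 have xs: "x' s > 0" if "t0 - de < s" "s < t0" for s using w(3) that d by auto
 have xt: "x' s < 0" if "t0 < s" "s < t0 + de" for s using w(4) that d by auto
 have Jl: "branch {t0 - de<..<t0}" and Jr: "branch {t0<..<t0 + de}" using xs xt by (auto simp: branch_def is_interval_oo) fastforce+
 have cols0: "!!r. \<bar>r - t0\<bar> < de ==> r ~= t0 ==> 0 < (x r - x t0) * (-1)" using cusp_columns(1)[OF z0 d(1), of "-1"] rc xs xt by simp
 have cols: "EX e>0. ALL xi. 0 < (xi - x t0) * (-1) & \<bar>xi - x t0\<bar> < e --> (EX s. t0 - ep < s & s < t0 & x s = xi) & (EX t. t0 < t & t < t0 + ep & x t = xi)"
  using cusp_columns(2)[OF z0 eps(1), of "-1"] rc xs xt eps by simp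
 then obtain e2 where e2: "e2 > 0" "!!xi. 0 < (xi - x t0) * (-1) ==> \<bar>xi - x t0\<bar> < e2 ==> (EX s. t0 - ep < s & s < t0 & x s = xi) & (EX t. t0 < t & t < t0 + ep & x t = xi)" by blast
 from tendstoD[OF x_tendsto e2(1)] obtain d' where d': "d' > 0" "!!t. \<bar>t - t0\<bar> < d' ==> \<bar>x t - x t0\<bar> < e2"
  unfolding eventually_nhds_metric by (auto simp: dist_real_def)
 let ?A = "e t0 (std t0 ze)"
 have step: "(z t' < z t --> E t = ?A) & (z t < z t' --> ?A = opr t' (E t) (E t'))"
  if t: "\<bar>t - t0\<bar> < ep" "\<bar>t' - t0\<bar> < ep" "x t' = x t" "t < t0 & t0 < t' | t' < t0 & t0 < t" for t t' proof -
  have T: "!!c. 0 < c ==> c <= ze ==> push K c t:Ub & (x t, z t + c):Q" "(x t, z t + ze) ~: range D" "\<bar>z t - z t0\<bar> < ze/2" "e t (std t ze) = ?A"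
   using top[of t] t(1) eps by auto
  have T': "\<bar>z t' - z t0\<bar> < ze/2" using top[of t'] t(2) eps by auto
  have pts: "z t + c = z t'" if c: "0 < c" "c <= ze" "(x t, z t + c):range D" for c proof -
   obtain r where r: "D r = (x t, z t + c)" using c(3) by auto
   then obtain k where k: "r + of_int k:{t0 - de<..<t0 + de}" using Q(3) T(1)[OF c(1,2)] by metis
   define q where "q = r + of_int k"
   have xz: "x q = x t" "z q = z t + c" using r by (auto simp: per D_def q_def)
   have q: "\<bar>q - t0\<bar> < de" using k by (auto simp: q_def abs_less_iff)
   have "q ~= t0" using cols0[of t] xz(1) t eps by auto
   hence "q = t | q = t'"
    using branch_inj[OF Jl, of q t] branch_inj[OF Jl, of q t'] branch_inj[OF Jr, of q t] branch_inj[OF Jr, of q t'] q t eps xz(1)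
    by (cases "q < t0") (auto simp: abs_less_iff)
   thus ?thesis using xz(2) c(1) by auto
  qed
  have "E t = ?A" if "z t' < z t" proof -
   have "(x t, z t + c) ~: range D" if "0 < c" "c <= ze" for c using pts[OF that] \<open>z t' < z t\<close> that by auto
   from E_clear[OF z(1,2) this] show ?thesis using T(4) by simp
  qed
  moreover have "?A = opr t' (E t) (E t')" if l: "z t < z t'" proof -
   have "e t (std t ze) = opr t' (E t) (E t')" proof (rule column_step[OF z(1,2), of t t' "z t' - z t"])
    show "D t' = (x t, z t + (z t' - z t))" using t(3) by (simp add: D_def)
    show "0 < z t' - z t" using l by simp
    show "z t' - z t < ze" using T' T(3) by linarith
    show "(x t, z t + c) ~: range D" if "0 < c" "c <= ze" "c ~= z t' - z t" for c using pts[OF that(1,2)] that(3) by auto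
    show "D t' ~: sing" using e1(2)[of t'] t eps d by auto
   qed (use T(1) in auto)
   thus ?thesis using T(4) by simp
  qed
  ultimately show ?thesis by blast
 qed
 have part: "EX t'. \<bar>t' - t0\<bar> < ep & x t' = x t & (t < t0 & t0 < t' | t' < t0 & t0 < t)" if t: "t ~= t0" "\<bar>t - t0\<bar> < min d' ep" for t
 proof -
  have "0 < (x t - x t0) * (-1)" by (rule cols0) (use t eps in auto)
  from e2(2)[OF this d'(2)] t obtain s' t' where "t0 - ep < s'" "s' < t0" "x s' = x t" "t0 < t'" "t' < t0 + ep" "x t' = x t" by auto
  thus ?thesis using t(1) by (cases "t < t0") (intro exI[of _ t'], simp, intro exI[of _ s'], simp)
 qed
 have "E s = iota R (E t)" if st: "t0 - min d' ep < s" "s < t0" "t0 < t" "t < t0 + min d' ep" for s t proof -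
  have "s ~= t0" "\<bar>s - t0\<bar> < min d' ep" "t ~= t0" "\<bar>t - t0\<bar> < min d' ep" using st by auto
  \<comment> \<open>\<open>s\<close> and \<open>t\<close> need not lie in one column;
    \<open>s'\<close> and \<open>t'\<close> are their partners on the other branch.\<close>
  from part[OF this(1,2)] part[OF this(3,4)] obtain s' t' where s': "\<bar>s' - t0\<bar> < ep" "x s' = x s" "t0 < s'"
   and t': "\<bar>t' - t0\<bar> < ep" "x t' = x t" "t' < t0" using st by auto
  have ws: "w * z s' < w * z s" using w(5)[rule_format, of s s'] s' st eps by (auto simp: abs_less_iff)
  have wt: "w * z t < w * z t'" using w(5)[rule_format, of t' t] t' st eps by (auto simp: abs_less_iff)
  have ss: "\<bar>s - t0\<bar> < ep" and tt: "\<bar>t - t0\<bar> < ep" using st by (auto simp: abs_less_iff)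
  have xp: "x' t' > 0" "x' s' < 0" using xs[of t'] xt[of s'] t' s' eps by (auto simp: abs_less_iff)
  note S1 = step[OF ss s'(1,2) disjI1[OF conjI[OF st(2) s'(3)]]] and S2 = step[OF tt t'(1,2) disjI2[OF conjI[OF t'(3) st(3)]]]
   and S3 = step[OF s'(1) ss s'(2)[symmetric] disjI2[OF conjI[OF st(2) s'(3)]]] and S4 = step[OF t'(1) tt t'(2)[symmetric] disjI1[OF conjI[OF t'(3) st(3)]]]
  note ac = rack_cancel[OF rackR]
  show ?thesis proof (cases "w = 1")
   case True
   hence "z s' < z s" "z t < z t'" using ws wt by auto
   hence "E s = ?A" "?A = opr t' (E t) (E t')" "E t' = ?A" using S1 S2 S4 by blast+
   moreover have "opr t' = rmul R" using xp by (simp add: opr_def)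
   \<comment> \<open>Multiplying \<open>E t\<close> by \<open>E s\<close> gives \<open>E s\<close>
     again. Passing to actions shows that \<open>E s\<close> and \<open>E t\<close> act alike, so
     the factor \<open>E s\<close> may be replaced by \<open>E t\<close>.\<close>
   ultimately have eq: "rmul R (E t) (E s) = E s" by metis
   have "act R (E s) = act R (rmul R (E t) (E s))" unfolding eq ..
   also have "... = - act R (E s) + act R (E t) + act R (E s)" using act_conj[OF rackR act_autos[OF rackR] E_closed, of "E s" t] by (simp add: app_act[OF rackR E_closed] E_closed)
   finally have "- act R (E s) + act R (E t) + act R (E s) = 0 + act R (E s)" by simp
   hence "- act R (E s) + act R (E t) = 0" using add_right_cancel by blast
   hence "act R (E s) = act R (E t)" using neg_eq_iff_add_eq_0[of "- act R (E s)" "act R (E t)"] by simp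
   hence "rmul R (E t) (E s) = rmul R (E t) (E t)" using app_act[OF rackR E_closed, of _ "E t"] E_closed by metis
   thus ?thesis using eq by simp
  next
   case False
   hence "z s < z s'" "z t' < z t" using ws wt w(1) by auto
   hence "E t = ?A" "?A = opr s' (E s) (E s')" "E s' = ?A" using S1 S2 S3 by blast+
   moreover have "opr s' = rdiv R" using xp by (simp add: opr_def)
   ultimately have "rdiv R (E s) (E t) = E t" by metis
   thus ?thesis using ac(2)[OF E_closed[of s] E_closed[of t]] by simp
  qed
 qed
 thus ?thesis using d'(1) eps(1) by (intro exI[of _ "min d' ep"]) auto
qed

lemma opr_inverse:
 assumes "a = opr s b (E s)" "b:rcarrier R" shows "b = app (gsym R x' E s) a" proof (cases "x' s > 0")
 case True
 hence "a = app (act R (E s)) b" using assms by (simp add: opr_def app_act[OF rackR E_closed])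
 thus ?thesis using True by (simp add: gsym_def)
next
 case False
 hence a: "a = rdiv R b (E s)" using assms by (simp add: opr_def)
 hence "a:rcarrier R" "rmul R a (E s) = b" using rack_closed(2)[OF rackR assms(2) E_closed] rack_cancel(2)[OF rackR assms(2) E_closed] by simp_all
 thus ?thesis using False by (simp add: gsym_def app_act[OF rackR E_closed])
qed

text \<open>The crossing and cusp rules are the local computations above. A left cusp is not
  \<open>rear\<close>, so there the colour is locally constant.\<close>

theorem E_coloring: "coloring x y z x' y' R E" proof (intro coloring.intro[OF plane_front_axioms] coloring_axioms.intro)
 show "rack R" by (rule rackR)
 show "E t:rcarrier R" for t by (rule E_closed)
 show "E (t + 1) = E t" for t by (rule E_per)
 have nb: "\<forall>\<^sub>F s in nhds t. E s = E t" if "~ rear t" for t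
  using E_const[OF that] unfolding eventually_nhds_metric by (simp add: dist_real_def)
 show "\<forall>\<^sub>F s in nhds t. E s = E t" if "~ brk t" for t by (rule nb) (use that in "auto simp: brk_def rear_def rcusp_def")
 have lr: "\<forall>\<^sub>F t1 in at_left t. \<forall>\<^sub>F t2 in at_right t. P t1 t2"
  if "d > 0" "!!t1 t2. t - d < t1 ==> t1 < t ==> t < t2 ==> t2 < t + d ==> P t1 t2" for P :: "real => real => bool" and d t proof -
  have 1: "\<forall>\<^sub>F t1 in at_left t. t - d < t1 & t1 < t" unfolding eventually_at_left_field using that(1) by (intro exI[of _ "t - d"]) auto
  have 2: "\<forall>\<^sub>F t2 in at_right t. t < t2 & t2 < t + d" unfolding eventually_at_right_field using that(1) by (intro exI[of _ "t + d"]) auto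
  show ?thesis by (rule eventually_mono[OF 1], rule eventually_mono[OF 2]) (use that(2) in blast)
 qed
 show "\<forall>\<^sub>F t1 in at_left t. \<forall>\<^sub>F t2 in at_right t. E t1 = (if rcusp t then iota R (E t2) else E t2)" if z: "x' t = 0" for t
 proof (cases "rcusp t")
  case True
  from E_cusp[OF this] obtain d where d: "d > 0" "!!s t'. t - d < s ==> s < t ==> t < t' ==> t' < t + d ==> E s = iota R (E t')" by blast
  show ?thesis proof (rule lr[OF d(1)])
   fix t1 t2 assume "t - d < t1" "t1 < t" "t < t2" "t2 < t + d"
   from d(2)[OF this] show "E t1 = (if rcusp t then iota R (E t2) else E t2)" using True by simp
  qed
 next
  case False
  hence "~ rear t" using z dp_x' by (auto simp: rear_def over_def)
  from E_const[OF this] obtain d where d: "d > 0" "!!s. \<bar>s - t\<bar> < d ==> E s = E t" by blast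
  show ?thesis proof (rule lr[OF d(1)])
   fix t1 t2 assume "t - d < t1" "t1 < t" "t < t2" "t2 < t + d"
   hence "E t1 = E t" "E t2 = E t" by (auto intro!: d(2))
   thus "E t1 = (if rcusp t then iota R (E t2) else E t2)" using False by simp
  qed
 qed
 show "\<forall>\<^sub>F t1 in at_left t. \<forall>\<^sub>F t2 in at_right t. if x' t > 0 then E t1 = app (gsym R x' E s) (E t2) else E t2 = app (gsym R x' E s) (E t1)"
  if ov: "over s t" for s t proof -
  have nz: "x' t ~= 0" using ov dp_x' by (auto simp: over_def)
  from E_cross[OF ov] obtain d A where d: "d > 0"
   and dA: "ALL r. r ~= t & \<bar>r - t\<bar> < d --> (x t < x r --> E r = A) & (x r < x t --> A = opr s (E r) (E s))" by blast
  have st: "E r = app (gsym R x' E s) (E r')" if "x r < x t" "x t < x r'" "\<bar>r - t\<bar> < d" "\<bar>r' - t\<bar> < d" for r r'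
  proof (rule opr_inverse[OF _ E_closed])
   have "E r' = A" using dA[rule_format, of r'] that by blast
   moreover have "A = opr s (E r) (E s)" using dA[rule_format, of r] that by blast
   ultimately show "E r' = opr s (E r) (E s)" by simp
  qed
  show ?thesis proof (cases "x' t > 0")
   case True
   obtain e1 e2 where e: "e1 > 0" "ALL h>0. h < e1 --> x t < x (t + h)" "e2 > 0" "ALL h>0. h < e2 --> x (t - h) < x t"
    using DERIV_pos_inc_right[OF dx True] DERIV_pos_inc_left[OF dx True] by blast
   show ?thesis proof (rule lr[of "min d (min e1 e2)"])
    fix t1 t2 assume t: "t - min d (min e1 e2) < t1" "t1 < t" "t < t2" "t2 < t + min d (min e1 e2)"
    have "E t1 = app (gsym R x' E s) (E t2)" by (rule st) (use t e(4)[rule_format, of "t - t1"] e(2)[rule_format, of "t2 - t"] in auto)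
    thus "if x' t > 0 then E t1 = app (gsym R x' E s) (E t2) else E t2 = app (gsym R x' E s) (E t1)" using True by simp
   qed (use d e in auto)
  next
   case False
   hence n: "x' t < 0" using nz by simp
   obtain e1 e2 where e: "e1 > 0" "ALL h>0. h < e1 --> x (t + h) < x t" "e2 > 0" "ALL h>0. h < e2 --> x t < x (t - h)"
    using DERIV_neg_dec_right[OF dx n] DERIV_neg_dec_left[OF dx n] by blast
   show ?thesis proof (rule lr[of "min d (min e1 e2)"])
    fix t1 t2 assume t: "t - min d (min e1 e2) < t1" "t1 < t" "t < t2" "t2 < t + min d (min e1 e2)"
    have "E t2 = app (gsym R x' E s) (E t1)" by (rule st) (use t e(4)[rule_format, of "t - t1"] e(2)[rule_format, of "t2 - t"] in auto)
    thus "if x' t > 0 then E t1 = app (gsym R x' E s) (E t2) else E t2 = app (gsym R x' E s) (E t1)" using False by simp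
   qed (use d e in auto)
  qed
 qed
qed

end

subsection \<open>Peripheral functionals are determined by their standard values\<close>

locale two_functionals = functional + other: functional x y z x' y' u M R e' for e'
begin

text \<open>Appending the loop does not affect whether the two functionals agree. Being an
  equivalence, this passes to products and inverses of loops; invariance of the values themselves
  would fail for meridians.\<close>

definition ok :: "(real => p3) list => bool" where
 "ok l \<longleftrightarrow> pchain X v l v & (ALL s xs. pchain X (B s) xs v --> (e s xs = e' s xs \<longleftrightarrow> e s (xs @ l) = e' s (xs @ l)))"

lemma ok_HE: assumes "HE X v l l' v" "ok l" shows "ok l'" proof -
 have "e s (xs @ l) = e s (xs @ l')" "e' s (xs @ l) = e' s (xs @ l')" if "pchain X (B s) xs v" for s xs
  using HE_append[OF HE_refl[OF that] assms(1)] by (auto intro: e_HE other.e_HE)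
 thus ?thesis using assms HE_pchain(2)[OF assms(1)] by (simp add: ok_def)
qed

lemma ok_Nil: "ok []" proof -
 have "v:X" using Uf_cmpl far_Uf[of v] by auto
 thus ?thesis by (simp add: ok_def)
qed

lemma ok_append: assumes "ok l" "ok l'" shows "ok (l @ l')" proof -
 have l: "pchain X v l v" "pchain X v l' v" using assms by (auto simp: ok_def)
 have "(e s xs = e' s xs) = (e s (xs @ l @ l') = e' s (xs @ l @ l'))" if "pchain X (B s) xs v" for s xs proof -
  have "(e s xs = e' s xs) = (e s (xs @ l) = e' s (xs @ l))" using assms(1) that unfolding ok_def by blast
  also have "... = (e s ((xs @ l) @ l') = e' s ((xs @ l) @ l'))" using assms(2) pchain_appendI[OF that l(1)] unfolding ok_def by blast
  finally show ?thesis by simp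
 qed
 thus ?thesis using pchain_appendI[OF l] by (simp add: ok_def)
qed

lemma ok_rl: assumes "ok l" shows "ok (rl l)" proof -
 have l: "pchain X v l v" using assms by (simp add: ok_def)
 have "(e s xs = e' s xs) = (e s (xs @ rl l) = e' s (xs @ rl l))" if xs: "pchain X (B s) xs v" for s xs proof -
  have "HE X (B s) (xs @ (rl l @ l)) (xs @ []) v" by (rule HE_append[OF HE_refl[OF xs] HE_rl_left[OF l]])
  hence "e s ((xs @ rl l) @ l) = e s xs" "e' s ((xs @ rl l) @ l) = e' s xs" using e_HE other.e_HE by (metis append.assoc append_Nil2)+
  moreover have "pchain X (B s) (xs @ rl l) v" by (rule pchain_appendI[OF xs pchain_rl[OF l]])
  ultimately show ?thesis using assms unfolding ok_def by metis
 qed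
 thus ?thesis using pchain_rl[OF l] by (simp add: ok_def)
qed

text \<open>The same property for paths between arbitrary points, closed up by chosen paths to the
  viewer. It is compatible with composition and inversion, so it can be checked piece by
  piece.\<close>

definition okp :: "p3 => (real => p3) list => (real => p3) list => (real => p3) list => p3 => bool" where
 "okp p alp xs be q \<longleftrightarrow> pchain X p alp v & pchain X p xs q & pchain X q be v & ok (rl alp @ xs @ be)"

lemma okp_HE: assumes "okp p alp xs be q" "HE X p xs ys q" shows "okp p alp ys be q"
 using assms HE_pchain(2)[OF assms(2)] ok_HE[OF HE_ctx[OF assms(2) pchain_rl[of X p alp v]], of be] by (simp add: okp_def)

lemma okp_trans: assumes "okp p alp xs be q" "okp q be ys ga r" shows "okp p alp (xs @ ys) ga r" proof -
 have c: "pchain X p alp v" "pchain X p xs q" "pchain X q be v" "pchain X q ys r" "pchain X r ga v" using assms by (auto simp: okp_def)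
 have "HE X v ((rl alp @ xs) @ (be @ rl be) @ (ys @ ga)) ((rl alp @ xs) @ [] @ (ys @ ga)) v"
  by (rule HE_ctx[OF HE_rl_right[OF c(3)] pchain_appendI[OF pchain_rl[OF c(1)] c(2)] pchain_appendI[OF c(4,5)]])
 from ok_HE[OF this] ok_append[of "rl alp @ xs @ be" "rl be @ ys @ ga"] assms c show ?thesis by (simp add: okp_def pchain_appendI)
qed

lemma okp_sym: assumes "okp p alp xs be q" shows "okp q be (rl xs) alp p" proof -
 have c: "pchain X p alp v" "pchain X p xs q" "pchain X q be v" using assms by (auto simp: okp_def)
 have rr: "rl (rl alp) = alp" by (simp add: rl_def rev_map comp_def)
 show ?thesis using ok_rl[of "rl alp @ xs @ be"] assms pchain_rl[OF c(2)] by (simp add: okp_def rr)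
qed

lemma okp_refl: assumes "pchain X p alp v" shows "okp p alp [] alp p"
 using ok_HE[OF HE_sym[OF HE_rl_left[OF assms]] ok_Nil] assms pchain_end[OF assms] by (simp add: okp_def)

abbreviation oku :: "p3 => (real => p3) list => p3 => bool" where "oku p xs q \<equiv> okp p (sig p) xs (sig q) q"

lemma oku_Uf: assumes "pchain Uf p xs q" shows "oku p xs q" proof -
 have f: "p:Uf" "q:Uf" using pchain_end[OF assms] by auto
 have "HE X v [] (rl (sig p) @ xs @ sig q) v"
  by (rule HE_Uf) (use far_Uf[of v] pchain_appendI[OF pchain_rl[OF sig_pchain[OF f(1)]] pchain_appendI[OF assms sig_pchain[OF f(2)]]] in simp_all)
 from ok_HE[OF this ok_Nil] show ?thesis using Uf_X[OF assms] Uf_X[OF sig_pchain] f by (simp add: okp_def)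
qed

end

locale agreeing = two_functionals +
 assumes agree: "D t ~: sing ==> E t = other.E t"
begin

lemma opr_cancel: assumes "a:rcarrier R" "b:rcarrier R" "c:rcarrier R" shows "opr t a c = opr t b c \<longleftrightarrow> a = b"
 using rack_cancel[OF rackR assms(1,3)] rack_cancel[OF rackR assms(2,3)] unfolding opr_def by (cases "x' t > 0"; simp only: if_True if_False; metis)

text \<open>Both functionals are multiplied or divided by the same element \<open>E t\<close>, and
  right translations of a rack are injective.\<close>

lemma ok_mer: assumes "D t ~: sing" "low t b" shows "ok (rl (std t b) @ mer t # std t b)" proof -
 note st = low_pchain[OF assms(2)]
 have "pchain X v (rl (std t b) @ mer t # std t b) v" using pchain_appendI[OF pchain_rl[OF st] pchain_appendI[OF mer_loop st]] by simp
 moreover have "(e s xs = e' s xs) = (e s (xs @ rl (std t b) @ mer t # std t b) = e' s (xs @ rl (std t b) @ mer t # std t b))" if xs: "pchain X (B s) xs v" for s xs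
 proof -
  have "e t (std t b) = E t" "e' t (std t b) = E t" using agree[OF assms(1)] E_low[OF assms(2)] other.E_low[OF assms(2)] by simp_all
  thus ?thesis unfolding e_mer[OF xs st] other.e_mer[OF xs st] using opr_cancel[OF e_closed[OF xs] other.e_closed[OF xs] E_closed, of t t] by (simp only:)
 qed
 ultimately show ?thesis by (simp add: ok_def)
qed

lemma oku_vcross:
 assumes reg: "D t ~: sing" and a: "0 < a" "!!c. 0 < \<bar>c\<bar> ==> \<bar>c\<bar> <= a ==> (x t, z t + c) ~: range D" and Y: "y t < Y"
 defines "p \<equiv> (x t, Y, z t - a)" and "q \<equiv> (x t, Y, z t + a)" shows "oku p [linepath p q] q" proof -
 obtain b where b: "low t b" using low_exists[OF u] by blast
 have h: "HE X p [linepath p q] (sig p @ rl (std t b) @ mer t # std t b @ rl (sig q)) q"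
  unfolding p_def q_def by (rule vcross[OF reg a(1) _ Y b]) (use a(2) in auto)
 have "p:Uf" "q:Uf" using a(1) a(2)[of a] a(2)[of "- a"] by (auto simp: p_def q_def intro!: off_Uf_Ub(1))
 hence s: "pchain X p (sig p) v" "pchain X q (sig q) v" using Uf_X[OF sig_pchain] by auto
 let ?l = "rl (std t b) @ mer t # std t b"
 have l: "pchain X v ?l v" using ok_mer[OF reg b] by (simp add: ok_def)
 have "HE X v ((rl (sig p) @ sig p) @ ?l @ (rl (sig q) @ sig q)) ([] @ ?l @ []) v"
  by (rule HE_append[OF HE_rl_left[OF s(1)] HE_append[OF HE_refl[OF l] HE_rl_left[OF s(2)]]])
 from ok_HE[OF HE_sym[OF this]] ok_mer[OF reg b] have 1: "ok (rl (sig p) @ (sig p @ ?l @ rl (sig q)) @ sig q)" by simp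
 have "HE X v (rl (sig p) @ (sig p @ ?l @ rl (sig q)) @ sig q) (rl (sig p) @ [linepath p q] @ sig q) v"
  by (rule HE_ctx[OF HE_sym pchain_rl[OF s(1)] s(2)]) (use h in simp)
 from ok_HE[OF this 1] show ?thesis using s HE_pchain(1)[OF h] by (simp add: okp_def)
qed

text \<open>Induction on the number of front points met, all of them regular. A branch is passed
  either behind, where \<open>oku_vcross\<close> applies, or in front, where the path stays in
  \<open>Uf\<close>.\<close>

lemma oku_vertical:
 assumes "c1 <= c2" "(w, c1) ~: range D" "(w, c2) ~: range D"
  "!!c. c1 < c ==> c < c2 ==> (w, c) ~: sing" "!!c. c1 < c ==> c < c2 ==> (w, Y, c):X"
 shows "oku (w, Y, c1) [linepath (w, Y, c1) (w, Y, c2)] (w, Y, c2)" using assms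
proof (induction "card {c. c1 < c & c < c2 & (w, c):range D}" arbitrary: c1 c2 rule: less_induct)
 case less
 have fin: "finite {c. c1 < c & c < c2 & (w, c):range D}" for c1 c2 proof (rule finite_subset)
  show "{c. c1 < c & c < c2 & (w, c):range D} <= snd ` {P. fst P = w & P:range D}" by (force simp: image_iff)
  show "finite (snd ` {P. fst P = w & P:range D})" using finite_column_z by (rule finite_imageI)
 qed
 have off: "closed_segment (w, Y, d1) (w, Y, d2) <= Uf Int Ub" if "d1 <= d2" "!!c. d1 <= c ==> c <= d2 ==> (w, c) ~: range D" for d1 d2
  by (rule seg_off) (use that in auto)
 show ?case proof (cases "EX c. c1 < c & c < c2 & (w, c):range D")
  case False
  have "(w, c) ~: range D" if "c1 <= c" "c <= c2" for c using False less.prems(2,3) that by (cases "c = c1"; cases "c = c2") auto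
  from off[OF less.prems(1) this] show ?thesis by (intro oku_Uf) auto
 next
  case True
  then obtain t c where c: "c1 < c" "c < c2" "D t = (w, c)" by auto
  have xz: "x t = w" "z t = c" using c(3) by (auto simp: D_def)
  obtain a0 where a0: "a0 > 0" "!!b. 0 < \<bar>b\<bar> ==> \<bar>b\<bar> <= a0 ==> (x t, z t + b) ~: range D" using column_gap[of t] by blast
  \<comment> \<open>Small enough that the piece around \<open>c\<close> meets no other front point
    and stays inside the segment; each remaining piece meets fewer front points.\<close>
  define a where "a = min a0 (min (c - c1) (c2 - c) / 2)"
  have a: "0 < a" "a <= a0" "c1 < c - a" "c + a < c2" using a0(1) c by (auto simp: a_def min_def field_simps)
  have gap: "(w, c') ~: range D" if "0 < \<bar>c' - c\<bar>" "\<bar>c' - c\<bar> <= a" for c' using a0(2)[of "c' - c"] that a xz by auto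
  have e1: "(w, c - a) ~: range D" "(w, c + a) ~: range D" using gap[of "c - a"] gap[of "c + a"] a(1) by auto
  let ?P = "%c. (w, Y, c)"
  have cS: "c:{c. c1 < c & c < c2 & (w, c):range D}" using c(1,2) rangeI[of D t] c(3) by simp
  have m1: "oku (?P c1) [linepath (?P c1) (?P (c - a))] (?P (c - a))" proof (rule less.hyps)
   have "{b. c1 < b & b < c - a & (w, b):range D} <= {c. c1 < c & c < c2 & (w, c):range D}" "c ~: {b. c1 < b & b < c - a & (w, b):range D}" using a by auto
   thus "card {b. c1 < b & b < c - a & (w, b):range D} < card {c. c1 < c & c < c2 & (w, c):range D}"
    using cS by (intro psubset_card_mono[OF fin]) blast
  qed (use less.prems a e1 in auto)
  have m3: "oku (?P (c + a)) [linepath (?P (c + a)) (?P c2)] (?P c2)" proof (rule less.hyps)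
   have "{b. c + a < b & b < c2 & (w, b):range D} <= {c. c1 < c & c < c2 & (w, c):range D}" "c ~: {b. c + a < b & b < c2 & (w, b):range D}" using a by auto
   thus "card {b. c + a < b & b < c2 & (w, b):range D} < card {c. c1 < c & c < c2 & (w, c):range D}"
    using cS by (intro psubset_card_mono[OF fin]) blast
  qed (use less.prems a e1 in auto)
  have reg: "D t ~: sing" using less.prems(4)[OF c(1,2)] c(3) by simp
  have m2: "oku (?P (c - a)) [linepath (?P (c - a)) (?P (c + a))] (?P (c + a))" proof (cases "y t < Y")
   case True
   have "oku (x t, Y, z t - a) [linepath (x t, Y, z t - a) (x t, Y, z t + a)] (x t, Y, z t + a)"
    by (rule oku_vcross[OF reg a(1) _ True]) (use a0(2) a(2) in auto)
   thus ?thesis by (simp add: xz)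
  next
   case False
   have "Y ~= y t" proof
    assume "Y = y t"
    hence "K t = (w, Y, c)" by (simp add: K_def xz)
    thus False using less.prems(5)[OF c(1,2)] rangeI[of K t] by (simp add: cmpl_def)
   qed
   hence Y: "Y < y t" using False by simp
   have "?P c':Uf" if "c - a <= c'" "c' <= c + a" for c' proof (cases "c' = c")
    case True
    have "Y < y r" if Dr: "D r = (w, c)" for r proof -
     obtain k where "r = t + of_int k" using regD(3)[OF reg, of r] Dr c(3) by auto
     thus ?thesis using Y by (simp add: per)
    qed
    thus ?thesis using True by (simp add: Uf_def)
   next
    case False
    thus ?thesis using gap[of c'] that by (intro off_Uf_Ub(1)) auto
   qed
   moreover have "closed_segment (?P (c - a)) (?P (c + a)) <= ?P ` {c - a..c + a}" proof
    fix p assume "p:closed_segment (?P (c - a)) (?P (c + a))"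
    then obtain l where l: "0 <= l" "l <= 1" "p = (1 - l) *\<^sub>R ?P (c - a) + l *\<^sub>R ?P (c + a)" by (auto simp: in_segment)
    have "(1 - l) * (c - a) + l * (c + a):closed_segment (c - a) (c + a)" using l by (auto simp: in_segment)
    hence "(1 - l) * (c - a) + l * (c + a):{c - a..c + a}" using a(1) by (simp add: closed_segment_eq_real_ivl)
    moreover have "p = ?P ((1 - l) * (c - a) + l * (c + a))" unfolding l(3) by (simp add: prod_eq_iff algebra_simps)
    ultimately show "p:?P ` {c - a..c + a}" by blast
   qed
   ultimately have "closed_segment (?P (c - a)) (?P (c + a)) <= Uf" by auto
   thus ?thesis by (intro oku_Uf) auto
  qed
  have all: "oku (?P c1) ([linepath (?P c1) (?P (c - a))] @ [linepath (?P (c - a)) (?P (c + a))] @ [linepath (?P (c + a)) (?P c2)]) (?P c2)"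
   using okp_trans[OF m1 okp_trans[OF m2 m3]] by simp
  show ?thesis proof (rule okp_HE[OF all])
   have ends: "?P c1:X" "?P c2:X" using off_Uf_Ub(1)[of "?P c1"] off_Uf_Ub(1)[of "?P c2"] less.prems(2,3) Uf_cmpl by auto
   have "?P ` {c1..c2} = {w} \<times> {Y} \<times> {c1..c2}" by auto
   hence cv: "convex (?P ` {c1..c2})" by (simp only:) (intro convex_Times convex_singleton convex_real_interval)
   have sub: "?P ` {c1..c2} <= X" proof
    fix p assume "p:?P ` {c1..c2}"
    then obtain c' where "p = ?P c'" "c1 <= c'" "c' <= c2" by auto
    thus "p:X" using ends less.prems(5)[of c'] by (cases "c' = c1"; cases "c' = c2") auto
   qed
   have sg: "closed_segment (?P d1) (?P d2) <= ?P ` {c1..c2}" if "c1 <= d1" "d1 <= c2" "c1 <= d2" "d2 <= c2" for d1 d2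
    by (rule closed_segment_subset[OF _ _ cv]) (use that in auto)
   show "HE X (?P c1) ([linepath (?P c1) (?P (c - a))] @ [linepath (?P (c - a)) (?P (c + a))] @ [linepath (?P (c + a)) (?P c2)]) [linepath (?P c1) (?P c2)] (?P c2)"
    by (rule HE_convex[OF cv sub]) (use sg a c less.prems(1) in auto)
  qed
 qed
qed

lemma column_free: assumes "a < b" shows "EX c. a < c & c < b & (w, c) ~: range D" proof -
 have "finite (snd ` {P. fst P = w & P:range D})" by (rule finite_imageI[OF finite_column_z])
 moreover have "infinite {a<..<b}" using assms by (simp add: infinite_Ioo)
 ultimately have "~ {a<..<b} <= snd ` {P. fst P = w & P:range D}" using finite_subset by blast
 then obtain c where c: "c:{a<..<b}" "c ~: snd ` {P. fst P = w & P:range D}" by blast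
 have "(w, c) ~: range D" proof
  assume "(w, c):range D"
  hence "(w, c):{P. fst P = w & P:range D}" by simp
  hence "c:snd ` {P. fst P = w & P:range D}" by (rule image_eqI[rotated]) simp
  thus False using c(2) by contradiction
 qed
 thus ?thesis using c(1) by auto
qed

lemma off_dense: assumes "open N" "p:N" shows "EX q:N. pl q ~: range D" proof -
 obtain r where r: "r > 0" "ball p r <= N" using openE[OF assms] .
 have "snd (snd p) < snd (snd p) + r" using r(1) by simp
 from column_free[OF this, of "fst p"] obtain c where c: "snd (snd p) < c" "c < snd (snd p) + r" "(fst p, c) ~: range D" by blast
 have "dist p (fst p, py3 p, c) = \<bar>c - snd (snd p)\<bar>" by (cases p) (simp add: dist_Pair_Pair dist_real_def)
 hence "(fst p, py3 p, c):N" using r(2) c(1,2) by auto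
 thus ?thesis using c(3) by (intro bexI) simp_all
qed

text \<open>In a small box everything can be moved to a top row that misses the front; only regular
  points are passed on the way, since the singular ones lie in a single column.\<close>

lemma good_box:
 assumes "p0:X" shows "EX N. open N & convex N & p0:N & N <= X &
  (ALL w:N. ALL w':N. pl w ~: range D --> pl w' ~: range D --> oku w [linepath w w'] w')" proof -
 obtain x0 y0 z0 where p0: "p0 = (x0, y0, z0)" by (cases p0) auto
 have "compact (K ` {0..1})" by (intro compact_continuous_image contK) auto
 moreover have "range K = K ` {0..1}" proof (intro equalityI subsetI)
  fix p assume "p:range K"
  then obtain t where t: "p = K t" by auto
  obtain s k where "s:{0..1}" "t = s + of_int k" using reduce[of t] by blast
  thus "p:K ` {0..1}" using t by (auto simp: per)
 qed auto
 ultimately have "open X" unfolding cmpl_def by (intro open_Compl compact_imp_closed) simp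
 then obtain r where r: "r > 0" "ball p0 r <= X" using assms openE by blast
 define r2 where "r2 = r / 4"
 have r2: "r2 > 0" using r(1) by (simp add: r2_def)
 \<comment> \<open>The level of the top row: inside the box and off the front at
   \<open>x0\<close>.\<close>
 obtain zt where zt: "z0 < zt" "zt < z0 + r2" "(x0, zt) ~: range D" using column_free[of z0 "z0 + r2" x0] r2 by auto
 have "open ((%xi. (xi, zt)) -` (- range D))" by (intro open_vimage open_Compl closed_D continuous_intros)
 moreover have "x0:(%xi. (xi, zt)) -` (- range D)" using zt(3) by simp
 ultimately obtain e1 where e1: "e1 > 0" "ball x0 e1 <= (%xi. (xi, zt)) -` (- range D)" by (rule openE)
 have "finite (fst ` sing)" using finite_sing by simp
 from finite_set_avoid[OF this, of x0] obtain e2 where e2: "e2 > 0" "ALL w:fst ` sing. w ~= x0 --> e2 <= dist x0 w" by blast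
 \<comment> \<open>\<open>e1\<close> keeps the row off the front; \<open>e2\<close> confines the
   singular points of the box to the column of \<open>x0\<close>.\<close>
 define r1 where "r1 = min r2 (min e1 e2)"
 have r1: "r1 > 0" "r1 <= r2" "r1 <= e1" "r1 <= e2" using r2 e1(1) e2(1) by (auto simp: r1_def)
 have top: "(xi, zt) ~: range D" if "\<bar>xi - x0\<bar> < r1" for xi proof -
  have "xi:ball x0 e1" using that r1(3) by (auto simp: dist_real_def)
  thus ?thesis using e1(2) by blast
 qed
 have nosing: "(xi, c) ~: sing" if "\<bar>xi - x0\<bar> < r1" "xi ~= x0" for xi c proof
  assume "(xi, c):sing"
  hence "xi:fst ` sing" by (rule image_eqI[rotated]) simp
  thus False using e2(2) that r1(4) by (auto simp: dist_real_def)
 qed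
 define N where "N = ball x0 r1 \<times> ball y0 r2 \<times> ball z0 r2"
 have N: "open N" "convex N" "p0:N" using r1(1) r2 by (auto simp: N_def p0 intro!: open_Times convex_Times)
 have mem: "(a, b, c):N \<longleftrightarrow> \<bar>a - x0\<bar> < r1 & \<bar>b - y0\<bar> < r2 & \<bar>c - z0\<bar> < r2" for a b c
  by (auto simp: N_def dist_real_def abs_minus_commute)
 have NX: "N <= X" proof
  fix p assume "p:N"
  then obtain a b c where p: "p = (a, b, c)" "\<bar>a - x0\<bar> < r1" "\<bar>b - y0\<bar> < r2" "\<bar>c - z0\<bar> < r2" by (cases p) (auto simp: mem)
  have "dist p0 p = norm (x0 - a, y0 - b, z0 - c)" by (simp add: p p0 dist_norm)
  also have "... <= norm (x0 - a) + (norm (y0 - b) + norm (z0 - c))"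
   using norm_Pair_le[of "x0 - a" "(y0 - b, z0 - c)"] norm_Pair_le[of "y0 - b" "z0 - c"] by linarith
  also have "... < r" using p r1(2) r(1) by (auto simp: r2_def abs_minus_commute)
  finally show "p:X" using r(2) by auto
 qed
 have seg: "closed_segment w w' <= N" if "w:N" "w':N" for w w' by (rule closed_segment_subset[OF that N(2)])
 have up: "oku w [linepath w (fst w, py3 w, zt)] (fst w, py3 w, zt)" if w: "w:N" "pl w ~: range D" "fst w ~= x0" for w proof -
  obtain a b c where w': "w = (a, b, c)" by (cases w) auto
  have m: "\<bar>a - x0\<bar> < r1" "\<bar>b - y0\<bar> < r2" "\<bar>c - z0\<bar> < r2" using w(1) by (auto simp: mem w')
  have ns: "(a, c') ~: sing" for c' using nosing[OF m(1)] w(3) by (simp add: w')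
  have iX: "(a, b, c'):X" if "min c zt < c'" "c' < max c zt" for c' proof -
   have "(a, b, c'):N" using m zt that by (auto simp: mem abs_less_iff)
   thus ?thesis using NX by blast
  qed
  have o: "(a, c) ~: range D" "(a, zt) ~: range D" using w(2) top[OF m(1)] by (auto simp: w')
  show ?thesis proof (cases "c <= zt")
   case True
   have "oku (a, b, c) [linepath (a, b, c) (a, b, zt)] (a, b, zt)" by (rule oku_vertical[OF True o ns]) (use iX True in "simp add: min_def max_def")
   thus ?thesis by (simp add: w')
  next
   case False
   have "oku (a, b, zt) [linepath (a, b, zt) (a, b, c)] (a, b, c)"
    by (rule oku_vertical[OF _ o(2,1) ns]) (use iX False in "simp_all add: min_def max_def")
   from okp_sym[OF this] show ?thesis by (simp add: w')
  qed
 qed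
 \<comment> \<open>A point in the exceptional column is first moved aside within a ball that misses
   the front.\<close>
 have shift: "EX w1:N. pl w1 ~: range D & fst w1 ~= x0 & oku w [linepath w w1] w1" if w: "w:N" "pl w ~: range D" for w proof -
  have "open (N Int (%p. pl p) -` (- range D))" by (intro open_Int N open_vimage open_Compl closed_D continuous_intros)
  moreover have "w:N Int (%p. pl p) -` (- range D)" using w by simp
  ultimately obtain e where e: "e > 0" "ball w e <= N Int (%p. pl p) -` (- range D)" by (rule openE)
  obtain h where h: "0 < h" "h < e" "fst w + h ~= x0" using e(1) that[of "e/2"] that[of "e/3"] by (cases "fst w + e/2 = x0") auto
  define w1 where "w1 = w + (h, 0, 0)"
  have "dist w w1 = h" using h(1) by (simp add: w1_def dist_norm norm_Pair)
  hence wb: "w1:ball w e" "w:ball w e" using h e(1) by auto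
  have "closed_segment w w1 <= ball w e" by (rule closed_segment_subset[OF wb(2,1) convex_ball])
  hence "closed_segment w w1 <= Uf" using e(2) off_Uf_Ub(1) by blast
  hence "oku w [linepath w w1] w1" by (intro oku_Uf) auto
  moreover have "w1:N" "pl w1 ~: range D" using wb(1) e(2) by blast+
  moreover have "fst w1 ~= x0" using h(3) by (simp add: w1_def)
  ultimately show ?thesis by blast
 qed
 have "oku w [linepath w w'] w'" if w: "w:N" "pl w ~: range D" and w': "w':N" "pl w' ~: range D" for w w' proof -
  obtain w1 where w1: "w1:N" "pl w1 ~: range D" "fst w1 ~= x0" "oku w [linepath w w1] w1" using shift[OF w] by blast
  obtain w1' where w1': "w1':N" "pl w1' ~: range D" "fst w1' ~= x0" "oku w' [linepath w' w1'] w1'" using shift[OF w'] by blast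
  let ?t = "(fst w1, py3 w1, zt)" and ?t' = "(fst w1', py3 w1', zt)"
  have tN: "?t:N" "?t':N" using w1(1) w1'(1) zt by (cases w1; cases w1'; auto simp: mem)+
  have "closed_segment ?t ?t' <= Uf" proof
   fix p assume p: "p:closed_segment ?t ?t'"
   hence "p:N" using seg[OF tN] by blast
   moreover obtain l where "p = (1 - l) *\<^sub>R ?t + l *\<^sub>R ?t'" using p by (auto simp: in_segment)
   hence "snd (snd p) = zt" by (simp add: algebra_simps)
   ultimately have "pl p ~: range D" using top[of "fst p"] by (cases p) (auto simp: mem)
   thus "p:Uf" by (rule off_Uf_Ub(1))
  qed
  hence "oku ?t [linepath ?t ?t'] ?t'" by (intro oku_Uf) auto
  from okp_trans[OF w1(4) okp_trans[OF up[OF w1(1-3)] okp_trans[OF this okp_trans[OF okp_sym[OF up[OF w1'(1-3)]] okp_sym[OF w1'(4)]]]]]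
  have 1: "oku w [linepath w w1, linepath w1 ?t, linepath ?t ?t', linepath ?t' w1', linepath w1' w'] w'" by simp
  show ?thesis by (rule okp_HE[OF 1], rule HE_convex[OF N(2) NX]) (use seg w1(1) w1'(1) w(1) w'(1) tN in auto)
 qed
 thus ?thesis using N NX by blast
qed

definition cell :: "p3 => p3 set" where
 "cell p = (SOME N. open N & convex N & p:N & N <= X &
  (ALL w:N. ALL w':N. pl w ~: range D --> pl w' ~: range D --> oku w [linepath w w'] w'))"

lemma cell: assumes "p:X" shows "open (cell p)" "convex (cell p)" "p:cell p" "cell p <= X"
  "!!w w'. w:cell p ==> w':cell p ==> pl w ~: range D ==> pl w' ~: range D ==> oku w [linepath w w'] w'"
 using someI_ex[OF good_box[OF assms], folded cell_def] by blast+

definition anchor :: "p3 => p3" where "anchor p = (SOME w. w:cell p & pl w ~: range D)"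
text \<open>\<open>sig\<close> avoids the knot only when it starts in front of it. From a general
  point one first moves within its cell to a point off the front.\<close>

definition alp :: "p3 => (real => p3) list" where "alp p = linepath p (anchor p) # sig (anchor p)"

lemma anchor: assumes "p:X" shows "anchor p:cell p" "pl (anchor p) ~: range D"
 using someI_ex[OF off_dense[OF cell(1,3)[OF assms], unfolded Bex_def]] unfolding anchor_def by auto

lemma off_sig: "pl w ~: range D ==> pchain X w (sig w) v" by (rule Uf_X[OF sig_pchain[OF off_Uf_Ub(1)]])

lemma cell_seg: "p:X ==> a:cell p ==> b:cell p ==> closed_segment a b <= cell p" using closed_segment_subset cell(2) by blast

lemma alp_pchain: assumes "p:X" shows "pchain X p (alp p) v"
 using off_sig[OF anchor(2)[OF assms]] cell_seg[OF assms cell(3)[OF assms] anchor(1)[OF assms]] cell(4)[OF assms] by (auto simp: alp_def)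

lemma alp_off:
 assumes p: "p:X" and w: "w:cell p" "pl w ~: range D" shows "okp p (alp p) [linepath p w] (sig w) w" proof -
 let ?a = "anchor p"
 note a = anchor[OF p]
 have 1: "oku ?a [linepath ?a w] w" by (rule cell(5)[OF p a(1) w(1) a(2) w(2)])
 have "HE X ?a [linepath ?a w] [linepath ?a p, linepath p w] w"
  by (rule HE_convex[OF cell(2,4)[OF p]]) (use cell_seg[OF p] cell(3)[OF p] a(1) w(1) in auto)
 from okp_HE[OF 1 this] have "ok (rl (sig ?a) @ [linepath ?a p, linepath p w] @ sig w)" by (simp add: okp_def)
 hence "ok (rl (alp p) @ [linepath p w] @ sig w)" by (simp add: alp_def)
 moreover have "pchain X p [linepath p w] w" using cell_seg[OF p cell(3)[OF p] w(1)] cell(4)[OF p] w(1) by auto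
 ultimately show ?thesis using alp_pchain[OF p] off_sig[OF w(2)] by (simp add: okp_def)
qed

text \<open>Points off the front are dense, so near each end one can be chosen in both the cell of
  that end and the cell of \<open>p0\<close>. The former cell links it to \<open>alp\<close>, the
  latter links the two choices.\<close>

lemma alp_local:
 assumes p0: "p0:X" and p: "p:cell p0" "q:cell p0" and g: "pchain (cell p0) p xs q" shows "okp p (alp p) xs (alp q) q" proof -
 have pX: "p:X" "q:X" using p cell(4)[OF p0] by auto
 obtain w where w: "w:cell p" "w:cell p0" "pl w ~: range D"
  using off_dense[OF open_Int[OF cell(1)[OF pX(1)] cell(1)[OF p0]], of p] cell(3)[OF pX(1)] p(1) by blast
 obtain w' where w': "w':cell q" "w':cell p0" "pl w' ~: range D"
  using off_dense[OF open_Int[OF cell(1)[OF pX(2)] cell(1)[OF p0]], of q] cell(3)[OF pX(2)] p(2) by blast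
 have 1: "okp p (alp p) ([linepath p w] @ [linepath w w'] @ rl [linepath q w']) (alp q) q"
  by (rule okp_trans[OF alp_off[OF pX(1) w(1,3)] okp_trans[OF cell(5)[OF p0 w(2) w'(2) w(3) w'(3)] okp_sym[OF alp_off[OF pX(2) w'(1,3)]]]])
 show ?thesis by (rule okp_HE[OF 1], rule HE_convex[OF cell(2,4)[OF p0]]) (use cell_seg[OF p0] p w(2) w'(2) g in auto)
qed

text \<open>Short pieces of a path lie in single cells by continuity, and bisection composes
  them.\<close>

lemma alp_path:
 assumes "path ga" "path_image ga <= X" shows "okp (pathstart ga) (alp (pathstart ga)) [ga] (alp (pathfinish ga)) (pathfinish ga)" proof -
 have c: "continuous_on {0..1} ga" and i: "ga ` {0..1} <= X" using assms by (auto simp: path_def path_image_def)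
 define P where "P a b \<longleftrightarrow> (0 <= a & b <= 1 --> okp (ga a) (alp (ga a)) [slide ga a b] (alp (ga b)) (ga b))" for a b
 have "P 0 1" proof (rule Bolzano)
  fix a b d :: real assume ab: "P a b" "P b d" "a <= b" "b <= d"
  show "P a d" unfolding P_def proof
   assume ad: "0 <= a & d <= 1"
   have "HE {0..1} a [linepath a b, linepath b d] [linepath a d] d"
    by (rule HE_convex[OF convex_real_interval(5) order_refl]) (use ab ad in "auto simp: closed_segment_eq_real_ivl")
   from HE_image[OF c i this] have h: "HE X (ga a) [slide ga a b, slide ga b d] [slide ga a d] (ga d)" by (simp add: slide_def)
   have "okp (ga a) (alp (ga a)) ([slide ga a b] @ [slide ga b d]) (alp (ga d)) (ga d)" by (rule okp_trans) (use ab ad in "auto simp: P_def")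
   from okp_HE[OF this] h show "okp (ga a) (alp (ga a)) [slide ga a d] (alp (ga d)) (ga d)" by simp
  qed
 next
  fix ta :: real assume t: "0 <= ta" "ta <= 1"
  have tX: "ga ta:X" using i t by auto
  obtain de where d: "de > 0" "!!r. r:{0..1} ==> \<bar>r - ta\<bar> < de ==> ga r:cell (ga ta)" proof -
   obtain e where e: "e > 0" "ball (ga ta) e <= cell (ga ta)" using openE[OF cell(1,3)[OF tX]] .
   obtain de where d: "de > 0" "ALL r:{0..1}. dist r ta < de --> dist (ga r) (ga ta) < e"
    using c[unfolded continuous_on_iff] t e(1) by (meson atLeastAtMost_iff)
   show thesis proof (rule that[OF d(1)])
    fix r :: real assume "r:{0..1}" "\<bar>r - ta\<bar> < de"
    hence "ga r:ball (ga ta) e" using d(2) by (simp add: dist_real_def dist_commute[of "ga ta"])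
    thus "ga r:cell (ga ta)" using e(2) by blast
   qed
  qed
  have "P a b" if ab: "a <= ta & ta <= b & b - a < de" for a b unfolding P_def proof
   assume r: "0 <= a & b <= 1"
   have m: "ga r':cell (ga ta)" if "r':{a..b}" for r' by (rule d(2)) (use that ab r in "auto simp: abs_less_iff")
   have cs: "closed_segment a b = {a..b}" using ab by (simp add: closed_segment_eq_real_ivl)
   have "pchain (cell (ga ta)) (ga a) [slide ga a b] (ga b)" proof -
    have "path (slide ga a b)" unfolding slide_def
     by (rule path_continuous_image[OF path_linepath]) (rule continuous_on_subset[OF c], use cs r in auto)
    moreover have "path_image (slide ga a b) <= cell (ga ta)" using m by (auto simp: slide_def path_image_compose cs)
    ultimately show ?thesis using m[of b] ab by (simp add: slide_def pathstart_compose pathfinish_compose)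
   qed
   thus "okp (ga a) (alp (ga a)) [slide ga a b] (alp (ga b)) (ga b)" by (rule alp_local[OF tX m m, rotated 2]) (use ab in auto)
  qed
  thus "EX d>0. ALL a b. a <= ta & ta <= b & b - a < d --> P a b" using d(1) by blast
 qed simp
 moreover have "slide ga 0 1 = ga" by (simp add: slide_def linepath_def fun_eq_iff)
 ultimately show ?thesis by (simp add: P_def pathstart_def pathfinish_def)
qed

lemma alp_pchain_ok: "pchain X p xs q ==> okp p (alp p) xs (alp q) q" proof (induction xs arbitrary: p)
 case Nil
 hence "p = q" "q:X" by auto
 thus ?case using okp_refl[OF alp_pchain[of q]] by simp
next
 case (Cons ga xs)
 hence c: "path ga" "path_image ga <= X" "pathstart ga = p" "pchain X (pathfinish ga) xs q" by auto
 show ?case using okp_trans[OF alp_path[OF c(1,2)] Cons.IH[OF c(4)]] c(3) by simp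
qed

lemma alp_front: assumes "p:Uf" shows "okp p (alp p) [] (sig p) p" proof -
 have pX: "p:X" using assms Uf_cmpl by blast
 obtain r where r: "r > 0" "ball p r <= cell p Int Uf" using openE[OF open_Int[OF cell(1)[OF pX] open_Uf]] assms cell(3)[OF pX] by blast
 obtain w where w: "w:ball p r" "pl w ~: range D" using off_dense[OF open_ball, of p p r] r(1) by auto
 have "p:ball p r" using r(1) by simp
 hence sg: "closed_segment p w <= Uf" using closed_segment_subset[OF _ w(1) convex_ball, of p] r(2) by blast
 have wf: "w:cell p" "w:Uf" using w r(2) by auto
 have pw: "pchain Uf p [linepath p w] w" using sg wf by auto
 have "okp p (alp p) ([linepath p w] @ rl [linepath p w]) (sig p) p" by (rule okp_trans[OF alp_off[OF pX wf(1) w(2)] okp_sym[OF oku_Uf[OF pw]]])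
 from okp_HE[OF this HE_rl_right[OF Uf_X[OF pw]]] show ?thesis .
qed

text \<open>Every path is now admissible with respect to \<open>alp\<close>. From a regular
  parameter, a path and a standard one differ by an \<open>ok\<close> loop, and the functionals
  agree on standard paths; other starting points are reached by sliding.\<close>

theorem agree_everywhere: assumes xs: "pchain X (B t) xs v" shows "e t xs = e' t xs" proof -
 have reg: "e r xs = e' r xs" if r: "D r ~: sing" and xs: "pchain X (B r) xs v" for r xs proof -
  obtain b where b: "low r b" using low_exists[OF u] by blast
  let ?q = "push K b r"
  have f: "?q:Uf" "v:Uf" using low_Uf[OF b lowI(1)[OF b] order_refl] far_Uf[of v] by auto
  note vX = vert_chain(1)[OF lowI[OF b]]
  note st = low_pchain[OF b]
  have 1: "okp (B r) (alp (B r)) ([vert r u b] @ []) (sig ?q) ?q" by (rule okp_trans[OF alp_pchain_ok[OF vX] alp_front[OF f(1)]])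
  have 2: "okp (B r) (alp (B r)) (xs @ []) (sig v) v" by (rule okp_trans[OF alp_pchain_ok[OF xs] alp_front[OF f(2)]])
  have 3: "okp ?q (sig ?q) (rl [vert r u b] @ xs) (sig v) v" using okp_trans[OF okp_sym[OF 1] 2] by simp
  have s: "HE X v (sig v) [] v" by (rule HE_Uf[OF sig_pchain[OF f(2)]]) (use f in simp)
  have "HE X v (rl (sig ?q) @ (rl [vert r u b] @ xs) @ sig v) (rl (std r b) @ xs) v"
   using HE_append[OF HE_refl[OF pchain_appendI[OF pchain_rl[OF st] xs]] s] by (simp add: std_def)
  from ok_HE[OF this] 3 have l: "ok (rl (std r b) @ xs)" by (simp add: okp_def)
  have "e r (std r b) = e' r (std r b)" using agree[OF r] E_low[OF b] other.E_low[OF b] by simp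
  hence "e r (std r b @ rl (std r b) @ xs) = e' r (std r b @ rl (std r b) @ xs)" using l st unfolding ok_def by blast
  moreover have "HE X (B r) (std r b @ rl (std r b) @ xs) xs v" using HE_append[OF HE_rl_right[OF st] HE_refl[OF xs]] by simp
  ultimately show ?thesis using e_HE other.e_HE by metis
 qed
 obtain de where d: "de > 0" "!!r. r ~= t ==> \<bar>r - t\<bar> < de ==> D r ~: sing" using reg_interval[of t] by blast
 have r: "D (t + de/2) ~: sing" using d(2)[of "t + de/2"] d(1) by simp
 have "pchain X (B (t + de/2)) (slide B (t + de/2) t # xs) v" using slide_X[OF u order_refl] xs by (simp add: slide_props)
 from reg[OF r this] show ?thesis using e_slide[OF xs] other.e_slide[OF xs] by metis
qed

end

section \<open>Strands and colourings\<close>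

text \<open>The dictionary between the front \<open>C\<close> and its coordinates. The determinant
  of the tangents at a crossing is \<open>x' s * x' t\<close> times the positive difference of
  slopes, whence the sign conditions.\<close>

locale lfront = plane_front +
 fixes C :: "real => real ^ 2"
 assumes cuspC: "cusp C t \<longleftrightarrow> x' t = 0"
  and posC: "positive_crossing C s t \<longleftrightarrow> over s t & x' s * x' t > 0"
  and negC: "negative_crossing C s t \<longleftrightarrow> over s t & x' s * x' t < 0"
  and crossC: "crossing C s t \<longleftrightarrow> over s t"
begin

lemma breaksC: "breaks C = {t. brk t}" by (simp add: breaks_def cuspC crossC brk_def)

lemma brk_isolated: "EX de>0. ALL s. s ~= t & \<bar>s - t\<bar> < de --> ~ brk s" using reg_interval[of t] regD(2) by blast

lemma closed_brk: "closed {t. brk t}" proof -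
 have "EX e>0. ALL s. dist s t < e --> ~ brk s" if "~ brk t" for t proof -
  obtain de where "de > 0" "!!s. s ~= t ==> \<bar>s - t\<bar> < de ==> ~ brk s" using brk_isolated[of t] by blast
  hence "ALL s. dist s t < de --> ~ brk s" using that unfolding dist_real_def by metis
  thus ?thesis using \<open>de > 0\<close> by blast
 qed
 hence "open (- {t. brk t})" unfolding open_dist by auto
 thus ?thesis by (simp add: closed_def)
qed

lemma finite_brk: "finite ({t. brk t} Int {a..b})" using finite_if_isolated[OF closed_brk] brk_isolated by simp

text \<open>By Rolle's theorem the periodic \<open>x\<close> has a critical point, which is a cusp,
  so the gaps between breaks are bounded.\<close>

lemma brk_exists: "EX b. brk b & t < b & b <= t + 1" proof -
 obtain r where r: "x' r = 0" using rolle_x[of 0 1] per(1)[of 0 1] by auto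
 define b where "b = r + of_int (\<lfloor>t - r\<rfloor> + 1)"
 have "brk b" unfolding b_def brk_shift by (simp add: brk_def r)
 moreover have "t < b" "b <= t + 1" unfolding b_def by linarith+
 ultimately show ?thesis by blast
qed

definition gap :: "real => real => bool" where
 "gap a b \<longleftrightarrow> a < b & brk a & brk b & (ALL s. a < s & s < b --> ~ brk s)"

lemma around: assumes "~ brk t" shows "EX a b. gap a b & a < t & t < b" proof -
 let ?S = "{t. brk t} Int {t..t + 1}" and ?T = "{t. brk t} Int {t - 1..t}"
 obtain b0 where b0: "brk b0" "t < b0" "b0 <= t + 1" using brk_exists by blast
 obtain a0 where a0: "brk a0" "t - 1 < a0" "a0 <= t" using brk_exists[of "t - 1"] by auto
 have S: "finite ?S" "?S ~= {}" and T: "finite ?T" "?T ~= {}" using finite_brk a0 b0 by auto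
 have b: "brk (Min ?S)" "t <= Min ?S" "Min ?S <= t + 1" using Min_in[OF S] by auto
 have a: "brk (Max ?T)" "t - 1 <= Max ?T" "Max ?T <= t" using Max_in[OF T] by auto
 have ne: "t ~= Min ?S" "t ~= Max ?T" using a(1) b(1) assms by metis+
 have "~ brk s" if s: "Max ?T < s" "s < Min ?S" for s proof
  assume k: "brk s"
  show False proof (cases "s <= t")
   case True
   thus False using Max_ge[OF T(1), of s] k s(1) a(2) by auto
  next
   case False
   thus False using Min_le[OF S(1), of s] k s(2) b(3) by auto
  qed
 qed
 hence "gap (Max ?T) (Min ?S)" using a b ne by (auto simp: gap_def)
 thus ?thesis using a b ne by (intro exI[of _ "Max ?T"] exI[of _ "Min ?S"]) auto
qed

lemma strand_gap: "strand_from_to C a b S \<longleftrightarrow> gap a b & S = {u. EX k::int. u + of_int k:{a<..<b}}"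
 unfolding strand_from_to_def gap_def breaksC by auto

lemma gap_unique: assumes "gap a b" "gap a' b'" "a < t" "t < b" "a' < t" "t < b'" shows "a = a' & b = b'" proof -
 have "~ a < a'" "~ a' < a" "~ b < b'" "~ b' < b" using assms by (force simp: gap_def)+
 thus ?thesis by auto
qed

lemma gap_shift: "gap (a + of_int k) (b + of_int k) \<longleftrightarrow> gap a b" proof -
 have "gap (a + of_int k) (b + of_int k)" if g: "gap a b" for a b and k :: int proof -
  have "~ brk s" if "a + of_int k < s" "s < b + of_int k" for s proof -
   have "~ brk (s + of_int (- k))" using g that unfolding gap_def by auto
   thus ?thesis unfolding brk_shift .
  qed
  thus ?thesis using g unfolding gap_def brk_shift by simp
 qed
 from this[of a b k] this[of "a + of_int k" "b + of_int k" "- k"] show ?thesis by auto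
qed

lemma strand_unique: assumes "S:strands C" "S':strands C" "t:S" "t:S'" shows "S = S'" proof -
 obtain a b k where S: "gap a b" "S = {u. EX k::int. u + of_int k:{a<..<b}}" "t + of_int k:{a<..<b}"
  using assms(1,3) by (auto simp: strands_def strand_gap)
 obtain a' b' k' where S': "gap a' b'" "S' = {u. EX k::int. u + of_int k:{a'<..<b'}}" "t + of_int k':{a'<..<b'}"
  using assms(2,4) by (auto simp: strands_def strand_gap)
 have "gap (a + of_int (- k)) (b + of_int (- k))" "gap (a' + of_int (- k')) (b' + of_int (- k'))" unfolding gap_shift by (rule S(1), rule S'(1))
 from gap_unique[OF this, of t] have e: "a' = a + of_int (k' - k)" "b' = b + of_int (k' - k)" using S(3) S'(3) by auto
 have "(EX j::int. u + of_int j:{a<..<b}) \<longleftrightarrow> (EX j::int. u + of_int j:{a'<..<b'})" for u proof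
  assume "EX j::int. u + of_int j:{a<..<b}"
  then obtain j :: int where "u + of_int j:{a<..<b}" by blast
  thus "EX j::int. u + of_int j:{a'<..<b'}" by (intro exI[of _ "j + (k' - k)"]) (auto simp: e)
 next
  assume "EX j::int. u + of_int j:{a'<..<b'}"
  then obtain j :: int where "u + of_int j:{a'<..<b'}" by blast
  thus "EX j::int. u + of_int j:{a<..<b}" by (intro exI[of _ "j - (k' - k)"]) (auto simp: e)
 qed
 thus ?thesis using S(2) S'(2) by blast
qed

definition strand :: "real => real set" where "strand t = (SOME S. S:strands C & t:S)"

lemma strand_eq: assumes "S:strands C" "t:S" shows "strand t = S" proof -
 have "strand t:strands C & t:strand t" unfolding strand_def by (rule someI[of _ S]) (use assms in simp)
 thus ?thesis using strand_unique assms by blast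
qed

lemma gap_strand: assumes "gap a b" shows "EX S:strands C. strand_from_to C a b S & {a<..<b} <= S" proof -
 let ?S = "{u. EX k::int. u + of_int k:{a<..<b}}"
 have 1: "strand_from_to C a b ?S" using assms by (simp add: strand_gap)
 hence 2: "?S:strands C" unfolding strands_def by blast
 have "t:?S" if "t:{a<..<b}" for t using that by (auto intro: exI[of _ 0])
 hence "{a<..<b} <= ?S" by blast
 thus ?thesis using 1 2 by blast
qed

lemma strand_const: assumes "gap a b" "a < t" "t < b" shows "strand_from_to C a b (strand t)" "strand t:strands C" proof -
 obtain S where "S:strands C" "strand_from_to C a b S" "{a<..<b} <= S" using gap_strand[OF assms(1)] by blast
 moreover from this have "strand t = S" using assms by (intro strand_eq) auto
 ultimately show "strand_from_to C a b (strand t)" "strand t:strands C" by auto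
qed

lemma strand_same: assumes "gap a b" "a < t" "t < b" "a < s" "s < b" shows "strand s = strand t"
 using strand_const(1)[OF assms(1-3)] strand_const(1)[OF assms(1,4,5)] by (simp add: strand_gap)

lemma strand_mem: assumes "~ brk t" shows "t:strand t" "strand t:strands C" proof -
 obtain a b where ab: "gap a b" "a < t" "t < b" using around[OF assms] by blast
 show "strand t:strands C" by (rule strand_const[OF ab])
 show "t:strand t" using strand_const(1)[OF ab] ab by (auto simp: strand_gap intro!: exI[of _ "0::int"])
qed

lemma mem_strand: assumes "S:strands C" "t:S" shows "~ brk t" "t + of_int k:S" proof -
 obtain a b j where S: "gap a b" "S = {u. EX k::int. u + of_int k:{a<..<b}}" "t + of_int j:{a<..<b}"
  using assms by (auto simp: strands_def strand_gap)
 have "~ brk (t + of_int j)" using S(1,3) by (auto simp: gap_def)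
 thus "~ brk t" by (simp add: brk_shift)
 have "t + of_int k + of_int (j - k):{a<..<b}" using S(3) by simp
 thus "t + of_int k:S" unfolding S(2) by blast
qed

lemma strand_per: "strand (t + of_int k) = strand t" proof -
 have "S:strands C & t + of_int k:S \<longleftrightarrow> S:strands C & t:S" for S
  using mem_strand(2)[of S t k] mem_strand(2)[of S "t + of_int k" "- k"] by auto
 thus ?thesis by (simp add: strand_def)
qed

lemma into_left: assumes "strand_into C t S" shows "\<forall>\<^sub>F r in at_left t. r:S" "S:strands C" proof -
 obtain a where a: "strand_from_to C a t S" using assms by (auto simp: strand_into_def)
 hence "ALL r. a < r & r < t --> r:S" by (auto simp: strand_gap intro!: exI[of _ "0::int"])
 thus "\<forall>\<^sub>F r in at_left t. r:S" unfolding eventually_at_left_field using a by (auto simp: strand_from_to_def)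
 show "S:strands C" using a by (auto simp: strands_def)
qed

lemma out_right: assumes "strand_out_of C t S" shows "\<forall>\<^sub>F r in at_right t. r:S" "S:strands C" proof -
 obtain a where a: "strand_from_to C t a S" using assms by (auto simp: strand_out_of_def)
 hence "ALL r. t < r & r < a --> r:S" by (auto simp: strand_gap intro!: exI[of _ "0::int"])
 thus "\<forall>\<^sub>F r in at_right t. r:S" unfolding eventually_at_right_field using a by (auto simp: strand_from_to_def)
 show "S:strands C" using a by (auto simp: strands_def)
qed

lemma adjacent_gaps: assumes "brk t" shows "EX a b. gap a t & gap t b" proof -
 obtain de where d: "de > 0" "!!s. s ~= t ==> \<bar>s - t\<bar> < de ==> ~ brk s" using brk_isolated[of t] by blast
 have nb: "~ brk s" if "t - de < s" "s < t + de" "s ~= t" for s using d(2)[of s] that by auto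
 obtain a b where ab: "gap a b" "a < t - de/2" "t - de/2 < b" using around[OF nb[of "t - de/2"]] d(1) by auto
 obtain a' b' where ab': "gap a' b'" "a' < t + de/2" "t + de/2 < b'" using around[OF nb[of "t + de/2"]] d(1) by auto
 have "b = t" using nb[of b] ab assms d(1) by (auto simp: gap_def) (smt (verit) field_sum_of_halves)
 moreover have "a' = t" using nb[of a'] ab' assms d(1) by (auto simp: gap_def) (smt (verit) field_sum_of_halves)
 ultimately show ?thesis using ab(1) ab'(1) by blast
qed

lemma left_into: assumes "brk t" shows "\<forall>\<^sub>F r in at_left t. ~ brk r & strand_into C t (strand r)" proof -
 obtain a where a: "gap a t" using adjacent_gaps[OF assms] by blast
 have "~ brk r & strand_into C t (strand r)" if "a < r" "r < t" for r using strand_const(1)[OF a that] a that by (auto simp: strand_into_def gap_def)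
 thus ?thesis unfolding eventually_at_left_field using a by (intro exI[of _ a]) (auto simp: gap_def)
qed

lemma right_out: assumes "brk t" shows "\<forall>\<^sub>F r in at_right t. ~ brk r & strand_out_of C t (strand r)" proof -
 obtain b where b: "gap t b" using adjacent_gaps[OF assms] by blast
 have "~ brk r & strand_out_of C t (strand r)" if "t < r" "r < b" for r
  using strand_const(1)[OF b that] b that by (auto simp: strand_out_of_def gap_def)
 thus ?thesis unfolding eventually_at_right_field using b by (intro exI[of _ b]) (auto simp: gap_def)
qed

lemma sign_near: assumes "x' t ~= 0" shows "\<forall>\<^sub>F r in nhds t. x' r > 0 \<longleftrightarrow> x' t > 0" proof -
 have l: "(x' \<longlongrightarrow> x' t) (nhds t)" using isCont_xyz(4)[of t] by (simp add: isCont_def tendsto_at_iff_tendsto_nhds)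
 show ?thesis proof (cases "x' t > 0")
  case True
  from order_tendstoD(1)[OF l True] show ?thesis by eventually_elim (use True in simp)
 next
  case False
  hence "x' t < 0" using assms by simp
  from order_tendstoD(2)[OF l this] show ?thesis by eventually_elim (use False in auto)
 qed
qed

lemma nhds_sides: "eventually P (nhds t) ==> eventually P (at_left t)" "eventually P (nhds t) ==> eventually P (at_right t)" for t :: real
 using filter_leD[OF at_within_le_nhds] by blast+

lemma cusp_signs: assumes "x' t = 0"
 shows "\<forall>\<^sub>F r in at_left t. x' r > 0 \<longleftrightarrow> rcusp t" "\<forall>\<^sub>F r in at_right t. x' r > 0 \<longleftrightarrow> ~ rcusp t"
proof -
 obtain de1 where d1: "de1 > 0"
  "ALL s. t - de1 < s & s < t --> (x' s > 0 \<longleftrightarrow> rcusp t) & (x' s < 0 \<longleftrightarrow> ~ rcusp t)"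
  "ALL s. t < s & s < t + de1 --> (x' s < 0 \<longleftrightarrow> rcusp t) & (x' s > 0 \<longleftrightarrow> ~ rcusp t)"
  using cusp_structure[OF assms] by (elim exE conjE) (rule that)
 show "\<forall>\<^sub>F r in at_left t. x' r > 0 \<longleftrightarrow> rcusp t" unfolding eventually_at_left_field using d1 by (intro exI[of _ "t - de1"]) auto
 show "\<forall>\<^sub>F r in at_right t. x' r > 0 \<longleftrightarrow> ~ rcusp t" unfolding eventually_at_right_field using d1 by (intro exI[of _ "t + de1"]) auto
qed

abbreviation gen :: "nat => real set => real set rack_term set" where
 "gen n S \<equiv> cong_class n (strands C) (LR_relations n C) (Gen S)"

text \<open>Strands that run to the left get \<open>n\<close> additional twists. At a left cusp
  these absorb the cusp relation; at a right cusp they add up with it to \<open>2 * n\<close>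
  twists, the inverse of \<open>iota\<close>.\<close>

definition cl :: "nat => real => real set rack_term set" where
 "cl n t = (if x' t > 0 then gen n (strand t) else (iota (LR n C) ^^ n) (gen n (strand t)))"

lemma LR_rack: "rack (LR n C)" "legendrian_rack n (LR n C)" using legendrian_rack_presented_rack[of n] by (auto simp: LR_def legendrian_rack_def)

lemma gen_closed: "S:strands C ==> gen n S:rcarrier (LR n C)" unfolding LR_def presented_carrier by (rule imageI) simp

lemma LR_rel:
 assumes "(Gen a, w):LR_relations n C" "a:strands C" "w:terms_over (strands C)" shows "gen n a = cong_class n (strands C) (LR_relations n C) w"
 using assms by (subst cong_class_eq_iff) (auto intro: rack_cong.rel)

lemma LR_pos:
 assumes "over s t" "x' s * x' t > 0" "~ brk s" "strand_into C t a" "strand_out_of C t b" shows "gen n b = rmul (LR n C) (gen n a) (gen n (strand s))"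
proof -
 have m: "a:strands C" "b:strands C" "strand s:strands C" "s:strand s"
  using into_left(2)[OF assms(4)] out_right(2)[OF assms(5)] strand_mem[OF assms(3)] by auto
 have "(Gen b, Mul (Gen a) (Gen (strand s))):LR_relations n C" unfolding LR_relations_def proof (intro UnI1 CollectI exI conjI)
  show "positive_crossing C s t" using assms(1,2) posC by blast
 qed (rule HOL.refl m assms)+
 from LR_rel[OF this] m show ?thesis by (simp add: LR_def presented_mul)
qed

lemma LR_neg:
 assumes "over s t" "x' s * x' t < 0" "~ brk s" "strand_into C t a" "strand_out_of C t b" shows "gen n b = rdiv (LR n C) (gen n a) (gen n (strand s))"
proof -
 have m: "a:strands C" "b:strands C" "strand s:strands C" "s:strand s"
  using into_left(2)[OF assms(4)] out_right(2)[OF assms(5)] strand_mem[OF assms(3)] by auto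
 have "(Gen b, Div (Gen a) (Gen (strand s))):LR_relations n C" unfolding LR_relations_def proof (rule UnI1, rule UnI2, intro CollectI exI conjI)
  show "negative_crossing C s t" using assms(1,2) negC by blast
 qed (rule HOL.refl m assms)+
 from LR_rel[OF this] m show ?thesis by (simp add: LR_def presented_div)
qed

lemma LR_cusp:
 assumes "x' t = 0" "strand_into C t a" "strand_out_of C t b" shows "gen n b = (iota (LR n C) ^^ n) (gen n a)" proof -
 have m: "a:strands C" "b:strands C" using into_left(2)[OF assms(2)] out_right(2)[OF assms(3)] by auto
 have "(Gen b, rack_power Mul (Gen a) (n + 1)):LR_relations n C" unfolding LR_relations_def proof (rule UnI2, intro CollectI exI conjI)
  show "cusp C t" using assms(1) cuspC by blast
 qed (rule HOL.refl assms)+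
 from LR_rel[OF this] m have "gen n b = cong_class n (strands C) (LR_relations n C) (rack_power Mul (Gen a) (n + 1))" by simp
 also have "... = rack_power (rmul (LR n C)) (gen n a) (n + 1)" using m by (simp add: LR_def presented_power)
 also have "... = (iota (LR n C) ^^ n) (gen n a)" using rack_power_iota[OF LR_rack(1) gen_closed[OF m(1)], of n n] by simp
 finally show ?thesis .
qed

lemma act_cl: assumes "~ brk t" shows "act (LR n C) (cl n t) = act (LR n C) (gen n (strand t))"
 using act_iota_pow[OF LR_rack(1) gen_closed[OF strand_mem(2)[OF assms]]] by (simp add: cl_def)

theorem cl_coloring: "coloring x y z x' y' (LR n C) (cl n)" proof (intro coloring.intro[OF plane_front_axioms] coloring_axioms.intro)
 let ?R = "LR n C"
 show "rack ?R" by (rule LR_rack)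
 have gc: "gen n (strand t):rcarrier ?R" if "~ brk t" for t by (rule gen_closed[OF strand_mem(2)[OF that]])
 show "cl n t:rcarrier ?R" if "~ brk t" for t using gc[OF that] iota_closed[OF LR_rack(1) gc[OF that]] by (simp add: cl_def)
 show "cl n (t + 1) = cl n t" for t using strand_per[of t 1] per(4)[of t 1] by (simp add: cl_def)
 show "\<forall>\<^sub>F s in nhds t. cl n s = cl n t" if nb: "~ brk t" for t proof -
  obtain a b where ab: "gap a b" "a < t" "t < b" using around[OF nb] by blast
  have "\<forall>\<^sub>F s in nhds t. s:{a<..<b}" using ab by (intro eventually_nhds_in_open) auto
  moreover have "x' t ~= 0" using nb by (simp add: brk_def)
  note sign_near[OF this]
  ultimately show ?thesis proof eventually_elim
   case (elim s)
   hence "strand s = strand t" using strand_same[OF ab, of s] by simp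
   thus ?case using elim by (simp add: cl_def)
  qed
 qed
 show "\<forall>\<^sub>F t1 in at_left t. \<forall>\<^sub>F t2 in at_right t. if x' t > 0 then cl n t1 = app (gsym ?R x' (cl n) s) (cl n t2) else cl n t2 = app (gsym ?R x' (cl n) s) (cl n t1)"
  if ov: "over s t" for s t proof -
  have nz: "x' s ~= 0" "x' t ~= 0" and bt: "brk t" and bs: "~ brk s" using ov dp_x' over_not_brk by (auto simp: over_def brk_def)
  let ?y = "gen n (strand s)"
  note yc = gc[OF bs]
  have gs: "gsym ?R x' (cl n) s = (if x' s > 0 then - act ?R ?y else act ?R ?y)" using act_cl[OF bs, of n] by (simp add: gsym_def)
  note sg = nhds_sides[OF sign_near[OF nz(2)]]
  have 1: "\<forall>\<^sub>F t1 in at_left t. (~ brk t1 & strand_into C t (strand t1)) & (x' t1 > 0 \<longleftrightarrow> x' t > 0)" by (rule eventually_conj[OF left_into[OF bt] sg(1)])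
  have 2: "\<forall>\<^sub>F t2 in at_right t. (~ brk t2 & strand_out_of C t (strand t2)) & (x' t2 > 0 \<longleftrightarrow> x' t > 0)" by (rule eventually_conj[OF right_out[OF bt] sg(2)])
  have main: "if x' t > 0 then cl n t1 = app (gsym ?R x' (cl n) s) (cl n t2) else cl n t2 = app (gsym ?R x' (cl n) s) (cl n t1)"
   if t1: "~ brk t1" "strand_into C t (strand t1)" "x' t1 > 0 \<longleftrightarrow> x' t > 0" and t2: "~ brk t2" "strand_out_of C t (strand t2)" "x' t2 > 0 \<longleftrightarrow> x' t > 0" for t1 t2
  proof -
   let ?a = "gen n (strand t1)" and ?b = "gen n (strand t2)"
   note ac = gc[OF t1(1)] and bc = gc[OF t2(1)]
   note ap = app_act[OF LR_rack(1) yc] app_minus_act[OF LR_rack(1) yc] rack_cancel[OF LR_rack(1)]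
   \<comment> \<open>The sign of a crossing is that of \<open>x' s * x' t\<close>. Once left and
     right replace before and after, the direction of the over-branch alone decides between
     \<open>act\<close> and its inverse.\<close>
   have rel: "?b = (if x' s * x' t > 0 then rmul ?R ?a ?y else rdiv ?R ?a ?y)"
    using LR_pos[OF ov _ bs t1(2) t2(2)] LR_neg[OF ov _ bs t1(2) t2(2)] nz by (auto simp: not_less order.order_iff_strict)
   have rel': "?a = (if x' s * x' t > 0 then rdiv ?R ?b ?y else rmul ?R ?b ?y)" unfolding rel using ac yc ap(3,4) by simp
   show ?thesis proof (cases "x' t > 0")
    case True
    hence c: "cl n t1 = ?a" "cl n t2 = ?b" using t1 t2 by (simp_all add: cl_def)
    show ?thesis unfolding c gs using True rel' nz bc ap(1,2) by (simp add: zero_less_mult_iff)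
   next
    case False
    hence tn: "x' t < 0" and c: "cl n t1 = (iota ?R ^^ n) ?a" "cl n t2 = (iota ?R ^^ n) ?b" using t1 t2 nz by (simp_all add: cl_def)
    \<comment> \<open>Twists commute with automorphisms, so adding them on both halves of the
      under-branch preserves the crossing rule.\<close>
    have au: "(if x' s > 0 then - act ?R ?y else act ?R ?y):autos ?R" using act_autos[OF LR_rack(1)] autos_uminus[OF LR_rack(1)] by auto
    have "app (if x' s > 0 then - act ?R ?y else act ?R ?y) ?a = ?b" using tn rel nz ac ap(1,2) by (simp add: zero_less_mult_iff)
    thus ?thesis unfolding c gs using False autos_iota_pow[OF LR_rack(1) au ac, of n] by simp
   qed
  qed
  show ?thesis using 1 proof eventually_elim
   case (elim t1)
   show ?case using 2 by eventually_elim (rule main; use elim in blast)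
  qed
 qed
 show "\<forall>\<^sub>F t1 in at_left t. \<forall>\<^sub>F t2 in at_right t. cl n t1 = (if rcusp t then iota ?R (cl n t2) else cl n t2)" if z: "x' t = 0" for t
 proof -
  have bt: "brk t" using z by (simp add: brk_def)
  have 1: "\<forall>\<^sub>F t1 in at_left t. (~ brk t1 & strand_into C t (strand t1)) & (x' t1 > 0 \<longleftrightarrow> rcusp t)" by (rule eventually_conj[OF left_into[OF bt] cusp_signs(1)[OF z]])
  have 2: "\<forall>\<^sub>F t2 in at_right t. (~ brk t2 & strand_out_of C t (strand t2)) & (x' t2 > 0 \<longleftrightarrow> ~ rcusp t)" by (rule eventually_conj[OF right_out[OF bt] cusp_signs(2)[OF z]])
  have main: "cl n t1 = (if rcusp t then iota ?R (cl n t2) else cl n t2)"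
   if t1: "~ brk t1" "strand_into C t (strand t1)" "x' t1 > 0 \<longleftrightarrow> rcusp t" and t2: "~ brk t2" "strand_out_of C t (strand t2)" "x' t2 > 0 \<longleftrightarrow> ~ rcusp t" for t1 t2
  proof -
   let ?a = "gen n (strand t1)"
   have b: "gen n (strand t2) = (iota ?R ^^ n) ?a" by (rule LR_cusp[OF z t1(2) t2(2)])
   have "(iota ?R ^^ (2 * n + 1)) ?a = ?a" by (rule legendrian_iota[OF LR_rack(2) gc[OF t1(1)]])
   \<comment> \<open>\<open>2 * n + 1\<close> twists are trivial: \<open>n\<close> from the cusp
     relation, \<open>n\<close> from the change of colours, and the one demanded at a right
     cusp.\<close>
   hence "iota ?R ((iota ?R ^^ n) ((iota ?R ^^ n) ?a)) = ?a" by (simp add: mult_2 funpow_add)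
   thus ?thesis using t1(3) t2(3) by (simp add: cl_def b)
  qed
  show ?thesis using 1 proof eventually_elim
   case (elim t1)
   show ?case using 2 by eventually_elim (rule main; use elim in blast)
  qed
 qed
qed

end

section \<open>Homomorphisms from the rack of a front\<close>

context lfront
begin

text \<open>When the twists built into \<open>cl\<close> are undone, the rules of a colouring become
  the crossing and cusp relations, so the presentation supplies the homomorphism.\<close>

theorem coloring_hom:
 fixes R :: "'a rack"
 assumes R: "legendrian_rack n R" and E: "coloring x y z x' y' R E" shows "EX f. rhom (LR n C) R f & (ALL t. ~ brk t --> f (cl n t) = E t)" proof -
 interpret E: coloring x y z x' y' R E by (rule E)
 have rackR: "rack R" using R by (simp add: legendrian_rack_def)
 \<comment> \<open>\<open>n + 1\<close> twists invert the \<open>n\<close> twists that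
   \<open>cl\<close> adds on strands running to the left.\<close>
 define h' where "h' t = (if x' t > 0 then E t else (iota R ^^ (n + 1)) (E t))" for t
 define h where "h S = h' (SOME t. t:S)" for S
 have hS: "h S = h' t" if S: "S:strands C" "t:S" for S t proof -
  obtain a b where ab: "gap a b" "S = {u. EX k::int. u + of_int k:{a<..<b}}" using S(1) by (auto simp: strands_def strand_gap)
  have eq: "h' r = h' s" if r: "r:S" "s:S" for r s proof -
   obtain k l :: int where kl: "r + of_int k:{a<..<b}" "s + of_int l:{a<..<b}" using r unfolding ab(2) by blast
   have nb: "~ brk t" if "t:{a<..<b}" for t using ab(1) that by (auto simp: gap_def)
   have "E (r + of_int k) = E (s + of_int l)" "x' (r + of_int k) > 0 \<longleftrightarrow> x' (s + of_int l) > 0"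
    using E.const_on_interval(1,2)[OF is_interval_oo nb kl] by blast+
   thus ?thesis by (simp add: h'_def per E.per_cf)
  qed
  show ?thesis unfolding h_def by (rule eq[OF someI[of "%t. t:S", OF S(2)] S(2)])
 qed
 have h'c: "h' t:rcarrier R" if "~ brk t" for t
  using E.cf_closed[OF that] iota_closed[OF rackR E.cf_closed[OF that], of "n + 1"] unfolding h'_def by simp
 have hc: "h ` strands C <= rcarrier R" proof
  fix w assume "w:h ` strands C"
  then obtain S where S: "S:strands C" "w = h S" by blast
  then obtain a b where "gap a b" "S = {u. EX k::int. u + of_int k:{a<..<b}}" by (auto simp: strands_def strand_gap)
  hence "(a + b) / 2:S" by (auto simp: gap_def intro!: exI[of _ "0::int"])
  thus "w:rcarrier R" using hS[OF S(1)] h'c mem_strand(1)[OF S(1)] S(2) by simp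
 qed
 have leg: "(iota R ^^ n) ((iota R ^^ (n + 1)) a) = a" if "a:rcarrier R" for a proof -
  have "(iota R ^^ (n + (n + 1))) a = a" using legendrian_iota[OF R that] by (simp add: mult_2)
  thus ?thesis by (simp only: funpow_add comp_apply)
 qed
 have leg': "(iota R ^^ (n + 1)) ((iota R ^^ n) a) = a" if "a:rcarrier R" for a proof -
  have "(iota R ^^ ((n + 1) + n)) a = a" using legendrian_iota[OF R that] by (simp add: mult_2)
  thus ?thesis by (simp only: funpow_add comp_apply)
 qed
 \<comment> \<open>The rules of a colouring hold for parameters close enough to a break; this picks
   such samples on the two adjacent strands, subject to further local conditions.\<close>
 have pick: "EX t1 t2. t1:a & t2:b & A t1 & B t2 & P t1 t2"
  if io: "strand_into C t a" "strand_out_of C t b" and AB: "eventually A (at_left t)" "eventually B (at_right t)"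
   and P: "\<forall>\<^sub>F t1 in at_left t. \<forall>\<^sub>F t2 in at_right t. P t1 t2" for t a b A B P proof -
  have "\<forall>\<^sub>F t1 in at_left t. t1:a & A t1 & (\<forall>\<^sub>F t2 in at_right t. P t1 t2)"
   by (intro eventually_conj into_left(1)[OF io(1)] AB P)
  from eventually_happens'[OF trivial_limit_at_left_real this] obtain t1 where t1: "t1:a" "A t1" "\<forall>\<^sub>F t2 in at_right t. P t1 t2" by blast
  have "\<forall>\<^sub>F t2 in at_right t. t2:b & B t2 & P t1 t2" by (intro eventually_conj out_right(1)[OF io(2)] AB t1(3))
  from eventually_happens'[OF trivial_limit_at_right_real this] show ?thesis using t1 by blast
 qed
 have crossing: "h b = (if x' s * x' t > 0 then rmul R (h a) (h w) else rdiv R (h a) (h w))"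
  if ov: "over s t" and w: "w:strands C" "s:w" and io: "strand_into C t a" "strand_out_of C t b" for s t a b w proof -
  have nz: "x' s ~= 0" "x' t ~= 0" and bs: "~ brk s" using ov dp_x' over_not_brk by (auto simp: over_def)
  obtain t1 t2 where t: "t1:a" "t2:b" "x' t1 > 0 \<longleftrightarrow> x' t > 0" "x' t2 > 0 \<longleftrightarrow> x' t > 0"
   and c: "if x' t > 0 then E t1 = app (E.g s) (E t2) else E t2 = app (E.g s) (E t1)"
   using pick[OF io nhds_sides[OF sign_near[OF nz(2)]] E.cf_cross[OF ov]] by blast
  note aS = into_left(2)[OF io(1)] and bS = out_right(2)[OF io(2)]
  have nb: "~ brk t1" "~ brk t2" using mem_strand(1) aS bS t by blast+
  have ha: "h a = h' t1" and hb: "h b = h' t2" and hw: "h w = h' s" using hS aS bS t w by auto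
  note sc = E.cf_closed[OF bs] and c1 = E.cf_closed[OF nb(1)] and c2 = E.cf_closed[OF nb(2)]
  have aw: "act R (h w) = act R (E s)" unfolding hw h'_def using act_iota_pow[OF rackR sc, of "n + 1"] by (simp only: if_cancel split: if_split) simp
  have wc: "h w:rcarrier R" unfolding hw by (rule h'c[OF bs])
  have gs: "E.g s = (if x' s > 0 then - act R (h w) else act R (h w))" by (simp add: gsym_def aw)
  note ap = app_act[OF rackR wc] app_minus_act[OF rackR wc]
  let ?m = "if x' s * x' t > 0 then act R (h w) else - act R (h w)"
  have "h b = app ?m (h a)" proof (cases "x' t > 0")
   case True
   hence hh: "h a = E t1" "h b = E t2" using t by (simp_all add: ha hb h'_def)
   have "E t1 = app (- ?m) (E t2)" using c True nz by (simp add: gs zero_less_mult_iff)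
   hence "app ?m (E t1) = E t2" by (simp only: app_uminus)
   thus ?thesis unfolding hh ..
  next
   case False
   hence hh: "h a = (iota R ^^ (n + 1)) (E t1)" "h b = (iota R ^^ (n + 1)) (E t2)" using t by (simp_all add: ha hb h'_def)
   have tn: "x' t < 0" using False nz by simp
   have au: "?m:autos R" using act_autos[OF rackR] autos_uminus[OF rackR] by auto
   have "E t2 = app ?m (E t1)" using c tn nz by (simp add: gs zero_less_mult_iff)
   thus ?thesis unfolding hh autos_iota_pow[OF rackR au c1] by simp
  qed
  moreover have "h a:rcarrier R" unfolding ha by (rule h'c[OF nb(1)])
  ultimately show ?thesis using ap by auto
 qed
 have cusp: "h b = (iota R ^^ n) (h a)" if z: "x' t = 0" and io: "strand_into C t a" "strand_out_of C t b" for t a b proof -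
  obtain t1 t2 where t: "t1:a" "t2:b" "x' t1 > 0 \<longleftrightarrow> rcusp t" "x' t2 > 0 \<longleftrightarrow> ~ rcusp t"
   and c: "E t1 = (if rcusp t then iota R (E t2) else E t2)" using pick[OF io cusp_signs[OF z] E.cf_cusp[OF z]] by blast
  note aS = into_left(2)[OF io(1)] and bS = out_right(2)[OF io(2)]
  have nb: "~ brk t1" "~ brk t2" using mem_strand(1) aS bS t by blast+
  have ha: "h a = h' t1" and hb: "h b = h' t2" using hS aS bS t by auto
  show ?thesis proof (cases "rcusp t")
   case True
   hence "h a = iota R (E t2)" "h b = (iota R ^^ (n + 1)) (E t2)" using t c by (simp_all add: ha hb h'_def)
   thus ?thesis using funpow_swap1[of "%a. iota R a" n "E t2"] by simp
  next
   case False
   hence "h a = (iota R ^^ (n + 1)) (E t2)" "h b = E t2" using t c by (simp_all add: ha hb h'_def)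
   thus ?thesis using leg[OF E.cf_closed[OF nb(2)]] by simp
  qed
 qed
 have rel: "eval_term R h p = eval_term R h q" if "(p, q):LR_relations n C" for p q proof -
  have "(EX a b w s t. positive_crossing C s t & w:strands C & s:w & strand_into C t a & strand_out_of C t b & p = Gen b & q = Mul (Gen a) (Gen w)) |
   (EX a b w s t. negative_crossing C s t & w:strands C & s:w & strand_into C t a & strand_out_of C t b & p = Gen b & q = Div (Gen a) (Gen w)) |
   (EX a b t. cusp C t & strand_into C t a & strand_out_of C t b & p = Gen b & q = rack_power Mul (Gen a) (n + 1))"
   using that unfolding LR_relations_def by blast
  thus ?thesis proof (elim disjE exE conjE)
   fix a b w s t assume "positive_crossing C s t" "w:strands C" "s:w" "strand_into C t a" "strand_out_of C t b" and e: "p = Gen b" "q = Mul (Gen a) (Gen w)"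
   thus ?thesis using crossing[of s t w a b] posC by (simp add: e)
  next
   fix a b w s t assume "negative_crossing C s t" "w:strands C" "s:w" "strand_into C t a" "strand_out_of C t b" and e: "p = Gen b" "q = Div (Gen a) (Gen w)"
   thus ?thesis using crossing[of s t w a b] negC by (simp add: e)
  next
   fix a b t assume c: "cusp C t" "strand_into C t a" "strand_out_of C t b" and e: "p = Gen b" "q = rack_power Mul (Gen a) (n + 1)"
   have "h a:rcarrier R" using hc into_left(2)[OF c(2)] by blast
   hence "rack_power (rmul R) (h a) (Suc n) = (iota R ^^ n) (h a)" by (rule rack_power_iota[OF rackR])
   thus ?thesis using cusp[of t a b] c cuspC by (simp add: e eval_rack_power)
  qed
 qed
 obtain f where f: "f ` rcarrier (LR n C) <= rcarrier R" "ALL g:strands C. f (gen n g) = h g"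
  "ALL x:rcarrier (LR n C). ALL y:rcarrier (LR n C). f (rmul (LR n C) x y) = rmul R (f x) (f y) & f (rdiv (LR n C) x y) = rdiv R (f x) (f y)"
  using presented_rack_universal[OF R hc rel] unfolding LR_def by blast
 have fi: "f ((iota (LR n C) ^^ m) a) = (iota R ^^ m) (f a)" if "a:rcarrier (LR n C)" for m a
  using f(3) iota_closed[OF LR_rack(1) that] by (induction m) simp_all
 have "f (cl n t) = E t" if nb: "~ brk t" for t proof -
  note m = strand_mem[OF nb]
  have fg: "f (gen n (strand t)) = h' t" using f(2) m hS by simp
  show ?thesis proof (cases "x' t > 0")
   case True
   thus ?thesis using fg by (simp add: cl_def h'_def)
  next
   case False
   thus ?thesis using fg fi[OF gen_closed[OF m(2)], of n] leg[OF E.cf_closed[OF nb]] by (simp add: cl_def h'_def)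
  qed
 qed
 moreover have "rhom (LR n C) R f" using f(1,3) unfolding rhom_def by blast
 ultimately show ?thesis by blast
qed

text \<open>Every strand contains a regular parameter, at which its generator is recovered from
  \<open>cl\<close> by twists. Homomorphisms commute with twists, so all generators are
  fixed.\<close>

lemma hom_unique:
 assumes f: "rhom (LR n C) (LR n C) f" and fix_cl: "!!t. D t ~: sing ==> f (cl n t) = cl n t" and a: "a:rcarrier (LR n C)" shows "f a = a" proof -
 let ?R = "LR n C"
 have fi: "f ((iota ?R ^^ m) b) = (iota ?R ^^ m) (f b)" if "b:rcarrier ?R" for m b
  using f iota_closed[OF LR_rack(1) that] unfolding rhom_def by (induction m) simp_all
 have gen: "f (gen n S) = gen n S" if S: "S:strands C" for S proof -
  obtain a b where ab: "gap a b" "S = {u. EX k::int. u + of_int k:{a<..<b}}" using S by (auto simp: strands_def strand_gap)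
  obtain de where d: "de > 0" "!!r. r ~= a ==> \<bar>r - a\<bar> < de ==> D r ~: sing" using reg_interval[of a] by blast
  define q where "q = min de (b - a)"
  define r where "r = a + q / 2"
  have "q > 0" "q <= de" "q <= b - a" using d(1) ab(1) by (auto simp: gap_def q_def)
  hence r: "a < r" "r < b" "r - a < de" unfolding r_def by auto
  have reg: "D r ~: sing" using d(2)[of r] r by auto
  have "r:S" unfolding ab(2) using r by (auto intro!: exI[of _ "0::int"])
  hence st: "strand r = S" by (rule strand_eq[OF S])
  note g = gen_closed[OF S, of n]
  show ?thesis proof (cases "x' r > 0")
   case True
   thus ?thesis using fix_cl[OF reg] by (simp add: cl_def st)
  next
   case False
   have leg: "(iota ?R ^^ (n + 1)) ((iota ?R ^^ n) (gen n S)) = gen n S" proof -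
    have "(iota ?R ^^ ((n + 1) + n)) (gen n S) = gen n S" using legendrian_iota[OF LR_rack(2) g] by (simp add: mult_2)
    thus ?thesis by (simp only: funpow_add comp_apply)
   qed
   have "f (gen n S) = f ((iota ?R ^^ (n + 1)) ((iota ?R ^^ n) (gen n S)))" unfolding leg ..
   also have "... = (iota ?R ^^ (n + 1)) (f ((iota ?R ^^ n) (gen n S)))" by (rule fi[OF iota_closed[OF LR_rack(1) g]])
   also have "... = gen n S" using fix_cl[OF reg] False leg by (simp add: cl_def st)
   finally show ?thesis .
  qed
 qed
 show ?thesis using a unfolding LR_def proof (rule presented_rack_induct)
  show "f (cong_class n (strands C) (LR_relations n C) (Gen g)) = cong_class n (strands C) (LR_relations n C) (Gen g)" if "g:strands C" for g by (rule gen[OF that])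
 qed (use f in "simp_all add: rhom_def LR_def")
qed

end

text \<open>Test racks of a single type suffice, since the racks of all fronts share one type.
  Uniqueness is put as rigidity of endomorphisms that fix the values of \<open>ev\<close>, the form
  in which it enters the comparison of two universal functionals.\<close>

definition universal :: "(real => p3) => (real => p3) => real => p3 => nat => 'a rack => (real => (real => p3) list => 'a) => bool" where
 "universal K dK u v n R ev \<longleftrightarrow> legendrian_rack n R & peripheral K dK u v R ev &
   (ALL R' e. legendrian_rack n (R' :: 'a rack) --> peripheral K dK u v R' e -->
    (EX f. rhom R R' f & (ALL t xs. pchain (cmpl K) (push K u t) xs v --> f (ev t xs) = e t xs))) &
   (ALL f. rhom R R f --> (ALL t xs. pchain (cmpl K) (push K u t) xs v --> f (ev t xs) = ev t xs) -->
    (ALL a:rcarrier R. f a = a))"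

lemma peripheral_rhom:
 assumes "peripheral K dK u v R e" "rhom R R' f" shows "peripheral K dK u v R' (%t xs. f (e t xs))" proof -
 have cl: "e t xs:rcarrier R" if "pchain (cmpl K) (push K u t) xs v" for t xs using assms(1) that unfolding peripheral_def by blast
 show ?thesis unfolding peripheral_def proof (intro conjI allI impI)
  fix s t xs assume p: "pchain (cmpl K) (push K u t) xs v"
  show "f (e t xs):rcarrier R'" using assms(2) cl[OF p] unfolding rhom_def by blast
  have "e s (slide (push K u) s t # xs) = e t xs" "e (t + 1) xs = e t xs" using assms(1) p unfolding peripheral_def by blast+
  thus "f (e s (slide (push K u) s t # xs)) = f (e t xs)" "f (e (t + 1) xs) = f (e t xs)" by simp_all
 next
  fix t xs ys assume "HE (cmpl K) (push K u t) xs ys v"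
  hence "e t xs = e t ys" using assms(1) unfolding peripheral_def by blast
  thus "f (e t xs) = f (e t ys)" by simp
 next
  fix s t xs ys assume p: "pchain (cmpl K) (push K u s) xs v" "pchain (cmpl K) (push K u t) ys v"
  have "e s (xs @ rl ys @ merid K dK u t # ys) = rmul R (e s xs) (e t ys)" using assms(1) p unfolding peripheral_def by blast
  thus "f (e s (xs @ rl ys @ merid K dK u t # ys)) = rmul R' (f (e s xs)) (f (e t ys))"
   using assms(2) cl[OF p(1)] cl[OF p(2)] unfolding rhom_def by simp
 qed
qed

locale vfront = lfront x y z x' y' C + viewed x y z x' y' u M for x y z x' y' C u M
begin

text \<open>The standard values of \<open>e\<close> form a colouring and hence give a homomorphism
  \<open>f\<close>; \<open>f\<close> after \<open>ev\<close> has the same standard values as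
  \<open>e\<close>, so the two agree everywhere. For uniqueness, the values of \<open>ev\<close>
  include \<open>cl n t\<close> at every regular \<open>t\<close>.\<close>

theorem LR_universal: "EX ev. universal K dK u v n (LR n C) ev" proof -
 interpret c: colored x y z x' y' "LR n C" "cl n" u M by (rule colored.intro[OF cl_coloring viewed_axioms])
 obtain ev where ev: "peripheral K dK u v (LR n C) ev" "!!t a. D t ~: sing ==> low t a ==> ev t (std t a) = cl n t"
  using c.peripheral_exists unfolding std_def by blast
 have 1: "EX f. rhom (LR n C) R f & (ALL t xs. pchain X (B t) xs v --> f (ev t xs) = e t xs)"
  if R: "legendrian_rack n R" "peripheral K dK u v R e" for R :: "real set rack_term set rack" and e proof -
  have rackR: "rack R" using R(1) by (simp add: legendrian_rack_def)
  interpret f: functional x y z x' y' u M R e by unfold_locales (rule rackR, rule R(2))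
  obtain f where f: "rhom (LR n C) R f" "!!t. ~ brk t ==> f (cl n t) = f.E t" using coloring_hom[OF R(1) f.E_coloring] by blast
  interpret f': functional x y z x' y' u M R "%t xs. f (ev t xs)" by unfold_locales (rule rackR, rule peripheral_rhom[OF ev(1) f(1)])
  interpret agreeing x y z x' y' u M R "%t xs. f (ev t xs)" e proof unfold_locales
   fix t assume t: "D t ~: sing"
   obtain a where a: "low t a" using low_exists[OF u] by blast
   show "f'.E t = f.E t" unfolding f'.E_low[OF a] ev(2)[OF t a] by (rule f(2)[OF regD(2)[OF t]])
  qed
  show ?thesis using f(1) agree_everywhere by blast
 qed
 have 2: "f a = a" if f: "rhom (LR n C) (LR n C) f" "!!t xs. pchain X (B t) xs v ==> f (ev t xs) = ev t xs" and a: "a:rcarrier (LR n C)" for f a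
 proof (rule hom_unique[OF f(1) _ a])
  fix t assume t: "D t ~: sing"
  obtain a where a: "low t a" using low_exists[OF u] by blast
  show "f (cl n t) = cl n t" using f(2)[OF low_pchain[OF a]] ev(2)[OF t a] by simp
 qed
 show ?thesis unfolding universal_def using LR_rack(2) ev(1) 1 2 by (intro exI[of _ ev]) blast
qed

end

text \<open>Pulling back along the homeomorphism and its inverse gives homomorphisms both ways.
  Their composites fix the universal functionals and are therefore identities.\<close>

theorem universal_iso:
 fixes R R' :: "'a rack"
 assumes U: "universal K dK u v n R ev" and U': "universal K' dK' u v n R' ev'" and k: "kequiv u v K dK K' dK' F G"
  and B: "!!t. merid K dK u t 0 = push K u t" "!!t. merid K' dK' u t 0 = push K' u t" shows "rack_isomorphic R R'" proof -
 have half: "EX f. rhom R R' f & (ALL t xs. pchain (cmpl K) (push K u t) xs v --> f (ev t xs) = ev' t (pim F xs))"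
  if U: "universal K dK u v n R ev" and U': "universal K' dK' u v n R' ev'" and k: "kequiv u v K dK K' dK' F G"
   and B: "!!t. merid K' dK' u t 0 = push K' u t"
  for K dK K' dK' F G and R R' :: "'a rack" and ev ev' proof -
  have "peripheral K dK u v R' (%t xs. ev' t (pim F xs))" by (rule peripheral_kequiv[OF k _ B]) (use U' in "simp add: universal_def")
  thus ?thesis using U U' unfolding universal_def by blast
 qed
 note k' = kequiv_sym[OF k]
 obtain f where f: "rhom R R' f" "!!t xs. pchain (cmpl K) (push K u t) xs v ==> f (ev t xs) = ev' t (pim F xs)" using half[OF U U' k B(2)] by blast
 obtain g where g: "rhom R' R g" "!!t xs. pchain (cmpl K') (push K' u t) xs v ==> g (ev' t xs) = ev t (pim G xs)" using half[OF U' U k' B(1)] by blast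
 have comp: "g' (f' a) = a" if "universal K dK u v n R ev" "kequiv u v K dK K' dK' F G" "rhom R R' f'" "rhom R' R g'"
  "!!t xs. pchain (cmpl K) (push K u t) xs v ==> f' (ev t xs) = ev' t (pim F xs)"
  "!!t xs. pchain (cmpl K') (push K' u t) xs v ==> g' (ev' t xs) = ev t (pim G xs)" "a:rcarrier R"
  for K dK K' dK' F G and R R' :: "'a rack" and ev ev' f' g' a proof -
  have "rhom R R (%a. g' (f' a))" using that(3,4) unfolding rhom_def by simp
  moreover have "g' (f' (ev t xs)) = ev t xs" if p: "pchain (cmpl K) (push K u t) xs v" for t xs proof -
   have c: "continuous_on (cmpl K) F" and FG: "ALL p. G (F p) = p" and e: "F (push K u t) = push K' u t" "F v = v"
    using \<open>kequiv u v K dK K' dK' F G\<close> unfolding kequiv_def by (auto intro: continuous_on_subset)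
   have "pchain (cmpl K') (push K' u t) (pim F xs) v"
    using pchain_image[OF c kequiv_cmpl(1)[OF \<open>kequiv u v K dK K' dK' F G\<close>] p] e by simp
   moreover have "G o (F o ga) = ga" for ga :: "real => p3" using FG by (simp add: fun_eq_iff del: split_paired_All)
   hence "pim G (pim F xs) = xs" by (induction xs) simp_all
   ultimately show ?thesis using that by (simp add: \<open>!!t xs. pchain (cmpl K) (push K u t) xs v ==> f' (ev t xs) = ev' t (pim F xs)\<close>[OF p] \<open>!!t xs. pchain (cmpl K') (push K' u t) xs v ==> g' (ev' t xs) = ev t (pim G xs)\<close>)
  qed
  ultimately show ?thesis using that(1,7) unfolding universal_def by blast
 qed
 have gf: "g (f a) = a" if "a:rcarrier R" for a by (rule comp[OF U k f(1) g(1) f(2) g(2) that])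
 have fg: "f (g a) = a" if "a:rcarrier R'" for a by (rule comp[OF U' k' g(1) f(1) g(2) f(2) that])
 have "bij_betw f (rcarrier R) (rcarrier R')" by (rule bij_betw_byWitness[of _ g]) (use gf fg f(1) g(1) in "auto simp: rhom_def")
 thus ?thesis using f(1) unfolding rack_isomorphic_def rhom_def by blast
qed

section \<open>From Legendrian knots to the geometric model\<close>

lemma velocity_works:
 assumes "smooth f" shows "(f has_vector_derivative velocity f t) (at t)" proof -
 have "higher_differentiable (Suc 0) f" using assms by (simp only: smooth_def)
 thus ?thesis using vector_derivative_works[of f "at t"] by simp
qed

text \<open>\<open>higher_differentiable\<close> speaks of directional derivatives; on the line, the
  one in direction 1 is the velocity.\<close>

lemma smooth_velocity: assumes "smooth f" shows "smooth (%t. velocity f t)" proof -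
 have eq: "frechet_derivative f (at t) 1 = velocity f t" for t proof -
  have "(f has_derivative (%h. h *\<^sub>R velocity f t)) (at t)" using velocity_works[OF assms] by (simp add: has_vector_derivative_def)
  from frechet_derivative_at[OF this] show ?thesis by (metis scaleR_one)
 qed
 have "higher_differentiable k (%t. velocity f t)" for k proof -
  have "higher_differentiable (Suc k) f" using assms by (simp only: smooth_def)
  hence "higher_differentiable k (%t. frechet_derivative f (at t) 1)" by simp
  thus ?thesis by (simp only: eq)
 qed
 thus ?thesis by (simp add: smooth_def)
qed

lemma smooth_continuous: "smooth f ==> continuous_on UNIV f" unfolding smooth_def by (metis higher_differentiable.simps(1))

abbreviation kp :: "(real => real ^ 3) => real => p3" where "kp c \<equiv> %t. (c t $ 1, c t $ 2, c t $ 3)"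
abbreviation dkp :: "(real => real ^ 3) => real => p3" where
 "dkp c \<equiv> %t. (velocity c t $ 1, velocity c t $ 2, velocity c t $ 3)"

lemma component_derivative:
 fixes f :: "real => real ^ 'n"
 assumes "(f has_vector_derivative d) (at t)" shows "((%t. f t $ i) has_real_derivative d $ i) (at t)"
 using bounded_linear.has_vector_derivative[OF bounded_linear_vec_nth assms] by (simp add: has_real_derivative_iff_has_vector_derivative)

lemma vec3_eq: "(a :: real ^ 3) = b \<longleftrightarrow> a $ 1 = b $ 1 & a $ 2 = b $ 2 & a $ 3 = b $ 3" by (simp add: vec_eq_iff forall_3)
lemma vec2_eq: "(a :: real ^ 2) = b \<longleftrightarrow> a $ 1 = b $ 1 & a $ 2 = b $ 2" by (simp add: vec_eq_iff forall_2)

lemma knot_injective: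
 assumes "smooth_knot c" "c s = c t" shows "s - t:\<int>" proof -
 have per: "c (t + 1) = c t" for t using assms(1) by (simp add: smooth_knot_def)
 have pk: "c (t + of_int k) = c t" for t k by (rule periodic_int) (rule per)
 have f: "c (frac t) = c t" for t using pk[of t "- \<lfloor>t\<rfloor>"] by (simp add: frac_def)
 have "inj_on c {0..<1}" using assms(1) by (simp add: smooth_knot_def)
 moreover have "c (frac s) = c (frac t)" using assms(2) by (simp add: f)
 ultimately have "frac s = frac t" by (auto simp: inj_on_def frac_lt_1)
 hence "s - t = of_int (\<lfloor>s\<rfloor> - \<lfloor>t\<rfloor>)" by (simp add: frac_def)
 thus ?thesis by (metis Ints_of_int)
qed

lemma legendrian_slope: "legendrian_knot c ==> velocity c t $ 3 = c t $ 2 * velocity c t $ 1" by (simp add: legendrian_knot_def xi_std_def)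

lemma legendrian_immersed: assumes "legendrian_knot c" shows "velocity c t $ 1 ~= 0 | velocity c t $ 2 ~= 0" proof -
 have "velocity c t ~= 0" using assms by (simp add: legendrian_knot_def smooth_knot_def)
 thus ?thesis using legendrian_slope[OF assms, of t] by (auto simp: vec3_eq)
qed

lemma generic_lfront:
 assumes leg: "legendrian_knot c" and gen: "generic_front (front c)"
 shows "lfront (%t. c t $ 1) (%t. c t $ 2) (%t. c t $ 3) (%t. velocity c t $ 1) (%t. velocity c t $ 2) (front c)" proof -
 have sm: "smooth c" and per: "!!t. c (t + 1) = c t" and sk: "smooth_knot c" using leg by (auto simp: legendrian_knot_def smooth_knot_def)
 note d = velocity_works[OF sm] and d2 = velocity_works[OF smooth_velocity[OF sm]]
 define L where "L p = (vector [p $ 1, p $ 3] :: real ^ 2)" for p :: "real ^ 3"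
 have L: "bounded_linear L" unfolding linear_conv_bounded_linear[symmetric] by (rule linearI) (auto simp: L_def vec2_eq)
 have fc: "front c = (%t. L (c t))" by (simp add: fun_eq_iff front_def L_def)
 have vf: "velocity (front c) t = L (velocity c t)" for t unfolding fc by (rule vector_derivative_at[OF bounded_linear.has_vector_derivative[OF L d]])
 hence vf': "velocity (front c) = (%t. L (velocity c t))" by (simp add: fun_eq_iff)
 have vvf: "velocity (velocity (front c)) t = L (velocity (velocity c) t)" for t
  unfolding vf' by (rule vector_derivative_at[OF bounded_linear.has_vector_derivative[OF L d2]])
 have Lc: "L p $ 1 = p $ 1" "L p $ 2 = p $ 3" for p by (simp_all add: L_def)
 have det: "det2 v w = v $ 1 * w $ 2 - v $ 2 * w $ 1" for v w :: "real ^ 2" by (simp add: det_2)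
 note sl = legendrian_slope[OF leg]
 have cu: "cusp (front c) t \<longleftrightarrow> velocity c t $ 1 = 0" for t proof
  assume "cusp (front c) t"
  thus "velocity c t $ 1 = 0" by (simp add: cusp_def vf vec2_eq Lc)
 next
  assume "velocity c t $ 1 = 0"
  hence "velocity (front c) t = 0" by (simp add: vf vec2_eq Lc sl)
  thus "cusp (front c) t" using gen by (simp add: generic_front_def)
 qed
 have dp: "double_point (front c) s t \<longleftrightarrow> s - t ~: \<int> & c s $ 1 = c t $ 1 & c s $ 3 = c t $ 3" for s t
  by (simp add: double_point_def fc vec2_eq Lc)
 \<comment> \<open>A vanishing \<open>x'\<close> makes the whole velocity of the front vanish,
   because \<open>z' = y * x'\<close>, and then the branches would not be transverse.\<close>
 have dn: "velocity c s $ 1 ~= 0 & velocity c t $ 1 ~= 0" if "double_point (front c) s t" for s t proof -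
  have "det2 (velocity (front c) s) (velocity (front c) t) ~= 0" using gen that by (simp add: generic_front_def)
  thus ?thesis by (auto simp: det vf Lc sl)
 qed
 interpret f: plane_front "%t. c t $ 1" "%t. c t $ 2" "%t. c t $ 3" "%t. velocity c t $ 1" "%t. velocity c t $ 2" proof
  show "((%t. c t $ 1) has_real_derivative velocity c t $ 1) (at t)" "((%t. c t $ 2) has_real_derivative velocity c t $ 2) (at t)" for t
   by (rule component_derivative[OF d])+
  show "((%t. c t $ 3) has_real_derivative c t $ 2 * velocity c t $ 1) (at t)" for t using component_derivative[OF d, of 3 t] by (simp add: sl)
  show "continuous_on UNIV (%t. velocity c t $ 1)" "continuous_on UNIV (%t. velocity c t $ 2)"
   by (intro continuous_intros smooth_continuous smooth_velocity sm)+
  show "velocity c t $ 2 ~= 0" if "velocity c t $ 1 = 0" for t using legendrian_immersed[OF leg, of t] that by simp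
  show "EX d. d ~= 0 & ((%t. velocity c t $ 1) has_real_derivative d) (at t)" if z: "velocity c t $ 1 = 0" for t proof (intro exI conjI)
   show D: "((%t. velocity c t $ 1) has_real_derivative velocity (velocity c) t $ 1) (at t)" by (rule component_derivative[OF d2])
   \<comment> \<open>If \<open>x''\<close> vanished too, differentiating \<open>z' = y * x'\<close>
     would give \<open>z'' = 0\<close>; the second derivative of the front would vanish, contrary to
     the cusp condition.\<close>
   show "velocity (velocity c) t $ 1 ~= 0" proof
    assume 0: "velocity (velocity c) t $ 1 = 0"
    have "((%t. velocity c t $ 3) has_real_derivative velocity (velocity c) t $ 3) (at t)" by (rule component_derivative[OF d2])
    moreover have "((%t. c t $ 2 * velocity c t $ 1) has_real_derivative velocity c t $ 2 * velocity c t $ 1 + velocity (velocity c) t $ 1 * c t $ 2) (at t)"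
     by (rule DERIV_mult[OF component_derivative[OF d] D])
    hence "((%t. velocity c t $ 3) has_real_derivative 0) (at t)" by (simp add: sl z 0)
    ultimately have "velocity (velocity c) t $ 3 = 0" by (rule DERIV_unique)
    hence "velocity (velocity (front c)) t = 0" by (simp add: vvf vec2_eq Lc 0)
    hence "~ cusp (front c) t" by (simp add: cusp_def det)
    thus False using cu z by simp
   qed
  qed
  show "s - t:\<int>" if "c s $ 1 = c t $ 1" "c s $ 2 = c t $ 2" "c s $ 3 = c t $ 3" for s t
   by (rule knot_injective[OF sk]) (use that in "simp add: vec3_eq")
  show "velocity c s $ 1 ~= 0" if "c s $ 1 = c t $ 1" "c s $ 3 = c t $ 3" "s - t ~: \<int>" for s t using dn[of s t] that by (simp add: dp)
  have "finite ((%p. (p $ 1, p $ 2)) ` {front c t |s t. double_point (front c) s t})" using gen by (simp add: generic_front_def)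
  moreover have "{(c t $ 1, c t $ 3) |s t. s - t ~: \<int> & c s $ 1 = c t $ 1 & c s $ 3 = c t $ 3} <= (%p. (p $ 1, p $ 2)) ` {front c t |s t. double_point (front c) s t}"
   unfolding dp[symmetric] by (auto simp: fc Lc image_iff) (metis Lc)
  ultimately show "finite {(c t $ 1, c t $ 3) |s t. s - t ~: \<int> & c s $ 1 = c t $ 1 & c s $ 3 = c t $ 3}" by (rule finite_subset[rotated])
  show False if "r - s ~: \<int>" "s - t ~: \<int>" "r - t ~: \<int>" "c r $ 1 = c s $ 1" "c r $ 3 = c s $ 3" "c s $ 1 = c t $ 1" "c s $ 3 = c t $ 3" for r s t
  proof -
   have "double_point (front c) r s" "double_point (front c) s t" "double_point (front c) r t" using that by (simp_all add: dp)
   thus False using gen unfolding generic_front_def by blast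
  qed
 qed (simp_all add: per)
 have ov: "f.over s t \<longleftrightarrow> double_point (front c) s t & c s $ 2 < c t $ 2" for s t by (simp add: f.over_def f.dp_def f.D_def dp)
 have cr: "crossing (front c) s t \<longleftrightarrow> f.over s t" for s t proof (cases "double_point (front c) s t")
  case True
  thus ?thesis using dn[OF True] by (simp add: crossing_def ov slope_def vf Lc sl)
 qed (simp add: crossing_def ov)
 have dd: "det2 (velocity (front c) s) (velocity (front c) t) = (velocity c s $ 1 * velocity c t $ 1) * (c t $ 2 - c s $ 2)" for s t
  by (simp add: det vf Lc sl algebra_simps)
 show ?thesis proof (unfold_locales)
  show "positive_crossing (front c) s t \<longleftrightarrow> f.over s t & velocity c s $ 1 * velocity c t $ 1 > 0" for s t
   unfolding positive_crossing_def cr dd by (auto simp: ov zero_less_mult_iff)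
  show "negative_crossing (front c) s t \<longleftrightarrow> f.over s t & velocity c s $ 1 * velocity c t $ 1 < 0" for s t
   unfolding negative_crossing_def cr dd by (auto simp: ov mult_less_0_iff)
 qed (rule cu cr)+
qed

lemma p3_derivative:
 assumes "(c has_vector_derivative d) (at t)" shows "(kp c has_vector_derivative (d $ 1, d $ 2, d $ 3)) (at t)" proof -
 have "((%t. c t $ i) has_vector_derivative d $ i) (at t)" for i
  using component_derivative[OF assms, of i] by (simp add: has_real_derivative_iff_has_vector_derivative)
 thus ?thesis by (intro has_vector_derivative_Pair)
qed

text \<open>Admitting all small \<open>u\<close> and all large \<open>M\<close> makes the relation
  transitive and lets the models of two knots share their parameters.\<close>

definition keq :: "(real => real ^ 3) => (real => real ^ 3) => bool" where
 "keq c d \<longleftrightarrow> (EX u0>0. EX M0. ALL u M. 0 < u & u <= u0 & M0 <= M -->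
   (EX F G. kequiv u (0, - M, 0) (kp c) (dkp c) (kp d) (dkp d) F G))"

lemma keq_sym: "keq c d ==> keq d c" unfolding keq_def using kequiv_sym by meson

lemma keq_trans: assumes "keq c d" "keq d e" shows "keq c e" proof -
 obtain u1 M1 where 1: "u1 > 0" "!!u M. 0 < u & u <= u1 & M1 <= M ==> EX F G. kequiv u (0, - M, 0) (kp c) (dkp c) (kp d) (dkp d) F G" using assms(1) unfolding keq_def by blast
 obtain u2 M2 where 2: "u2 > 0" "!!u M. 0 < u & u <= u2 & M2 <= M ==> EX F G. kequiv u (0, - M, 0) (kp d) (dkp d) (kp e) (dkp e) F G" using assms(2) unfolding keq_def by blast
 have "EX F G. kequiv u (0, - M, 0) (kp c) (dkp c) (kp e) (dkp e) F G" if um: "0 < u & u <= min u1 u2 & max M1 M2 <= M" for u M proof -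
  have um: "0 < u & u <= u1 & M1 <= M" "0 < u & u <= u2 & M2 <= M" using um by auto
  obtain F G where "kequiv u (0, - M, 0) (kp c) (dkp c) (kp d) (dkp d) F G" using 1(2)[OF um(1)] by blast
  moreover obtain F' G' where "kequiv u (0, - M, 0) (kp d) (dkp d) (kp e) (dkp e) F' G'" using 2(2)[OF um(2)] by blast
  ultimately show ?thesis using kequiv_trans by blast
 qed
 thus ?thesis unfolding keq_def using 1(1) 2(1) by (intro exI[of _ "min u1 u2"] conjI exI[of _ "max M1 M2"]) auto
qed

text \<open>Push-offs and meridians are indexed by the parameter, so a change of parameter has to be
  realised. The maps interpolating linearly between \<open>t\<close> and \<open>ph t\<close> have
  positive derivative and commute with the shift by 1; composed with \<open>c\<close> they form an
  isotopy.\<close>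

lemma reparametrisation:
 assumes leg: "legendrian_knot c" and so: "same_oriented_knot c d"
 shows "EX u0>0. EX M0. ALL u M. 0 < u & u <= u0 & M0 <= M --> valid (kp c) (dkp c) u &
   (EX F G. kequiv u (0, - M, 0) (kp c) (dkp c) (kp d) (dkp d) F G)" proof -
 have sm: "smooth c" and per: "!!t. c (t + 1) = c t" and sk: "smooth_knot c" using leg by (auto simp: legendrian_knot_def smooth_knot_def)
 obtain ph where ph: "smooth ph" "!!t. ph (t + 1) = ph t + 1" "!!t. deriv ph t > 0" "d = c o ph" using so unfolding same_oriented_knot_def by blast
 have vd: "velocity ph t = deriv ph t" for t
  using velocity_works[OF ph(1), of t] by (simp add: DERIV_imp_deriv has_real_derivative_iff_has_vector_derivative)
 have dph: "(ph has_real_derivative deriv ph t) (at t)" for t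
  using velocity_works[OF ph(1), of t] by (simp add: vd has_real_derivative_iff_has_vector_derivative)
 have cd: "continuous_on UNIV (deriv ph)" using smooth_continuous[OF smooth_velocity[OF ph(1)]] by (simp add: vd)
 note cphi = smooth_continuous[OF ph(1)] and cc = smooth_continuous[OF sm] and cv = smooth_continuous[OF smooth_velocity[OF sm]]
 define ps where "ps s t = (1 - s) * t + s * ph t" for s t
 define ps' where "ps' s t = (1 - s) + s * deriv ph t" for s t
 have dps: "(ps s has_real_derivative ps' s t) (at t)" for s t unfolding ps_def ps'_def by (auto intro!: derivative_eq_intros dph)
 have pos: "ps' s t > 0" if "s:{0..1}" for s t proof (cases "s = 0")
  case False
  hence "s * deriv ph t > 0" using ph(3) that by auto
  thus ?thesis using that by (auto simp: ps'_def)
 qed (simp add: ps'_def)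
 have mono: "ps s a < ps s b" if "a < b" "s:{0..1}" for s a b by (rule DERIV_pos_imp_increasing[OF that(1)]) (use dps pos[OF that(2)] in blast)
 have shift: "ps s (t + 1) = ps s t + 1" for s t unfolding ps_def ph(2) by (simp add: algebra_simps)
 have shiftk: "ps s (t + of_int k) = ps s t + of_int k" for s t k using periodic_int[of "%t. ps s t - t" t k] shift by (simp add: algebra_simps)
 have cont: "continuous_on A (%q. ps (fst q) (snd q))" "continuous_on A (%q. ps' (fst q) (snd q))" for A
  unfolding ps_def ps'_def by (intro continuous_intros continuous_on_compose2[OF cphi] continuous_on_compose2[OF cd]; simp)+
 interpret I: isotopy "%s t. kp c (ps s t)" "%s t. ps' s t *\<^sub>R dkp c (ps s t)" proof
  show "continuous_on ({0..1} \<times> UNIV) (%q. kp c (ps (fst q) (snd q)))" by (intro continuous_intros continuous_on_compose2[OF cc] cont) auto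
  show "continuous_on ({0..1} \<times> UNIV) (%q. ps' (fst q) (snd q) *\<^sub>R dkp c (ps (fst q) (snd q)))"
   by (intro continuous_intros continuous_on_compose2[OF cv] cont) auto
  fix s :: real assume s: "s:{0..1}"
  show "((%t. kp c (ps s t)) has_vector_derivative ps' s t *\<^sub>R dkp c (ps s t)) (at t)" for t proof -
   have "(ps s has_vector_derivative ps' s t) (at t)" using dps by (simp add: has_real_derivative_iff_has_vector_derivative)
   from vector_diff_chain_at[OF this p3_derivative[OF velocity_works[OF sm]]] show ?thesis by (simp add: comp_def)
  qed
  show "kp c (ps s (t + 1)) = kp c (ps s t)" for t by (simp add: shift per)
  show "t - t':\<int>" if "kp c (ps s t) = kp c (ps s t')" for t t' proof -
   have "ps s t - ps s t':\<int>" by (rule knot_injective[OF sk]) (use that in "simp add: vec3_eq")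
   then obtain k where "ps s t - ps s t' = of_int k" by (auto elim: Ints_cases)
   hence "ps s t = ps s (t' + of_int k)" by (simp add: shiftk)
   hence "t = t' + of_int k" using mono[OF _ s, of t "t' + of_int k"] mono[OF _ s, of "t' + of_int k" t] by (cases t "t' + of_int k" rule: linorder_cases) auto
   thus ?thesis by simp
  qed
  show "hor (ps' s t *\<^sub>R dkp c (ps s t)) ~= 0" for t using legendrian_immersed[OF leg, of "ps s t"] pos[OF s, of t] by (simp add: zero_prod_def)
 qed
 have vdd: "velocity d t = deriv ph t *\<^sub>R velocity c (ph t)" for t
  unfolding ph(4) by (rule vector_derivative_at, rule vector_diff_chain_at) (use dph velocity_works[OF sm] in "simp_all add: has_real_derivative_iff_has_vector_derivative")
 have e: "(%t. kp c (ps 0 t)) = kp c" "(%t. ps' 0 t *\<^sub>R dkp c (ps 0 t)) = dkp c"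
  "(%t. kp c (ps 1 t)) = kp d" "(%t. ps' 1 t *\<^sub>R dkp c (ps 1 t)) = dkp d" by (simp_all add: ps_def ps'_def ph(4) vdd[unfolded ph(4)])
 obtain u0 M0 where um: "u0 > 0" "!!u M. 0 < u & u <= u0 & M0 <= M ==> (ALL s:{0..1}. valid (%t. kp c (ps s t)) (%t. ps' s t *\<^sub>R dkp c (ps s t)) u) &
   (EX F G. kequiv u (0, - M, 0) (%t. kp c (ps 0 t)) (%t. ps' 0 t *\<^sub>R dkp c (ps 0 t)) (%t. kp c (ps 1 t)) (%t. ps' 1 t *\<^sub>R dkp c (ps 1 t)) F G)"
  using I.isotopy_kequiv by blast
 have "valid (kp c) (dkp c) u & (EX F G. kequiv u (0, - M, 0) (kp c) (dkp c) (kp d) (dkp d) F G)" if "0 < u & u <= u0 & M0 <= M" for u M proof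
  show "valid (kp c) (dkp c) u" using conjunct1[OF um(2)[OF that], THEN bspec, of 0] by (simp only: e) simp
  show "EX F G. kequiv u (0, - M, 0) (kp c) (dkp c) (kp d) (dkp d) F G" using conjunct2[OF um(2)[OF that]] by (simp only: e)
 qed
 thus ?thesis using um(1) by blast
qed

lemma keq_same: "legendrian_knot c ==> same_oriented_knot c d ==> keq c d" unfolding keq_def using reparametrisation by meson

text \<open>The constant isotopy, seen as a reparametrisation by the identity.\<close>

lemma valid_exists: assumes "legendrian_knot c" shows "EX u0>0. ALL u. 0 < u & u <= u0 --> valid (kp c) (dkp c) u" proof -
 have "higher_differentiable k (%_ :: real. w)" for k and w :: real by (induction k arbitrary: w) (simp_all add: frechet_derivative_const)
 hence "higher_differentiable k (%t. t :: real)" for k by (cases k) (simp_all add: continuous_on_id frechet_derivative_ident)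
 hence "same_oriented_knot c c" unfolding same_oriented_knot_def by (intro exI[of _ "%t. t"]) (simp add: smooth_def comp_def)
 from reparametrisation[OF assms this] obtain u0 M0 where um: "u0 > 0" and v: "ALL u M. 0 < u & u <= u0 & M0 <= M --> valid (kp c) (dkp c) u &
   (EX F G. kequiv u (0, - M, 0) (kp c) (dkp c) (kp c) (dkp c) F G)" by (elim exE conjE) (rule that)
 have "valid (kp c) (dkp c) u" if "0 < u & u <= u0" for u using v[rule_format, of u M0] that by simp
 thus ?thesis using um by blast
qed

text \<open>Beyond regularity and injectivity of the stages, the Legendrian condition enters through
  the nonvanishing horizontal velocity.\<close>

lemma keq_isotopic:
 assumes "smooth H" and leg: "!!s. s:{0..1} ==> legendrian_knot (%t. H (s, t))" shows "keq (%t. H (0 :: real, t :: real)) (%t. H (1, t))" proof -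
 have cH: "continuous_on UNIV H" by (rule smooth_continuous[OF assms(1)])
 have "higher_differentiable (Suc 0) H" using assms(1) by (simp only: smooth_def)
 hence h: "(ALL q. H differentiable (at q)) & (ALL w. continuous_on UNIV (%q. frechet_derivative H (at q) w))" unfolding higher_differentiable.simps .
 have dH: "H differentiable (at q)" for q using h[THEN conjunct1, THEN spec] .
 have cdH: "continuous_on UNIV (%q. frechet_derivative H (at q) (0, 1))" using h[THEN conjunct2, THEN spec] .
 have der: "((%t. H (s, t)) has_vector_derivative frechet_derivative H (at (s, t)) (0, 1)) (at t)" for s t proof -
  have 1: "(H has_derivative frechet_derivative H (at (s, t))) (at (s, t))" using dH frechet_derivative_works by blast
  have 2: "((%t. (s, t)) has_vector_derivative (0, 1)) (at t)" by (auto intro!: derivative_eq_intros)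
  from vector_derivative_diff_chain_within[OF 2 has_derivative_at_withinI[OF 1]] show ?thesis by (simp add: comp_def)
 qed
 have vel: "velocity (%t. H (s, t)) t = frechet_derivative H (at (s, t)) (0, 1)" for s t by (rule vector_derivative_at[OF der])
 interpret I: isotopy "%s. kp (%t. H (s, t))" "%s. dkp (%t. H (s, t))" proof
  show "continuous_on ({0..1} \<times> UNIV) (%q. kp (%t. H (fst q, t)) (snd q))" by (simp, intro continuous_intros continuous_on_subset[OF cH]) auto
  show "continuous_on ({0..1} \<times> UNIV) (%q. dkp (%t. H (fst q, t)) (snd q))"
   unfolding vel by (simp, intro continuous_intros continuous_on_subset[OF cdH]) auto
  fix s :: real assume s: "s:{0..1}"
  have sk: "smooth_knot (%t. H (s, t))" using leg[OF s] by (simp add: legendrian_knot_def)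
  show "(kp (%t. H (s, t)) has_vector_derivative dkp (%t. H (s, t)) t) (at t)" for t unfolding vel by (rule p3_derivative[OF der])
  show "kp (%t. H (s, t)) (t + 1) = kp (%t. H (s, t)) t" for t using sk by (simp add: smooth_knot_def)
  show "t - t':\<int>" if "kp (%t. H (s, t)) t = kp (%t. H (s, t)) t'" for t t' by (rule knot_injective[OF sk]) (use that in "simp add: vec3_eq")
  show "hor (dkp (%t. H (s, t)) t) ~= 0" for t using legendrian_immersed[OF leg[OF s], of t] by (simp add: zero_prod_def)
 qed
 show ?thesis unfolding keq_def using I.isotopy_kequiv by blast
qed

lemma keq_legendrian_isotopic:
 assumes "legendrian_knot c" "legendrian_knot d" "legendrian_isotopic c d" shows "keq c d" proof -
 obtain H :: "real * real => real ^ 3" where H0: "smooth H & (ALL s:{0..1}. legendrian_knot (%t. H (s, t))) &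
   same_oriented_knot c (%t. H (0, t)) & same_oriented_knot d (%t. H (1, t))" using assms(3) unfolding legendrian_isotopic_def by blast
 hence H: "smooth H" "!!s. s:{0..1} ==> legendrian_knot (%t. H (s, t))" "same_oriented_knot c (%t. H (0, t))" "same_oriented_knot d (%t. H (1, t))"
  by simp_all
 show ?thesis by (rule keq_trans[OF keq_same[OF assms(1) H(3)] keq_trans[OF keq_isotopic[OF H(1,2)] keq_sym[OF keq_same[OF assms(2) H(4)]]]])
qed

lemma LR_keq:
 assumes c: "legendrian_knot c" "generic_front (front c)" and d: "legendrian_knot d" "generic_front (front d)" and k: "keq c d"
 shows "rack_isomorphic (LR n (front c)) (LR n (front d))" proof -
 obtain u0 M0 where um: "u0 > 0" "!!u M. 0 < u & u <= u0 & M0 <= M ==> EX F G. kequiv u (0, - M, 0) (kp c) (dkp c) (kp d) (dkp d) F G" using k unfolding keq_def by blast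
 have model: "EX u1>0. EX M1. ALL u M. 0 < u & u <= u1 & M1 <= M --> (EX ev. universal (kp c) (dkp c) u (0, - M, 0) n (LR n (front c)) ev)"
  if c: "legendrian_knot c" "generic_front (front c)" for c proof -
  interpret lfront "%t. c t $ 1" "%t. c t $ 2" "%t. c t $ 3" "%t. velocity c t $ 1" "%t. velocity c t $ 2" "front c" by (rule generic_lfront[OF c])
  have e: "K = kp c" "dK = dkp c" by (simp_all add: fun_eq_iff K_def dK_def legendrian_slope[OF c(1)])
  obtain u1 where u1: "u1 > 0" "!!u. 0 < u & u <= u1 ==> valid (kp c) (dkp c) u" using valid_exists[OF c(1)] by blast
  obtain b where b: "!!t. \<bar>c t $ 2\<bar> < b" using y_bounded by blast
  have M: "- M < c t $ 2" if "b + 1 <= M" for M t using b[of t] that by linarith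
  have "EX ev. universal (kp c) (dkp c) u (0, - M, 0) n (LR n (front c)) ev" if um: "0 < u & u <= u1 & b + 1 <= M" for u M proof -
   interpret vfront "%t. c t $ 1" "%t. c t $ 2" "%t. c t $ 3" "%t. velocity c t $ 1" "%t. velocity c t $ 2" "front c" u M
    by unfold_locales (use um u1(2)[of u] M[of M] in "simp_all add: e")
   show ?thesis using LR_universal unfolding e .
  qed
  thus ?thesis using u1(1) by blast
 qed
 obtain u1 M1 where 1: "u1 > 0" "!!u M. 0 < u & u <= u1 & M1 <= M ==> EX ev. universal (kp c) (dkp c) u (0, - M, 0) n (LR n (front c)) ev" using model[OF c] by blast
 obtain u2 M2 where 2: "u2 > 0" "!!u M. 0 < u & u <= u2 & M2 <= M ==> EX ev. universal (kp d) (dkp d) u (0, - M, 0) n (LR n (front d)) ev" using model[OF d] by blast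
 \<comment> \<open>Within the bounds of both models and of the equivalence between them.\<close>
 define u M where "u = min u0 (min u1 u2)" and "M = max M0 (max M1 M2)"
 have u: "0 < u & u <= u0 & M0 <= M" "0 < u & u <= u1 & M1 <= M" "0 < u & u <= u2 & M2 <= M" using um(1) 1(1) 2(1) by (auto simp: u_def M_def)
 obtain F G where F: "kequiv u (0, - M, 0) (kp c) (dkp c) (kp d) (dkp d) F G" using um(2)[OF u(1)] by blast
 obtain ev where ev: "universal (kp c) (dkp c) u (0, - M, 0) n (LR n (front c)) ev" using 1(2)[OF u(2)] by blast
 obtain ev' where ev': "universal (kp d) (dkp d) u (0, - M, 0) n (LR n (front d)) ev'" using 2(2)[OF u(3)] by blast
 show ?thesis by (rule universal_iso[OF ev ev' F merid_ends(1) merid_ends(1)])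
qed

theorem theorem1:
  fixes n :: nat
  shows "(\<forall>L D D'. legendrian_knot L \<longrightarrow>
            front_projection_of D L \<longrightarrow> front_projection_of D' L \<longrightarrow>
            rack_isomorphic (LR n D) (LR n D')) \<and>
         (\<forall>L L' D D'. legendrian_knot L \<longrightarrow> legendrian_knot L' \<longrightarrow> legendrian_isotopic L L' \<longrightarrow>
            front_projection_of D L \<longrightarrow> front_projection_of D' L' \<longrightarrow>
            rack_isomorphic (LR n D) (LR n D'))"
proof -
 have main: "rack_isomorphic (LR n D) (LR n D')"
  if L: "legendrian_knot L" "legendrian_knot L'" and k: "keq L L'" and D: "front_projection_of D L" "front_projection_of D' L'" for L L' D D' proof -
  obtain K where K: "legendrian_knot K" "legendrian_isotopic L K" "D = front K" "generic_front D" using D(1) unfolding front_projection_of_def by blast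
  obtain K' where K': "legendrian_knot K'" "legendrian_isotopic L' K'" "D' = front K'" "generic_front D'" using D(2) unfolding front_projection_of_def by blast
  \<comment> \<open>Each front belongs to a knot isotopic to the given one; the equivalences are
    composed along \<open>K\<close>, \<open>L\<close>, \<open>L'\<close>, \<open>K'\<close>.\<close>
  have "keq K K'" by (rule keq_trans[OF keq_sym[OF keq_legendrian_isotopic[OF L(1) K(1,2)]] keq_trans[OF k keq_legendrian_isotopic[OF L(2) K'(1,2)]]])
  from LR_keq[OF K(1) _ K'(1) _ this] show ?thesis using K K' by simp
 qed
 \<comment> \<open>A round trip from \<open>L\<close> to the knot of its front and back.\<close>
 have refl: "keq L L" if L: "legendrian_knot L" and D: "front_projection_of D L" for L D proof -
  obtain K where K: "legendrian_knot K" "legendrian_isotopic L K" using D unfolding front_projection_of_def by blast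
  note k = keq_legendrian_isotopic[OF L K]
  show ?thesis by (rule keq_trans[OF k keq_sym[OF k]])
 qed
 show ?thesis using main refl keq_legendrian_isotopic by blast
qed

end
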